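(* Let $1<p<\infty$, $1/p+1/q=1$. Assume that $(a,b)\in L^\infty\times L^\infty$ is a Fredholm matching pair with subordinated pair $(c,d)$, and let $\kappa_1:=\operatorname{ind}T(c)$, $\kappa_2:=\operatorname{ind}T(d)$ (on $H^p$). Consider $T(a)\pm H(b)$ on $H^p$. Then: (i) If $(\kappa_1,\kappa_2)\in\mathbb{Z}_+\times\mathbb{Z}_+$, then $T(a)+H(b)$ and $T(a)-H(b)$ are invertible from the right and $$\ker(T(a)+H(b))=\operatorname{im}\mathbf{P}_c^-\dotplus\varphi_+^{a,b}(\operatorname{im}\mathbf{P}_d^+),\qquad \ker(T(a)-H(b))=\operatorname{im}\mathbf{P}_c^+\dotplus\varphi_-^{a,b}(\operatorname{im}\mathbf{P}_d^-).$$ (ii) If $(\kappa_1,\kappa_2)\in(\mathbb{Z}\setminus\mathbb{N})\times(\mathbb{Z}\setminus\mathbb{N})$, then $T(a)+H(b)$ and $T(a)-H(b)$ are invertible from the left and $$\operatorname{coker}(T(a)+H(b))=\operatorname{im}\mathbf{P}_{\overline d}^-\dotplus\varphi_+^{\overline a,\widetilde{\overline b}}(\operatorname{im}\mathbf{P}_{\overline c}^+),\qquad \operatorname{coker}(T(a)-H(b))=\operatorname{im}\mathbf{P}_{\overline d}^+\dotplus\varphi_-^{\overline a,\widetilde{\overline b}}(\operatorname{im}\mathbf{P}_{\overline c}^-),$$ and $\operatorname{im}\mathbf{P}_{\overline d}^{\pm}=\{0\}$ for $\kappa_2=0$. (iii) If $(\kappa_1,\kappa_2)\in\mathbb{Z}_+\times\mathbb{Z}_-$,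 then $$\ker(T(a)+H(b))=\operatorname{im}\mathbf{P}_c^-,\qquad \operatorname{coker}(T(a)+H(b))=\operatorname{im}\mathbf{P}_{\overline d}^-,$$ $$\ker(T(a)-H(b))=\operatorname{im}\mathbf{P}_c^+,\qquad \operatorname{coker}(T(a)-H(b))=\operatorname{im}\mathbf{P}_{\overline d}^+.$$
   Context: $\mathbb{T}$ is the unit circle, $L^p=L^p(\mathbb{T})$, $H^p=\{f\in L^p:\widehat f_n=0\text{ for }n<0\}$. $P$ is the Riesz projection of $L^p$ onto $H^p$, $Q=I-P$, $(Jf)(t)=\overline tf(\overline t)$, $\widetilde a(t)=a(1/t)$; $T(a)f=P(af)$, $H(a)f=PaQJf$ on $H^p$ for $a\in L^\infty$. $\mathbb{Z}_+=\mathbb{N}\cup\{0\}$, $\mathbb{Z}_-$ is the set of negative integers. The index is $\dim\ker-\dim\operatorname{coker}$. A matching pair $(a,b)$ consists of $a\in L^\infty$ invertible in $L^\infty$ and $b\in L^\infty$ with $a\widetilde a=b\widetilde b$ (then $b$ is invertible too). Its subordinated pair is $(c,d)$ with $c=ab^{-1}=\widetilde b\widetilde a^{-1}$, $d=b\widetilde a^{-1}=a\widetilde b^{-1}$. It is Fredholm if $T(c)$ and $T(d)$ are Fredholm on $H^p$. $\operatorname{coker}A:=\ker A^*$, with the identification $(T(a)\pm H(b))^*=T(\overline a)\pm H(\widetilde{\overline b})$ acting on $H^q$. The pair $(\overline a,\widetilde{\overline b})$ is again a matching pair, with subordinated pair $(\overline d,\overline c)$; operators and spaces attached to $\overline c,\overline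 d$ are considered in $H^q$. For $g\in L^\infty$ with $g\widetilde g=1$, $\mathbf{P}_g:=JQgP|_{\ker T(g)}$ maps $\ker T(g)$ into itself, $\mathbf{P}_g^2=I$, and $\mathbf{P}_g^{\pm}:=\frac12(I\pm\mathbf{P}_g)$ are complementary projections on $\ker T(g)$. For $g$ with $T(g)$ Fredholm of index $\kappa\ge0$, $T_r^{-1}(g):=T^{-1}(gt^{\kappa})T(t^{\kappa})$, a right inverse of $T(g)$. For a matching pair $(\alpha,\beta)$ with subordinated pair $(\gamma,\delta)$ such that $T(\gamma)$ is Fredholm of nonnegative index, define for $s\in\ker T(\delta)$ $$\varphi_\pm^{\alpha,\beta}(s):=T_r^{-1}(\gamma)T(\widetilde\alpha^{-1})s\mp JQ\gamma P\,T_r^{-1}(\gamma)T(\widetilde\alpha^{-1})s\pm JQ\widetilde\alpha^{-1}s.$$ *)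

theory Defs
  imports "HOL-Analysis.Analysis"
begin

section \<open>Measurable functions on the unit circle modulo null sets\<close>

text \<open>Normalized arc length, as a Borel measure on the complex plane carried by the unit circle;
  the values of a function off the circle are therefore irrelevant.\<close>

definition arc_measure :: "complex measure" where
  "arc_measure = distr (uniform_measure lborel {0..2*pi}) borel cis"

lemma sets_arc_measure [simp, measurable_cong]: "sets arc_measure = sets borel"
  and space_arc_measure [simp]: "space arc_measure = UNIV"
  by (simp_all add: arc_measure_def)

lemma cis_borel_measurable [measurable]: "cis \<in> borel_measurable borel"
  by (intro borel_measurable_continuous_onI continuous_intros)

lemma AE_arc_measure_iff:
  assumes [measurable]: "Measurable.pred borel P"
  shows "(AE t in arc_measure. P t) \<longleftrightarrow> (AE x in lborel. x \<in> {0..2*pi} \<longrightarrow> P (cis x))"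
proof -
  have "(AE t in arc_measure. P t) \<longleftrightarrow> (AE x in uniform_measure lborel {0..2*pi}. P (cis x))"
    unfolding arc_measure_def by (subst AE_distr_iff) auto
  also have "\<dots> \<longleftrightarrow> (AE x in lborel. x \<in> {0..2*pi} \<longrightarrow> P (cis x))"
    by (rule AE_uniform_measure) auto
  finally show ?thesis .
qed

lemma AE_arc_measure_nontrivial: "\<not> (AE t in arc_measure. False)"
proof
  assume "AE t in arc_measure. False"
  then have "AE x in lborel. x \<notin> {0..2*pi}"
    by (subst (asm) AE_arc_measure_iff) auto
  then have "emeasure lborel {0..2*pi} = 0"
    by (subst (asm) AE_iff_measurable[of "{0..2*pi}"]) auto
  then show False by simp
qed

lemma AE_arc_measure_inverse:
  assumes [measurable]: "Measurable.pred borel P"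
    and P: "AE t in arc_measure. P t"
  shows "AE t in arc_measure. P (inverse t)"
proof -
  have "AE x in lborel. x \<in> {0..2*pi} \<longrightarrow> P (cis x)"
    using P by (simp add: AE_arc_measure_iff)
  then have "AE x in lborel. 2*pi + (-1) * x \<in> {0..2*pi} \<longrightarrow> P (cis (2*pi + (-1) * x))"
    by (intro AE_borel_affine) auto
  moreover have "cis (2*pi + (-1) * x) = inverse (cis x)" for x
    by (simp add: cis_inverse complex_eq_iff cos_diff sin_diff)
  ultimately show ?thesis
    by (subst AE_arc_measure_iff) (auto elim!: eventually_mono)
qed

lemma cnj_borel_measurable [measurable]: "cnj \<in> borel_measurable borel"
  by (intro borel_measurable_continuous_onI continuous_intros)

lemma powi_borel_measurable [measurable]: "(\<lambda>t::complex. t powi n) \<in> borel_measurable borel"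
  by (cases "n \<ge> 0") (simp_all add: power_int_def)

definition circ_eq :: "(complex \<Rightarrow> complex) \<Rightarrow> (complex \<Rightarrow> complex) \<Rightarrow> bool" where
  "circ_eq f g \<longleftrightarrow> f \<in> borel_measurable borel \<and> g \<in> borel_measurable borel \<and>
     (AE t in arc_measure. f t = g t)"

quotient_type circ_fun = "complex \<Rightarrow> complex" / partial: circ_eq
proof (rule part_equivpI)
  show "\<exists>f. circ_eq f f"
    by (rule exI[of _ "\<lambda>_. 0"]) (simp add: circ_eq_def)
  show "symp circ_eq"
    by (auto simp: circ_eq_def symp_def elim!: eventually_mono)
  show "transp circ_eq"
    by (auto simp: circ_eq_def transp_def elim!: eventually_elim2)
qed

instantiation circ_fun :: comm_ring_1
begin

lift_definition zero_circ_fun :: circ_fun is "\<lambda>_. 0"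
  by (simp add: circ_eq_def)

lift_definition one_circ_fun :: circ_fun is "\<lambda>_. 1"
  by (simp add: circ_eq_def)

lift_definition plus_circ_fun :: "circ_fun \<Rightarrow> circ_fun \<Rightarrow> circ_fun" is "\<lambda>f g t. f t + g t"
  by (auto simp: circ_eq_def elim!: eventually_elim2)

lift_definition minus_circ_fun :: "circ_fun \<Rightarrow> circ_fun \<Rightarrow> circ_fun" is "\<lambda>f g t. f t - g t"
  by (auto simp: circ_eq_def elim!: eventually_elim2)

lift_definition uminus_circ_fun :: "circ_fun \<Rightarrow> circ_fun" is "\<lambda>f t. - f t"
  by (auto simp: circ_eq_def elim!: eventually_mono)

lift_definition times_circ_fun :: "circ_fun \<Rightarrow> circ_fun \<Rightarrow> circ_fun" is "\<lambda>f g t. f t * g t"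
  by (auto simp: circ_eq_def elim!: eventually_elim2)

instance
proof
  show "(0::circ_fun) \<noteq> 1"
    by transfer (auto simp: circ_eq_def AE_arc_measure_nontrivial)
qed (transfer; auto simp: circ_eq_def algebra_simps)+

end

text \<open>The pointwise inverse, with \<open>inverse 0 = 0\<close>. If \<open>a\<close> is invertible in \<open>L\<^sup>\<infinity>\<close>, it is the inverse of \<open>a\<close>.\<close>

instantiation circ_fun :: inverse
begin

lift_definition inverse_circ_fun :: "circ_fun \<Rightarrow> circ_fun" is "\<lambda>f t. inverse (f t)"
  by (auto simp: circ_eq_def elim!: eventually_mono)

definition divide_circ_fun :: "circ_fun \<Rightarrow> circ_fun \<Rightarrow> circ_fun" where
  "divide_circ_fun f g = f * inverse g"

instance ..

end

lift_definition cscale :: "complex \<Rightarrow> circ_fun \<Rightarrow> circ_fun" is "\<lambda>z f t. z * f t"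
  by (auto simp: circ_eq_def elim!: eventually_mono)

global_interpretation circ: vector_space cscale
  by unfold_locales (transfer; auto simp: circ_eq_def algebra_simps)+

text \<open>The coordinate function \<open>t\<close>.\<close>

lift_definition coord :: circ_fun is "\<lambda>t. t"
  by (simp add: circ_eq_def)

lift_definition conjugate :: "circ_fun \<Rightarrow> circ_fun" is "\<lambda>f t. cnj (f t)"
  by (auto simp: circ_eq_def elim!: eventually_mono)

text \<open>\<open>reflect a\<close> is the function \<open>t \<mapsto> a (1/t)\<close>.\<close>

lift_definition reflect :: "circ_fun \<Rightarrow> circ_fun" is "\<lambda>f t. f (inverse t)"
proof -
  fix f g assume "circ_eq f g"
  then have [measurable]: "f \<in> borel_measurable borel" "g \<in> borel_measurable borel"
    and "AE t in arc_measure. f t = g t"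
    by (auto simp: circ_eq_def)
  then have "AE t in arc_measure. f (inverse t) = g (inverse t)"
    by (intro AE_arc_measure_inverse) auto
  then show "circ_eq (\<lambda>t. f (inverse t)) (\<lambda>t. g (inverse t))"
    by (simp add: circ_eq_def)
qed

section \<open>Lebesgue and Hardy spaces\<close>

lift_definition fourier :: "circ_fun \<Rightarrow> int \<Rightarrow> complex" is
  "\<lambda>f n. LINT t|arc_measure. f t * t powi (- n)"
  by (intro ext integral_cong_AE) (auto simp: circ_eq_def elim!: eventually_mono)

lift_definition pairing :: "circ_fun \<Rightarrow> circ_fun \<Rightarrow> complex" is
  "\<lambda>f g. LINT t|arc_measure. f t * cnj (g t)"
  by (intro integral_cong_AE) (auto simp: circ_eq_def elim!: eventually_elim2)

lift_definition bounded_ae :: "circ_fun \<Rightarrow> bool" is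
  "\<lambda>f. \<exists>C. AE t in arc_measure. norm (f t) \<le> C"
  by (intro ex_cong1 eventually_subst) (auto simp: circ_eq_def elim!: eventually_mono)

lift_definition p_integrable :: "real \<Rightarrow> circ_fun \<Rightarrow> bool" is
  "\<lambda>p f. integrable arc_measure (\<lambda>t. norm (f t) powr p)"
  by (intro integrable_cong_AE) (auto simp: circ_eq_def elim!: eventually_mono)

lift_definition Lp_norm :: "real \<Rightarrow> circ_fun \<Rightarrow> real" is
  "\<lambda>p f. (LINT t|arc_measure. norm (f t) powr p) powr (1 / p)"
  by (intro arg_cong2[where f = "(powr)"] integral_cong_AE)
    (auto simp: circ_eq_def elim!: eventually_mono)

definition Linf :: "circ_fun set" where
  "Linf = {f. bounded_ae f}"

definition Lp :: "real \<Rightarrow> circ_fun set" where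
  "Lp p = {f. p_integrable p f}"

definition Hp :: "real \<Rightarrow> circ_fun set" where
  "Hp p = {f \<in> Lp p. \<forall>n<0. fourier f n = 0}"

definition invertible_Linf :: "circ_fun \<Rightarrow> bool" where
  "invertible_Linf a \<longleftrightarrow> a \<in> Linf \<and> (\<exists>g\<in>Linf. a * g = 1)"

section \<open>Operators on Hardy spaces\<close>

text \<open>Operators are functions on all of \<open>circ_fun\<close>, of which only the values on the
  Hardy space under consideration matter.\<close>

definition bounded_operator :: "real \<Rightarrow> (circ_fun \<Rightarrow> circ_fun) \<Rightarrow> bool" where
  "bounded_operator p A \<longleftrightarrow>
     (\<forall>f\<in>Hp p. A f \<in> Hp p) \<and>
     (\<forall>f\<in>Hp p. \<forall>g\<in>Hp p. A (f + g) = A f + A g) \<and>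
     (\<forall>z. \<forall>f\<in>Hp p. A (cscale z f) = cscale z (A f)) \<and>
     (\<exists>C. \<forall>f\<in>Hp p. Lp_norm p (A f) \<le> C * Lp_norm p f)"

definition right_invertible :: "real \<Rightarrow> (circ_fun \<Rightarrow> circ_fun) \<Rightarrow> bool" where
  "right_invertible p A \<longleftrightarrow>
     bounded_operator p A \<and> (\<exists>B. bounded_operator p B \<and> (\<forall>f\<in>Hp p. A (B f) = f))"

definition left_invertible :: "real \<Rightarrow> (circ_fun \<Rightarrow> circ_fun) \<Rightarrow> bool" where
  "left_invertible p A \<longleftrightarrow>
     bounded_operator p A \<and> (\<exists>B. bounded_operator p B \<and> (\<forall>f\<in>Hp p. B (A f) = f))"

definition ker :: "real \<Rightarrow> (circ_fun \<Rightarrow> circ_fun) \<Rightarrow> circ_fun set" where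
  "ker p A = {f \<in> Hp p. A f = 0}"

definition conj_exponent :: "real \<Rightarrow> real" where
  "conj_exponent p = p / (p - 1)"

text \<open>The dual of \<open>H\<^sup>p\<close> is identified with \<open>H\<^sup>q\<close>, \<open>1/p + 1/q = 1\<close>, through the sesquilinear
  pairing, so the adjoint of an operator on \<open>H\<^sup>p\<close> is an operator on \<open>H\<^sup>q\<close>.\<close>

definition adjoint_Hp :: "real \<Rightarrow> (circ_fun \<Rightarrow> circ_fun) \<Rightarrow> circ_fun \<Rightarrow> circ_fun" where
  "adjoint_Hp p A g =
     (THE h. h \<in> Hp (conj_exponent p) \<and> (\<forall>f\<in>Hp p. pairing (A f) g = pairing f h))"

definition coker :: "real \<Rightarrow> (circ_fun \<Rightarrow> circ_fun) \<Rightarrow> circ_fun set" where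
  "coker p A = ker (conj_exponent p) (adjoint_Hp p A)"

definition finite_dimensional :: "circ_fun set \<Rightarrow> bool" where
  "finite_dimensional V \<longleftrightarrow> (\<exists>B. finite B \<and> V \<subseteq> circ.span B)"

definition closed_in_Hp :: "real \<Rightarrow> circ_fun set \<Rightarrow> bool" where
  "closed_in_Hp p S \<longleftrightarrow>
     (\<forall>f g. (\<forall>n::nat. f n \<in> S) \<and> g \<in> Hp p \<and> (\<lambda>n. Lp_norm p (f n - g)) \<longlonglongrightarrow> 0 \<longrightarrow> g \<in> S)"

definition fredholm :: "real \<Rightarrow> (circ_fun \<Rightarrow> circ_fun) \<Rightarrow> bool" where
  "fredholm p A \<longleftrightarrow>
     bounded_operator p A \<and> closed_in_Hp p (A ` Hp p) \<and>
     finite_dimensional (ker p A) \<and> finite_dimensional (coker p A)"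

definition ind :: "real \<Rightarrow> (circ_fun \<Rightarrow> circ_fun) \<Rightarrow> int" where
  "ind p A = int (circ.dim (ker p A)) - int (circ.dim (coker p A))"

definition direct_sum :: "circ_fun set \<Rightarrow> circ_fun set \<Rightarrow> circ_fun set \<Rightarrow> bool" where
  "direct_sum V U W \<longleftrightarrow>
     circ.subspace U \<and> circ.subspace W \<and> U \<inter> W = {0} \<and> V = {u + w | u w. u \<in> U \<and> w \<in> W}"

section \<open>Toeplitz and Hankel operators\<close>

text \<open>The Riesz projection \<open>\<Sum>n. f\<^sub>n t\<^sup>n \<mapsto> \<Sum>n\<ge>0. f\<^sub>n t\<^sup>n\<close>. Fourier coefficients determine an \<open>L\<^sup>1\<close>
  function, so the value does not depend on \<open>p\<close>; for \<open>f \<in> L\<^sup>p\<close> with \<open>1 < p < \<infinity>\<close> it lies in \<open>H\<^sup>p\<close>.\<close>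

definition riesz :: "circ_fun \<Rightarrow> circ_fun" where
  "riesz f = (THE g. g \<in> Hp 1 \<and> (\<forall>n\<ge>0. fourier g n = fourier f n))"

definition riesz_compl :: "circ_fun \<Rightarrow> circ_fun" where
  "riesz_compl f = f - riesz f"

definition flipJ :: "circ_fun \<Rightarrow> circ_fun" where
  "flipJ f = conjugate coord * reflect f"

definition toeplitz :: "circ_fun \<Rightarrow> circ_fun \<Rightarrow> circ_fun" where
  "toeplitz a f = riesz (a * f)"

definition hankel :: "circ_fun \<Rightarrow> circ_fun \<Rightarrow> circ_fun" where
  "hankel a f = riesz (a * riesz_compl (flipJ f))"

definition T_plus_H :: "circ_fun \<Rightarrow> circ_fun \<Rightarrow> circ_fun \<Rightarrow> circ_fun" where
  "T_plus_H a b f = toeplitz a f + hankel b f"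

definition T_minus_H :: "circ_fun \<Rightarrow> circ_fun \<Rightarrow> circ_fun \<Rightarrow> circ_fun" where
  "T_minus_H a b f = toeplitz a f - hankel b f"

section \<open>Matching pairs\<close>

definition matching_pair :: "circ_fun \<Rightarrow> circ_fun \<Rightarrow> bool" where
  "matching_pair a b \<longleftrightarrow> invertible_Linf a \<and> b \<in> Linf \<and> a * reflect a = b * reflect b"

definition subordinated_pair :: "circ_fun \<Rightarrow> circ_fun \<Rightarrow> circ_fun \<times> circ_fun" where
  "subordinated_pair a b = (a * inverse b, b * inverse (reflect a))"

definition fredholm_matching_pair :: "real \<Rightarrow> circ_fun \<Rightarrow> circ_fun \<Rightarrow> bool" where
  "fredholm_matching_pair p a b \<longleftrightarrow> matching_pair a b \<and>
     (case subordinated_pair a b of (c, d) \<Rightarrow> fredholm p (toeplitz c) \<and> fredholm p (toeplitz d))"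

definition PP :: "circ_fun \<Rightarrow> circ_fun \<Rightarrow> circ_fun" where
  "PP g f = flipJ (riesz_compl (g * riesz f))"

text \<open>The images of the complementary projections of \<open>ker T(g)\<close>, on \<open>H\<^sup>p\<close>,
  associated with the restriction of \<open>PP g\<close>.\<close>

definition im_PP_plus :: "real \<Rightarrow> circ_fun \<Rightarrow> circ_fun set" where
  "im_PP_plus p g = (\<lambda>f. cscale (1/2) (f + PP g f)) ` ker p (toeplitz g)"

definition im_PP_minus :: "real \<Rightarrow> circ_fun \<Rightarrow> circ_fun set" where
  "im_PP_minus p g = (\<lambda>f. cscale (1/2) (f - PP g f)) ` ker p (toeplitz g)"

text \<open>The right inverse \<open>T\<^sup>-\<^sup>1(g t\<^sup>\<kappa>) T(t\<^sup>\<kappa>)\<close> of \<open>T(g)\<close>, where \<open>\<kappa> \<ge> 0\<close> is the index of \<open>T(g)\<close> on \<open>H\<^sup>p\<close>.\<close>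

definition toeplitz_right_inv :: "real \<Rightarrow> circ_fun \<Rightarrow> circ_fun \<Rightarrow> circ_fun" where
  "toeplitz_right_inv p g f =
     (let \<kappa> = nat (ind p (toeplitz g))
      in the_inv_into (Hp p) (toeplitz (g * coord ^ \<kappa>)) (toeplitz (coord ^ \<kappa>) f))"

definition phi_plus :: "real \<Rightarrow> circ_fun \<Rightarrow> circ_fun \<Rightarrow> circ_fun \<Rightarrow> circ_fun" where
  "phi_plus p \<alpha> \<beta> s =
     (let \<gamma> = fst (subordinated_pair \<alpha> \<beta>);
          r = toeplitz_right_inv p \<gamma> (toeplitz (inverse (reflect \<alpha>)) s)
      in r - flipJ (riesz_compl (\<gamma> * riesz r)) + flipJ (riesz_compl (inverse (reflect \<alpha>) * s)))"

definition phi_minus :: "real \<Rightarrow> circ_fun \<Rightarrow> circ_fun \<Rightarrow> circ_fun \<Rightarrow> circ_fun" where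
  "phi_minus p \<alpha> \<beta> s =
     (let \<gamma> = fst (subordinated_pair \<alpha> \<beta>);
          r = toeplitz_right_inv p \<gamma> (toeplitz (inverse (reflect \<alpha>)) s)
      in r + flipJ (riesz_compl (\<gamma> * riesz r)) - flipJ (riesz_compl (inverse (reflect \<alpha>) * s)))"

end

theory Submission
  imports Defs "HOL-Complex_Analysis.Complex_Analysis"
begin

text \<open>Everything reduces to one identity. For a matching pair, \<open>G = a f + \<epsilon> b J f\<close> satisfies \<open>d J G = \<epsilon> G\<close>, and
  \<open>(T(a) + \<epsilon> H(b)) f = P G\<close>. Hence if \<open>f\<close> is in the kernel, \<open>s = J G\<close> lies in the \<open>\<epsilon>\<close>-eigenspace of \<open>P\<^sub>d\<close>, and \<open>s = 0\<close> exactly when \<open>f\<close> lies in the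
  \<open>-\<epsilon>\<close>-eigenspace of \<open>P\<^sub>c\<close>. Conversely, if \<open>g J y = \<epsilon> y\<close> and \<open>R\<close> is a right inverse of \<open>T(g)\<close>, then
  \<open>x = (R P y + \<epsilon> J (y - g R P y)) / 2\<close> solves \<open>g x + \<epsilon> J x = y\<close>. For \<open>g = c\<close> this gives \<open>\<phi>\<^sub>\<plusminus>\<close>, up to a constant factor a section of
  \<open>f \<mapsto> s\<close>; used for \<open>c\<close> and \<open>d\<close> it gives a right inverse of \<open>T(a) + \<epsilon> H(b)\<close>.

  The analytic input is that \<open>T(g t\<^sup>\<kappa>)\<close> is invertible when \<open>T(g)\<close> is Fredholm of index \<open>\<kappa>\<close>. It rests on Coburn's lemma (a nonzero
  function in a Hardy space is nonzero almost everywhere), on the duality of \<open>H\<^sup>p\<close> and \<open>H\<^sup>q\<close>, which follows from uniform convexity, and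
  on M. Riesz's theorem that \<open>P\<close> is bounded.\<close>

section \<open>Arc length measure\<close>

text \<open>Write a~ for the reflection of a. The matching condition enters through the relations d
  a~ = b and d b~ = a: J turns a f + \<epsilon> b J f into a~ J f + \<epsilon> b~ f, and
  multiplication by d exchanges the two terms. Moreover c c~ = d d~ = 1, so f \<mapsto> J (c f) and
  f \<mapsto> J (d f) are involutions. The cokernel statements are the kernel statements of the
  adjoint: conj a and the reflection of conj b again match, with conj d and conj c in place of c and
  d, and the indices change sign. This is why the duality of H^p and H^q is part of the input. In
  the mixed case T(d) is injective on H^p and T(conj c) on H^q, which forces s = 0 for the operator
  and for its adjoint. For M. Riesz's theorem the obstacle is the range of p: a pointwise inequality
  in the half plane works for 1 < p \<le> 2, where p arg z stays within [-pi, pi]; larger p follows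
  by transposition. As \<open>riesz\<close> is a definite description, this theorem also has to
  supply the existence of P f.\<close>

lemma emeasure_arc_measure_space [simp]: "emeasure arc_measure UNIV = 1"
proof -
  have "emeasure arc_measure UNIV = emeasure (uniform_measure lborel {0..2*pi}) UNIV"
    unfolding arc_measure_def by (subst emeasure_distr) auto
  also have "\<dots> = ennreal (2*pi) / ennreal (2*pi)"
    by (subst emeasure_uniform_measure) auto
  also have "\<dots> = 1"
    by (rule ennreal_divide_self) auto
  finally show ?thesis .
qed

interpretation arc: finite_measure arc_measure
  by standard auto

lemma measure_arc_measure_space [simp]: "measure arc_measure UNIV = 1"
  by (simp add: measure_def)

lemma integral_arc_measure:
  fixes f :: "complex \<Rightarrow> 'b::{banach, second_countable_topology}"
  assumes [measurable]: "f \<in> borel_measurable borel"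
  shows "(LINT t|arc_measure. f t) = (LINT x:{0..2*pi}|lborel. f (cis x)) /\<^sub>R (2*pi)"
proof -
  have "(LINT t|arc_measure. f t) = (LINT x|uniform_measure lborel {0..2*pi}. f (cis x))"
    unfolding arc_measure_def by (subst integral_distr) auto
  also have "\<dots> = (LINT x:{0..2*pi}|lborel. f (cis x)) /\<^sub>R (2*pi)"
  proof -
    have "uniform_measure lborel {0..2*pi} = density lborel (\<lambda>x. ennreal (indicator {0..2*pi} x / (2*pi)))"
      unfolding uniform_measure_def
    proof (intro density_cong AE_I2)
      fix x :: real
      show "indicator {0..2 * pi} x / emeasure lborel {0..2 * pi} = ennreal (indicator {0..2 * pi} x / (2 * pi))"
        using divide_ennreal[of 1 "2*pi"] by (cases "x \<in> {0..2*pi}") simp_all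
    qed simp_all
    then have "(LINT x|uniform_measure lborel {0..2*pi}. f (cis x)) =
        (LINT x|lborel. (indicator {0..2*pi} x / (2*pi)) *\<^sub>R f (cis x))"
      by (simp add: integral_density)
    also have "\<dots> = (LINT x|lborel. (1 / (2*pi)) *\<^sub>R (indicator {0..2*pi} x *\<^sub>R f (cis x)))"
      by simp
    also have "\<dots> = (LINT x:{0..2*pi}|lborel. f (cis x)) /\<^sub>R (2*pi)"
      unfolding set_lebesgue_integral_def by (subst integral_scaleR_right) (simp only: inverse_eq_divide)
    finally show ?thesis .
  qed
  finally show ?thesis .
qed

lemma AE_arc_measure_norm: "AE t in arc_measure. norm t = 1"
  by (subst AE_arc_measure_iff) auto

text \<open>In the angle, inversion is x \<mapsto> 2 pi - x, which preserves Lebesgue measure and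
  the interval [0, 2 pi]. It makes \<open>reflect\<close> and \<open>flipJ\<close> isometries of
  every L^p.\<close>

lemma distr_arc_measure_inverse: "distr arc_measure borel inverse = arc_measure"
proof (rule measure_eqI)
  fix A assume "A \<in> sets (distr arc_measure borel inverse)"
  then have A [measurable]: "A \<in> sets borel" by simp
  have em: "emeasure arc_measure B = (\<integral>\<^sup>+x. indicator {0..2*pi} x * indicator B (cis x) \<partial>lborel) / ennreal (2*pi)"
    if [measurable]: "B \<in> sets borel" for B
  proof -
    have "emeasure arc_measure B = emeasure (uniform_measure lborel {0..2*pi}) (cis -` B)"
      unfolding arc_measure_def by (subst emeasure_distr) auto
    also have "\<dots> = emeasure lborel ({0..2*pi} \<inter> cis -` B) / ennreal (2*pi)"
      using measurable_sets[OF cis_borel_measurable that]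
      by (subst emeasure_uniform_measure) auto
    also have "emeasure lborel ({0..2*pi} \<inter> cis -` B) =
        (\<integral>\<^sup>+x. indicator ({0..2*pi} \<inter> cis -` B) x \<partial>lborel)"
      using measurable_sets[OF cis_borel_measurable that]
      by (subst nn_integral_indicator) auto
    also have "\<dots> = (\<integral>\<^sup>+x. indicator {0..2*pi} x * indicator B (cis x) \<partial>lborel)"
      by (intro nn_integral_cong) (auto simp: indicator_def)
    finally show ?thesis .
  qed
  have cis: "cis (2*pi - x) = inverse (cis x)" for x
    by (simp add: cis_inverse complex_eq_iff cos_diff sin_diff)
  have "emeasure (distr arc_measure borel inverse) A = emeasure arc_measure (inverse -` A)"
    by (subst emeasure_distr) auto
  also have "\<dots> = (\<integral>\<^sup>+x. indicator {0..2*pi} x * indicator (inverse -` A) (cis x) \<partial>lborel) / ennreal (2*pi)"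
    by (rule em) (use measurable_sets[of inverse borel borel A] in auto)
  also have "(\<integral>\<^sup>+x. indicator {0..2*pi} x * indicator (inverse -` A) (cis x) \<partial>lborel) =
     (\<integral>\<^sup>+x. indicator {0..2*pi} (2*pi + (-1) * x) * indicator A (cis (2*pi + (-1) * x)) \<partial>lborel)"
    by (intro nn_integral_cong) (auto simp: indicator_def cis)
  also have "\<dots> = (\<integral>\<^sup>+x. indicator {0..2*pi} x * indicator A (cis x) \<partial>lborel)"
    by (subst (2) nn_integral_real_affine[where c="-1" and t="2*pi"]) auto
  also have "\<dots> / ennreal (2*pi) = emeasure arc_measure A"
    by (rule em[symmetric]) simp
  finally show "emeasure (distr arc_measure borel inverse) A = emeasure arc_measure A" .
qed simp

lemma integral_arc_measure_inverse:
  fixes f :: "complex \<Rightarrow> 'b::{banach, second_countable_topology}"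
  assumes [measurable]: "f \<in> borel_measurable borel"
  shows "(LINT t|arc_measure. f (inverse t)) = (LINT t|arc_measure. f t)"
  by (subst (2) distr_arc_measure_inverse[symmetric], subst integral_distr) auto

lemma integrable_arc_measure_inverse:
  fixes f :: "complex \<Rightarrow> 'b::{banach, second_countable_topology}"
  assumes [measurable]: "f \<in> borel_measurable borel"
  shows "integrable arc_measure (\<lambda>t. f (inverse t)) \<longleftrightarrow> integrable arc_measure f"
  by (subst (2) distr_arc_measure_inverse[symmetric], subst integrable_distr_eq) auto

lemma integrable_arc_bounded:
  fixes f :: "complex \<Rightarrow> 'b::{banach, second_countable_topology}"
  assumes "f \<in> borel_measurable borel" "AE t in arc_measure. norm (f t) \<le> C"
  shows "integrable arc_measure f"
  using assms by (intro arc.integrable_const_bound[of _ C]) auto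

lemma norm_powi_circle: "norm t = 1 \<Longrightarrow> norm (t powi n) = (1::real)" for t :: complex
  by (simp add: norm_power_int)

lemma cnj_circle: "norm t = 1 \<Longrightarrow> cnj t = inverse t"
  by (metis complex_norm_square inverse_unique mult_1_right of_real_1 power_one)



lemma integral_arc_measure_interval:
  assumes "f \<in> borel_measurable borel" "continuous_on UNIV (\<lambda>x. f (cis x))"
  shows "(LINT t|arc_measure. f t) = integral {0..2*pi} (\<lambda>x. f (cis x) :: complex) /\<^sub>R (2*pi)"
proof -
  have "set_integrable lborel {0..2*pi} (\<lambda>x. f (cis x))"
    using assms(2) continuous_on_subset by (intro borel_integrable_atLeastAtMost') blast
  from set_borel_integral_eq_integral(2)[OF this] show ?thesis
    by (simp add: integral_arc_measure[OF assms(1)])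
qed

text \<open>For n \<noteq> 0 the primitive cis (n x) / (i n) takes the same value at 0 and at 2
  pi.\<close>

lemma integral_arc_powi: "(LINT t|arc_measure. t powi n) = (if n = 0 then 1 else 0)"
proof -
  have "(LINT t|arc_measure. t powi n) = integral {0..2*pi} (\<lambda>x. cis (of_int n * x)) /\<^sub>R (2*pi)"
    by (subst integral_arc_measure_interval) (auto simp: cis_power_int intro!: continuous_intros)
  also have "integral {0..2*pi} (\<lambda>x. cis (of_int n * x)) = (if n = 0 then 2 * pi else 0)"
  proof (cases "n = 0")
    case False
    have "((\<lambda>x. cis (of_int n * x)) has_integral
       (cis (of_int n * (2*pi)) / (\<i> * of_int n) - cis (of_int n * 0) / (\<i> * of_int n))) {0..2*pi}"
    proof (rule fundamental_theorem_of_calculus)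
      fix x :: real
      show "((\<lambda>x. cis (of_int n * x) / (\<i> * of_int n)) has_vector_derivative cis (of_int n * x))
          (at x within {0..2*pi})"
      proof -
        \<comment> \<open>The derivative is taken in a complex variable and then restricted to the
          real line.\<close>
        have "((\<lambda>z. exp (\<i> * (of_int n * z)) / (\<i> * of_int n)) has_field_derivative exp (\<i> * (of_int n * complex_of_real x)))
           (at (complex_of_real x))"
        proof -
          have ii: "- (\<i> * (z * \<i>)) = z" for z by (simp add: complex_eq_iff)
          show ?thesis using False by (auto intro!: derivative_eq_intros simp: ii)
        qed
        note v = has_vector_derivative_real_field[OF this]
        show ?thesis using v unfolding cis_conv_exp o_def of_real_mult of_real_of_int_eq .
      qed
    qed auto
    moreover have "cis (of_int n * (2*pi)) = 1"
      using cis_multiple_2pi[of "of_int n"] by (simp add: mult.commute)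
    ultimately show ?thesis using False by (simp add: integral_unique)
  qed (simp add: scaleR_conv_of_real)
  finally have *: "(LINT t|arc_measure. t powi n) = complex_of_real (if n = 0 then 2 * pi else 0) /\<^sub>R (2*pi)" .
  show ?thesis unfolding * by (cases "n = 0") (simp_all add: scaleR_conv_of_real)
qed

section \<open>Lebesgue spaces on the circle\<close>

abbreviation rep :: "circ_fun \<Rightarrow> complex \<Rightarrow> complex" where "rep \<equiv> rep_circ_fun"

lemma circ_eq_rep: "circ_eq (rep f) (rep f)"
  using Quotient_rep_reflp[OF Quotient_circ_fun] .

lemma rep_measurable [measurable, simp]: "rep f \<in> borel_measurable borel"
  using circ_eq_rep[of f] by (simp add: circ_eq_def)

lemma abs_rep [simp]: "abs_circ_fun (rep f) = f"
  using Quotient_abs_rep[OF Quotient_circ_fun] .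

lemma rep_abs: 
  assumes "g \<in> borel_measurable borel"
  shows "AE t in arc_measure. rep (abs_circ_fun g) t = g t"
proof -
  have "circ_eq (rep (abs_circ_fun g)) g"
  proof -
    have "circ_eq g g" using assms by (simp add: circ_eq_def)
    then show ?thesis
      using Quotient_rel[OF Quotient_circ_fun, of "rep (abs_circ_fun g)" g] circ_eq_rep by simp
  qed
  then show ?thesis by (simp add: circ_eq_def)
qed

lemma circ_fun_eq_iff: "f = g \<longleftrightarrow> (AE t in arc_measure. rep f t = rep g t)"
  using Quotient_rel_rep[OF Quotient_circ_fun, of f g] by (auto simp: circ_eq_def)

lemma circ_fun_eqI: "AE t in arc_measure. rep f t = rep g t \<Longrightarrow> f = g"
  by (simp add: circ_fun_eq_iff)

lemma rep_zero: "AE t in arc_measure. rep 0 t = 0"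
  unfolding zero_circ_fun_def by (rule rep_abs) simp
lemma rep_one: "AE t in arc_measure. rep 1 t = 1"
  unfolding one_circ_fun_def by (rule rep_abs) simp
lemma rep_add: "AE t in arc_measure. rep (f + g) t = rep f t + rep g t"
  unfolding plus_circ_fun_def map_fun_def o_def id_def by (rule rep_abs) simp
lemma rep_diff: "AE t in arc_measure. rep (f - g) t = rep f t - rep g t"
  unfolding minus_circ_fun_def map_fun_def o_def id_def by (rule rep_abs) simp
lemma rep_mult: "AE t in arc_measure. rep (f * g) t = rep f t * rep g t"
  unfolding times_circ_fun_def map_fun_def o_def id_def by (rule rep_abs) simp
lemma rep_inverse: "AE t in arc_measure. rep (inverse f) t = inverse (rep f t)"
  unfolding inverse_circ_fun_def map_fun_def o_def id_def by (rule rep_abs) simp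
lemma rep_cscale: "AE t in arc_measure. rep (cscale z f) t = z * rep f t"
  unfolding cscale_def map_fun_def o_def id_def by (rule rep_abs) simp
lemma rep_conjugate: "AE t in arc_measure. rep (conjugate f) t = cnj (rep f t)"
  unfolding conjugate_def map_fun_def o_def id_def by (rule rep_abs) simp
lemma rep_reflect: "AE t in arc_measure. rep (reflect f) t = rep f (inverse t)"
  unfolding reflect_def map_fun_def o_def id_def by (rule rep_abs) simp

lemma fourier_rep: "fourier f n = (LINT t|arc_measure. rep f t * t powi (- n))"
  by (simp add: fourier_def)
lemma pairing_rep: "pairing f g = (LINT t|arc_measure. rep f t * cnj (rep g t))"
  by (simp add: pairing_def)
lemma bounded_ae_rep: "bounded_ae f \<longleftrightarrow> (\<exists>C. AE t in arc_measure. norm (rep f t) \<le> C)"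
  by (simp add: bounded_ae_def)
lemma p_integrable_rep: "p_integrable p f \<longleftrightarrow> integrable arc_measure (\<lambda>t. norm (rep f t) powr p)"
  by (simp add: p_integrable_def)
lemma Lp_norm_rep: "Lp_norm p f = (LINT t|arc_measure. norm (rep f t) powr p) powr (1 / p)"
  by (simp add: Lp_norm_def)

section \<open>The norms of L^p, and the inequalities of Minkowski and Hoelder\<close>

lemma Lp_iff: "f \<in> Lp p \<longleftrightarrow> integrable arc_measure (\<lambda>t. norm (rep f t) powr p)"
  by (simp add: Lp_def p_integrable_rep)

lemma Linf_iff: "f \<in> Linf \<longleftrightarrow> (\<exists>C. AE t in arc_measure. norm (rep f t) \<le> C)"
  by (simp add: Linf_def bounded_ae_rep)

lemma LinfI: "AE t in arc_measure. norm (rep f t) \<le> C \<Longrightarrow> f \<in> Linf"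
  by (auto simp: Linf_iff)

lemma LinfE:
  assumes "f \<in> Linf"
  obtains C where "C > 0" "AE t in arc_measure. norm (rep f t) \<le> C"
proof -
  obtain C where C: "AE t in arc_measure. norm (rep f t) \<le> C" using assms by (auto simp: Linf_iff)
  have "AE t in arc_measure. norm (rep f t) \<le> max C 1" using C by eventually_elim simp
  then show ?thesis using that[of "max C 1"] by simp
qed

lemma Lp_norm_nonneg [simp]: "0 \<le> Lp_norm p f"
  by (simp add: Lp_norm_rep)

lemma Lp_norm_powr:
  assumes "p > 0" shows "Lp_norm p f powr p = (LINT t|arc_measure. norm (rep f t) powr p)"
  using assms by (simp add: Lp_norm_rep powr_powr)

lemma Lp_norm_leI:
  assumes "p > 0" "C \<ge> 0" "(LINT t|arc_measure. norm (rep f t) powr p) \<le> C powr p"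
  shows "Lp_norm p f \<le> C"
proof -
  have "Lp_norm p f \<le> (C powr p) powr (1/p)"
    unfolding Lp_norm_rep using assms by (intro powr_mono2) auto
  then show ?thesis using assms by (simp add: powr_powr)
qed

lemma Lp_dominated:
  assumes "g \<in> Lp p" "p \<ge> 0" "AE t in arc_measure. norm (rep f t) \<le> norm (rep g t)"
  shows "f \<in> Lp p"
  unfolding Lp_iff
proof (rule Bochner_Integration.integrable_bound)
  show "integrable arc_measure (\<lambda>t. norm (rep g t) powr p)" using assms by (simp add: Lp_iff)
  show "AE t in arc_measure. norm (norm (rep f t) powr p) \<le> norm (norm (rep g t) powr p)"
    using assms(3) by eventually_elim (use assms in \<open>auto intro!: powr_mono2\<close>)
qed simp

lemma Lp_norm_mono:
  assumes "g \<in> Lp p" "p > 0" "AE t in arc_measure. norm (rep f t) \<le> norm (rep g t)"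
  shows "Lp_norm p f \<le> Lp_norm p g"
proof -
  have f: "f \<in> Lp p" using Lp_dominated assms by auto
  have "(LINT t|arc_measure. norm (rep f t) powr p) \<le> (LINT t|arc_measure. norm (rep g t) powr p)"
    using assms f by (intro integral_mono_AE) (auto simp: Lp_iff elim!: eventually_mono intro!: powr_mono2)
  then show ?thesis unfolding Lp_norm_rep using assms by (intro powr_mono2) auto
qed

lemma Lp_norm_cong:
  assumes "AE t in arc_measure. norm (rep f t) = norm (rep g t)"
  shows "Lp_norm p f = Lp_norm p g"
  unfolding Lp_norm_rep
  by (intro arg_cong2[where f="(powr)"] integral_cong_AE) (use assms in \<open>auto elim!: eventually_mono\<close>)

lemma Lp_cong:
  assumes "AE t in arc_measure. norm (rep f t) = norm (rep g t)"
  shows "f \<in> Lp p \<longleftrightarrow> g \<in> Lp p"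
  unfolding Lp_iff
  by (intro integrable_cong_AE) (use assms in \<open>auto elim!: eventually_mono\<close>)

text \<open>Convexity of the p-th power applied to x + y = l (x / l) + (1 - l) (y / (1 - l)). The
  weight stays free: l = 1/2 shows that L^p is closed under addition, and a weight adapted to the
  norms gives Minkowski's inequality.\<close>

lemma powr_add_le_convex:
  fixes x y l p :: real
  assumes "x \<ge> 0" "y \<ge> 0" "0 < l" "l < 1" "p \<ge> 1"
  shows "(x + y) powr p \<le> l powr (1 - p) * x powr p + (1 - l) powr (1 - p) * y powr p"
proof -
  have e: "m * (z / m) powr p = m powr (1 - p) * z powr p" if "m > 0" "z \<ge> 0" for m z
    using that by (simp add: powr_divide powr_diff)
  show ?thesis
  proof (cases "x = 0 \<or> y = 0")
    case False
    then have pos: "x > 0" "y > 0" using assms by auto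
    \<comment> \<open>The first weight is written 1 - (1 - l) to fit the shape of
      \<open>convex_onD\<close>.\<close>
    have "((1 - (1 - l)) *\<^sub>R (x/l) + (1-l) *\<^sub>R (y/(1-l))) powr p
        \<le> (1 - (1 - l)) * (x/l) powr p + (1-l) * (y/(1-l)) powr p"
      using pos assms by (intro convex_onD[OF powr_convex[OF assms(5)]]) auto
    then show ?thesis using assms pos e[of l x] e[of "1 - l" y] by simp
  next
    case True
    \<comment> \<open>If one summand is 0, it suffices that both coefficients are at least
      1.\<close>
    have ge: "1 \<le> m powr (1 - p)" if "0 < m" "m < 1" for m
      using that assms powr_mono'[of "1 - p" 0 m] by simp
    show ?thesis
      using True assms mult_right_mono[OF ge[of l], of "x powr p"]
        mult_right_mono[OF ge[of "1-l"], of "y powr p"] by auto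
  qed
qed

lemma Lp_add:
  assumes "f \<in> Lp p" "g \<in> Lp p" "p \<ge> 1"
  shows "f + g \<in> Lp p"
  unfolding Lp_iff
proof (rule Bochner_Integration.integrable_bound)
  show "integrable arc_measure (\<lambda>t. (1/2) powr (1 - p) * norm (rep f t) powr p + (1/2) powr (1 - p) * norm (rep g t) powr p)"
    using assms by (simp add: Lp_iff)
  show "AE t in arc_measure. norm (norm (rep (f + g) t) powr p)
         \<le> norm ((1 / 2) powr (1 - p) * cmod (rep f t) powr p + (1 / 2) powr (1 - p) * cmod (rep g t) powr p)"
    using rep_add[of f g]
  proof eventually_elim
    case (elim t)
    have "norm (rep (f + g) t) powr p \<le> (norm (rep f t) + norm (rep g t)) powr p"
      using assms(3) by (intro powr_mono2) (auto simp: elim norm_triangle_ineq)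
    also have "\<dots> \<le> (1 / 2) powr (1 - p) * cmod (rep f t) powr p + (1 / 2) powr (1 - p) * cmod (rep g t) powr p"
      using powr_add_le_convex[of "norm (rep f t)" "norm (rep g t)" "1/2" p] assms(3) by simp
    finally show ?case by simp
  qed
qed simp

lemma Lp_cscale:
  assumes "f \<in> Lp p" "p > 0"
  shows "cscale z f \<in> Lp p" and "Lp_norm p (cscale z f) = norm z * Lp_norm p f"
proof -
  have e: "AE t in arc_measure. norm (rep (cscale z f) t) powr p = norm z powr p * norm (rep f t) powr p"
    using rep_cscale[of z f] by eventually_elim (simp add: norm_mult powr_mult)
  show "cscale z f \<in> Lp p" unfolding Lp_iff
    by (subst integrable_cong_AE[OF _ _ e]) (use assms in \<open>auto simp: Lp_iff\<close>)
  have "(LINT t|arc_measure. norm (rep (cscale z f) t) powr p) = (LINT t|arc_measure. norm z powr p * norm (rep f t) powr p)"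
    by (rule integral_cong_AE) (use e in auto)
  then show "Lp_norm p (cscale z f) = norm z * Lp_norm p f"
    using assms by (simp add: Lp_norm_rep powr_mult powr_powr)
qed

lemma Lp_zero [simp]: "p > 0 \<Longrightarrow> 0 \<in> Lp p" "p > 0 \<Longrightarrow> Lp_norm p 0 = 0"
proof -
  assume "p > 0"
  have e: "AE t in arc_measure. norm (rep 0 t) powr p = (0::real)"
    using rep_zero by eventually_elim (use \<open>p > 0\<close> in auto)
  show "0 \<in> Lp p" unfolding Lp_iff
    by (subst integrable_cong_AE[OF _ _ e]) auto
  have "(LINT t|arc_measure. norm (rep 0 t) powr p) = 0"
    using integral_cong_AE[OF _ _ e] by simp
  then show "Lp_norm p 0 = 0" using \<open>p > 0\<close> by (simp add: Lp_norm_rep)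
qed

lemma Lp_norm_eq_0:
  assumes "f \<in> Lp p" "p > 0" "Lp_norm p f = 0" shows "f = 0"
proof -
  have "(LINT t|arc_measure. norm (rep f t) powr p) = 0"
    using assms by (simp add: Lp_norm_rep)
  then have "AE t in arc_measure. norm (rep f t) powr p = 0"
    using assms by (subst (asm) integral_nonneg_eq_0_iff_AE) (auto simp: Lp_iff)
  then have "AE t in arc_measure. rep f t = rep 0 t"
    using rep_zero by eventually_elim auto
  then show ?thesis by (rule circ_fun_eqI)
qed

lemma circ_fun_minus_eq: "f - g = f + cscale (-1) g"
  by (simp add: circ.scale_minus_left)

lemma Lp_uminus: "f \<in> Lp p \<Longrightarrow> p > 0 \<Longrightarrow> - f \<in> Lp p"
  using Lp_cscale(1)[of f p "-1"] by (simp add: circ.scale_minus_left)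

lemma Lp_norm_uminus: "f \<in> Lp p \<Longrightarrow> p > 0 \<Longrightarrow> Lp_norm p (- f) = Lp_norm p f"
  using Lp_cscale(2)[of f p "-1"] by (simp add: circ.scale_minus_left)

lemma Lp_diff: "f \<in> Lp p \<Longrightarrow> g \<in> Lp p \<Longrightarrow> p \<ge> 1 \<Longrightarrow> f - g \<in> Lp p"
  using Lp_add[of f p "- g"] Lp_uminus[of g p] by simp

lemma Lp_norm_triangle:
  assumes f: "f \<in> Lp p" and g: "g \<in> Lp p" and p: "p \<ge> 1"
  shows "Lp_norm p (f + g) \<le> Lp_norm p f + Lp_norm p g"
proof (cases "Lp_norm p f = 0 \<or> Lp_norm p g = 0")
  case True
  then have "f = 0 \<or> g = 0" using Lp_norm_eq_0 assms by auto
  then show ?thesis using p by auto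
next
  case False
  define \<alpha> \<beta> where "\<alpha> = Lp_norm p f" and "\<beta> = Lp_norm p g"
  have pos: "\<alpha> > 0" "\<beta> > 0" using False Lp_norm_nonneg[of p f] Lp_norm_nonneg[of p g]
    unfolding \<alpha>_def \<beta>_def by linarith+
  \<comment> \<open>With this weight l^(1-p) \<alpha>^p = (\<alpha> + \<beta>)^(p-1) \<alpha>, and
    likewise for \<beta>, so the bound collapses to (\<alpha> + \<beta>)^p.\<close>
  define l where "l = \<alpha> / (\<alpha> + \<beta>)"
  have l: "0 < l" "l < 1" "1 - l = \<beta> / (\<alpha> + \<beta>)" using pos by (auto simp: l_def field_simps)
  have "(LINT t|arc_measure. norm (rep (f + g) t) powr p) \<le>
    (LINT t|arc_measure. l powr (1 - p) * norm (rep f t) powr p + (1 - l) powr (1 - p) * norm (rep g t) powr p)"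
  proof (rule integral_mono_AE)
    show "AE t in arc_measure. norm (rep (f + g) t) powr p \<le>
      l powr (1 - p) * cmod (rep f t) powr p + (1 - l) powr (1 - p) * cmod (rep g t) powr p"
      using rep_add[of f g]
    proof eventually_elim
      case (elim t)
      have "norm (rep (f + g) t) powr p \<le> (norm (rep f t) + norm (rep g t)) powr p"
        using p by (intro powr_mono2) (auto simp: elim norm_triangle_ineq)
      also note powr_add_le_convex[OF _ _ l(1,2) p]
      finally show ?case by simp
    qed
  qed (use assms Lp_add[OF assms] in \<open>auto simp: Lp_iff\<close>)
  also have "\<dots> = l powr (1 - p) * \<alpha> powr p + (1 - l) powr (1 - p) * \<beta> powr p"
    using assms p by (simp add: Lp_iff \<alpha>_def \<beta>_def Lp_norm_powr)
  also have "\<dots> = (\<alpha> + \<beta>) powr (p - 1) * \<alpha> + (\<alpha> + \<beta>) powr (p - 1) * \<beta>"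
    unfolding l(3) unfolding l_def using pos by (simp add: powr_divide powr_diff mult.commute)
  also have "\<dots> = (\<alpha> + \<beta>) powr p" using pos powr_add[of "\<alpha> + \<beta>" "p - 1" 1] by (simp add: distrib_left)
  finally show ?thesis using pos p by (intro Lp_norm_leI) (auto simp: \<alpha>_def \<beta>_def)
qed

lemma Lp_norm_triangle_diff:
  assumes "f \<in> Lp p" "g \<in> Lp p" "p \<ge> 1"
  shows "Lp_norm p (f - g) \<le> Lp_norm p f + Lp_norm p g"
  using Lp_norm_triangle[of f p "- g"] assms Lp_uminus[of g p] Lp_norm_uminus[of g p] by auto

lemma Lp_norm_diff_commute:
  assumes "f \<in> Lp p" "g \<in> Lp p" "p \<ge> 1"
  shows "Lp_norm p (f - g) = Lp_norm p (g - f)"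
  using Lp_norm_uminus[of "f - g" p] Lp_diff[OF assms] assms by simp

lemma Lp_norm_triangle_lower:
  assumes "f \<in> Lp p" "g \<in> Lp p" "p \<ge> 1"
  shows "\<bar>Lp_norm p f - Lp_norm p g\<bar> \<le> Lp_norm p (f - g)"
  using Lp_norm_triangle[of "f - g" p g] Lp_norm_triangle[of "g - f" p f] assms
   Lp_norm_diff_commute[OF assms] Lp_diff[of f p g] Lp_diff[of g p f] by auto

lemma Linf_mult_Lp:
  assumes "AE t in arc_measure. norm (rep a t) \<le> C" "C \<ge> 0" "f \<in> Lp p" "p > 0"
  shows "a * f \<in> Lp p" "Lp_norm p (a * f) \<le> C * Lp_norm p f"
proof -
  have *: "AE t in arc_measure. norm (rep (a * f) t) \<le> norm (rep (cscale (of_real C) f) t)"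
    using assms(1) rep_mult[of a f] rep_cscale[of "of_real C" f]
    by eventually_elim (use assms in \<open>auto simp: norm_mult intro!: mult_right_mono\<close>)
  show "a * f \<in> Lp p"
    by (rule Lp_dominated[OF _ _ *]) (use assms Lp_cscale in auto)
  have "Lp_norm p (a * f) \<le> Lp_norm p (cscale (of_real C) f)"
    by (rule Lp_norm_mono[OF _ _ *]) (use assms Lp_cscale in auto)
  then show "Lp_norm p (a * f) \<le> C * Lp_norm p f"
    using assms Lp_cscale(2)[of f p "of_real C"] by simp
qed

lemma mult_Lp: "a \<in> Linf \<Longrightarrow> f \<in> Lp p \<Longrightarrow> p > 0 \<Longrightarrow> a * f \<in> Lp p"
  by (meson LinfE Linf_mult_Lp(1) less_imp_le)

lemma Linf_subset_Lp: assumes "f \<in> Linf" "p > 0" shows "f \<in> Lp p"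
proof -
  obtain C where C: "C > 0" "AE t in arc_measure. norm (rep f t) \<le> C" using assms by (auto elim: LinfE)
  show ?thesis unfolding Lp_iff
  proof (rule integrable_arc_bounded)
    show "AE t in arc_measure. norm (norm (rep f t) powr p) \<le> C powr p"
      using C(2) by eventually_elim (use assms in \<open>auto intro!: powr_mono2\<close>)
  qed simp
qed

lemma Lp_norm_le_const: assumes "AE t in arc_measure. norm (rep f t) \<le> C" "C \<ge> 0" "p > 0" shows "Lp_norm p f \<le> C"
proof (rule Lp_norm_leI)
  have f: "f \<in> Lp p" using assms Linf_subset_Lp LinfI by blast
  have "(LINT t|arc_measure. norm (rep f t) powr p) \<le> (LINT t|arc_measure. C powr p)"
  proof (rule integral_mono_AE)
    show "AE t in arc_measure. norm (rep f t) powr p \<le> C powr p"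
      using assms(1) by eventually_elim (use assms in \<open>auto intro!: powr_mono2\<close>)
  qed (use f in \<open>auto simp: Lp_iff\<close>)
  then show "(LINT t|arc_measure. norm (rep f t) powr p) \<le> C powr p" by simp
qed (use assms in auto)

definition conjugate_exponents :: "real \<Rightarrow> real \<Rightarrow> bool" where
  "conjugate_exponents p q \<longleftrightarrow> 1 < p \<and> 1 < q \<and> 1 / p + 1 / q = 1"

lemma conjugate_exponents_sym: "conjugate_exponents p q \<Longrightarrow> conjugate_exponents q p"
  by (auto simp: conjugate_exponents_def add.commute)

text \<open>Young's inequality for f and g gives integrability; for f and g divided by their norms
  it gives the bound.\<close>

lemma Holder:
  assumes pq: "conjugate_exponents p q" and f: "f \<in> Lp p" and g: "g \<in> Lp q"
  shows "integrable arc_measure (\<lambda>t. rep f t * rep g t)"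
    and "(LINT t|arc_measure. norm (rep f t * rep g t)) \<le> Lp_norm p f * Lp_norm q g"
proof -
  have p: "1 < p" "1 < q" "1/p + 1/q = 1" using pq by (auto simp: conjugate_exponents_def)
  have young: "norm (rep f t * rep g t) \<le> norm (rep f t) powr p / p + norm (rep g t) powr q / q" for t
    using Youngs_inequality[OF p, of "norm (rep f t)" "norm (rep g t)"] by (simp add: norm_mult)
  show int: "integrable arc_measure (\<lambda>t. rep f t * rep g t)"
  proof (rule Bochner_Integration.integrable_bound)
    show "integrable arc_measure (\<lambda>t. norm (rep f t) powr p / p + norm (rep g t) powr q / q)"
      using f g by (auto simp: Lp_iff)
    show "AE t in arc_measure. norm (rep f t * rep g t) \<le> norm (norm (rep f t) powr p / p + norm (rep g t) powr q / q)"
      using young by (intro AE_I2) (smt (verit) real_norm_def)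
  qed simp
  show "(LINT t|arc_measure. norm (rep f t * rep g t)) \<le> Lp_norm p f * Lp_norm q g"
  proof (cases "Lp_norm p f = 0 \<or> Lp_norm q g = 0")
    case True
    then have "f = 0 \<or> g = 0" using Lp_norm_eq_0 f g p by (metis less_trans zero_less_one)
    then have "AE t in arc_measure. norm (rep f t * rep g t) = 0"
      using rep_zero by auto
    then have "(LINT t|arc_measure. norm (rep f t * rep g t)) = 0"
      by (subst integral_cong_AE[where g="\<lambda>_. 0"]) auto
    then show ?thesis using True by auto
  next
    case False
    define \<alpha> \<beta> where "\<alpha> = Lp_norm p f" and "\<beta> = Lp_norm q g"
    have pos: "\<alpha> > 0" "\<beta> > 0" using False Lp_norm_nonneg[of p f] Lp_norm_nonneg[of q g]
      unfolding \<alpha>_def \<beta>_def by linarith+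
    have "norm (rep f t * rep g t) \<le> \<alpha> * \<beta> * ((norm (rep f t) powr p / \<alpha> powr p) / p + (norm (rep g t) powr q / \<beta> powr q) / q)" for t
    proof -
      have "norm (rep f t) / \<alpha> * (norm (rep g t) / \<beta>) \<le>
          (norm (rep f t) / \<alpha>) powr p / p + (norm (rep g t) / \<beta>) powr q / q"
        using pos by (intro Youngs_inequality p) auto
      then show ?thesis using pos by (simp add: powr_divide norm_mult field_simps)
    qed
    then have "(LINT t|arc_measure. norm (rep f t * rep g t)) \<le>
       (LINT t|arc_measure. \<alpha> * \<beta> * ((norm (rep f t) powr p / \<alpha> powr p) / p + (norm (rep g t) powr q / \<beta> powr q) / q))"
      using f g int by (intro integral_mono) (auto simp: Lp_iff)
    also have "\<dots> = \<alpha> * \<beta> * ((\<alpha> powr p / \<alpha> powr p) / p + (\<beta> powr q / \<beta> powr q) / q)"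
      using f g p by (simp add: Lp_iff \<alpha>_def \<beta>_def Lp_norm_powr)
    also have "\<dots> = \<alpha> * \<beta>" using pos p by simp
    finally show ?thesis by (simp add: \<alpha>_def \<beta>_def)
  qed
qed

section \<open>Reflection, conjugation, J and the monomials\<close>

lemma reflect_mult: "reflect (f * g) = reflect f * reflect g"
  by transfer (auto simp: circ_eq_def)
lemma reflect_diff: "reflect (f - g) = reflect f - reflect g"
  by transfer (auto simp: circ_eq_def)
lemma reflect_add: "reflect (f + g) = reflect f + reflect g"
  by transfer (auto simp: circ_eq_def)
lemma reflect_cscale: "reflect (cscale z f) = cscale z (reflect f)"
  by transfer (auto simp: circ_eq_def)
lemma reflect_inverse: "reflect (inverse f) = inverse (reflect f)"
  by transfer (auto simp: circ_eq_def)
lemma reflect_one [simp]: "reflect 1 = 1"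
  by transfer (auto simp: circ_eq_def)
lemma reflect_reflect [simp]: "reflect (reflect f) = f"
  by transfer (auto simp: circ_eq_def)
lemma conjugate_mult: "conjugate (f * g) = conjugate f * conjugate g"
  by transfer (auto simp: circ_eq_def)
lemma conjugate_add: "conjugate (f + g) = conjugate f + conjugate g"
  by transfer (auto simp: circ_eq_def)
lemma conjugate_cscale: "conjugate (cscale z f) = cscale (cnj z) (conjugate f)"
  by transfer (auto simp: circ_eq_def)
lemma conjugate_inverse: "conjugate (inverse f) = inverse (conjugate f)"
  by transfer (auto simp: circ_eq_def)
lemma conjugate_one [simp]: "conjugate 1 = 1"
  by transfer (auto simp: circ_eq_def)

lemma conjugate_zero [simp]: "conjugate 0 = 0"
  by transfer (auto simp: circ_eq_def)

lemma conjugate_conjugate [simp]: "conjugate (conjugate f) = f"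
  by transfer (auto simp: circ_eq_def)
lemma conjugate_reflect: "conjugate (reflect f) = reflect (conjugate f)"
  by transfer (auto simp: circ_eq_def)
lemma cscale_mult: "cscale z f * g = cscale z (f * g)" "f * cscale z g = cscale z (f * g)"
  by (transfer; auto simp: circ_eq_def)+

text \<open>Integer powers of \<open>coord\<close>, negative ones included: they shift Fourier
  coefficients, and as factors of a symbol they change the index of a Toeplitz operator.\<close>

lift_definition monomial :: "int \<Rightarrow> circ_fun" is "\<lambda>n t. t powi n"
  by (simp add: circ_eq_def)

lemma rep_monomial: "AE t in arc_measure. rep (monomial n) t = t powi n"
  unfolding monomial_def map_fun_def o_def id_def by (rule rep_abs) simp

lemma monomial_0 [simp]: "monomial 0 = 1"
  by transfer (auto simp: circ_eq_def)

lemma monomial_add: "monomial (m + n) = monomial m * monomial n"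
proof (rule circ_fun_eqI)
  show "AE t in arc_measure. rep (monomial (m + n)) t = rep (monomial m * monomial n) t"
    using rep_mult[of "monomial m" "monomial n"] rep_monomial[of m] rep_monomial[of n]
      rep_monomial[of "m + n"] AE_arc_measure_norm
  proof eventually_elim
    case (elim t)
    then have "t \<noteq> 0" by auto
    then show ?case by (simp add: elim power_int_add)
  qed
qed

lemma reflect_monomial: "reflect (monomial n) = monomial (- n)"
  by transfer (simp add: circ_eq_def power_int_minus power_int_inverse)

lemma conjugate_monomial: "conjugate (monomial n) = monomial (- n)"
proof (rule circ_fun_eqI)
  show "AE t in arc_measure. rep (conjugate (monomial n)) t = rep (monomial (- n)) t"
    using rep_conjugate[of "monomial n"] rep_monomial[of n] rep_monomial[of "-n"] AE_arc_measure_norm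
  proof eventually_elim
    case (elim t)
    have "cnj (t powi n) = inverse (t powi n)"
      using elim by (intro cnj_circle norm_powi_circle)
    then show ?case by (simp add: elim power_int_minus)
  qed
qed

lemma coord_power: "coord ^ n = monomial (int n)"
proof (induction n)
  case (Suc n)
  have "coord = monomial 1" by transfer (auto simp: circ_eq_def)
  then show ?case using monomial_add[of 1 "int n"] Suc by simp
qed simp

lemma coord_eq: "coord = monomial 1"
  using coord_power[of 1] by simp

lemma monomial_Linf: "monomial n \<in> Linf"
  by (rule LinfI[of _ 1]) (use rep_monomial[of n] AE_arc_measure_norm in \<open>eventually_elim, simp add: norm_powi_circle\<close>)

lemma conjugate_Linf: "conjugate f \<in> Linf \<longleftrightarrow> f \<in> Linf"
proof -
  have *: "conjugate f \<in> Linf" if f: "f \<in> Linf" for f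
  proof -
    obtain C where "AE t in arc_measure. norm (rep f t) \<le> C" using f by (auto simp: Linf_iff)
    then show ?thesis
      using rep_conjugate[of f] by (intro LinfI[of _ C], eventually_elim) simp
  qed
  show ?thesis using *[of f] *[of "conjugate f"] by auto
qed

lemma reflect_Linf: "reflect f \<in> Linf \<longleftrightarrow> f \<in> Linf"
proof -
  have *: "reflect f \<in> Linf" if f: "f \<in> Linf" for f
  proof -
    obtain C where "AE t in arc_measure. norm (rep f t) \<le> C" using f by (auto simp: Linf_iff)
    then have "AE t in arc_measure. norm (rep f (inverse t)) \<le> C"
      by (rule AE_arc_measure_inverse[rotated]) simp
    then show ?thesis
      using rep_reflect[of f] by (intro LinfI[of _ C], eventually_elim) simp
  qed
  show ?thesis using *[of f] *[of "reflect f"] by auto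
qed

lemma mult_Linf: "f \<in> Linf \<Longrightarrow> g \<in> Linf \<Longrightarrow> f * g \<in> Linf"
proof -
  assume "f \<in> Linf" "g \<in> Linf"
  then obtain C D where CD: "AE t in arc_measure. norm (rep f t) \<le> C" "AE t in arc_measure. norm (rep g t) \<le> D"
    "C > 0" "D > 0"
    by (metis LinfE)
  show ?thesis
    by (rule LinfI[of _ "C * D"], use CD(1,2) rep_mult[of f g] in eventually_elim)
      (use CD in \<open>auto simp: norm_mult intro!: mult_mono\<close>)
qed

lemma conjugate_Lp: "conjugate f \<in> Lp p \<longleftrightarrow> f \<in> Lp p" 
  and conjugate_Lp_norm: "Lp_norm p (conjugate f) = Lp_norm p f"
proof -
  have *: "AE t in arc_measure. norm (rep (conjugate f) t) = norm (rep f t)"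
    using rep_conjugate[of f] by eventually_elim simp
  show "conjugate f \<in> Lp p \<longleftrightarrow> f \<in> Lp p" "Lp_norm p (conjugate f) = Lp_norm p f"
    using Lp_cong[OF *] Lp_norm_cong[OF *] by auto
qed

lemma reflect_Lp: "reflect f \<in> Lp p \<longleftrightarrow> f \<in> Lp p" 
  and reflect_Lp_norm: "Lp_norm p (reflect f) = Lp_norm p f"
proof -
  have *: "AE t in arc_measure. norm (rep (reflect f) t) powr p = norm (rep f (inverse t)) powr p"
    using rep_reflect[of f] by eventually_elim simp
  have "integrable arc_measure (\<lambda>t. norm (rep (reflect f) t) powr p) \<longleftrightarrow>
     integrable arc_measure (\<lambda>t. norm (rep f (inverse t)) powr p)"
    by (rule integrable_cong_AE[OF _ _ *]) simp_all
  also have "\<dots> \<longleftrightarrow> integrable arc_measure (\<lambda>t. norm (rep f t) powr p)"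
    by (rule integrable_arc_measure_inverse) simp
  finally show "reflect f \<in> Lp p \<longleftrightarrow> f \<in> Lp p" by (simp add: Lp_iff)
  have "(LINT t|arc_measure. norm (rep (reflect f) t) powr p) = (LINT t|arc_measure. norm (rep f (inverse t)) powr p)"
    by (rule integral_cong_AE[OF _ _ *]) simp_all
  also have "\<dots> = (LINT t|arc_measure. norm (rep f t) powr p)"
    by (rule integral_arc_measure_inverse) simp
  finally show "Lp_norm p (reflect f) = Lp_norm p f" by (simp add: Lp_norm_rep)
qed

lemma flipJ_alt: "flipJ f = monomial (-1) * reflect f"
  by (simp add: flipJ_def coord_eq conjugate_monomial)

lemma flipJ_flipJ [simp]: "flipJ (flipJ f) = f"
  by (simp add: flipJ_alt reflect_mult reflect_monomial mult.assoc[symmetric] monomial_add[symmetric])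

lemma flipJ_mult: "flipJ (a * f) = reflect a * flipJ f"
  by (simp add: flipJ_alt reflect_mult mult_ac)
lemma flipJ_add: "flipJ (f + g) = flipJ f + flipJ g"
  by (simp add: flipJ_alt reflect_add algebra_simps)
lemma flipJ_diff: "flipJ (f - g) = flipJ f - flipJ g"
  by (simp add: flipJ_alt reflect_diff algebra_simps)
lemma flipJ_cscale: "flipJ (cscale z f) = cscale z (flipJ f)"
  by (simp add: flipJ_alt reflect_cscale cscale_mult)

lemma monomial_mult_norm: "AE t in arc_measure. norm (rep (monomial n * f) t) = norm (rep f t)"
  using rep_mult[of "monomial n" f] rep_monomial[of n] AE_arc_measure_norm
  by eventually_elim (simp add: norm_mult norm_powi_circle)

lemma flipJ_Lp: "flipJ f \<in> Lp p \<longleftrightarrow> f \<in> Lp p" and flipJ_Lp_norm: "Lp_norm p (flipJ f) = Lp_norm p f"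
  unfolding flipJ_alt
  by (simp_all only: Lp_cong[OF monomial_mult_norm] Lp_norm_cong[OF monomial_mult_norm] reflect_Lp reflect_Lp_norm)

lemma monomial_mult_Lp: "monomial n * f \<in> Lp p \<longleftrightarrow> f \<in> Lp p" "Lp_norm p (monomial n * f) = Lp_norm p f"
  by (simp_all only: Lp_cong[OF monomial_mult_norm] Lp_norm_cong[OF monomial_mult_norm])

section \<open>Fourier coefficients and the sesquilinear pairing\<close>

lemma Lp1_iff: "f \<in> Lp 1 \<longleftrightarrow> integrable arc_measure (rep f)"
  by (simp add: Lp_iff integrable_norm_iff)

lemma Lp1_norm: "Lp_norm 1 f = (LINT t|arc_measure. norm (rep f t))"
  by (simp add: Lp_norm_rep)

lemma Lp_subset_Lp1: assumes "f \<in> Lp p" "p \<ge> 1" shows "f \<in> Lp 1" "Lp_norm 1 f \<le> Lp_norm p f"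
proof -
  have "f \<in> Lp 1 \<and> Lp_norm 1 f \<le> Lp_norm p f"
  proof (cases "p = 1")
    case False
    then have pq: "conjugate_exponents p (p / (p - 1))"
      using assms(2) by (auto simp: conjugate_exponents_def field_simps)
    have ae1: "AE t in arc_measure. norm (rep 1 t) \<le> 1"
      using rep_one by eventually_elim simp
    have one: "1 \<in> Lp (p/(p-1))" "Lp_norm (p/(p-1)) 1 \<le> 1"
      using monomial_Linf[of 0] pq Lp_norm_le_const[OF ae1, of "p/(p-1)"]
      by (auto simp: conjugate_exponents_def Linf_subset_Lp)
    note H = Holder[OF pq assms(1) one(1)]
    have ae: "AE t in arc_measure. rep f t * rep 1 t = rep f t" "AE t in arc_measure. norm (rep f t * rep 1 t) = norm (rep f t)"
      using rep_one by (auto elim!: eventually_mono)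
    have "f \<in> Lp 1" using H(1) integrable_cong_AE[OF _ _ ae(1)] by (simp add: Lp1_iff)
    moreover have "Lp_norm 1 f = (LINT t|arc_measure. norm (rep f t * rep 1 t))"
      unfolding Lp1_norm by (rule integral_cong_AE) (use ae(2) in \<open>auto elim!: eventually_mono\<close>)
    then have "Lp_norm 1 f \<le> Lp_norm p f"
      using H(2) mult_left_mono[OF one(2), of "Lp_norm p f"] by simp
    ultimately show ?thesis by blast
  qed (use assms in auto)
  then show "f \<in> Lp 1" "Lp_norm 1 f \<le> Lp_norm p f" by auto
qed

lemma fourier_integrable: "f \<in> Lp 1 \<Longrightarrow> integrable arc_measure (\<lambda>t. rep f t * t powi n)"
proof -
  assume "f \<in> Lp 1"
  show ?thesis
  proof (rule Bochner_Integration.integrable_bound)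
    show "integrable arc_measure (rep f)" using \<open>f \<in> Lp 1\<close> by (simp add: Lp1_iff)
    show "AE t in arc_measure. norm (rep f t * t powi n) \<le> norm (rep f t)"
      using AE_arc_measure_norm by eventually_elim (simp add: norm_mult norm_powi_circle)
  qed simp
qed

lemma fourier_add: "f \<in> Lp 1 \<Longrightarrow> g \<in> Lp 1 \<Longrightarrow> fourier (f + g) n = fourier f n + fourier g n"
proof -
  assume fg: "f \<in> Lp 1" "g \<in> Lp 1"
  have "fourier (f + g) n = (LINT t|arc_measure. rep f t * t powi (-n) + rep g t * t powi (-n))"
    unfolding fourier_rep by (rule integral_cong_AE)
      (use rep_add[of f g] in \<open>auto elim!: eventually_mono simp: algebra_simps\<close>)
  then show ?thesis using fg fourier_integrable by (simp add: fourier_rep)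
qed

lemma fourier_cscale: "fourier (cscale z f) n = z * fourier f n"
proof -
  have "fourier (cscale z f) n = (LINT t|arc_measure. z * (rep f t * t powi (-n)))"
    unfolding fourier_rep by (rule integral_cong_AE)
      (use rep_cscale[of z f] in \<open>auto elim!: eventually_mono\<close>)
  then show ?thesis by (simp add: fourier_rep)
qed

lemma fourier_zero [simp]: "fourier 0 n = 0"
  using fourier_cscale[of 0 0] by simp

lemma fourier_diff: "f \<in> Lp 1 \<Longrightarrow> g \<in> Lp 1 \<Longrightarrow> fourier (f - g) n = fourier f n - fourier g n"
  unfolding circ_fun_minus_eq[of f g]
  by (subst fourier_add) (auto simp: Lp_cscale fourier_cscale simp del: circ.scale_minus_left)

lemma fourier_monomial: "fourier (monomial m) n = (if m = n then 1 else 0)"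
proof -
  have ae: "AE t in arc_measure. rep (monomial m) t * t powi - n = t powi (m - n)"
    using rep_monomial[of m] AE_arc_measure_norm
  proof eventually_elim
    case (elim t)
    then have "t \<noteq> 0" by auto
    then show ?case using power_int_add[of t m "-n"] by (simp add: elim)
  qed
  have "fourier (monomial m) n = (LINT t|arc_measure. t powi (m - n))"
    unfolding fourier_rep by (rule integral_cong_AE)
      (use ae in auto)
  then show ?thesis by (simp add: integral_arc_powi)
qed

lemma fourier_mult_monomial: "fourier (monomial m * f) n = fourier f (n - m)"
  unfolding fourier_rep
proof (rule integral_cong_AE)
  show "AE t in arc_measure. rep (monomial m * f) t * t powi - n = rep f t * t powi - (n - m)"
    using rep_mult[of "monomial m" f] rep_monomial[of m] AE_arc_measure_norm
  proof eventually_elim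
    case (elim t)
    then have "t \<noteq> 0" by auto
    then have "t powi (- (n - m)) = t powi m * t powi (- n)"
      using power_int_add[of t m "-n"] by simp
    then show ?case by (simp add: elim)
  qed
qed simp_all

lemma fourier_reflect: "fourier (reflect f) n = fourier f (- n)"
proof -
  have "fourier (reflect f) n = (LINT t|arc_measure. rep f (inverse t) * (inverse t) powi n)"
    unfolding fourier_rep by (rule integral_cong_AE)
      (use rep_reflect[of f] in \<open>auto elim!: eventually_mono simp: power_int_minus power_int_inverse\<close>)
  also have "\<dots> = (LINT t|arc_measure. rep f t * t powi n)"
    using integral_arc_measure_inverse[of "\<lambda>t. rep f t * t powi n"] by simp
  finally show ?thesis by (simp add: fourier_rep)
qed

text \<open>The map n \<mapsto> -n - 1 exchanges the nonnegative and the negative integers;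
  therefore J exchanges H^p and the kernel of P.\<close>

lemma fourier_flipJ: "fourier (flipJ f) n = fourier f (- n - 1)"
  by (simp add: flipJ_alt fourier_mult_monomial fourier_reflect)

lemma norm_fourier_le: "f \<in> Lp 1 \<Longrightarrow> norm (fourier f n) \<le> Lp_norm 1 f"
proof -
  assume f: "f \<in> Lp 1"
  have "norm (fourier f n) \<le> (LINT t|arc_measure. norm (rep f t * t powi (-n)))"
    unfolding fourier_rep by (rule integral_norm_bound)
  also have "\<dots> = (LINT t|arc_measure. norm (rep f t))"
    by (rule integral_cong_AE) (use AE_arc_measure_norm in \<open>auto elim!: eventually_mono simp: norm_mult norm_powi_circle\<close>)
  finally show ?thesis by (simp add: Lp1_norm)
qed

lemma fourier_conjugate: "fourier (conjugate f) n = cnj (fourier f (- n))"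
proof -
  have "fourier (conjugate f) n = (LINT t|arc_measure. cnj (rep f t * t powi n))"
    unfolding fourier_rep
  proof (rule integral_cong_AE)
    show "AE t in arc_measure. rep (conjugate f) t * t powi - n = cnj (rep f t * t powi n)"
      using rep_conjugate[of f] AE_arc_measure_norm
      by eventually_elim (simp add: complex_cnj_power_int cnj_circle power_int_minus power_int_inverse)
  qed simp_all
  also have "\<dots> = cnj (LINT t|arc_measure. rep f t * t powi n)"
    by (rule Bochner_Integration.integral_cnj)
  finally show ?thesis by (simp add: fourier_rep)
qed

lemma pairing_fourier: "pairing f g = fourier (f * conjugate g) 0"
  unfolding pairing_rep fourier_rep
proof (rule integral_cong_AE)
  show "AE t in arc_measure. rep f t * cnj (rep g t) = rep (f * conjugate g) t * t powi - 0"
    using rep_mult[of f "conjugate g"] rep_conjugate[of g] by eventually_elim simp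
qed simp_all

lemma Holder_Lp1:
  assumes "conjugate_exponents p q" "f \<in> Lp p" "g \<in> Lp q"
  shows "f * g \<in> Lp 1" "Lp_norm 1 (f * g) \<le> Lp_norm p f * Lp_norm q g"
proof -
  have "integrable arc_measure (rep (f * g)) \<longleftrightarrow> integrable arc_measure (\<lambda>t. rep f t * rep g t)"
    using rep_mult[of f g] by (intro integrable_cong_AE) auto
  then show "f * g \<in> Lp 1" using Holder(1)[OF assms] by (simp add: Lp1_iff)
  have "Lp_norm 1 (f * g) = (LINT t|arc_measure. norm (rep f t * rep g t))"
    unfolding Lp1_norm by (rule integral_cong_AE) (use rep_mult[of f g] in \<open>auto elim!: eventually_mono\<close>)
  then show "Lp_norm 1 (f * g) \<le> Lp_norm p f * Lp_norm q g" using Holder(2)[OF assms] by simp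
qed

lemma norm_pairing_le:
  assumes "conjugate_exponents p q" "f \<in> Lp p" "g \<in> Lp q"
  shows "norm (pairing f g) \<le> Lp_norm p f * Lp_norm q g"
proof -
  have g: "conjugate g \<in> Lp q" using assms(3) by (simp add: conjugate_Lp)
  have "norm (pairing f g) \<le> Lp_norm 1 (f * conjugate g)"
    unfolding pairing_fourier by (rule norm_fourier_le[OF Holder_Lp1(1)[OF assms(1,2) g]])
  also have "\<dots> \<le> Lp_norm p f * Lp_norm q g"
    using Holder_Lp1(2)[OF assms(1,2) g] by (simp add: conjugate_Lp_norm)
  finally show ?thesis .
qed

lemma pairing_add_left:
  assumes "conjugate_exponents p q" "f \<in> Lp p" "f' \<in> Lp p" "g \<in> Lp q"
  shows "pairing (f + f') g = pairing f g + pairing f' g"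
  unfolding pairing_fourier distrib_right
  by (rule fourier_add; rule Holder_Lp1(1)[OF assms(1)]) (use assms in \<open>auto simp: conjugate_Lp\<close>)

lemma pairing_diff_left:
  assumes "conjugate_exponents p q" "f \<in> Lp p" "f' \<in> Lp p" "g \<in> Lp q"
  shows "pairing (f - f') g = pairing f g - pairing f' g"
  unfolding pairing_fourier left_diff_distrib
  by (rule fourier_diff; rule Holder_Lp1(1)[OF assms(1)]) (use assms in \<open>auto simp: conjugate_Lp\<close>)

lemma pairing_cscale_left: "pairing (cscale z f) g = z * pairing f g"
  by (simp add: pairing_fourier cscale_mult fourier_cscale)

lemma pairing_cnj: "cnj (pairing f g) = pairing g f"
proof -
  have "pairing g f = fourier (conjugate (f * conjugate g)) 0"
    by (simp add: pairing_fourier conjugate_mult mult.commute)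
  then show ?thesis by (simp add: fourier_conjugate pairing_fourier)
qed

lemma pairing_add_right:
  assumes "conjugate_exponents p q" "f \<in> Lp p" "g \<in> Lp q" "g' \<in> Lp q"
  shows "pairing f (g + g') = pairing f g + pairing f g'"
  using pairing_add_left[OF conjugate_exponents_sym[OF assms(1)] assms(3,4,2)]
  by (metis complex_cnj_add pairing_cnj)

lemma pairing_diff_right:
  assumes "conjugate_exponents p q" "f \<in> Lp p" "g \<in> Lp q" "g' \<in> Lp q"
  shows "pairing f (g - g') = pairing f g - pairing f g'"
  using pairing_diff_left[OF conjugate_exponents_sym[OF assms(1)] assms(3,4,2)]
  by (metis complex_cnj_diff pairing_cnj)

lemma pairing_cscale_right: "pairing f (cscale z g) = cnj z * pairing f g"
  by (metis complex_cnj_mult pairing_cnj pairing_cscale_left complex_cnj_cnj)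

lemma pairing_mult_left: "pairing (a * f) g = pairing f (conjugate a * g)"
  by (simp add: pairing_fourier conjugate_mult mult_ac)

text \<open>Reflecting the integrand does not change its zeroth Fourier coefficient, and it moves J
  from one factor to the other.\<close>

lemma pairing_flipJ: "pairing (flipJ f) g = pairing f (flipJ g)"
proof -
  have "pairing (flipJ f) g = fourier (flipJ f * conjugate g) 0" by (simp add: pairing_fourier)
  also have "\<dots> = fourier (reflect (flipJ f * conjugate g)) 0" by (simp add: fourier_reflect)
  also have "reflect (flipJ f * conjugate g) = f * conjugate (flipJ g)"
    by (simp add: flipJ_alt reflect_mult reflect_monomial conjugate_mult conjugate_monomial conjugate_reflect mult_ac)
  finally show ?thesis by (simp add: pairing_fourier)
qed

lemma pairing_monomial: "pairing f (monomial n) = fourier f n"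
  using fourier_mult_monomial[of "-n" f 0] by (simp add: pairing_fourier conjugate_monomial mult.commute)

section \<open>Completeness and density\<close>

text \<open>Along a fast subsequence the differences are absolutely summable in L^1, hence almost
  everywhere; this gives a pointwise limit. Fatou's lemma then bounds the distance of the whole
  sequence to that limit.\<close>

lemma Lp_complete:
  fixes f :: "nat \<Rightarrow> circ_fun"
  assumes p: "p \<ge> 1" and f: "\<And>n. f n \<in> Lp p"
    and cauchy: "\<And>e. e > 0 \<Longrightarrow> \<exists>N. \<forall>m\<ge>N. \<forall>n\<ge>N. Lp_norm p (f m - f n) < e"
  obtains g where "g \<in> Lp p" "(\<lambda>n. Lp_norm p (f n - g)) \<longlonglongrightarrow> 0"
proof -
  have "\<exists>N. \<forall>k. (\<forall>m\<ge>N k. \<forall>n\<ge>N k. Lp_norm p (f m - f n) < (1/2)^k) \<and> k \<le> N k"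
  proof (rule choice, rule allI)
    fix k :: nat
    obtain N where "\<forall>m\<ge>N. \<forall>n\<ge>N. Lp_norm p (f m - f n) < (1/2)^k" using cauchy[of "(1/2)^k"] by auto
    then show "\<exists>N. (\<forall>m\<ge>N. \<forall>n\<ge>N. Lp_norm p (f m - f n) < (1/2)^k) \<and> k \<le> N"
      by (intro exI[of _ "max N k"]) auto
  qed
  then obtain N where N: "\<And>k m n. m \<ge> N k \<Longrightarrow> n \<ge> N k \<Longrightarrow> Lp_norm p (f m - f n) < (1/2)^k"
    and Nk: "\<And>k. k \<le> N k" by metis
  \<comment> \<open>A maximum over all earlier thresholds, so that r k lies beyond N j for every j
    \<le> k.\<close>
  define r where "r k = Max (N ` {..k})" for k
  have rN: "N j \<le> r k" if "j \<le> k" for j k using that by (auto simp: r_def)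
  define d where "d k = f (r (Suc k)) - f (r k)" for k
  have d: "d k \<in> Lp p" "Lp_norm p (d k) < (1/2)^k" for k
    using N[of k "r (Suc k)" "r k"] rN[of k] f p by (auto simp: d_def Lp_diff)
  have nn: "(\<integral>\<^sup>+t. ennreal (norm (rep (d k) t)) \<partial>arc_measure) \<le> ennreal ((1/2)^k)" for k
  proof -
    have "d k \<in> Lp 1" "Lp_norm 1 (d k) \<le> (1/2)^k"
      using Lp_subset_Lp1[OF d(1)[of k] p] d(2)[of k] by auto
    then show ?thesis by (subst nn_integral_eq_integral) (auto simp: Lp1_iff Lp1_norm intro: ennreal_leI)
  qed
  have "(\<integral>\<^sup>+t. (\<Sum>k. ennreal (norm (rep (d k) t))) \<partial>arc_measure) = (\<Sum>k. \<integral>\<^sup>+t. ennreal (norm (rep (d k) t)) \<partial>arc_measure)"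
    by (rule nn_integral_suminf) simp
  also have "\<dots> \<le> (\<Sum>k. ennreal ((1/2)^k))"
    by (intro suminf_le nn) auto
  also have "\<dots> = ennreal (\<Sum>k. (1/2)^k)"
    by (intro suminf_ennreal2) (auto intro: summable_geometric)
  also have "\<dots> < \<infinity>" by simp
  finally have "AE t in arc_measure. (\<Sum>k. ennreal (norm (rep (d k) t))) \<noteq> \<infinity>"
    by (intro nn_integral_PInf_AE) auto
  moreover have "AE t in arc_measure. \<forall>k. rep (d k) t = rep (f (r (Suc k))) t - rep (f (r k)) t"
    unfolding d_def by (subst AE_all_countable) (simp add: rep_diff)
  ultimately have conv: "AE t in arc_measure. convergent (\<lambda>k. rep (f (r k)) t)"
  proof eventually_elim
    case (elim t)
    have "summable (\<lambda>k. norm (rep (d k) t))"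
      using elim(1) by (intro summable_suminf_not_top) (auto simp: top_ennreal_def)
    then have "summable (\<lambda>k. rep (d k) t)" by (rule summable_norm_cancel)
    then have "convergent (\<lambda>n. \<Sum>k<n. rep (d k) t)" by (simp add: summable_iff_convergent)
    moreover have "(\<Sum>k<n. rep (d k) t) = rep (f (r n)) t - rep (f (r 0)) t" for n
      using sum_lessThan_telescope[of "\<lambda>k. rep (f (r k)) t" n] elim(2) by simp
    ultimately have "convergent (\<lambda>n. rep (f (r n)) t - rep (f (r 0)) t)" by simp
    then show ?case by (simp add: convergent_diff_const_right_iff)
  qed
  define G where "G t = lim (\<lambda>k. rep (f (r k)) t)" for t
  have G [measurable]: "G \<in> borel_measurable borel" unfolding G_def by measurable
  define g where "g = abs_circ_fun G"
  have lim: "AE t in arc_measure. (\<lambda>k. rep (f (r k)) t) \<longlonglongrightarrow> rep g t"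
    using conv rep_abs[OF G] by eventually_elim (simp add: g_def G_def convergent_LIMSEQ_iff)
  \<comment> \<open>Fatou's lemma along the subsequence. It also yields that f m - g lies in L^p,
    from which g does.\<close>
  have key: "f m - g \<in> Lp p \<and> Lp_norm p (f m - g) \<le> (1/2)^k" if m: "m \<ge> N k" for m k
  proof -
    have "(\<integral>\<^sup>+t. ennreal (norm (rep (f m - g) t) powr p) \<partial>arc_measure) \<le>
       (\<integral>\<^sup>+t. liminf (\<lambda>j. ennreal (norm (rep (f m - f (r j)) t) powr p)) \<partial>arc_measure)"
    proof (rule nn_integral_mono_AE)
      have "AE t in arc_measure. \<forall>j. rep (f m - f (r j)) t = rep (f m) t - rep (f (r j)) t"
        by (subst AE_all_countable) (simp add: rep_diff)
      then show "AE t in arc_measure. ennreal (norm (rep (f m - g) t) powr p) \<le>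
         liminf (\<lambda>j. ennreal (norm (rep (f m - f (r j)) t) powr p))"
        using rep_diff[of "f m" g] lim
      proof eventually_elim
        case (elim t)
        have "(\<lambda>j. ennreal (norm (rep (f m) t - rep (f (r j)) t) powr p)) \<longlonglongrightarrow> ennreal (norm (rep (f m) t - rep g t) powr p)"
          using elim p by (intro tendsto_ennrealI tendsto_powr' tendsto_norm tendsto_diff tendsto_const) auto
        then have "liminf (\<lambda>j. ennreal (norm (rep (f m) t - rep (f (r j)) t) powr p)) = ennreal (norm (rep (f m) t - rep g t) powr p)"
          by (intro lim_imp_Liminf) auto
        then show ?case by (simp add: elim)
      qed
    qed
    also have "\<dots> \<le> liminf (\<lambda>j. \<integral>\<^sup>+t. ennreal (norm (rep (f m - f (r j)) t) powr p) \<partial>arc_measure)"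
      by (rule nn_integral_liminf) simp
    also have "\<dots> \<le> liminf (\<lambda>j::nat. ennreal (((1/2)^k) powr p))"
    proof (rule Liminf_mono)
      show "\<forall>\<^sub>F j in sequentially. (\<integral>\<^sup>+t. ennreal (norm (rep (f m - f (r j)) t) powr p) \<partial>arc_measure) \<le> ennreal (((1/2)^k) powr p)"
      proof (rule eventually_sequentiallyI[of k])
        fix j assume "k \<le> j"
        have "Lp_norm p (f m - f (r j)) \<le> (1/2)^k" using N[OF m, of "r j"] rN[OF \<open>k \<le> j\<close>] by simp
        then have "Lp_norm p (f m - f (r j)) powr p \<le> ((1/2)^k) powr p" using p by (intro powr_mono2) auto
        moreover have "f m - f (r j) \<in> Lp p" using f p by (simp add: Lp_diff)
        ultimately show "(\<integral>\<^sup>+t. ennreal (norm (rep (f m - f (r j)) t) powr p) \<partial>arc_measure) \<le> ennreal (((1/2)^k) powr p)"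
          using p by (subst nn_integral_eq_integral) (auto simp: Lp_iff Lp_norm_powr intro: ennreal_leI)
      qed
    qed
    also have "\<dots> = ennreal (((1/2)^k) powr p)" by (rule Liminf_const) simp
    finally have *: "(\<integral>\<^sup>+t. ennreal (norm (rep (f m - g) t) powr p) \<partial>arc_measure) \<le> ennreal (((1/2)^k) powr p)" .
    have L: "f m - g \<in> Lp p" unfolding Lp_iff
      by (rule integrableI_bounded) (use * le_less_trans[OF *] in auto)
    then have "(LINT t|arc_measure. norm (rep (f m - g) t) powr p) \<le> ((1/2)^k) powr p"
      using * by (subst (asm) nn_integral_eq_integral) (auto simp: Lp_iff)
    with L show ?thesis using p by (auto intro!: Lp_norm_leI)
  qed
  show ?thesis
  proof (rule that)
    have "f (N 0) - (f (N 0) - g) \<in> Lp p" by (rule Lp_diff) (use key[of 0 "N 0"] f p in auto)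
    then show "g \<in> Lp p" by simp
    show "(\<lambda>n. Lp_norm p (f n - g)) \<longlonglongrightarrow> 0"
    proof (rule LIMSEQ_I)
      fix e :: real assume "e > 0"
      then obtain k where k: "(1/2)^k < e" using real_arch_pow_inv[of e "1/2"] by auto
      show "\<exists>no. \<forall>n\<ge>no. norm (Lp_norm p (f n - g) - 0) < e"
        using key[of k] k by (intro exI[of _ "N k"]) (auto intro: le_less_trans)
    qed
  qed
qed

lemma Lp_dominated_convergence:
  fixes f :: "nat \<Rightarrow> circ_fun"
  assumes p: "p \<ge> 1" and w: "w \<in> Lp p"
    and lim: "AE t in arc_measure. (\<lambda>n. rep (f n) t) \<longlonglongrightarrow> rep g t"
    and bound: "\<And>n. AE t in arc_measure. norm (rep (f n) t) \<le> norm (rep w t)"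
  shows "(\<lambda>n. Lp_norm p (f n - g)) \<longlonglongrightarrow> 0"
proof -
  have "AE t in arc_measure. \<forall>n. norm (rep (f n) t) \<le> norm (rep w t)"
    using bound by (simp add: AE_all_countable)
  then have gw: "AE t in arc_measure. norm (rep g t) \<le> norm (rep w t)"
    using lim by eventually_elim (metis LIMSEQ_le_const2 tendsto_norm)
  have "(\<lambda>n. LINT t|arc_measure. norm (rep (f n - g) t) powr p) \<longlonglongrightarrow> (LINT t|arc_measure. 0)"
  proof (rule integral_dominated_convergence)
    show "integrable arc_measure (\<lambda>t. 2 powr p * norm (rep w t) powr p)" using w by (simp add: Lp_iff)
    show "AE t in arc_measure. norm (norm (rep (f n - g) t) powr p) \<le> 2 powr p * norm (rep w t) powr p" for n
      using bound[of n] gw rep_diff[of "f n" g]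
    proof eventually_elim
      case (elim t)
      have "norm (rep (f n - g) t) \<le> 2 * norm (rep w t)"
        using elim norm_triangle_ineq4[of "rep (f n) t" "rep g t"] by simp
      then have "norm (rep (f n - g) t) powr p \<le> (2 * norm (rep w t)) powr p" using p by (intro powr_mono2) auto
      then show ?case by (simp add: powr_mult)
    qed
    have "AE t in arc_measure. \<forall>n. rep (f n - g) t = rep (f n) t - rep g t"
      by (subst AE_all_countable) (simp add: rep_diff)
    then show "AE t in arc_measure. (\<lambda>n. norm (rep (f n - g) t) powr p) \<longlonglongrightarrow> 0"
      using lim
    proof eventually_elim
      case (elim t)
      have "(\<lambda>n. norm (rep (f n) t - rep g t) powr p) \<longlonglongrightarrow> norm (rep g t - rep g t) powr p"
        using elim p by (intro tendsto_powr' tendsto_norm tendsto_diff tendsto_const) auto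
      then show ?case using elim p by simp
    qed
  qed simp_all
  then have "(\<lambda>n. (LINT t|arc_measure. norm (rep (f n - g) t) powr p) powr (1/p)) \<longlonglongrightarrow> 0 powr (1/p)"
    using p by (intro tendsto_powr' tendsto_const) auto
  then show ?thesis using p by (simp add: Lp_norm_rep)
qed

section \<open>Closures in L^p and density of the continuous functions\<close>

definition Lp_closure :: "real \<Rightarrow> circ_fun set \<Rightarrow> circ_fun set" where
  "Lp_closure p S = {f \<in> Lp p. \<forall>e>0. \<exists>g\<in>S. Lp_norm p (f - g) < e}"

lemma Lp_closure_approx: "f \<in> Lp_closure p S \<Longrightarrow> e > 0 \<Longrightarrow> \<exists>g\<in>S. Lp_norm p (f - g) < e"
  by (simp add: Lp_closure_def)

lemma Lp_closureD:
  assumes "f \<in> Lp_closure p S" 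
  obtains F :: "nat \<Rightarrow> circ_fun" where "\<And>n. F n \<in> S" "(\<lambda>n. Lp_norm p (f - F n)) \<longlonglongrightarrow> 0"
proof -
  have "\<exists>F. \<forall>n. F n \<in> S \<and> Lp_norm p (f - F n) < 1 / Suc n"
    using Lp_closure_approx[OF assms] by (intro choice allI) (simp add: Bex_def)
  then obtain F where F: "\<And>n. F n \<in> S" "\<And>n. Lp_norm p (f - F n) < 1 / Suc n" by blast
  have "(\<lambda>n. Lp_norm p (f - F n)) \<longlonglongrightarrow> 0"
  proof (rule tendsto_sandwich[OF _ _ tendsto_const LIMSEQ_inverse_real_of_nat])
    show "\<forall>\<^sub>F n in sequentially. Lp_norm p (f - F n) \<le> inverse (real (Suc n))"
      using F(2) by (auto simp: inverse_eq_divide intro!: always_eventually less_imp_le)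
  qed auto
  then show ?thesis using that F(1) by blast
qed

lemma Lp_closure_subset: "S \<subseteq> Lp p \<Longrightarrow> p \<ge> 1 \<Longrightarrow> S \<subseteq> Lp_closure p S"
  by (auto simp: Lp_closure_def intro!: bexI)

lemma Lp_closure_closure:
  assumes "p \<ge> 1" "S \<subseteq> Lp p" "f \<in> Lp p" "\<And>e. e > 0 \<Longrightarrow> \<exists>g\<in>Lp_closure p S. Lp_norm p (f - g) < e"
  shows "f \<in> Lp_closure p S"
  unfolding Lp_closure_def
proof (intro CollectI conjI allI impI)
  fix e :: real assume e: "e > 0"
  obtain g where g: "g \<in> Lp_closure p S" "Lp_norm p (f - g) < e/2" using assms(4)[of "e/2"] e by auto
  then obtain h where h: "h \<in> S" "Lp_norm p (g - h) < e/2"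
    using Lp_closure_approx[OF g(1), of "e/2"] e by auto
  have "Lp_norm p ((f - g) + (g - h)) \<le> Lp_norm p (f - g) + Lp_norm p (g - h)"
    using assms g h by (intro Lp_norm_triangle Lp_diff) (auto simp: Lp_closure_def)
  then show "\<exists>g\<in>S. Lp_norm p (f - g) < e" using g h by (intro bexI[of _ h]) auto
qed (use assms in auto)

lemma subspace_Lp_closure:
  assumes "p \<ge> 1" "S \<subseteq> Lp p" "circ.subspace S"
  shows "circ.subspace (Lp_closure p S)"
proof (rule circ.subspaceI)
  show "0 \<in> Lp_closure p S"
    using Lp_closure_subset[of S p] assms circ.subspace_0 by auto
next
  fix f g assume fg: "f \<in> Lp_closure p S" "g \<in> Lp_closure p S"
  have L: "f \<in> Lp p" "g \<in> Lp p" using fg by (auto simp: Lp_closure_def)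
  show "f + g \<in> Lp_closure p S" unfolding Lp_closure_def
  proof (intro CollectI conjI allI impI)
    show "f + g \<in> Lp p" using assms L by (intro Lp_add) auto
    fix e :: real assume "e > 0"
    then obtain u v where uv: "u \<in> S" "Lp_norm p (f - u) < e/2" "v \<in> S" "Lp_norm p (g - v) < e/2"
      using Lp_closure_approx[OF fg(1), of "e/2"] Lp_closure_approx[OF fg(2), of "e/2"] by auto
    have "Lp_norm p ((f - u) + (g - v)) \<le> Lp_norm p (f - u) + Lp_norm p (g - v)"
      using assms L uv by (intro Lp_norm_triangle Lp_diff) auto
    also have "(f - u) + (g - v) = (f + g) - (u + v)" by simp
    finally show "\<exists>h\<in>S. Lp_norm p (f + g - h) < e"
      using uv assms by (intro bexI[of _ "u + v"]) (auto intro: circ.subspace_add)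
  qed
next
  fix c f assume f: "f \<in> Lp_closure p S"
  have L: "f \<in> Lp p" using f by (auto simp: Lp_closure_def)
  show "cscale c f \<in> Lp_closure p S" unfolding Lp_closure_def
  proof (intro CollectI conjI allI impI)
    show "cscale c f \<in> Lp p" using assms L by (intro Lp_cscale) auto
    fix e :: real assume "e > 0"
    then obtain u where u: "u \<in> S" "Lp_norm p (f - u) < e / (norm c + 1)"
      using Lp_closure_approx[OF f, of "e / (norm c + 1)"] by (auto simp: add_nonneg_pos)
    have "Lp_norm p (cscale c (f - u)) = norm c * Lp_norm p (f - u)"
      using L u assms by (intro Lp_cscale(2) Lp_diff) auto
    also have "\<dots> \<le> (norm c + 1) * Lp_norm p (f - u)" by (intro mult_right_mono) auto
    also have "\<dots> < e" using u(2) by (simp add: pos_less_divide_eq add_nonneg_pos mult.commute)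
    also have "cscale c (f - u) = cscale c f - cscale c u" by (rule circ.scale_right_diff_distrib)
    finally show "\<exists>h\<in>S. Lp_norm p (cscale c f - h) < e"
      using u assms by (intro bexI[of _ "cscale c u"]) (auto intro: circ.subspace_scale)
  qed
qed

definition cont_funs :: "circ_fun set" where
  "cont_funs = abs_circ_fun ` {h. continuous_on UNIV h}"

lemma rep_abs_cont: "continuous_on UNIV h \<Longrightarrow> AE t in arc_measure. rep (abs_circ_fun h) t = h t"
  by (intro rep_abs borel_measurable_continuous_onI)

lemma continuous_bounded_circle:
  assumes "continuous_on UNIV (h :: complex \<Rightarrow> 'b::real_normed_vector)"
  obtains C where "C > 0" "\<And>t. norm t = 1 \<Longrightarrow> norm (h t) \<le> C"
proof -
  have "compact (h ` sphere 0 1)"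
    using assms continuous_on_subset by (intro compact_continuous_image) auto
  then obtain C where "C > 0" "\<forall>x\<in>h ` sphere 0 1. norm x \<le> C"
    using compact_imp_bounded bounded_pos by blast
  then show ?thesis using that[of C] by auto
qed

lemma cont_funs_Linf: "cont_funs \<subseteq> Linf"
proof
  fix f assume "f \<in> cont_funs"
  then obtain h where h: "continuous_on UNIV h" "f = abs_circ_fun h" by (auto simp: cont_funs_def)
  obtain C where "C > 0" "\<And>t. norm t = 1 \<Longrightarrow> norm (h t) \<le> C" using continuous_bounded_circle[OF h(1)] by blast
  then show "f \<in> Linf"
    using rep_abs_cont[OF h(1)] AE_arc_measure_norm
    by (intro LinfI[of _ C], elim eventually_elim2) (auto simp: h(2))
qed

lemma subspace_cont_funs: "circ.subspace cont_funs"
proof (rule circ.subspaceI)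
  show "0 \<in> cont_funs" unfolding cont_funs_def zero_circ_fun_def by (rule imageI) simp
next
  fix f g assume "f \<in> cont_funs" "g \<in> cont_funs"
  then obtain h k where h: "continuous_on UNIV h" "f = abs_circ_fun h"
    and k: "continuous_on UNIV k" "g = abs_circ_fun k" by (auto simp: cont_funs_def)
  have c: "continuous_on UNIV (\<lambda>t. h t + k t)" using h k by (intro continuous_intros)
  have "f + g = abs_circ_fun (\<lambda>t. h t + k t)"
    by (rule circ_fun_eqI)
      (use rep_add[of f g] rep_abs_cont[OF h(1)] rep_abs_cont[OF k(1)] rep_abs_cont[OF c] in \<open>eventually_elim, simp add: h k\<close>)
  then show "f + g \<in> cont_funs" using c by (auto simp: cont_funs_def)
next
  fix z f assume "f \<in> cont_funs"
  then obtain h where h: "continuous_on UNIV h" "f = abs_circ_fun h" by (auto simp: cont_funs_def)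
  have c: "continuous_on UNIV (\<lambda>t. z * h t)" using h by (intro continuous_intros)
  have "cscale z f = abs_circ_fun (\<lambda>t. z * h t)"
    by (rule circ_fun_eqI)
      (use rep_cscale[of z f] rep_abs_cont[OF h(1)] rep_abs_cont[OF c] in \<open>eventually_elim, simp add: h\<close>)
  then show "cscale z f \<in> cont_funs" using c by (auto simp: cont_funs_def)
qed

text \<open>By regularity of the measure, A lies between a compact K and an open U with U - K of
  small measure. A Urysohn function for K and the complement of U differs from the indicator only on
  U - K, and there by at most 1.\<close>

lemma indicator_closure_cont:
  assumes A: "A \<in> sets borel" and p: "p \<ge> 1"
  shows "abs_circ_fun (indicator A) \<in> Lp_closure p cont_funs"
  unfolding Lp_closure_def
proof (intro CollectI conjI allI impI)
  have m: "(indicator A :: complex \<Rightarrow> complex) \<in> borel_measurable borel" using A by simp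
  have r: "AE t in arc_measure. rep (abs_circ_fun (indicator A)) t = indicator A t" by (rule rep_abs[OF m])
  have "abs_circ_fun (indicator A) \<in> Linf"
    by (rule LinfI[of _ 1]) (use r in \<open>eventually_elim, auto simp: indicator_def\<close>)
  then show L: "abs_circ_fun (indicator A) \<in> Lp p" using p by (intro Linf_subset_Lp) auto
  fix e :: real assume e: "e > 0"
  \<comment> \<open>The p-th power of the distance will be at most the measure of U - K; half of e^p
    keeps the final inequality strict.\<close>
  define d where "d = e powr p / 2"
  have d: "d > 0" using e by (simp add: d_def)
  have fin: "emeasure arc_measure A \<noteq> \<infinity>" "emeasure arc_measure X \<noteq> \<infinity>" for X by auto
  have "emeasure arc_measure A < emeasure arc_measure A + ennreal (d/2)"
    using d by (simp add: arc.emeasure_eq_measure ennreal_less_iff flip: ennreal_plus)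
  moreover have "emeasure arc_measure A = (INF U \<in> {U. A \<subseteq> U \<and> open U}. emeasure arc_measure U)"
    using A fin by (intro outer_regular) auto
  ultimately obtain U where U: "A \<subseteq> U" "open U" "emeasure arc_measure U < emeasure arc_measure A + ennreal (d/2)"
    by (auto simp: INF_less_iff)
  obtain K where K: "K \<subseteq> A" "compact K" "emeasure arc_measure A \<le> emeasure arc_measure K + ennreal (d/2)"
  \<comment> \<open>If A has measure at most d/2, the empty set serves. Otherwise subtracting d/2
    gives a value strictly below the measure of A, and inner regularity applies.\<close>
  proof (cases "emeasure arc_measure A \<le> ennreal (d/2)")
    case True
    then show ?thesis using that[of "{}"] by simp
  next
    case False
    have "emeasure arc_measure A - ennreal (d/2) < emeasure arc_measure A"
      using False d by (simp add: arc.emeasure_eq_measure ennreal_less_iff ennreal_minus)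
    moreover have "emeasure arc_measure A = (SUP K \<in> {K. K \<subseteq> A \<and> compact K}. emeasure arc_measure K)"
      using A fin by (intro inner_regular) auto
    ultimately obtain K where K: "K \<subseteq> A" "compact K" "emeasure arc_measure A - ennreal (d/2) < emeasure arc_measure K"
      by (auto simp: less_SUP_iff)
    then show ?thesis using that[of K] False d
      by (simp add: arc.emeasure_eq_measure ennreal_minus ennreal_less_iff flip: ennreal_plus)
  qed
  have [measurable]: "K \<in> sets borel" "U \<in> sets borel" using U K by (auto intro: borel_compact)
  obtain h :: "complex \<Rightarrow> real" where h: "continuous_on UNIV h" "\<And>x. h x \<in> closed_segment 1 0"
     "\<And>x. x \<in> K \<Longrightarrow> h x = 1" "\<And>x. x \<in> - U \<Longrightarrow> h x = 0"
  proof -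
    have "closed K" "closed (- U)" "K \<inter> - U = {}"
      using K U by (auto intro: compact_imp_closed)
    from Urysohn[OF this, of 1 0] that show thesis by metis
  qed
  have h01: "0 \<le> h x" "h x \<le> 1" for x using h(2)[of x] by (auto simp: closed_segment_eq_real_ivl)
  have hc: "continuous_on UNIV (\<lambda>x. complex_of_real (h x))" using h by (intro continuous_intros)
  define g where "g = abs_circ_fun (\<lambda>x. complex_of_real (h x))"
  have "measure arc_measure (U - K) = measure arc_measure U - measure arc_measure K"
    using K(1) U(1) by (intro arc.finite_measure_Diff) auto
  also have "\<dots> < d"
  proof -
    have "measure arc_measure U < measure arc_measure A + d/2"
      using U(3) d by (simp add: arc.emeasure_eq_measure flip: ennreal_plus) (subst (asm) ennreal_less_iff, auto)
    moreover have "measure arc_measure A \<le> measure arc_measure K + d/2"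
      using K(3) d by (simp add: arc.emeasure_eq_measure flip: ennreal_plus)
    ultimately show ?thesis by simp
  qed
  finally have mUK: "measure arc_measure (U - K) < d" .
  have "(LINT t|arc_measure. norm (rep (abs_circ_fun (indicator A) - g) t) powr p) \<le> (LINT t|arc_measure. indicator (U - K) t)"
  proof (rule integral_mono_AE)
    have "g \<in> Linf" using cont_funs_Linf hc by (auto simp: g_def cont_funs_def)
    then show "integrable arc_measure (\<lambda>t. cmod (rep (abs_circ_fun (indicator A) - g) t) powr p)"
      using Lp_diff[OF L Linf_subset_Lp] p by (simp add: Lp_iff)
    show "AE t in arc_measure. norm (rep (abs_circ_fun (indicator A) - g) t) powr p \<le> indicator (U - K) t"
      using rep_diff[of "abs_circ_fun (indicator A)" g] r rep_abs_cont[OF hc, folded g_def]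
    proof eventually_elim
      case (elim t)
      have "norm (indicator A t - complex_of_real (h t)) \<le> indicator (U - K) t"
      proof -
        have "norm (1 - complex_of_real (h t)) = 1 - h t"
          using h01[of t] norm_of_real[of "1 - h t", where 'a=complex] by simp
        then show ?thesis using h01[of t] h(3,4)[of t] K(1) U(1)
          by (auto simp: indicator_def)
      qed
      then have "norm (indicator A t - complex_of_real (h t)) powr p \<le> (indicator (U - K) t) powr p"
        using p by (intro powr_mono2) auto
      also have "\<dots> = indicator (U - K) t" using p by (auto simp: indicator_def)
      finally show ?case by (simp add: elim)
    qed
    show "integrable arc_measure (indicat_real (U - K))"
      by (rule integrable_arc_bounded[of _ 1]) (auto simp: indicator_def)
  qed
  also have "\<dots> = measure arc_measure (U - K)" by simp
  also have "\<dots> \<le> (e powr p / 2)" using mUK by (simp add: d_def)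
  also have "\<dots> = (e / 2 powr (1/p)) powr p" using e p by (simp add: powr_divide powr_powr)
  finally have "Lp_norm p (abs_circ_fun (indicator A) - g) \<le> e / 2 powr (1/p)"
    using e p by (intro Lp_norm_leI) auto
  also have "\<dots> < e" using e p by (simp add: field_simps)
  finally show "\<exists>g\<in>cont_funs. Lp_norm p (abs_circ_fun (indicator A) - g) < e"
    using hc by (intro bexI[of _ g]) (auto simp: g_def cont_funs_def)
qed

text \<open>Simple functions dominated by 2 |f| converge to f pointwise, hence in L^p, and each is a
  finite combination of indicators.\<close>

lemma Lp_closure_cont: assumes p: "p \<ge> 1" shows "Lp_closure p cont_funs = Lp p"
proof (intro equalityI subsetI)
  fix f assume f: "f \<in> Lp p"
  have sub: "circ.subspace (Lp_closure p cont_funs)" "cont_funs \<subseteq> Lp p"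
    using p cont_funs_Linf by (auto intro!: subspace_Lp_closure subspace_cont_funs intro: Linf_subset_Lp)
  obtain s where s: "\<And>i. simple_function arc_measure (s i)" "\<And>x. (\<lambda>i. s i x) \<longlonglongrightarrow> rep f x"
    "\<And>i x. norm (s i x) \<le> 2 * norm (rep f x)"
    using borel_measurable_implies_sequence_metric[of "rep f" arc_measure 0] by (auto simp: dist_norm)
  have sm: "s i \<in> borel_measurable borel" for i using borel_measurable_simple_function[OF s(1)] by simp
  have rs: "AE t in arc_measure. \<forall>i. rep (abs_circ_fun (s i)) t = s i t"
    by (subst AE_all_countable) (simp add: rep_abs[OF sm])
  have scl: "abs_circ_fun (s i) \<in> Lp_closure p cont_funs" for i
  proof -
    have finr: "finite (range (s i))" using simple_functionD(1)[OF s(1)[of i]] by simp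
    have meas: "s i -` {y} \<in> sets borel" for y using simple_functionD(2)[OF s(1)[of i], of "{y}"] by simp
    define g where "g y = cscale y (abs_circ_fun (indicator (s i -` {y})))" for y
    have g: "AE t in arc_measure. rep (g y) t = y * indicator (s i -` {y}) t" for y
      using rep_cscale[of y "abs_circ_fun (indicator (s i -` {y}))"] rep_abs[OF borel_measurable_indicator[OF meas[of y]]]
      by eventually_elim (simp add: g_def)
    have sumr: "AE t in arc_measure. rep (sum g Y) t = (\<Sum>y\<in>Y. rep (g y) t)" if "finite Y" for Y
      using that
    proof (induction Y rule: finite_induct)
      case (insert y Y)
      show ?case using rep_add[of "g y" "sum g Y"] insert(3) by eventually_elim (use insert in simp)
    qed (simp add: rep_zero)
    have all: "AE t in arc_measure. \<forall>y\<in>range (s i). rep (g y) t = y * indicator (s i -` {y}) t"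
      unfolding AE_finite_all[OF finr] using g by blast
    have "abs_circ_fun (s i) = sum g (range (s i))"
    proof (rule circ_fun_eqI)
      show "AE t in arc_measure. rep (abs_circ_fun (s i)) t = rep (sum g (range (s i))) t"
        using rs sumr[OF finr] all
      proof eventually_elim
        case (elim t)
        have "(\<Sum>y\<in>range (s i). rep (g y) t) = (\<Sum>y\<in>range (s i). if s i t = y then y else 0)"
          by (intro sum.cong) (use elim in \<open>auto simp: indicator_def\<close>)
        also have "\<dots> = s i t" using finr by (subst sum.delta') auto
        finally show ?case using elim by simp
      qed
    qed
    also have "\<dots> \<in> Lp_closure p cont_funs"
      unfolding g_def using sub indicator_closure_cont[OF meas p]
      by (intro circ.subspace_sum circ.subspace_scale) auto
    finally show ?thesis .
  qed
  show "f \<in> Lp_closure p cont_funs"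
  proof (rule Lp_closure_closure[OF p sub(2) f])
    fix e :: real assume e: "e > 0"
    have "(\<lambda>i. Lp_norm p (abs_circ_fun (s i) - f)) \<longlonglongrightarrow> 0"
    proof (rule Lp_dominated_convergence[OF p Lp_cscale(1)[OF f, of 2]])
      show "AE t in arc_measure. (\<lambda>n. rep (abs_circ_fun (s n)) t) \<longlonglongrightarrow> rep f t"
        using rs by eventually_elim (use s(2) in simp)
      show "AE t in arc_measure. norm (rep (abs_circ_fun (s n)) t) \<le> norm (rep (cscale 2 f) t)" for n
        using rs rep_cscale[of 2 f] by eventually_elim (use s(3) in \<open>simp add: norm_mult\<close>)
    qed (use p in auto)
    then obtain i where "Lp_norm p (abs_circ_fun (s i) - f) < e"
      using LIMSEQ_D[of _ 0 e] e by fastforce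
    moreover have "abs_circ_fun (s i) \<in> Lp p" using scl[of i] by (simp add: Lp_closure_def)
    ultimately show "\<exists>g\<in>Lp_closure p cont_funs. Lp_norm p (f - g) < e"
      using scl[of i] Lp_norm_diff_commute[OF f _ p] by (intro bexI[of _ "abs_circ_fun (s i)"]) auto
  qed
qed (simp add: Lp_closure_def)

section \<open>Trigonometric polynomials\<close>

definition trig_polys :: "circ_fun set" where
  "trig_polys = circ.span (range monomial)"

definition analytic_polys :: "circ_fun set" where
  "analytic_polys = circ.span (monomial ` {0..})"

definition antianalytic_polys :: "circ_fun set" where
  "antianalytic_polys = circ.span (monomial ` {..<0})"

lemma monomial_trig [simp]: "monomial n \<in> trig_polys"
  by (auto simp: trig_polys_def intro: circ.span_base)

lemma subspace_trig: "circ.subspace trig_polys"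
  by (simp add: trig_polys_def circ.subspace_span)

lemma subspace_Linf: "circ.subspace Linf"
proof (rule circ.subspaceI)
  show "0 \<in> Linf" by (rule LinfI[of _ 0]) (use rep_zero in \<open>auto elim: eventually_mono\<close>)
next
  fix f g assume "f \<in> Linf" "g \<in> Linf"
  then obtain C D where "AE t in arc_measure. norm (rep f t) \<le> C" "AE t in arc_measure. norm (rep g t) \<le> D"
    by (metis LinfE)
  then show "f + g \<in> Linf"
    using rep_add[of f g] 
    by (intro LinfI[of _ "C + D"], eventually_elim) (simp add: norm_triangle_le add_mono)
next
  fix z f assume "f \<in> Linf"
  then obtain C where "AE t in arc_measure. norm (rep f t) \<le> C" by (metis LinfE)
  then show "cscale z f \<in> Linf"
    using rep_cscale[of z f]
    by (intro LinfI[of _ "norm z * C"], eventually_elim) (simp add: norm_mult mult_left_mono)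
qed

lemma trig_Linf: "trig_polys \<subseteq> Linf"
  unfolding trig_polys_def by (rule circ.span_minimal[OF _ subspace_Linf]) (auto simp: monomial_Linf)

lemma trig_Lp: "f \<in> trig_polys \<Longrightarrow> p > 0 \<Longrightarrow> f \<in> Lp p"
  using trig_Linf Linf_subset_Lp by auto

lemma analytic_subset_trig: "analytic_polys \<subseteq> trig_polys"
  unfolding analytic_polys_def trig_polys_def by (intro circ.span_mono) auto

lemma antianalytic_subset_trig: "antianalytic_polys \<subseteq> trig_polys"
  unfolding antianalytic_polys_def trig_polys_def by (intro circ.span_mono) auto

lemma trig_mult: assumes "f \<in> trig_polys" "g \<in> trig_polys" shows "f * g \<in> trig_polys"
proof -
  have *: "monomial n * g \<in> trig_polys" for n
    using assms(2) unfolding trig_polys_def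
  proof (induction rule: circ.span_induct_alt)
    case base then show ?case by (simp add: circ.span_zero)
  next
    case (step c x y)
    then obtain m where "x = monomial m" by auto
    then show ?case using step
      by (simp add: distrib_left cscale_mult flip: monomial_add)
         (rule circ.span_add, rule circ.span_scale, rule circ.span_base, auto)
  qed
  show ?thesis using assms(1) unfolding trig_polys_def
  proof (induction rule: circ.span_induct_alt)
    case base then show ?case by (simp add: circ.span_zero)
  next
    case (step c x y)
    then show ?case using *
      by (auto simp add: distrib_right cscale_mult trig_polys_def intro!: circ.span_add circ.span_scale)
  qed
qed

lemma trig_conjugate: assumes "f \<in> trig_polys" shows "conjugate f \<in> trig_polys"
  using assms unfolding trig_polys_def
proof (induction rule: circ.span_induct_alt)
  case base then show ?case by (simp add: circ.span_zero)
next
  case (step c x y)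
  then show ?case by (auto simp: conjugate_add conjugate_cscale conjugate_monomial
        intro!: circ.span_add circ.span_scale intro: circ.span_base)
qed

text \<open>On the circle Re t and Im t are combinations of t and t^(-1), and trigonometric
  polynomials form an algebra. The Stone-Weierstrass theorem for real polynomials on the plane thus
  becomes approximation by trigonometric polynomials.\<close>

lemma trig_real_polynomial:
  assumes "real_polynomial_function (h :: complex \<Rightarrow> real)"
  shows "abs_circ_fun (\<lambda>t. complex_of_real (h t)) \<in> trig_polys"
  using assms
proof (induction rule: real_polynomial_function.induct)
  case (linear f)
  interpret bounded_linear f by fact
  have cf: "continuous_on UNIV (\<lambda>t. complex_of_real (f t))"
    by (intro continuous_intros continuous_on)
  have f: "f t = Re t * f 1 + Im t * f \<i>" for t
  proof -
    have "f (Re t *\<^sub>R 1 + Im t *\<^sub>R \<i>) = Re t * f 1 + Im t * f \<i>" by (simp only: add scaleR real_scaleR_def)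
    also have "Re t *\<^sub>R 1 + Im t *\<^sub>R \<i> = t" by (simp add: complex_eq_iff)
    finally show ?thesis .
  qed
  \<comment> \<open>The coefficients come from Re t = (t + t^(-1)) / 2 and Im t = (t - t^(-1)) / (2
    i).\<close>
  define z where "z = complex_of_real (f 1) / 2 + complex_of_real (f \<i>) / (2 * \<i>)"
  define w where "w = complex_of_real (f 1) / 2 - complex_of_real (f \<i>) / (2 * \<i>)"
  have "abs_circ_fun (\<lambda>t. complex_of_real (f t)) = cscale z (monomial 1) + cscale w (monomial (-1))"
  proof (rule circ_fun_eqI)
    show "AE t in arc_measure. rep (abs_circ_fun (\<lambda>t. complex_of_real (f t))) t = rep (cscale z (monomial 1) + cscale w (monomial (-1))) t"
      using rep_abs_cont[OF cf] rep_add[of "cscale z (monomial 1)" "cscale w (monomial (-1))"]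
        rep_cscale[of z "monomial 1"] rep_cscale[of w "monomial (-1)"] rep_monomial[of 1] rep_monomial[of "-1"] AE_arc_measure_norm
    proof eventually_elim
      case (elim t)
      have i: "t powi - 1 = cnj t" using cnj_circle[OF elim(7)] by (simp add: power_int_minus)
      show ?case unfolding elim i by (subst f) (simp add: z_def w_def complex_eq_iff field_simps)
    qed
  qed
  then show ?case by (auto intro!: circ.subspace_add[OF subspace_trig] circ.subspace_scale[OF subspace_trig])
next
  case (const c)
  have "abs_circ_fun (\<lambda>t. complex_of_real c) = cscale (complex_of_real c) (monomial 0)"
  proof (rule circ_fun_eqI)
    have "(\<lambda>t::complex. complex_of_real c) \<in> borel_measurable borel" by simp
    from rep_abs[OF this] show "AE t in arc_measure. rep (abs_circ_fun (\<lambda>t. complex_of_real c)) t = rep (cscale (complex_of_real c) (monomial 0)) t"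
      using rep_cscale[of "complex_of_real c" "monomial 0"] rep_monomial[of 0] by eventually_elim simp
  qed
  then show ?case by (auto intro!: circ.subspace_scale[OF subspace_trig] simp del: monomial_0)
next
  case (add f g)
  have m: "(\<lambda>t. complex_of_real (f t)) \<in> borel_measurable borel" "(\<lambda>t. complex_of_real (g t)) \<in> borel_measurable borel"
    using continuous_on_polymonial_function[of f UNIV] continuous_on_polymonial_function[of g UNIV] add
    by (auto intro!: borel_measurable_continuous_onI continuous_intros simp: real_polynomial_function_eq)
  have m': "(\<lambda>t. complex_of_real (f t + g t)) \<in> borel_measurable borel" using m by simp
  have "abs_circ_fun (\<lambda>t. complex_of_real (f t + g t)) = abs_circ_fun (\<lambda>t. complex_of_real (f t)) + abs_circ_fun (\<lambda>t. complex_of_real (g t))"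
    by (rule circ_fun_eqI)
      (use rep_add[of "abs_circ_fun (\<lambda>t. complex_of_real (f t))" "abs_circ_fun (\<lambda>t. complex_of_real (g t))"]
        rep_abs[OF m(1)] rep_abs[OF m(2)] rep_abs[OF m'] in \<open>eventually_elim, simp\<close>)
  then show ?case using add by (auto intro: circ.subspace_add[OF subspace_trig])
next
  case (mult f g)
  have m: "(\<lambda>t. complex_of_real (f t)) \<in> borel_measurable borel" "(\<lambda>t. complex_of_real (g t)) \<in> borel_measurable borel"
    using continuous_on_polymonial_function[of f UNIV] continuous_on_polymonial_function[of g UNIV] mult
    by (auto intro!: borel_measurable_continuous_onI continuous_intros simp: real_polynomial_function_eq)
  have m': "(\<lambda>t. complex_of_real (f t * g t)) \<in> borel_measurable borel" using m by simp
  have "abs_circ_fun (\<lambda>t. complex_of_real (f t * g t)) = abs_circ_fun (\<lambda>t. complex_of_real (f t)) * abs_circ_fun (\<lambda>t. complex_of_real (g t))"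
    by (rule circ_fun_eqI)
      (use rep_mult[of "abs_circ_fun (\<lambda>t. complex_of_real (f t))" "abs_circ_fun (\<lambda>t. complex_of_real (g t))"]
        rep_abs[OF m(1)] rep_abs[OF m(2)] rep_abs[OF m'] in \<open>eventually_elim, simp\<close>)
  then show ?case using mult by (auto intro: trig_mult)
qed

text \<open>Besides the class v, a continuous real function k representing it is returned: later
  arguments use bounds at every point of the circle, which a class does not provide.\<close>

lemma trig_approx_real:
  fixes h :: "complex \<Rightarrow> real"
  assumes "continuous_on UNIV h" "e > 0"
  obtains v k where "v \<in> trig_polys" "continuous_on UNIV k" "\<And>t. norm t = 1 \<Longrightarrow> \<bar>h t - k t\<bar> < e"
    "AE t in arc_measure. rep v t = complex_of_real (k t)"
proof -
  have "continuous_on (sphere 0 1) h" using assms continuous_on_subset by blast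
  then obtain k where k: "real_polynomial_function k" "\<And>t. t \<in> sphere 0 1 \<Longrightarrow> \<bar>h t - k t\<bar> < e"
    using Stone_Weierstrass_real_polynomial_function[of "sphere 0 1" h e] assms by auto
  have c: "continuous_on UNIV k" using k continuous_on_polymonial_function by (auto simp: real_polynomial_function_eq)
  have "continuous_on UNIV (\<lambda>t. complex_of_real (k t))" using c by (intro continuous_intros)
  from rep_abs_cont[OF this] show ?thesis
    using that[OF trig_real_polynomial[OF k(1)] c] k(2) by auto
qed

lemma Lp_closure_trig: assumes p: "p \<ge> 1" shows "Lp_closure p trig_polys = Lp p"
proof -
  have sub: "trig_polys \<subseteq> Lp p" using p trig_Lp by auto
  have "f \<in> Lp_closure p trig_polys" if f: "f \<in> Lp p" for f
  proof (rule Lp_closure_closure[OF p sub f])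
    fix e :: real assume e: "e > 0"
    obtain g where g: "g \<in> cont_funs" "Lp_norm p (f - g) < e"
      using f Lp_closure_approx[of f p cont_funs e] e Lp_closure_cont[OF p] by auto
    have gL: "g \<in> Lp p" using g cont_funs_Linf p by (auto intro: Linf_subset_Lp)
    obtain h where h: "continuous_on UNIV h" "g = abs_circ_fun h" using g by (auto simp: cont_funs_def)
    have "g \<in> Lp_closure p trig_polys" unfolding Lp_closure_def
    proof (intro CollectI conjI allI impI gL)
      fix e :: real assume e: "e > 0"
      then have e4: "e/4 > 0" by simp
      have ch: "continuous_on UNIV (\<lambda>t. Re (h t))" "continuous_on UNIV (\<lambda>t. Im (h t))"
        using h(1) by (auto intro: continuous_intros)
      obtain v k where v: "v \<in> trig_polys" "\<And>t. norm t = 1 \<Longrightarrow> \<bar>Re (h t) - k t\<bar> < e/4"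
          "AE t in arc_measure. rep v t = complex_of_real (k t)"
        using trig_approx_real[OF ch(1) e4] by metis
      obtain w l where w: "w \<in> trig_polys" "\<And>t. norm t = 1 \<Longrightarrow> \<bar>Im (h t) - l t\<bar> < e/4"
          "AE t in arc_measure. rep w t = complex_of_real (l t)"
        using trig_approx_real[OF ch(2) e4] by metis
      define u where "u = v + cscale \<i> w"
      have u: "u \<in> trig_polys" unfolding u_def using v w by (intro circ.subspace_add circ.subspace_scale subspace_trig)
      have "AE t in arc_measure. norm (rep (g - u) t) \<le> e/2"
        using rep_abs_cont[OF h(1), folded h(2)] rep_diff[of g u] rep_add[of v "cscale \<i> w", folded u_def] rep_cscale[of \<i> w] v(3) w(3) AE_arc_measure_norm
      proof eventually_elim
        case (elim t)
        have "norm (rep (g - u) t) \<le> \<bar>Re (h t) - k t\<bar> + \<bar>Im (h t) - l t\<bar>"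
          using cmod_le[of "h t - (complex_of_real (k t) + \<i> * complex_of_real (l t))"]
          by (simp add: elim)
        then show ?case using v(2)[OF elim(7)] w(2)[OF elim(7)] by linarith
      qed
      then have "Lp_norm p (g - u) \<le> e/2" using e p by (intro Lp_norm_le_const) auto
      then show "\<exists>u\<in>trig_polys. Lp_norm p (g - u) < e" using e u by (intro bexI[of _ u]) auto
    qed
    then show "\<exists>g\<in>Lp_closure p trig_polys. Lp_norm p (f - g) < e" using g by blast
  qed
  then show ?thesis by (auto simp: Lp_closure_def)
qed

text \<open>L^1 approximation by continuous functions gives convergence almost everywhere of a
  subsequence; truncation keeps it bounded, and a uniform approximation within 1/(n+1) replaces the
  truncated functions by trigonometric polynomials. The common bound is what dominated convergence
  will use.\<close>

lemma bounded_approx_trig: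
  fixes u :: "complex \<Rightarrow> real"
  assumes u: "u \<in> borel_measurable borel" "\<And>t. \<bar>u t\<bar> \<le> C"
  obtains v :: "nat \<Rightarrow> circ_fun" and k :: "nat \<Rightarrow> complex \<Rightarrow> real" where
    "\<And>n. v n \<in> trig_polys" "\<And>n. continuous_on UNIV (k n)" "\<And>n t. norm t = 1 \<Longrightarrow> \<bar>k n t\<bar> \<le> C + 1"
    "\<And>n. AE t in arc_measure. rep (v n) t = complex_of_real (k n t)"
    "AE t in arc_measure. (\<lambda>n. k n t) \<longlonglongrightarrow> u t"
proof -
  define f where "f = abs_circ_fun (\<lambda>t. complex_of_real (u t))"
  have mu: "(\<lambda>t. complex_of_real (u t)) \<in> borel_measurable borel" using u by simp
  have rf: "AE t in arc_measure. rep f t = complex_of_real (u t)" unfolding f_def by (rule rep_abs[OF mu])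
  have "f \<in> Linf" by (rule LinfI[of _ C]) (use rf in \<open>eventually_elim, simp add: u\<close>)
  then have fL: "f \<in> Lp 1" by (rule Linf_subset_Lp) simp
  obtain F where F: "\<And>n. F n \<in> cont_funs" "(\<lambda>n. Lp_norm 1 (f - F n)) \<longlonglongrightarrow> 0"
    using fL Lp_closure_cont[of 1] Lp_closureD[of f 1 cont_funs] by auto
  have FL: "f - F n \<in> Lp 1" for n by (rule Lp_diff[OF fL]) (use F(1)[of n] cont_funs_Linf Linf_subset_Lp in auto)
  have "(\<lambda>n. LINT t|arc_measure. norm (rep (f - F n) t)) \<longlonglongrightarrow> 0" using F(2) by (simp add: Lp1_norm)
  then obtain r where r: "strict_mono r" "AE t in arc_measure. (\<lambda>n. rep (f - F (r n)) t) \<longlonglongrightarrow> 0"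
    using tendsto_L1_AE_subseq[of arc_measure "\<lambda>n. rep (f - F n)"] FL by (auto simp: Lp1_iff)
  have "\<forall>n. \<exists>h. continuous_on UNIV h \<and> F n = abs_circ_fun h" using F(1) by (auto simp: cont_funs_def)
  then obtain h where h: "\<And>n. continuous_on UNIV (h n)" "\<And>n. F n = abs_circ_fun (h n)" by metis
  \<comment> \<open>Truncation to [-C, C] leaves the limit unchanged, since u takes its values
    there.\<close>
  define l where "l n t = max (-C) (min C (Re (h (r n) t)))" for n t
  have C0: "C \<ge> 0" using u(2)[of 0] by linarith
  have lC: "\<bar>l n t\<bar> \<le> C" for n t using C0 by (auto simp: l_def)
  have lc: "continuous_on UNIV (l n)" for n unfolding l_def using h by (intro continuous_intros)
  have "\<exists>v k. v \<in> trig_polys \<and> continuous_on UNIV k \<and> (\<forall>t. norm t = 1 \<longrightarrow> \<bar>l n t - k t\<bar> < 1 / Suc n) \<and>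
     (AE t in arc_measure. rep v t = complex_of_real (k t))" for n
  proof -
    have "1 / real (Suc n) > 0" by simp
    from trig_approx_real[OF lc[of n] this] show ?thesis by metis
  qed
  then obtain v k where vk: "\<And>n. v n \<in> trig_polys" "\<And>n. continuous_on UNIV (k n)"
    "\<And>n t. norm t = 1 \<Longrightarrow> \<bar>l n t - k n t\<bar> < 1 / Suc n" "\<And>n. AE t in arc_measure. rep (v n) t = complex_of_real (k n t)"
    by metis
  have kC: "\<bar>k n t\<bar> \<le> C + 1" if "norm t = 1" for n t
  proof -
    have "1 / real (Suc n) \<le> 1" by simp
    then show ?thesis using vk(3)[OF that, of n] lC[of n t] by linarith
  qed
  have all: "AE t in arc_measure. \<forall>n. rep (f - F (r n)) t = rep f t - rep (F (r n)) t \<and> rep (F (r n)) t = h (r n) t"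
    by (subst AE_all_countable, intro allI AE_conjI rep_diff) (simp add: h(2) rep_abs_cont[OF h(1)])
  have "AE t in arc_measure. (\<lambda>n. k n t) \<longlonglongrightarrow> u t"
    using r(2) all rf AE_arc_measure_norm
  proof eventually_elim
    case (elim t)
    have "(\<lambda>n. complex_of_real (u t) - (complex_of_real (u t) - h (r n) t)) \<longlonglongrightarrow> complex_of_real (u t) - 0"
      using elim by (intro tendsto_diff tendsto_const) auto
    then have "(\<lambda>n. Re (h (r n) t)) \<longlonglongrightarrow> u t" using tendsto_Re by fastforce
    then have "(\<lambda>n. l n t) \<longlonglongrightarrow> max (-C) (min C (u t))" unfolding l_def by (intro tendsto_intros)
    also have "max (-C) (min C (u t)) = u t" using u(2)[of t] by (auto simp: max_def min_def)
    finally have l: "(\<lambda>n. l n t) \<longlonglongrightarrow> u t" .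
    have "(\<lambda>n. l n t - k n t) \<longlonglongrightarrow> 0"
    proof (rule Lim_null_comparison[OF _ LIMSEQ_inverse_real_of_nat])
      show "\<forall>\<^sub>F n in sequentially. norm (l n t - k n t) \<le> inverse (real (Suc n))"
        using vk(3)[OF elim(4)] by (auto simp: inverse_eq_divide intro!: always_eventually less_imp_le)
    qed
    from tendsto_diff[OF l this] show ?case by simp
  qed
  then show ?thesis by (intro that[of v k] vk(1) vk(2) kC vk(4))
qed

text \<open>f integrates to 0 against trigonometric polynomials, hence against every bounded
  measurable real function. Real and imaginary part of \<open>sgn (rep f t)\<close> are such
  functions, and together they produce the integral of |f|.\<close>

lemma fourier_unique_zero:
  assumes f: "f \<in> Lp 1" and z: "\<And>n. fourier f n = 0"
  shows "f = 0"
proof -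
  have trig: "(LINT t|arc_measure. rep f t * rep v t) = 0" if "v \<in> trig_polys" for v
  proof -
    have "f * v \<in> Lp 1 \<and> fourier (f * v) 0 = 0" using that unfolding trig_polys_def
    proof (induction rule: circ.span_induct_alt)
      case base then show ?case by simp
    next
      case (step c x y)
      then obtain m where x: "x = monomial m" by auto
      have 1: "f * x \<in> Lp 1" using f monomial_mult_Lp(1)[of m f 1] by (simp add: x mult.commute)
      have 2: "fourier (f * x) 0 = 0" using fourier_mult_monomial[of m f 0] z by (simp add: x mult.commute)
      show ?case using step 1 2
        by (simp add: distrib_left cscale_mult Lp_add Lp_cscale fourier_add fourier_cscale)
    qed
    then have "(LINT t|arc_measure. rep (f * v) t) = 0" by (simp add: fourier_rep)
    moreover have "(LINT t|arc_measure. rep (f * v) t) = (LINT t|arc_measure. rep f t * rep v t)"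
      by (rule integral_cong_AE) (use rep_mult[of f v] in auto)
    ultimately show ?thesis by simp
  qed
  have intf: "integrable arc_measure (rep f)" using f by (simp add: Lp1_iff)
  have real: "(LINT t|arc_measure. rep f t * complex_of_real (u t)) = 0"
    and int: "integrable arc_measure (\<lambda>t. rep f t * complex_of_real (u t))"
    if u: "u \<in> borel_measurable borel" "\<And>t. \<bar>u t\<bar> \<le> 1" for u :: "complex \<Rightarrow> real"
  proof -
    obtain v k where vk: "\<And>n. v n \<in> trig_polys" "\<And>n. continuous_on UNIV (k n)" "\<And>n t. norm t = 1 \<Longrightarrow> \<bar>k n t\<bar> \<le> 1 + 1"
    "\<And>n. AE t in arc_measure. rep (v n) t = complex_of_real (k n t)"
    "AE t in arc_measure. (\<lambda>n. k n t) \<longlonglongrightarrow> u t" by (rule bounded_approx_trig[OF u]) (rule that)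
    have [measurable]: "k n \<in> borel_measurable borel" for n using vk(2) by (rule borel_measurable_continuous_onI)
    note [measurable] = u(1)
    have L: "(\<lambda>n. LINT t|arc_measure. rep f t * complex_of_real (k n t)) \<longlonglongrightarrow> (LINT t|arc_measure. rep f t * complex_of_real (u t))"
    proof (rule integral_dominated_convergence)
      show "integrable arc_measure (\<lambda>t. norm (rep f t) * 2)" using intf by simp
      show "AE t in arc_measure. (\<lambda>n. rep f t * complex_of_real (k n t)) \<longlonglongrightarrow> rep f t * complex_of_real (u t)"
        using vk(5) by eventually_elim (intro tendsto_intros)
      show "AE t in arc_measure. norm (rep f t * complex_of_real (k n t)) \<le> norm (rep f t) * 2" for n
        using AE_arc_measure_norm by eventually_elim (use vk(3) in \<open>auto simp: norm_mult intro!: mult_left_mono\<close>)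
    qed simp_all
    have "(LINT t|arc_measure. rep f t * complex_of_real (k n t)) = (LINT t|arc_measure. rep f t * rep (v n) t)" for n
      by (rule integral_cong_AE) (use vk(4)[of n] in auto)
    then show "(LINT t|arc_measure. rep f t * complex_of_real (u t)) = 0"
      using L trig[OF vk(1)] by (simp add: LIMSEQ_const_iff)
    show "integrable arc_measure (\<lambda>t. rep f t * complex_of_real (u t))"
      by (rule Bochner_Integration.integrable_bound[OF intf]) (use u(2) in \<open>auto simp: norm_mult mult_left_le\<close>)
  qed
  define u where "u t = Re (sgn (rep f t))" for t
  define v where "v t = Im (sgn (rep f t))" for t
  have [measurable]: "u \<in> borel_measurable borel" "v \<in> borel_measurable borel" unfolding u_def v_def sgn_div_norm by measurable
  have b: "\<bar>u t\<bar> \<le> 1" "\<bar>v t\<bar> \<le> 1" for t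
    using abs_Re_le_cmod[of "sgn (rep f t)"] abs_Im_le_cmod[of "sgn (rep f t)"] 
    by (auto simp: u_def v_def norm_sgn split: if_splits)
  have e: "complex_of_real (norm (rep f t)) = rep f t * complex_of_real (u t) - \<i> * (rep f t * complex_of_real (v t))" for t
  proof -
    have "rep f t * cnj (sgn (rep f t)) = complex_of_real (norm (rep f t))"
      by (simp add: sgn_eq complex_norm_square[symmetric] power2_eq_square)
    moreover have "cnj (sgn (rep f t)) = complex_of_real (u t) - \<i> * complex_of_real (v t)"
      by (simp add: u_def v_def complex_eq_iff)
    ultimately show ?thesis by (simp add: algebra_simps)
  qed
  have "complex_of_real (LINT t|arc_measure. norm (rep f t)) = (LINT t|arc_measure. complex_of_real (norm (rep f t)))"
    by simp
  also have "\<dots> = 0" unfolding e using real[of u] real[of v] int[of u] int[of v] b by simp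
  finally have "Lp_norm 1 f = 0" by (simp add: Lp1_norm)
  then show ?thesis using Lp_norm_eq_0[OF f] by simp
qed

lemma fourier_unique:
  assumes "f \<in> Lp 1" "g \<in> Lp 1" "\<And>n. fourier f n = fourier g n"
  shows "f = g"
  using fourier_unique_zero[of "f - g"] assms by (simp add: Lp_diff fourier_diff)

section \<open>The theorem of M. Riesz\<close>

text \<open>Cauchy's formula at the centre. The integrand is a Borel function f on the plane
  agreeing with G on the circle, since G is controlled on the disc only.\<close>

lemma mean_value_circle:
  assumes contG: "continuous_on (cball 0 1) G" and holG: "G holomorphic_on ball 0 1"
    and f: "f \<in> borel_measurable borel" "\<And>t. norm t = 1 \<Longrightarrow> f t = G t"
  shows "(LINT t|arc_measure. f t) = G 0"
proof -
  have "((\<lambda>u. G u / (u - 0)) has_contour_integral (2 * of_real pi * \<i> * G 0)) (circlepath 0 1)"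
    by (rule Cauchy_integral_circlepath) (use assms in auto)
  then have "((\<lambda>t. G (cis t) / cis t * \<i> * cis t) has_integral (2 * of_real pi * \<i> * G 0)) {0..2*pi}"
    unfolding circlepath_def by (subst (asm) has_contour_integral_part_circlepath_iff) auto
  then have "((\<lambda>t. (1/\<i>) * (G (cis t) / cis t * \<i> * cis t)) has_integral ((1/\<i>) * (2 * of_real pi * \<i> * G 0))) {0..2*pi}"
    by (rule has_integral_mult_right)
  then have "((\<lambda>t. G (cis t)) has_integral (2 * of_real pi * G 0)) {0..2*pi}"
    by (simp add: field_simps)
  then have I: "integral {0..2*pi} (\<lambda>t. f (cis t)) = 2 * of_real pi * G 0"
    using f(2) by (simp add: integral_unique)
  have "continuous_on UNIV (\<lambda>x. G (cis x))"
    by (rule continuous_on_compose2[OF contG continuous_on_cis]) (auto intro!: continuous_intros)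
  then have "continuous_on UNIV (\<lambda>x. f (cis x))" using f(2) by simp
  then show ?thesis using integral_arc_measure_interval[OF f(1)] I by (simp add: scaleR_conv_of_real)
qed

text \<open>A negative value would persist on a nonempty open set of angles, and such a set is not
  null.\<close>

lemma AE_arc_continuous_nonneg:
  fixes k :: "complex \<Rightarrow> real"
  assumes k: "continuous_on UNIV k" and ae: "AE t in arc_measure. 0 \<le> k t" and t: "norm t = 1"
  shows "0 \<le> k t"
proof (rule ccontr)
  assume neg: "\<not> 0 \<le> k t"
  have [measurable]: "k \<in> borel_measurable borel" by (rule borel_measurable_continuous_onI[OF k])
  define U where "U = {x. k (cis x) < 0} \<inter> {0<..<2*pi}"
  have kc: "continuous_on UNIV (\<lambda>x. k (cis x))"
    by (rule continuous_on_compose2[OF k continuous_on_cis]) (auto intro!: continuous_intros)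
  have op: "open {x. k (cis x) < 0}" using open_Collect_less[OF kc continuous_on_const[of _ 0]] by simp
  then have "open U" by (auto simp: U_def)
  obtain y where y: "t = cis y" "0 \<le> y" "y < 2*pi"
    using t complex_unimodular_polar[of t] by (metis cis.ctr complex.collapse complex_surj)
  have "y \<in> {x. k (cis x) < 0}" using neg y by simp
  then obtain e where e: "e > 0" "ball y e \<subseteq> {x. k (cis x) < 0}"
    using op openE by metis
  \<comment> \<open>The angle y may be the endpoint 0; a shift by m stays in the ball around y and
    lands strictly between 0 and 2 pi.\<close>
  define m where "m = min (e/2) (pi - y/2)"
  have m: "0 < m" "m < e" "m < 2*pi - y" using e(1) y by (auto simp: m_def min_def)
  define x where "x = y + m"
  have "x \<in> U" unfolding U_def using subsetD[OF e(2), of x] m y by (auto simp: x_def dist_real_def)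
  have "AE x in lborel. x \<in> {0..2*pi} \<longrightarrow> 0 \<le> k (cis x)"
    using ae by (subst (asm) AE_arc_measure_iff) auto
  then have "AE x in lborel. x \<notin> U" by eventually_elim (auto simp: U_def)
  then have "emeasure lborel U = 0" using \<open>open U\<close> by (subst (asm) AE_iff_measurable[of U]) auto
  then have "U \<in> null_sets lborel" using \<open>open U\<close> by auto
  moreover have "\<not> negligible U" using open_not_negligible[OF \<open>open U\<close>] \<open>x \<in> U\<close> by auto
  ultimately show False using negligible_iff_null_sets null_sets_completionI by blast
qed

text \<open>Near pi/2 the angle p \<alpha> lies beyond pi/2 and, as p \<le> 2, does not pass pi, so
  -cos (p \<alpha>) is bounded below by a positive number. Away from pi/2 it is cos \<alpha> that is
  bounded below. One multiple of each term covers both regions.\<close>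

lemma cos_powr_inequality:
  assumes p: "1 < p" "p \<le> 2"
  obtains A B :: real where "A > 0" "B > 0"
    "\<And>\<alpha>. \<bar>\<alpha>\<bar> \<le> pi/2 \<Longrightarrow> 1 \<le> A * cos \<alpha> powr p - B * cos (p * \<alpha>)"
proof -
  \<comment> \<open>The border of the two regions: p a is the midpoint of pi/2 and p pi/2.\<close>
  define a where "a = pi * (p + 1) / (4 * p)"
  have pa: "p * a = pi * (p + 1) / 4" using p by (simp add: a_def)
  have pa_gt: "pi/2 < p * a" unfolding pa using p by (simp add: field_simps)
  have pa_lt: "p * a < p * (pi/2)" unfolding pa using p by (simp add: field_simps)
  have a: "0 < a" "a < pi/2"
    using mult_less_cancel_left_pos[of p a "pi/2"] pa_lt p by (auto simp: a_def)
  have le_pi: "p * (pi/2) \<le> pi" using p by simp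
  have c: "cos (p * a) < 0"
    using cos_monotone_0_pi[of "pi/2" "p * a"] pa_gt pa_lt le_pi by simp
  define B where "B = - 1 / cos (p * a)"
  have B: "B > 0" using c by (simp add: B_def divide_neg_neg)
  have ca: "cos a > 0" using a by (intro cos_gt_zero_pi) auto
  \<comment> \<open>For \<alpha> \<le> a this pays for the 1 on the left and for B cos (p \<alpha>)
    \<le> B.\<close>
  define A where "A = (1 + B) / cos a powr p"
  have A: "A > 0" using B ca by (simp add: A_def)
  have pos: "1 \<le> A * cos \<alpha> powr p - B * cos (p * \<alpha>)" if al: "0 \<le> \<alpha>" "\<alpha> \<le> pi/2" for \<alpha>
  proof (cases "\<alpha> \<le> a")
    case True
    have "cos a \<le> cos \<alpha>" using True al a by (intro cos_monotone_0_pi_le) auto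
    then have "cos a powr p \<le> cos \<alpha> powr p" using ca p by (intro powr_mono2) auto
    then have "A * cos a powr p \<le> A * cos \<alpha> powr p" using A by simp
    moreover have "A * cos a powr p = 1 + B" using ca by (simp add: A_def)
    moreover have "B * cos (p * \<alpha>) \<le> B" using B cos_le_one[of "p * \<alpha>"] by (simp add: mult_left_le)
    ultimately show ?thesis by linarith
  next
    case False
    have "cos (p * \<alpha>) \<le> cos (p * a)"
    proof (rule cos_monotone_0_pi_le)
      show "0 \<le> p * a" using p a by simp
      show "p * a \<le> p * \<alpha>" using False p by (intro mult_left_mono) auto
      have "p * \<alpha> \<le> p * (pi/2)" using al p by (intro mult_left_mono) auto
      then show "p * \<alpha> \<le> pi" using le_pi by linarith
    qed
    then have "B * cos (p * \<alpha>) \<le> B * cos (p * a)" using B by simp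
    also have "\<dots> = -1" using c by (simp add: B_def)
    finally have "1 \<le> - (B * cos (p * \<alpha>))" by simp
    moreover have "0 \<le> A * cos \<alpha> powr p" using A by simp
    ultimately show ?thesis by linarith
  qed
  show ?thesis
  proof (rule that[OF A B])
    fix \<alpha> :: real assume "\<bar>\<alpha>\<bar> \<le> pi/2"
    then show "1 \<le> A * cos \<alpha> powr p - B * cos (p * \<alpha>)"
      using pos[of "\<bar>\<alpha>\<bar>"] by (cases "\<alpha> \<ge> 0") auto
  qed
qed

text \<open>With z = |z| exp (i \<alpha>), the subtracted term is B |z|^p cos (p \<alpha>), B times
  the real part of the p-th power. For holomorphic z its mean over the circle is known, which leaves
  |z|^p bounded by Re z alone.\<close>

lemma norm_powr_le_half_plane:
  assumes p: "1 < p" "p \<le> 2"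
  obtains A B :: real where "A > 0" "B > 0"
    "\<And>z. Re z > 0 \<Longrightarrow> norm z powr p \<le> A * Re z powr p - B * Re (exp (of_real p * Ln z))"
proof -
  obtain A B :: real where AB: "A > 0" "B > 0"
    "\<And>\<alpha>. \<bar>\<alpha>\<bar> \<le> pi/2 \<Longrightarrow> 1 \<le> A * cos \<alpha> powr p - B * cos (p * \<alpha>)"
    using cos_powr_inequality[OF p] by blast
  show ?thesis
  proof (rule that[OF AB(1,2)])
    fix z :: complex assume z: "Re z > 0"
    then have z0: "z \<noteq> 0" by auto
    define \<alpha> where "\<alpha> = Im (Ln z)"
    have al: "\<bar>\<alpha>\<bar> < pi/2" using Re_Ln_pos_lt[OF z0] z by (simp add: \<alpha>_def)
    have cpos: "cos \<alpha> > 0" using al by (intro cos_gt_zero_pi) auto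
    have "z = exp (Ln z)" using z0 by simp
    then have Re: "Re z = norm z * cos \<alpha>" using z0 by (metis Re_exp \<alpha>_def Re_Ln exp_ln zero_less_norm_iff)
    have e: "Re (exp (of_real p * Ln z)) = norm z powr p * cos (p * \<alpha>)"
      using z0 by (simp add: Re_exp \<alpha>_def powr_def)
    have "norm z powr p * 1 \<le> norm z powr p * (A * cos \<alpha> powr p - B * cos (p * \<alpha>))"
      using AB(3)[of \<alpha>] al by (intro mult_left_mono) auto
    also have "\<dots> = A * Re z powr p - B * Re (exp (of_real p * Ln z))"
      unfolding e Re using cpos by (simp add: powr_mult algebra_simps)
    finally show "norm z powr p \<le> A * Re z powr p - B * Re (exp (of_real p * Ln z))" by simp
  qed
qed

section \<open>The Riesz projection on trigonometric polynomials\<close>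

lemma analytic_poly_rep:
  assumes "f \<in> analytic_polys"
  obtains q :: "complex poly" where "AE t in arc_measure. rep f t = poly q t"
proof -
  have "\<exists>q :: complex poly. AE t in arc_measure. rep f t = poly q t"
    using assms unfolding analytic_polys_def
  proof (induction rule: circ.span_induct_alt)
    case base then show ?case using rep_zero by (intro exI[of _ 0]) simp
  next
    case (step c x y)
    then obtain n where n: "n \<ge> 0" "x = monomial n" by auto
    obtain q where q: "AE t in arc_measure. rep y t = poly q t" using step by auto
    have "AE t in arc_measure. rep (cscale c x + y) t = poly (smult c (monom 1 (nat n)) + q) t"
      using rep_add[of "cscale c x" y] rep_cscale[of c x] rep_monomial[of n] q
      by eventually_elim (simp add: poly_monom power_int_def n)
    then show ?case by blast
  qed
  then show ?thesis using that by blast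
qed

lemma analytic_Hp: assumes "f \<in> analytic_polys" "p > 0" shows "f \<in> Hp p"
proof -
  have "f \<in> Lp 1 \<and> (\<forall>n<0. fourier f n = 0)" using assms(1) unfolding analytic_polys_def
  proof (induction rule: circ.span_induct_alt)
    case (step c x y)
    then have "x \<in> Lp 1" using trig_Lp monomial_trig by auto
    then show ?case using step Lp_add[of "cscale c x" 1 y] Lp_cscale[of x 1 c]
      by (auto simp: fourier_add Lp_cscale fourier_cscale fourier_monomial)
  qed simp
  then show ?thesis using assms trig_Lp analytic_subset_trig by (auto simp: Hp_def)
qed

lemma antianalytic_fourier: assumes "f \<in> antianalytic_polys" "n \<ge> 0" shows "fourier f n = 0"
proof -
  have "f \<in> Lp 1 \<and> fourier f n = 0" using assms(1) unfolding antianalytic_polys_def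
  proof (induction rule: circ.span_induct_alt)
    case (step c x y)
    then have "x \<in> Lp 1" using trig_Lp monomial_trig by auto
    then show ?case using step assms(2) Lp_add[of "cscale c x" 1 y] Lp_cscale[of x 1 c]
      by (auto simp: fourier_add Lp_cscale fourier_cscale fourier_monomial)
  qed simp
  then show ?thesis by simp
qed

lemma trig_decomp:
  assumes "f \<in> trig_polys"
  obtains g h where "g \<in> analytic_polys" "h \<in> antianalytic_polys" "f = g + h"
proof -
  have "\<exists>g h. g \<in> analytic_polys \<and> h \<in> antianalytic_polys \<and> f = g + h"
    using assms unfolding trig_polys_def
  proof (induction rule: circ.span_induct_alt)
    case base
    show ?case by (intro exI[of _ 0]) (simp add: analytic_polys_def antianalytic_polys_def circ.span_zero)
  next
    case (step c x y)
    then obtain n g h where x: "x = monomial n" and gh: "g \<in> analytic_polys" "h \<in> antianalytic_polys" "y = g + h" by auto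
    show ?case
    proof (cases "n \<ge> 0")
      case True
      then have "cscale c x + g \<in> analytic_polys" using gh x unfolding analytic_polys_def
        by (intro circ.span_add circ.span_scale circ.span_base[of x]) auto
      then show ?thesis using gh by (intro exI[of _ "cscale c x + g"] exI[of _ h]) (simp add: add.assoc)
    next
      case False
      then have "cscale c x + h \<in> antianalytic_polys" using gh x unfolding antianalytic_polys_def
        by (intro circ.span_add circ.span_scale circ.span_base[of x]) auto
      then show ?thesis using gh by (intro exI[of _ g] exI[of _ "cscale c x + h"]) (simp add: add_ac)
    qed
  qed
  then show ?thesis using that by blast
qed

text \<open>A Hardy function is determined by its nonnegative coefficients, so the description in
  \<open>riesz\<close> is settled by exhibiting one candidate.\<close>

lemma riesz_eqI:
  assumes "g \<in> Hp 1" "\<And>n. n \<ge> 0 \<Longrightarrow> fourier g n = fourier f n"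
  shows "riesz f = g"
  unfolding riesz_def
proof (rule the_equality)
  fix g' assume g': "g' \<in> Hp 1 \<and> (\<forall>n\<ge>0. fourier g' n = fourier f n)"
  show "g' = g"
  proof (rule fourier_unique)
    fix n :: int show "fourier g' n = fourier g n"
      using g' assms by (cases "n \<ge> 0") (auto simp: Hp_def)
  qed (use g' assms in \<open>auto simp: Hp_def\<close>)
qed (use assms in auto)

lemma riesz_trig_decomp:
  assumes "g \<in> analytic_polys" "h \<in> antianalytic_polys"
  shows "riesz (g + h) = g"
proof (rule riesz_eqI)
  show "g \<in> Hp 1" using analytic_Hp assms by simp
  fix n :: int assume "n \<ge> 0"
  then show "fourier g n = fourier (g + h) n"
    using antianalytic_fourier[OF assms(2)] assms analytic_subset_trig antianalytic_subset_trig trig_Lp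
    by (subst fourier_add) auto
qed

lemma riesz_trig:
  assumes "f \<in> trig_polys"
  shows "riesz f \<in> analytic_polys" "f - riesz f \<in> antianalytic_polys"
  using trig_decomp[OF assms] riesz_trig_decomp by (metis, metis add_diff_cancel_left')

lemma riesz_trig_add:
  assumes "f \<in> trig_polys" "g \<in> trig_polys"
  shows "riesz (f + g) = riesz f + riesz g"
proof -
  have "riesz ((riesz f + riesz g) + ((f - riesz f) + (g - riesz g))) = riesz f + riesz g"
    using riesz_trig[OF assms(1)] riesz_trig[OF assms(2)]
    by (intro riesz_trig_decomp) (auto simp: analytic_polys_def antianalytic_polys_def intro: circ.span_add)
  then show ?thesis by (simp add: algebra_simps)
qed

lemma riesz_trig_cscale:
  assumes "f \<in> trig_polys"
  shows "riesz (cscale z f) = cscale z (riesz f)"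
proof -
  have "riesz (cscale z (riesz f) + cscale z (f - riesz f)) = cscale z (riesz f)"
    using riesz_trig[OF assms]
    by (intro riesz_trig_decomp) (auto simp: analytic_polys_def antianalytic_polys_def intro: circ.span_scale)
  then show ?thesis by (simp flip: circ.scale_right_distrib)
qed

lemma riesz_trig_diff:
  assumes "f \<in> trig_polys" "g \<in> trig_polys"
  shows "riesz (f - g) = riesz f - riesz g"
  unfolding circ_fun_minus_eq[of f g] circ_fun_minus_eq[of "riesz f"]
  by (simp add: riesz_trig_add riesz_trig_cscale assms circ.subspace_scale[OF subspace_trig] del: circ.scale_minus_left)

lemma riesz_trig_Lp: "f \<in> trig_polys \<Longrightarrow> p > 0 \<Longrightarrow> riesz f \<in> Lp p"
  using riesz_trig analytic_subset_trig trig_Lp by blast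

lemma one_analytic: "1 \<in> analytic_polys" unfolding analytic_polys_def
  by (rule circ.span_base) (use monomial_0 in \<open>auto simp del: monomial_0 intro!: image_eqI[of _ _ 0]\<close>)

text \<open>For real u the coefficients at n and -n are conjugate, so f = 2 P u - fourier u 0
  satisfies f + conj f = 2 u. On the circle f is a polynomial in t, whose value at 0 is its
  mean.\<close>

lemma analytic_completion:
  assumes u: "u \<in> trig_polys" and uk: "AE t in arc_measure. rep u t = complex_of_real (k t)"
  obtains q :: "complex poly" where
    "AE t in arc_measure. rep (cscale 2 (riesz u) - cscale (fourier u 0) 1) t = poly q t"
    "AE t in arc_measure. Re (poly q t) = k t" "poly q 0 = fourier u 0" "cnj (fourier u 0) = fourier u 0"
proof -
  define g where "g = riesz u"
  define z0 where "z0 = fourier u 0"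
  define f where "f = cscale 2 g - cscale z0 1"
  note one = one_analytic
  have g: "g \<in> analytic_polys" unfolding g_def by (rule riesz_trig[OF u])
  have fa: "f \<in> analytic_polys" using g one unfolding f_def analytic_polys_def
    by (intro circ.span_diff circ.span_scale)
  have L1: "u \<in> Lp 1" "g \<in> Lp 1" "f \<in> Lp 1" "1 \<in> Lp 1"
    using u g fa one analytic_subset_trig trig_Lp by auto
  have cu: "conjugate u = u"
    by (rule circ_fun_eqI) (use rep_conjugate[of u] uk in \<open>eventually_elim, simp\<close>)
  have z0r: "cnj z0 = z0" using fourier_conjugate[of u 0] by (simp add: cu z0_def)
  have gn: "fourier g n = (if n \<ge> 0 then fourier u n else 0)" for n
  proof (cases "n \<ge> 0")
    case True
    then show ?thesis using antianalytic_fourier[OF riesz_trig(2)[OF u] True] L1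
      by (simp add: fourier_diff g_def)
  next
    case False
    then show ?thesis using analytic_Hp[OF g, of 1] by (simp add: Hp_def)
  qed
  have f1: "fourier 1 n = (if n = 0 then 1 else 0)" for n using fourier_monomial[of 0 n] by simp
  have fn: "fourier f n = 2 * fourier g n - z0 * (if n = 0 then 1 else 0)" for n
    unfolding f_def using L1 by (simp add: fourier_diff fourier_cscale Lp_cscale f1)
  have fcf: "f + conjugate f = cscale 2 u"
  proof (rule fourier_unique)
    fix n
    have "fourier (f + conjugate f) n = fourier f n + cnj (fourier f (-n))"
      using L1 by (simp add: fourier_add fourier_conjugate conjugate_Lp)
    also have "\<dots> = 2 * fourier u n"
      using fourier_conjugate[of u n] z0r by (simp add: fn gn cu z0_def)
    finally show "fourier (f + conjugate f) n = fourier (cscale 2 u) n" by (simp add: fourier_cscale)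
  qed (use L1 in \<open>auto simp: Lp_add conjugate_Lp Lp_cscale\<close>)
  obtain q where q: "AE t in arc_measure. rep f t = poly q t" using analytic_poly_rep[OF fa] by blast
  have Re_q: "AE t in arc_measure. Re (poly q t) = k t"
    using q uk rep_add[of f "conjugate f"] rep_conjugate[of f] rep_cscale[of 2 u]
  proof eventually_elim
    case (elim t)
    have "rep f t + cnj (rep f t) = 2 * rep u t" using elim by (simp add: fcf)
    then have "poly q t + cnj (poly q t) = complex_of_real (2 * k t)" by (simp add: elim)
    then have "Re (poly q t + cnj (poly q t)) = 2 * k t" by (metis Re_complex_of_real)
    then show ?case by simp
  qed
  have cq: "continuous_on S (poly q)" for S by (intro continuous_intros)
  have [measurable]: "poly q \<in> borel_measurable borel" by (rule borel_measurable_continuous_onI[OF cq])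
  have q0: "poly q 0 = z0"
  proof -
    have "(LINT t|arc_measure. poly q t) = poly q 0"
      by (rule mean_value_circle[OF cq]) (auto intro!: holomorphic_intros)
    moreover have "(LINT t|arc_measure. poly q t) = fourier f 0"
      unfolding fourier_rep by (rule integral_cong_AE) (use q in \<open>auto elim!: eventually_mono\<close>)
    ultimately show ?thesis using fn[of 0] gn[of 0] by (simp add: z0_def)
  qed
  show ?thesis by (rule that[of q]) (use q Re_q q0 z0r in \<open>auto simp: f_def g_def z0_def\<close>)
qed

text \<open>The analytic completion \<open>f\<close> of \<open>u > 0\<close> has values in the right half plane, so \<open>f\<^sup>p\<close> is holomorphic and its mean
  value over the circle is \<open>f(0)\<^sup>p \<ge> 0\<close>.\<close>

lemma riesz_bound_positive:
  assumes p: "1 < p" "p \<le> 2"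
  obtains C where "C > 0" "\<And>u k d. u \<in> trig_polys \<Longrightarrow> continuous_on UNIV k \<Longrightarrow> d > 0 \<Longrightarrow>
      \<forall>t. norm t = 1 \<longrightarrow> k t \<ge> d \<Longrightarrow>
      AE t in arc_measure. rep u t = complex_of_real (k t) \<Longrightarrow> Lp_norm p (riesz u) \<le> C * Lp_norm p u"
proof -
  obtain A B :: real where AB: "A > 0" "B > 0"
    "\<And>z. Re z > 0 \<Longrightarrow> norm z powr p \<le> A * Re z powr p - B * Re (exp (of_real p * Ln z))"
    using norm_powr_le_half_plane[OF p] by blast
  \<comment> \<open>From 2 P u = f + fourier u 0, where f contributes A^(1/p) times the norm of u
    and the constant at most that norm.\<close>
  define C where "C = A powr (1/p) + 1"
  have p0: "p > 0" "p \<ge> 1" using p by auto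
  show ?thesis
  proof (rule that[of C])
    show "C > 0" by (simp add: C_def add_nonneg_pos)
    fix u k and d :: real assume u: "u \<in> trig_polys" and k: "continuous_on UNIV k" and d: "d > 0"
      and kd': "\<forall>t. norm t = 1 \<longrightarrow> k t \<ge> d" and uk: "AE t in arc_measure. rep u t = complex_of_real (k t)"
    have kd: "k t \<ge> d" if "norm t = 1" for t using kd' that by blast
    define g where "g = riesz u"
    define z0 where "z0 = fourier u 0"
    define f where "f = cscale 2 g - cscale z0 1"
    obtain q where q: "AE t in arc_measure. rep f t = poly q t" and Re_q: "AE t in arc_measure. Re (poly q t) = k t"
      and q0: "poly q 0 = z0" and z0r: "cnj z0 = z0"
      using analytic_completion[OF u uk] unfolding f_def g_def z0_def by metis
    note one = one_analytic
    have g: "g \<in> analytic_polys" unfolding g_def by (rule riesz_trig[OF u])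
    have fa: "f \<in> analytic_polys" using g one unfolding f_def analytic_polys_def
      by (intro circ.span_diff circ.span_scale)
    have L1: "u \<in> Lp 1" using u trig_Lp by auto
    have cq: "continuous_on S (poly q)" for S by (intro continuous_intros)
    have [measurable]: "poly q \<in> borel_measurable borel" by (rule borel_measurable_continuous_onI[OF cq])
    have circ_ge: "Re (poly q t) \<ge> d" if "norm t = 1" for t
    proof -
      have "0 \<le> Re (poly q t) - d"
      proof (rule AE_arc_continuous_nonneg[OF _ _ that])
        show "continuous_on UNIV (\<lambda>t. Re (poly q t) - d)" by (intro continuous_intros cq)
        show "AE t in arc_measure. 0 \<le> Re (poly q t) - d"
          using Re_q AE_arc_measure_norm by eventually_elim (use kd in auto)
      qed
      then show ?thesis by simp
    qed
    \<comment> \<open>The maximum principle for the real part of -q carries the lower bound from the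
      circle into the disc; hence q avoids the cut of Ln.\<close>
    have disc: "Re (poly q w) \<ge> d" if w: "w \<in> cball 0 1" for w
    proof -
      have "Re (- poly q w) \<le> - d"
      proof (rule maximum_real_frontier[of "\<lambda>w. - poly q w" "cball 0 1"])
        show "(\<lambda>w. - poly q w) holomorphic_on interior (cball 0 1)" by (intro holomorphic_intros)
        show "continuous_on (closure (cball 0 1)) (\<lambda>w. - poly q w)" by (intro continuous_intros cq)
        show "\<And>z. z \<in> frontier (cball 0 1) \<Longrightarrow> Re (- poly q z) \<le> - d"
          using circ_ge by (auto simp: frontier_cball)
      qed (use w in auto)
      then show ?thesis by simp
    qed
    define G where "G w = exp (of_real p * Ln (poly q w))" for w
    have nonpos: "poly q w \<notin> \<real>\<^sub>\<le>\<^sub>0" if "w \<in> cball 0 1" for w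
      using disc[OF that] d by (auto simp: complex_nonpos_Reals_iff)
    have contG: "continuous_on (cball 0 1) G" unfolding G_def
      using nonpos by (intro continuous_intros cq) auto
    have holG: "G holomorphic_on ball 0 1" unfolding G_def
      using nonpos by (intro holomorphic_intros) auto
    \<comment> \<open>A Borel function equal to G on the circle and 0 elsewhere, as the mean value
      property requires.\<close>
    define G' where "G' t = indicator (sphere 0 1) t *\<^sub>R G t" for t :: complex
    have "continuous_on (sphere 0 1) G" using contG by (rule continuous_on_subset) auto
    then have G'm [measurable]: "G' \<in> borel_measurable borel" unfolding G'_def
      by (intro borel_measurable_continuous_on_indicator) auto
    have mean: "(LINT t|arc_measure. G' t) = G 0"
      by (rule mean_value_circle[OF contG holG G'm]) (simp add: G'_def)
    obtain M where M: "\<And>t. t \<in> cball 0 1 \<Longrightarrow> norm (G t) \<le> M"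
      using compact_continuous_image[OF contG compact_cball] compact_imp_bounded bounded_iff
      by (metis imageI)
    have intG: "integrable arc_measure G'"
    proof (rule integrable_arc_bounded[OF G'm])
      show "AE t in arc_measure. norm (G' t) \<le> M"
        using AE_arc_measure_norm by eventually_elim (use M in \<open>auto simp: G'_def\<close>)
    qed
    have ReG0: "0 \<le> Re (G 0)"
    proof -
      have r: "z0 = complex_of_real (Re z0)" using z0r by (simp add: complex_eq_iff)
      have "Re z0 > 0" using disc[of 0] d q0 by simp
      then have "Ln z0 = complex_of_real (ln (Re z0))" using r Ln_of_real by metis
      then have "G 0 = exp (complex_of_real (p * ln (Re z0)))" by (simp add: G_def q0)
      then show ?thesis by (simp add: Re_exp)
    qed
    have Lpu: "u \<in> Lp p" "f \<in> Lp p" using u fa analytic_subset_trig trig_Lp p by auto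
    have "(LINT t|arc_measure. norm (rep f t) powr p) \<le>
      (LINT t|arc_measure. A * norm (rep u t) powr p - B * Re (G' t))"
    proof (rule integral_mono_AE)
      show "AE t in arc_measure. norm (rep f t) powr p \<le> A * norm (rep u t) powr p - B * Re (G' t)"
        using q uk Re_q AE_arc_measure_norm
      proof eventually_elim
        case (elim t)
        have "k t \<ge> d" using kd elim by auto
        then show ?case using AB(3)[of "poly q t"] elim d by (simp add: G'_def G_def)
      qed
    qed (use Lpu intG in \<open>auto simp: Lp_iff\<close>)
    also have "\<dots> = A * (LINT t|arc_measure. norm (rep u t) powr p) - B * Re (G 0)"
      using Lpu intG by (simp add: Lp_iff mean[symmetric])
    also have "\<dots> \<le> A * Lp_norm p u powr p"
      using AB ReG0 p by (simp add: Lp_norm_powr)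
    also have "\<dots> = (A powr (1/p) * Lp_norm p u) powr p"
      using AB p by (simp add: powr_mult powr_powr)
    finally have f_le: "Lp_norm p f \<le> A powr (1/p) * Lp_norm p u"
      using p by (intro Lp_norm_leI) auto
    have "norm z0 \<le> Lp_norm p u"
      using norm_fourier_le[OF L1, of 0] Lp_subset_Lp1(2)[OF Lpu(1)] p by (simp add: z0_def)
    moreover have "Lp_norm p 1 \<le> 1" 
      by (rule Lp_norm_le_const) (use rep_one p in \<open>auto elim!: eventually_mono\<close>)
    ultimately have z1: "norm z0 * Lp_norm p 1 \<le> Lp_norm p u"
      by (metis Lp_norm_nonneg mult_left_le norm_ge_zero order_trans)
    have L1p: "1 \<in> Lp p" using one analytic_subset_trig trig_Lp p by auto
    have "cscale 2 g = f + cscale z0 1" by (simp add: f_def)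
    then have "2 * Lp_norm p g = Lp_norm p (f + cscale z0 1)"
      using Lp_cscale(2)[of g p 2] riesz_trig_Lp[OF u, of p] p by (simp add: g_def)
    also have "\<dots> \<le> Lp_norm p f + Lp_norm p (cscale z0 1)"
      using Lpu L1p p by (intro Lp_norm_triangle Lp_cscale) auto
    also have "\<dots> \<le> A powr (1/p) * Lp_norm p u + Lp_norm p u"
      using f_le z1 Lp_cscale(2)[OF L1p] p by simp
    also have "\<dots> = C * Lp_norm p u" by (simp add: C_def algebra_simps)
    finally show "Lp_norm p (riesz u) \<le> C * Lp_norm p u" using Lp_norm_nonneg[of p g] unfolding g_def by linarith
  qed
qed

section \<open>Orthogonality, the duality map, and the bound for P for every exponent\<close>

lemma conjugate_exponents_2: "conjugate_exponents 2 2"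
  by (simp add: conjugate_exponents_def)

lemma Hp_Lp: "f \<in> Hp p \<Longrightarrow> f \<in> Lp p"
  by (simp add: Hp_def)

lemma pairing_Hp_antianalytic:
  assumes pq: "conjugate_exponents p q" and g: "g \<in> Hp p" and h: "h \<in> antianalytic_polys"
  shows "pairing g h = 0"
proof -
  have "h \<in> Lp q \<and> pairing g h = 0" using h unfolding antianalytic_polys_def
  proof (induction rule: circ.span_induct_alt)
    case base
    then show ?case using pq by (simp add: pairing_fourier conjugate_exponents_def)
  next
    case (step c x y)
    then obtain n where n: "n < 0" "x = monomial n" by auto
    have x: "x \<in> Lp q" using n pq trig_Lp by (auto simp: conjugate_exponents_def)
    show ?case using step x g n pq
      by (auto simp: pairing_add_right[OF pq] Lp_add Lp_cscale pairing_cscale_right pairing_monomial Hp_def conjugate_exponents_def)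
  qed
  then show ?thesis by simp
qed

lemma pairing_riesz_trig:
  assumes "f \<in> trig_polys" "g \<in> trig_polys"
  shows "pairing (riesz f) g = pairing f (riesz g)"
proof -
  have L: "u \<in> Lp 2" if "u \<in> trig_polys" for u using trig_Lp[OF that, of 2] by simp
  have L': "riesz f \<in> Lp 2" "riesz g \<in> Lp 2" using assms riesz_trig_Lp by auto
  have H: "riesz f \<in> Hp 2" "riesz g \<in> Hp 2" using assms riesz_trig analytic_Hp by auto
  have 1: "pairing (riesz f) (g - riesz g) = 0" "pairing (riesz g) (f - riesz f) = 0"
    using pairing_Hp_antianalytic[OF conjugate_exponents_2] H riesz_trig assms by auto
  have "pairing (riesz f) g = pairing (riesz f) (riesz g)"
    using 1(1) pairing_diff_right[OF conjugate_exponents_2 L'(1) L[OF assms(2)] L'(2)] by simp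
  moreover have "pairing (f - riesz f) (riesz g) = 0" using 1(2) by (metis pairing_cnj complex_cnj_zero)
  then have "pairing f (riesz g) = pairing (riesz f) (riesz g)"
    using pairing_diff_left[OF conjugate_exponents_2 L[OF assms(1)] L'] by simp
  ultimately show ?thesis by simp
qed

text \<open>The duality map of L^p: up to a positive factor, the element of L^q giving equality in
  Hoelder's inequality for g. At zeros of g the value is 0, also for p < 2.\<close>

definition dual_map :: "real \<Rightarrow> circ_fun \<Rightarrow> circ_fun" where
  "dual_map p g = abs_circ_fun (\<lambda>t. complex_of_real (norm (rep g t) powr (p - 2)) * rep g t)"

lemma rep_dual_map: "AE t in arc_measure. rep (dual_map p g) t = complex_of_real (norm (rep g t) powr (p - 2)) * rep g t"
  unfolding dual_map_def by (rule rep_abs) simp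

lemma dual_map:
  assumes pq: "conjugate_exponents p q" and g: "g \<in> Lp p"
  shows "dual_map p g \<in> Lp q" "Lp_norm q (dual_map p g) = Lp_norm p g powr (p - 1)"
    "pairing g (dual_map p g) = complex_of_real (Lp_norm p g powr p)"
proof -
  have p: "p > 1" "q > 1" using pq by (auto simp: conjugate_exponents_def)
  have q: "q = p / (p - 1)" using pq by (auto simp: conjugate_exponents_def field_simps)
  have pw: "x powr (p - 2) * x = x powr (p - 1)" if "x \<ge> 0" for x :: real
  proof (cases "x = 0")
    case False
    then show ?thesis using that powr_add[of x "p - 2" 1] by simp
  qed simp
  have n: "AE t in arc_measure. norm (rep (dual_map p g) t) powr q = norm (rep g t) powr p"
    using rep_dual_map[of p g]
  proof eventually_elim
    case (elim t)
    have "norm (rep (dual_map p g) t) = norm (rep g t) powr (p - 1)" by (simp add: elim norm_mult pw)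
    then show ?case using p by (simp add: powr_powr q)
  qed
  show L: "dual_map p g \<in> Lp q" unfolding Lp_iff
    by (subst integrable_cong_AE[OF _ _ n]) (use g in \<open>auto simp: Lp_iff\<close>)
  have "(LINT t|arc_measure. norm (rep (dual_map p g) t) powr q) = Lp_norm p g powr p"
    using integral_cong_AE[OF _ _ n] p by (simp add: Lp_norm_powr)
  then show "Lp_norm q (dual_map p g) = Lp_norm p g powr (p - 1)"
    using p by (simp add: Lp_norm_rep[of "p / (p - 1)"] powr_powr q)
  have "pairing g (dual_map p g) = (LINT t|arc_measure. complex_of_real (norm (rep g t) powr p))"
    unfolding pairing_rep
  proof (rule integral_cong_AE)
    show "AE t in arc_measure. rep g t * cnj (rep (dual_map p g) t) = complex_of_real (norm (rep g t) powr p)"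
      using rep_dual_map[of p g]
    proof eventually_elim
      case (elim t)
      have "norm (rep g t) powr p = norm (rep g t) powr (p - 2) * (norm (rep g t) * norm (rep g t))"
        using pw[of "norm (rep g t)"] powr_add[of "norm (rep g t)" "p - 1" 1] 
        by (cases "rep g t = 0") (auto simp: mult.assoc)
      moreover have "rep g t * cnj (rep g t) = complex_of_real (norm (rep g t) * norm (rep g t))"
        using complex_norm_square[of "rep g t"] by (simp add: power2_eq_square)
      moreover have "rep g t * cnj (rep (dual_map p g) t) = complex_of_real (norm (rep g t) powr (p - 2)) * (rep g t * cnj (rep g t))"
        by (simp add: elim)
      ultimately show ?case by (simp only: of_real_mult)
    qed
  qed simp_all
  then show "pairing g (dual_map p g) = complex_of_real (Lp_norm p g powr p)"
    using p by (simp add: Lp_norm_powr)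
qed

text \<open>The square of the norm of P f is the pairing of P f with itself, which equals that of f
  with P f; the Cauchy-Schwarz inequality finishes.\<close>

lemma Bessel_trig: assumes "f \<in> trig_polys" shows "Lp_norm 2 (riesz f) \<le> Lp_norm 2 f"
proof -
  have L: "f \<in> Lp 2" "riesz f \<in> Lp 2" using assms trig_Lp riesz_trig_Lp by auto
  have d: "dual_map 2 (riesz f) = riesz f"
    by (rule circ_fun_eqI) (use rep_dual_map[of 2 "riesz f"] in \<open>eventually_elim, auto\<close>)
  have "riesz (riesz f) = riesz f"
    using riesz_trig_decomp[of "riesz f" 0] riesz_trig[OF assms] by (simp add: antianalytic_polys_def circ.span_zero)
  then have "pairing (riesz f) (riesz f) = pairing f (riesz f)"
    using pairing_riesz_trig[OF assms, of "riesz f"] riesz_trig[OF assms] analytic_subset_trig by auto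
  then have "complex_of_real (Lp_norm 2 (riesz f) powr 2) = pairing f (riesz f)"
    using dual_map(3)[OF conjugate_exponents_2 L(2)] by (simp add: d)
  then have "Lp_norm 2 (riesz f) powr 2 = norm (pairing f (riesz f))"
    by (metis norm_of_real abs_of_nonneg powr_ge_zero)
  also have "\<dots> \<le> Lp_norm 2 f * Lp_norm 2 (riesz f)" by (rule norm_pairing_le[OF conjugate_exponents_2 L])
  finally have "Lp_norm 2 (riesz f) * Lp_norm 2 (riesz f) \<le> Lp_norm 2 f * Lp_norm 2 (riesz f)"
    by (simp add: power2_eq_square)
  then show ?thesis
    using Lp_norm_nonneg[of 2 "riesz f"] Lp_norm_nonneg[of 2 f] by (metis less_eq_real_def mult_le_cancel_right)
qed

text \<open>Pointwise |f|^p is at most e^p where |f| \<le> e and at most e^(p-2) |f|^2 elsewhere.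
  Integrated, each part contributes at most e^p, and 2 e^p \<le> (2 e)^p.\<close>

lemma Lp_norm_le_L2:
  assumes f: "f \<in> Lp 2" and p: "1 \<le> p" "p \<le> 2" and L: "f \<in> Lp p" and e: "e > 0" "Lp_norm 2 f \<le> e"
  shows "Lp_norm p f \<le> 2 * e"
proof (rule Lp_norm_leI)
  have "(LINT t|arc_measure. norm (rep f t) powr p) \<le> (LINT t|arc_measure. e powr p + e powr (p - 2) * norm (rep f t) powr 2)"
  proof (rule integral_mono)
    fix t
    show "norm (rep f t) powr p \<le> e powr p + e powr (p - 2) * norm (rep f t) powr 2"
    proof (cases "norm (rep f t) \<le> e")
      case True
      then have "norm (rep f t) powr p \<le> e powr p" using p by (intro powr_mono2) auto
      then show ?thesis using add_increasing2[of "e powr (p - 2) * norm (rep f t) powr 2"] by simp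
    next
      case False
      then have "norm (rep f t) powr (p - 2) \<le> e powr (p - 2)" using p e by (intro powr_mono2') auto
      then have "norm (rep f t) powr (p - 2) * norm (rep f t) powr 2 \<le> e powr (p - 2) * norm (rep f t) powr 2"
        by (rule mult_right_mono) simp
      also have "norm (rep f t) powr (p - 2) * norm (rep f t) powr 2 = norm (rep f t) powr p"
        using False e powr_add[of "norm (rep f t)" "p - 2" 2] by simp
      finally show ?thesis by (simp add: add_increasing)
    qed
  qed (use f L in \<open>auto simp: Lp_iff\<close>)
  also have "\<dots> = e powr p + e powr (p - 2) * Lp_norm 2 f powr 2"
    using f Lp_norm_powr[of 2 f] by (simp add: Lp_iff)
  also have "\<dots> \<le> e powr p + e powr (p - 2) * e powr 2"
    using e by (intro add_left_mono mult_left_mono powr_mono2) auto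
  also have "e powr (p - 2) * e powr 2 = e powr p" by (simp only: powr_add[symmetric]) simp
  also have "e powr p + e powr p \<le> (2 * e) powr p"
    using e p powr_mono[of 1 p 2] by (simp add: powr_mult)
  finally show "(LINT t|arc_measure. norm (rep f t) powr p) \<le> (2 * e) powr p" .
qed (use p e in auto)

text \<open>The positive and negative part of \<open>u\<close> are approximated uniformly by positive trigonometric polynomials;
  the remaining uniformly small error is controlled in \<open>L\<^sup>2\<close>, which suffices because \<open>p \<le> 2\<close>.\<close>

lemma riesz_bound_real:
  assumes p: "1 < p" "p \<le> 2"
  obtains C where "C > 0" "\<And>u. u \<in> trig_polys \<Longrightarrow> conjugate u = u \<Longrightarrow> Lp_norm p (riesz u) \<le> C * Lp_norm p u"
proof -
  obtain C where C: "C > 0" "\<And>u k d. u \<in> trig_polys \<Longrightarrow> continuous_on UNIV k \<Longrightarrow> d > 0 \<Longrightarrow>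
      \<forall>t. norm t = 1 \<longrightarrow> k t \<ge> d \<Longrightarrow>
      AE t in arc_measure. rep u t = complex_of_real (k t) \<Longrightarrow> Lp_norm p (riesz u) \<le> C * Lp_norm p u"
    by (rule riesz_bound_positive[OF p]) (rule that)
  have p0: "p \<ge> 1" "p > 0" using p by auto
  show ?thesis
  proof (rule that[of "2 * C"])
    show "2 * C > 0" using C by simp
    fix u assume u: "u \<in> trig_polys" and real: "conjugate u = u"
    have uL: "u \<in> Lp p" using u trig_Lp p0 by auto
    obtain g h where gh: "g \<in> analytic_polys" "h \<in> antianalytic_polys" "u = g + h" using trig_decomp[OF u] by blast
    obtain q1 where q1: "AE t in arc_measure. rep g t = poly q1 t" using analytic_poly_rep[OF gh(1)] by blast
    have "conjugate h \<in> analytic_polys"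
    proof -
      have *: "conjugate h \<in> circ.span (monomial ` {0..})" using gh(2) unfolding antianalytic_polys_def
      proof (induction rule: circ.span_induct_alt)
        case (step c x y)
        then obtain n where "x = monomial n" "n < 0" by auto
        then show ?case using step by (auto simp: conjugate_add conjugate_cscale conjugate_monomial
              intro!: circ.span_add circ.span_scale intro: circ.span_base)
      qed (simp add: circ.span_zero)
      then show ?thesis by (simp add: analytic_polys_def)
    qed
    then obtain q2 where q2: "AE t in arc_measure. rep (conjugate h) t = poly q2 t" using analytic_poly_rep by blast
    \<comment> \<open>u is real and u = g + h, where g and conj h are polynomials in t; k is
      therefore a continuous representative of u.\<close>
    define k where "k t = Re (poly q1 t) + Re (poly q2 t)" for t
    have k: "continuous_on UNIV k" unfolding k_def by (intro continuous_intros)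
    have uk: "AE t in arc_measure. rep u t = complex_of_real (k t)"
      using q1 q2 rep_add[of g h] rep_conjugate[of h] rep_conjugate[of u]
    proof eventually_elim
      case (elim t)
      have "cnj (rep u t) = rep u t" using elim by (simp add: real)
      then have "rep u t = complex_of_real (Re (rep u t))" by (simp add: complex_eq_iff)
      moreover have "cnj (poly q2 t) = rep h t" using elim by (metis complex_cnj_cnj)
      then have "Re (rep u t) = k t" using elim by (simp add: k_def gh(3)) (metis complex_cnj_cnj cnj.simps(1))
      ultimately show ?case by simp
    qed
    have main: "Lp_norm p (riesz u) \<le> 2 * C * (Lp_norm p u + 3 * e) + 4 * e" if e: "e > 0" for e
    proof -
      \<comment> \<open>The sign s = 1 gives the positive part and s = -1 the negative part. The
        shift by 2 e keeps the approximant at least e, as the bound for positive functions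
        requires.\<close>
      have part: "\<exists>v l. v \<in> trig_polys \<and> (AE t in arc_measure. rep v t = complex_of_real (l t)) \<and>
         (\<forall>t. norm t = 1 \<longrightarrow> \<bar>max 0 (s * k t) + 2 * e - l t\<bar> < e) \<and>
         Lp_norm p (riesz v) \<le> C * (Lp_norm p u + 3 * e)" if s: "\<bar>s\<bar> = 1" for s :: real
      proof -
        have c: "continuous_on UNIV (\<lambda>t. max 0 (s * k t) + 2 * e)" by (intro continuous_intros k)
        obtain v l where v: "v \<in> trig_polys" "continuous_on UNIV l"
          "\<And>t. norm t = 1 \<Longrightarrow> \<bar>max 0 (s * k t) + 2 * e - l t\<bar> < e" "AE t in arc_measure. rep v t = complex_of_real (l t)"
          using trig_approx_real[OF c e] by metis
        have le: "e \<le> l t" "\<bar>l t\<bar> \<le> \<bar>k t\<bar> + 3 * e" if "norm t = 1" for t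
        proof -
          have "\<bar>s * k t\<bar> = \<bar>k t\<bar>" using s by (simp add: abs_mult)
          then show "e \<le> l t" "\<bar>l t\<bar> \<le> \<bar>k t\<bar> + 3 * e" using v(3)[OF that] e by linarith+
        qed
        have "Lp_norm p (riesz v) \<le> C * Lp_norm p v" by (rule C(2)[OF v(1,2) e _ v(4)]) (use le(1) in blast)
        moreover have "Lp_norm p v \<le> Lp_norm p u + 3 * e"
        proof -
          define w where "w = abs_circ_fun (\<lambda>t. complex_of_real (\<bar>k t\<bar>))"
          have "continuous_on UNIV (\<lambda>t. complex_of_real (\<bar>k t\<bar>))" by (intro continuous_intros k)
          then have w: "AE t in arc_measure. rep w t = complex_of_real \<bar>k t\<bar>" unfolding w_def by (rule rep_abs_cont)
          have wu: "AE t in arc_measure. norm (rep w t) = norm (rep u t)"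
            using w uk by eventually_elim simp
          have wL: "w \<in> Lp p" "Lp_norm p w = Lp_norm p u" using Lp_cong[OF wu] Lp_norm_cong[OF wu] uL by auto
          have oneL: "cscale (complex_of_real (3 * e)) 1 \<in> Lp p"
            using monomial_trig[of 0] trig_Lp p0 by (intro Lp_cscale) auto
          have "Lp_norm p v \<le> Lp_norm p (w + cscale (complex_of_real (3 * e)) 1)"
          proof (rule Lp_norm_mono)
            show "AE t in arc_measure. norm (rep v t) \<le> norm (rep (w + cscale (complex_of_real (3 * e)) 1) t)"
              using v(4) w rep_add[of w "cscale (complex_of_real (3 * e)) 1"] rep_cscale[of "complex_of_real (3 * e)" 1] rep_one AE_arc_measure_norm
            proof eventually_elim
              case (elim t)
              have n: "norm (complex_of_real \<bar>k t\<bar> + complex_of_real (3 * e)) = \<bar>k t\<bar> + 3 * e"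
                using e by (subst of_real_add[symmetric], subst norm_of_real) simp
              show ?case using le(2)[OF elim(6)] by (simp only: elim(1-5) mult_1_right n norm_of_real)
            qed
          qed (use wL oneL p0 Lp_add[OF wL(1) oneL p0(1)] in auto)
          also have "\<dots> \<le> Lp_norm p w + Lp_norm p (cscale (complex_of_real (3 * e)) 1)"
            using wL oneL p0 by (intro Lp_norm_triangle) auto
          also have "Lp_norm p (cscale (complex_of_real (3 * e)) 1) \<le> 3 * e"
            using e p0 rep_cscale[of "complex_of_real (3 * e)" 1] rep_one
            by (intro Lp_norm_le_const, elim eventually_elim2) auto
          finally show ?thesis using wL by simp
        qed
        then have "C * Lp_norm p v \<le> C * (Lp_norm p u + 3 * e)" using C(1) by simp
        ultimately show ?thesis using v by (intro exI[of _ v] exI[of _ l]) auto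
      qed
      obtain v l where v: "v \<in> trig_polys" "AE t in arc_measure. rep v t = complex_of_real (l t)"
         "\<And>t. norm t = 1 \<Longrightarrow> \<bar>max 0 (1 * k t) + 2 * e - l t\<bar> < e" "Lp_norm p (riesz v) \<le> C * (Lp_norm p u + 3 * e)"
        using part[of 1] by auto
      obtain w m where w: "w \<in> trig_polys" "AE t in arc_measure. rep w t = complex_of_real (m t)"
         "\<And>t. norm t = 1 \<Longrightarrow> \<bar>max 0 ((-1) * k t) + 2 * e - m t\<bar> < e" "Lp_norm p (riesz w) \<le> C * (Lp_norm p u + 3 * e)"
        using part[of "-1"] by auto
      \<comment> \<open>The shifts 2 e cancel in v - w, leaving only the two approximation errors,
        each below e.\<close>
      define d where "d = u - (v - w)"
      have d: "d \<in> trig_polys" "v - w \<in> trig_polys" unfolding d_def using u v w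
        by (auto intro!: circ.subspace_diff[OF subspace_trig])
      have "AE t in arc_measure. norm (rep d t) \<le> 2 * e"
        using uk v(2) w(2) rep_diff[of u "v - w", folded d_def] rep_diff[of v w] AE_arc_measure_norm
      proof eventually_elim
        case (elim t)
        have "norm (rep d t) = \<bar>k t - (l t - m t)\<bar>" unfolding elim
          by (simp only: of_real_diff[symmetric] norm_of_real)
        also have "\<dots> \<le> 2 * e" using v(3)[OF elim(6)] w(3)[OF elim(6)] by linarith
        finally show ?case .
      qed
      then have "Lp_norm 2 d \<le> 2 * e" using e by (intro Lp_norm_le_const) auto
      then have "Lp_norm 2 (riesz d) \<le> 2 * e" using Bessel_trig[OF d(1)] by linarith
      then have dd: "Lp_norm p (riesz d) \<le> 4 * e"
        using Lp_norm_le_L2[of "riesz d" p "2 * e"] riesz_trig_Lp[OF d(1)] p e by simp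
      have "riesz u = riesz v - riesz w + riesz d"
        using riesz_trig_add[OF d(2) d(1)] riesz_trig_diff[OF v(1) w(1)] by (simp add: d_def)
      then have "Lp_norm p (riesz u) \<le> Lp_norm p (riesz v - riesz w) + Lp_norm p (riesz d)"
        using v w d p0 by (simp add: Lp_norm_triangle Lp_diff riesz_trig_Lp)
      also have "Lp_norm p (riesz v - riesz w) \<le> Lp_norm p (riesz v) + Lp_norm p (riesz w)"
        using v w p0 by (simp add: Lp_norm_triangle_diff riesz_trig_Lp)
      finally show ?thesis using v(4) w(4) dd by linarith
    qed
    show "Lp_norm p (riesz u) \<le> 2 * C * Lp_norm p u"
    proof (rule field_le_epsilon)
      fix e :: real assume e: "e > 0"
      \<comment> \<open>The total error in \<open>main\<close> is 2 C \<cdot> 3 e' + 4 e'.\<close>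
      define e' where "e' = e / (6 * C + 4)"
      have e': "e' > 0" "e' * (6 * C + 4) = e" using e C(1) by (auto simp: e'_def)
      have "Lp_norm p (riesz u) \<le> 2 * C * (Lp_norm p u + 3 * e') + 4 * e'" by (rule main[OF e'(1)])
      also have "\<dots> = 2 * C * Lp_norm p u + e' * (6 * C + 4)" by (simp add: algebra_simps)
      finally show "Lp_norm p (riesz u) \<le> 2 * C * Lp_norm p u + e" using e' by simp
    qed
  qed
qed

lemma riesz_bound_le2:
  assumes p: "1 < p" "p \<le> 2"
  obtains C where "C > 0" "\<And>u. u \<in> trig_polys \<Longrightarrow> Lp_norm p (riesz u) \<le> C * Lp_norm p u"
proof -
  obtain C where C: "C > 0" "\<And>u. u \<in> trig_polys \<Longrightarrow> conjugate u = u \<Longrightarrow> Lp_norm p (riesz u) \<le> C * Lp_norm p u"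
    by (rule riesz_bound_real[OF p]) (rule that)
  have p0: "p \<ge> 1" "p > 0" using p by auto
  show ?thesis
  proof (rule that[of "2 * C"])
    fix u assume u: "u \<in> trig_polys"
    \<comment> \<open>v is the real part of z u; z = 1 and z = -i yield the real and the imaginary
      part of u.\<close>
    have part: "\<exists>v. v \<in> trig_polys \<and> v = cscale (z/2) u + cscale (cnj z/2) (conjugate u) \<and> Lp_norm p (riesz v) \<le> C * Lp_norm p u"
      if z: "norm z = 1" for z
    proof -
      define v where "v = cscale (z/2) u + cscale (cnj z/2) (conjugate u)"
      have v: "v \<in> trig_polys" unfolding v_def using u
        by (intro circ.subspace_add[OF subspace_trig] circ.subspace_scale[OF subspace_trig] trig_conjugate)
      have "conjugate v = v" by (simp add: v_def conjugate_add conjugate_cscale add.commute)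
      from C(2)[OF v this] have "Lp_norm p (riesz v) \<le> C * Lp_norm p v" .
      also have "Lp_norm p v \<le> Lp_norm p (cscale (z/2) u) + Lp_norm p (cscale (cnj z/2) (conjugate u))"
        unfolding v_def using u trig_conjugate[OF u] p0 trig_Lp
        by (intro Lp_norm_triangle Lp_cscale) auto
      also have "\<dots> = Lp_norm p u" using u trig_conjugate[OF u] p0 trig_Lp z
        by (simp add: Lp_cscale norm_divide conjugate_Lp_norm)
      finally show ?thesis using v C(1) by (auto simp: v_def)
    qed
    obtain v where v: "v \<in> trig_polys" "v = cscale (1/2) u + cscale (1/2) (conjugate u)" "Lp_norm p (riesz v) \<le> C * Lp_norm p u"
      using part[of 1] by auto
    obtain w where w: "w \<in> trig_polys" "w = cscale (-\<i>/2) u + cscale (\<i>/2) (conjugate u)" "Lp_norm p (riesz w) \<le> C * Lp_norm p u"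
      using part[of "-\<i>"] by auto
    have "u = v + cscale \<i> w"
    proof -
      have i: "\<i> * (-\<i>/2) = 1/2" "\<i> * (\<i>/2) = -1/2" by simp_all
      have "cscale \<i> w = cscale (1/2) u + cscale (-1/2) (conjugate u)"
        by (simp only: w(2) circ.scale_right_distrib circ.scale_scale i)
      then have "v + cscale \<i> w = cscale (1/2 + 1/2) u + cscale (1/2 + -1/2) (conjugate u)"
        by (simp only: v(2) circ.scale_left_distrib add_ac)
      then show ?thesis by simp
    qed
    then have "riesz u = riesz v + cscale \<i> (riesz w)"
      using v w by (metis riesz_trig_add riesz_trig_cscale circ.subspace_scale[OF subspace_trig])
    then have "Lp_norm p (riesz u) \<le> Lp_norm p (riesz v) + Lp_norm p (cscale \<i> (riesz w))"
      using v(1) w(1) p0 Lp_norm_triangle[OF riesz_trig_Lp Lp_cscale(1)[OF riesz_trig_Lp], of v p w \<i>] by simp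
    also have "\<dots> \<le> 2 * C * Lp_norm p u" using v w p0 Lp_cscale(2)[OF riesz_trig_Lp[OF w(1)], of p \<i>] by simp
    finally show "Lp_norm p (riesz u) \<le> 2 * C * Lp_norm p u" .
  qed (use C in simp)
qed

text \<open>For p > 2 the bound at the conjugate exponent is transposed: P f is tested against its
  dual element k, which is approximated in L^q by a trigonometric polynomial, so that P can be moved
  across the pairing.\<close>

lemma riesz_bound_trig:
  assumes p: "1 < p"
  obtains C where "C > 0" "\<And>u. u \<in> trig_polys \<Longrightarrow> Lp_norm p (riesz u) \<le> C * Lp_norm p u"
proof (cases "p \<le> 2")
  case True
  show ?thesis by (rule riesz_bound_le2[OF p True]) (rule that)
next
  case False
  define q where "q = p / (p - 1)"
  have pq: "conjugate_exponents p q" using p by (auto simp: conjugate_exponents_def q_def field_simps)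
  have q: "1 < q" "q \<le> 2" using False pq by (auto simp: conjugate_exponents_def) (auto simp: q_def field_simps)
  obtain C where C: "C > 0" "\<And>u. u \<in> trig_polys \<Longrightarrow> Lp_norm q (riesz u) \<le> C * Lp_norm q u"
    by (rule riesz_bound_le2[OF q]) (rule that)
  show ?thesis
  proof (rule that[OF C(1)])
    fix f assume f: "f \<in> trig_polys"
    define g where "g = riesz f"
    define k where "k = dual_map p g"
    have g: "g \<in> Lp p" using f riesz_trig_Lp p by (auto simp: g_def)
    have fL: "f \<in> Lp p" using f trig_Lp p by auto
    have k: "k \<in> Lp q" "Lp_norm q k = Lp_norm p g powr (p - 1)" "pairing g k = complex_of_real (Lp_norm p g powr p)"
      using dual_map[OF pq g] by (auto simp: k_def)
    have "Lp_norm p g powr p \<le> Lp_norm p f * C * Lp_norm q k"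
    proof (rule field_le_epsilon)
      fix e :: real assume e: "e > 0"
      \<comment> \<open>The approximation costs e' times the first two summands of the denominator;
        the summand 1 keeps the denominator positive.\<close>
      define e' where "e' = e / (Lp_norm p f * C + Lp_norm p g + 1)"
      have den: "Lp_norm p f * C + Lp_norm p g + 1 > 0" using C by (simp add: add_nonneg_pos)
      have e': "e' > 0" "e' * (Lp_norm p f * C + Lp_norm p g + 1) = e" using e den by (auto simp: e'_def)
      have "k \<in> Lp_closure q trig_polys" using k(1) q Lp_closure_trig[of q] by simp
      then obtain k' where k': "k' \<in> trig_polys" "Lp_norm q (k - k') < e'" using Lp_closure_approx e'(1) by blast
      have k'L: "k' \<in> Lp q" using k' trig_Lp q by auto
      have "Lp_norm q k' \<le> Lp_norm q k + e'"
        using Lp_norm_triangle_lower[OF k'L k(1)] Lp_norm_diff_commute[OF k'L k(1)] k'(2) q by auto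
      then have 1: "Lp_norm p f * C * Lp_norm q k' \<le> Lp_norm p f * C * (Lp_norm q k + e')"
        using C by (intro mult_left_mono) auto
      have "pairing g k = pairing g k' + pairing g (k - k')"
        using pairing_diff_right[OF pq g k(1) k'L] by simp
      also have "pairing g k' = pairing f (riesz k')" unfolding g_def by (rule pairing_riesz_trig[OF f k'(1)])
      finally have "norm (pairing g k) \<le> norm (pairing f (riesz k')) + norm (pairing g (k - k'))"
        by (metis norm_triangle_ineq)
      also have "norm (pairing f (riesz k')) \<le> Lp_norm p f * Lp_norm q (riesz k')"
        using riesz_trig_Lp[OF k'(1)] q by (intro norm_pairing_le[OF pq fL]) auto
      also have "\<dots> \<le> Lp_norm p f * (C * Lp_norm q k')" by (intro mult_left_mono C k') auto
      also have "norm (pairing g (k - k')) \<le> Lp_norm p g * Lp_norm q (k - k')"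
        using k k'L q by (intro norm_pairing_le[OF pq g] Lp_diff) auto
      also have "\<dots> \<le> Lp_norm p g * e'" using k'(2) by (intro mult_left_mono) auto
      finally have "Lp_norm p g powr p \<le> Lp_norm p f * C * (Lp_norm q k + e') + Lp_norm p g * e'"
        using 1 k(3) by (simp add: mult.assoc)
      also have "\<dots> \<le> Lp_norm p f * C * Lp_norm q k + e' * (Lp_norm p f * C + Lp_norm p g + 1)"
        using e' by (simp add: algebra_simps)
      finally show "Lp_norm p g powr p \<le> Lp_norm p f * C * Lp_norm q k + e" using e' by simp
    qed
    then have le: "Lp_norm p g powr p \<le> C * Lp_norm p f * Lp_norm p g powr (p - 1)"
      by (simp add: k mult_ac)
    show "Lp_norm p (riesz f) \<le> C * Lp_norm p f"
    proof (cases "Lp_norm p g = 0")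
      case False
      then have pos: "Lp_norm p g > 0" using Lp_norm_nonneg[of p g] by linarith
      have "Lp_norm p g powr p = Lp_norm p g * Lp_norm p g powr (p - 1)"
        using powr_add[of "Lp_norm p g" 1 "p - 1"] pos by simp
      then show ?thesis using le pos by (simp add: g_def)
    qed (use C in \<open>simp add: g_def\<close>)
  qed
qed

lemma Lp_norm_fourier_tendsto:
  assumes "p \<ge> 1" "\<And>n. f n \<in> Lp p" "g \<in> Lp p" "(\<lambda>n. Lp_norm p (f n - g)) \<longlonglongrightarrow> 0"
  shows "(\<lambda>n. fourier (f n) m) \<longlonglongrightarrow> fourier g m"
proof -
  have "norm (fourier (f n) m - fourier g m) \<le> Lp_norm p (f n - g)" for n
  proof -
    have d: "f n - g \<in> Lp p" using assms by (intro Lp_diff)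
    have "fourier (f n) m - fourier g m = fourier (f n - g) m"
      using Lp_subset_Lp1(1)[OF assms(2,1)] Lp_subset_Lp1(1)[OF assms(3,1)] by (simp add: fourier_diff)
    also have "norm \<dots> \<le> Lp_norm 1 (f n - g)" by (rule norm_fourier_le[OF Lp_subset_Lp1(1)[OF d assms(1)]])
    also have "\<dots> \<le> Lp_norm p (f n - g)" by (rule Lp_subset_Lp1(2)[OF d assms(1)])
    finally show ?thesis .
  qed
  then have "(\<lambda>n. fourier (f n) m - fourier g m) \<longlonglongrightarrow> 0"
    by (intro Lim_null_comparison[OF _ assms(4)]) auto
  then show ?thesis by (simp add: LIM_zero_iff)
qed

text \<open>Trigonometric polynomials are dense, and the bound makes their projections a Cauchy
  sequence. Fourier coefficients are continuous for the norm, so they identify the limit as the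
  value of \<open>riesz\<close>.\<close>

theorem riesz_bounded:
  assumes p: "1 < p"
  obtains C where "C > 0" "\<And>f. f \<in> Lp p \<Longrightarrow> riesz f \<in> Hp p \<and> Lp_norm p (riesz f) \<le> C * Lp_norm p f
     \<and> (\<forall>n\<ge>0. fourier (riesz f) n = fourier f n)"
proof -
  obtain C where C: "C > 0" "\<And>u. u \<in> trig_polys \<Longrightarrow> Lp_norm p (riesz u) \<le> C * Lp_norm p u"
    by (rule riesz_bound_trig[OF p]) (rule that)
  have p1: "p \<ge> 1" "p > 0" using p by auto
  show ?thesis
  proof (rule that[OF C(1)])
    fix f assume f: "f \<in> Lp p"
    obtain F where F: "\<And>n. F n \<in> trig_polys" "(\<lambda>n. Lp_norm p (f - F n)) \<longlonglongrightarrow> 0"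
      using f Lp_closure_trig[OF p1(1)] Lp_closureD by blast
    have FL: "F n \<in> Lp p" "riesz (F n) \<in> Lp p" for n using F(1) trig_Lp riesz_trig_Lp p1 by auto
    have F': "(\<lambda>n. Lp_norm p (F n - f)) \<longlonglongrightarrow> 0"
      using F(2) Lp_norm_diff_commute[OF f FL(1) p1(1)] by simp
    have dif: "Lp_norm p (riesz (F m) - riesz (F n)) \<le> C * (Lp_norm p (F m - f) + Lp_norm p (F n - f))" for m n
    proof -
      have "Lp_norm p (riesz (F m) - riesz (F n)) = Lp_norm p (riesz (F m - F n))"
        by (simp add: riesz_trig_diff F)
      also have "\<dots> \<le> C * Lp_norm p (F m - F n)" by (intro C circ.subspace_diff[OF subspace_trig] F)
      also have "F m - F n = (F m - f) - (F n - f)" by simp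
      also have "Lp_norm p \<dots> \<le> Lp_norm p (F m - f) + Lp_norm p (F n - f)"
        using FL f p1 by (intro Lp_norm_triangle_diff Lp_diff)
      finally show ?thesis using C by simp
    qed
    have "\<exists>g\<in>Lp p. (\<lambda>n. Lp_norm p (riesz (F n) - g)) \<longlonglongrightarrow> 0"
    proof -
      have cau: "\<exists>N. \<forall>m\<ge>N. \<forall>n\<ge>N. Lp_norm p (riesz (F m) - riesz (F n)) < e" if e: "e > 0" for e
      proof -
        have "e / (2 * C) > 0" using e C by simp
        then obtain N where N: "\<And>n. n \<ge> N \<Longrightarrow> Lp_norm p (F n - f) < e / (2 * C)"
          using LIMSEQ_D[OF F', of "e / (2 * C)"] by auto
        have "Lp_norm p (riesz (F m) - riesz (F n)) < e" if "m \<ge> N" "n \<ge> N" for m n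
        proof -
          have "C * (Lp_norm p (F m - f) + Lp_norm p (F n - f)) < C * (e / (2 * C) + e / (2 * C))"
            using N[OF that(1)] N[OF that(2)] C by (intro mult_strict_left_mono add_strict_mono)
          also have "\<dots> = e" using C by simp
          finally show ?thesis using dif[of m n] by linarith
        qed
        then show ?thesis by blast
      qed
      show ?thesis by (rule Lp_complete[OF p1(1) FL(2) cau]) blast+
    qed
    then obtain g where g: "g \<in> Lp p" "(\<lambda>n. Lp_norm p (riesz (F n) - g)) \<longlonglongrightarrow> 0" by blast
    have lim: "(\<lambda>n. fourier (riesz (F n)) m) \<longlonglongrightarrow> fourier g m" for m
      by (rule Lp_norm_fourier_tendsto[OF p1(1) FL(2) g])
    have limf: "(\<lambda>n. fourier (F n) m) \<longlonglongrightarrow> fourier f m" for m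
      by (rule Lp_norm_fourier_tendsto[OF p1(1) FL(1) f F'])
    have neg: "fourier g m = 0" if "m < 0" for m
    proof -
      have "fourier (riesz (F n)) m = 0" for n
        using analytic_Hp[OF riesz_trig(1)[OF F(1)], of 1] that by (auto simp: Hp_def)
      then show ?thesis using lim[of m] by (simp add: LIMSEQ_const_iff)
    qed
    have nonneg: "fourier g m = fourier f m" if "m \<ge> 0" for m
    proof -
      have "fourier (riesz (F n)) m = fourier (F n) m" for n
        using antianalytic_fourier[OF riesz_trig(2)[OF F(1)] that, of n]
          Lp_subset_Lp1(1)[OF FL(1) p1(1)] Lp_subset_Lp1(1)[OF FL(2) p1(1)] by (simp add: fourier_diff)
      then show ?thesis using lim[of m] limf[of m] LIMSEQ_unique by simp
    qed
    have gH: "g \<in> Hp p" "g \<in> Hp 1" using g neg Lp_subset_Lp1(1)[OF g(1) p1(1)] by (auto simp: Hp_def)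
    have rf: "riesz f = g" by (rule riesz_eqI[OF gH(2) nonneg])
    have "Lp_norm p g \<le> C * Lp_norm p f"
    proof (rule LIMSEQ_le)
      have "(\<lambda>n. Lp_norm p (riesz (F n)) - Lp_norm p g) \<longlonglongrightarrow> 0"
        by (rule Lim_null_comparison[OF _ g(2)]) (use Lp_norm_triangle_lower[OF FL(2) g(1) p1(1)] in auto)
      then show "(\<lambda>n. Lp_norm p (riesz (F n))) \<longlonglongrightarrow> Lp_norm p g" by (simp add: LIM_zero_iff)
      have "(\<lambda>n. Lp_norm p (F n) - Lp_norm p f) \<longlonglongrightarrow> 0"
        by (rule Lim_null_comparison[OF _ F']) (use Lp_norm_triangle_lower[OF FL(1) f p1(1)] in auto)
      then have "(\<lambda>n. Lp_norm p (F n)) \<longlonglongrightarrow> Lp_norm p f" by (simp add: LIM_zero_iff)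
      then show "(\<lambda>n. C * Lp_norm p (F n)) \<longlonglongrightarrow> C * Lp_norm p f" by (intro tendsto_intros)
      show "\<exists>N. \<forall>n\<ge>N. Lp_norm p (riesz (F n)) \<le> C * Lp_norm p (F n)" using C F by blast
    qed
    then show "riesz f \<in> Hp p \<and> Lp_norm p (riesz f) \<le> C * Lp_norm p f \<and> (\<forall>n\<ge>0. fourier (riesz f) n = fourier f n)"
      using rf gH nonneg by auto
  qed
qed

section \<open>Hardy spaces and the theorem of Coburn\<close>

context
  fixes p :: real
  assumes p: "1 < p"
begin

lemma riesz_Hp: "f \<in> Lp p \<Longrightarrow> riesz f \<in> Hp p"
  using riesz_bounded[OF p] by metis

lemma fourier_riesz: "f \<in> Lp p \<Longrightarrow> fourier (riesz f) n = (if n \<ge> 0 then fourier f n else 0)"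
  using riesz_bounded[OF p] riesz_Hp[of f] by (auto simp: Hp_def)

lemma Lp_Lp1: "f \<in> Lp p \<Longrightarrow> f \<in> Lp 1"
  using Lp_subset_Lp1(1)[of f p] p by simp

lemma Hp_Hp1: "f \<in> Hp p \<Longrightarrow> f \<in> Hp 1"
  by (simp add: Hp_def Lp_Lp1)

lemma Hp_neg: "f \<in> Hp p \<Longrightarrow> n < 0 \<Longrightarrow> fourier f n = 0"
  by (simp add: Hp_def)

lemma subspace_Hp: "circ.subspace (Hp p)"
proof (rule circ.subspaceI)
  show "0 \<in> Hp p" using p by (simp add: Hp_def)
next
  fix f g assume "f \<in> Hp p" "g \<in> Hp p"
  then show "f + g \<in> Hp p" using p by (simp add: Hp_def Lp_add fourier_add Lp_Lp1)
next
  fix z f assume "f \<in> Hp p"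
  then show "cscale z f \<in> Hp p" using p by (simp add: Hp_def Lp_cscale fourier_cscale)
qed

lemmas Hp_add = circ.subspace_add[OF subspace_Hp]
lemmas Hp_diff = circ.subspace_diff[OF subspace_Hp]
lemmas Hp_scale = circ.subspace_scale[OF subspace_Hp]
lemmas Hp_0 = circ.subspace_0[OF subspace_Hp]

lemma riesz_add: "f \<in> Lp p \<Longrightarrow> g \<in> Lp p \<Longrightarrow> riesz (f + g) = riesz f + riesz g"
  by (rule riesz_eqI) (auto simp: Hp_Hp1 Hp_add riesz_Hp fourier_add fourier_riesz Lp_Lp1 Hp_Lp)

lemma riesz_diff: "f \<in> Lp p \<Longrightarrow> g \<in> Lp p \<Longrightarrow> riesz (f - g) = riesz f - riesz g"
  by (rule riesz_eqI) (auto simp: Hp_Hp1 Hp_diff riesz_Hp fourier_diff fourier_riesz Lp_Lp1 Hp_Lp)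

lemma riesz_cscale: "f \<in> Lp p \<Longrightarrow> riesz (cscale z f) = cscale z (riesz f)"
  by (rule riesz_eqI) (auto simp: Hp_Hp1 Hp_scale riesz_Hp fourier_cscale fourier_riesz)

lemma riesz_id: "f \<in> Hp p \<Longrightarrow> riesz f = f"
  by (rule riesz_eqI) (auto simp: Hp_Hp1)

lemma riesz_eq_0_iff: "f \<in> Lp p \<Longrightarrow> riesz f = 0 \<longleftrightarrow> (\<forall>n\<ge>0. fourier f n = 0)"
proof
  assume "f \<in> Lp p" "riesz f = 0"
  then show "\<forall>n\<ge>0. fourier f n = 0" using fourier_riesz[of f] by (metis fourier_zero)
next
  assume "\<forall>n\<ge>0. fourier f n = 0"
  then show "riesz f = 0" by (intro riesz_eqI) (auto simp: Hp_def)
qed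

lemma riesz_flipJ: "f \<in> Hp p \<Longrightarrow> riesz (flipJ f) = 0"
  using p by (subst riesz_eq_0_iff) (auto simp: flipJ_Lp Hp_Lp fourier_flipJ Hp_neg)

lemma flipJ_Hp: "f \<in> Lp p \<Longrightarrow> riesz f = 0 \<Longrightarrow> flipJ f \<in> Hp p"
  by (simp add: riesz_eq_0_iff Hp_def flipJ_Lp fourier_flipJ)

lemma monomial_mult_Hp: "f \<in> Hp p \<Longrightarrow> n \<ge> 0 \<Longrightarrow> monomial n * f \<in> Hp p"
  by (simp add: Hp_def monomial_mult_Lp fourier_mult_monomial)

lemma monomial_Hp: "n \<ge> 0 \<Longrightarrow> monomial n \<in> Hp p"
  using p by (auto simp: Hp_def monomial_Linf Linf_subset_Lp fourier_monomial)

end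

text \<open>h is approximated by trigonometric polynomials F n, of which only the antianalytic part
  is used. As P h = 0, the discarded part P (F n) equals -P (h - F n), which is small by the
  boundedness of P.\<close>

lemma pairing_Hp_anti:
  assumes pq: "conjugate_exponents p q" and g: "g \<in> Hp p" and h: "h \<in> Lp q" "riesz h = 0"
  shows "pairing g h = 0"
proof -
  have q: "q > 1" "q \<ge> 1" using pq by (auto simp: conjugate_exponents_def)
  obtain C where C: "C > 0" "\<And>f. f \<in> Lp q \<Longrightarrow> riesz f \<in> Hp q \<and> Lp_norm q (riesz f) \<le> C * Lp_norm q f
     \<and> (\<forall>n\<ge>0. fourier (riesz f) n = fourier f n)"
    using riesz_bounded[OF q(1)] by blast
  obtain F where F: "\<And>n. F n \<in> trig_polys" "(\<lambda>n. Lp_norm q (h - F n)) \<longlonglongrightarrow> 0"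
    using h Lp_closure_trig[OF q(2)] Lp_closureD by blast
  have FL: "F n \<in> Lp q" for n using F(1) trig_Lp q by auto
  have RL: "riesz (F n) \<in> Lp q" for n using C(2)[OF FL] by (auto simp: Hp_def)
  have "norm (pairing g h) \<le> Lp_norm p g * ((1 + C) * Lp_norm q (h - F n))" for n
  proof -
    have 0: "pairing g (F n - riesz (F n)) = 0"
      by (rule pairing_Hp_antianalytic[OF pq g riesz_trig(2)[OF F(1)]])
    have r: "riesz (h - F n) = - riesz (F n)" using riesz_diff[OF q(1) h(1) FL] h by simp
    have e: "h - (F n - riesz (F n)) = (h - F n) - riesz (h - F n)" unfolding r by simp
    have "pairing g h = pairing g (h - (F n - riesz (F n)))"
      using pairing_diff_right[OF pq Hp_Lp[OF g] h(1), of "F n - riesz (F n)"] 0 Lp_diff[OF FL RL q(2)] by simp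
    also have "norm \<dots> \<le> Lp_norm p g * Lp_norm q ((h - F n) - riesz (h - F n))"
      unfolding e using h FL C(2) q by (intro norm_pairing_le[OF pq Hp_Lp[OF g]] Lp_diff) (auto simp: Lp_diff Hp_def)
    also have "Lp_norm q ((h - F n) - riesz (h - F n)) \<le> Lp_norm q (h - F n) + Lp_norm q (riesz (h - F n))"
      using h FL C(2) q by (intro Lp_norm_triangle_diff) (auto simp: Lp_diff Hp_def)
    also have "\<dots> \<le> (1 + C) * Lp_norm q (h - F n)"
      using C(2)[of "h - F n"] Lp_diff[OF h(1) FL q(2)] by (simp add: distrib_right)
    finally show ?thesis by (simp add: mult_left_mono)
  qed
  moreover have "(\<lambda>n. Lp_norm p g * ((1 + C) * Lp_norm q (h - F n))) \<longlonglongrightarrow> Lp_norm p g * ((1 + C) * 0)"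
    by (intro tendsto_intros F)
  ultimately have "norm (pairing g h) \<le> 0" by (intro LIMSEQ_le_const) auto
  then show ?thesis by simp
qed

text \<open>P f is orthogonal to g - P g, and f - P f to P g; both sides thus equal the pairing of P
  f with P g.\<close>

lemma pairing_riesz:
  assumes pq: "conjugate_exponents p q" and f: "f \<in> Lp p" and g: "g \<in> Lp q"
  shows "pairing (riesz f) g = pairing f (riesz g)"
proof -
  have p: "p > 1" "q > 1" using pq by (auto simp: conjugate_exponents_def)
  note qp = conjugate_exponents_sym[OF pq]
  have R: "riesz f \<in> Hp p" "riesz g \<in> Hp q" using riesz_Hp p f g by auto
  have z: "riesz (f - riesz f) = 0" "riesz (g - riesz g) = 0"
    using riesz_diff[OF p(1) f Hp_Lp[OF R(1)]] riesz_diff[OF p(2) g Hp_Lp[OF R(2)]]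
      riesz_id[OF p(1) R(1)] riesz_id[OF p(2) R(2)] by auto
  have L: "f - riesz f \<in> Lp p" "g - riesz g \<in> Lp q" using f g R p by (auto simp: Lp_diff Hp_Lp)
  have "pairing (riesz f) (g - riesz g) = 0" "pairing (riesz g) (f - riesz f) = 0"
    using pairing_Hp_anti[OF pq R(1) L(2) z(2)] pairing_Hp_anti[OF qp R(2) L(1) z(1)] by auto
  then have "pairing (riesz f) (g - riesz g) = 0" "pairing (f - riesz f) (riesz g) = 0"
    by (auto simp: pairing_cnj[of "riesz g", symmetric])
  then show ?thesis
    using pairing_diff_right[OF pq Hp_Lp[OF R(1)] g Hp_Lp[OF R(2)]]
      pairing_diff_left[OF pq f Hp_Lp[OF R(1)] Hp_Lp[OF R(2)]] by simp
qed

text \<open>A coefficient of f g with index n < 0 is the pairing of f with t^n conj g, whose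
  coefficients are all negative.\<close>

lemma mult_Hp:
  assumes pq: "conjugate_exponents p q" and f: "f \<in> Hp p" and g: "g \<in> Hp q"
  shows "f * g \<in> Hp 1"
proof -
  have p: "p > 1" "q > 1" using pq by (auto simp: conjugate_exponents_def)
  have "fourier (f * g) n = 0" if "n < 0" for n
  proof -
    define h where "h = monomial n * conjugate g"
    have hL: "h \<in> Lp q" using g by (simp add: h_def monomial_mult_Lp conjugate_Lp Hp_Lp)
    have "riesz h = 0" using that Hp_neg[OF p(2) g] unfolding riesz_eq_0_iff[OF p(2) hL]
      by (simp add: h_def fourier_mult_monomial fourier_conjugate)
    then have "pairing f h = 0" using pairing_Hp_anti[OF pq f hL] by simp
    also have "pairing f h = fourier (monomial (-n) * (f * g)) 0"
      by (simp add: pairing_fourier h_def conjugate_mult conjugate_monomial mult_ac)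
    finally show ?thesis by (simp add: fourier_mult_monomial)
  qed
  then show ?thesis using Holder_Lp1(1)[OF pq Hp_Lp[OF f] Hp_Lp[OF g]] by (simp add: Hp_def)
qed

text \<open>In the Taylor expansion of h only the constant term contributes, because f t^k has mean
  0 for k > 0.\<close>

lemma integral_Hp1_entire:
  assumes f: "f \<in> Hp 1" and h: "h holomorphic_on UNIV"
  shows "integrable arc_measure (\<lambda>t. rep f t * h t)" "(LINT t|arc_measure. rep f t * h t) = fourier f 0 * h 0"
proof -
  have intf: "integrable arc_measure (rep f)" using f by (simp add: Hp_def Lp1_iff)
  have ch: "continuous_on UNIV h" using h holomorphic_on_imp_continuous_on by blast
  have [measurable]: "h \<in> borel_measurable borel" by (rule borel_measurable_continuous_onI[OF ch])
  define a where "a n = (deriv ^^ n) h 0 / fact n" for n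
  have hs: "(\<lambda>n. a n * z ^ n) sums h z" if "norm z < 2" for z
    using holomorphic_power_series[of h 0 2 z] h that holomorphic_on_subset[of h UNIV "ball 0 2"]
    by (simp add: a_def)
  \<comment> \<open>Convergence at a point outside the closed disc gives absolute convergence on the
    circle, hence the uniform bound M on the partial sums.\<close>
  have "summable (\<lambda>n. a n * (3/2) ^ n)" using hs[of "3/2"] sums_summable by auto
  then have sa: "summable (\<lambda>n. norm (a n * 1 ^ n))" by (rule powser_insidea) simp
  define M where "M = (\<Sum>n. norm (a n))"
  have bd: "norm (\<Sum>k<n. a k * t ^ k) \<le> M" if "norm t = 1" for t n
  proof -
    have "norm (\<Sum>k<n. a k * t ^ k) \<le> (\<Sum>k<n. norm (a k))"
      by (rule order_trans[OF norm_sum]) (simp add: norm_mult norm_power that)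
    also have "\<dots> \<le> M" unfolding M_def using sa by (intro sum_le_suminf) auto
    finally show ?thesis .
  qed
  obtain K where K: "\<And>t. norm t = 1 \<Longrightarrow> norm (h t) \<le> K" using continuous_bounded_circle[OF ch] by metis
  show "integrable arc_measure (\<lambda>t. rep f t * h t)"
  proof (rule Bochner_Integration.integrable_bound)
    show "integrable arc_measure (\<lambda>t. norm (rep f t) * K)" using intf by simp
    show "AE t in arc_measure. norm (rep f t * h t) \<le> norm (norm (rep f t) * K)"
      using AE_arc_measure_norm by eventually_elim 
       (use K in \<open>auto simp: norm_mult intro!: mult_left_mono order_trans[OF _ abs_ge_self]\<close>)
  qed simp
  have L: "(\<lambda>n. LINT t|arc_measure. rep f t * (\<Sum>k<n. a k * t ^ k)) \<longlonglongrightarrow> (LINT t|arc_measure. rep f t * h t)"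
  proof (rule integral_dominated_convergence)
    show "integrable arc_measure (\<lambda>t. norm (rep f t) * M)" using intf by simp
    show "AE t in arc_measure. (\<lambda>n. rep f t * (\<Sum>k<n. a k * t ^ k)) \<longlonglongrightarrow> rep f t * h t"
      using AE_arc_measure_norm by eventually_elim (use hs in \<open>auto simp: sums_def intro!: tendsto_intros\<close>)
    show "AE t in arc_measure. norm (rep f t * (\<Sum>k<n. a k * t ^ k)) \<le> norm (rep f t) * M" for n
      using AE_arc_measure_norm by eventually_elim (use bd in \<open>auto simp: norm_mult intro!: mult_left_mono\<close>)
  qed simp_all
  have fk: "(LINT t|arc_measure. rep f t * t ^ k) = (if k = 0 then fourier f 0 else 0)"
    and ik: "integrable arc_measure (\<lambda>t. rep f t * t ^ k)" for k
    using f fourier_integrable[of f "int k"] fourier_rep[of f "- int k"] by (auto simp: Hp_def)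
  have "(LINT t|arc_measure. rep f t * (\<Sum>k<Suc n. a k * t ^ k)) = fourier f 0 * a 0" for n
  proof -
    have "(LINT t|arc_measure. rep f t * (\<Sum>k<Suc n. a k * t ^ k)) = (LINT t|arc_measure. (\<Sum>k<Suc n. a k * (rep f t * t ^ k)))"
      by (simp add: sum_distrib_left mult_ac del: sum.lessThan_Suc)
    also have "\<dots> = (\<Sum>k<Suc n. a k * (LINT t|arc_measure. rep f t * t ^ k))"
      using ik by (subst Bochner_Integration.integral_sum) auto
    also have "\<dots> = (\<Sum>k<Suc n. if k = 0 then a 0 * fourier f 0 else 0)" by (intro sum.cong) (auto simp: fk)
    also have "\<dots> = fourier f 0 * a 0" by (subst sum.delta) auto
    finally show ?thesis .
  qed
  then have "(\<lambda>n. LINT t|arc_measure. rep f t * (\<Sum>k<Suc n. a k * t ^ k)) \<longlonglongrightarrow> fourier f 0 * a 0" by simp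
  then have "(LINT t|arc_measure. rep f t * h t) = fourier f 0 * a 0"
    using LIMSEQ_Suc[OF L] LIMSEQ_unique by blast
  then show "(LINT t|arc_measure. rep f t * h t) = fourier f 0 * h 0" by (simp add: a_def)
qed

text \<open>If u is a trigonometric polynomial with analytic completion q, then f exp q has mean
  fourier f 0 \<cdot> exp (q 0), while |exp q| = exp u. Bounded u follow by approximation. This
  replaces Jensen's inequality for log |f|.\<close>

lemma Hp1_exp_bound:
  assumes f: "f \<in> Hp 1" and u: "u \<in> borel_measurable borel" "\<And>t. \<bar>u t\<bar> \<le> C" "(LINT t|arc_measure. u t) = 0"
  shows "norm (fourier f 0) \<le> (LINT t|arc_measure. norm (rep f t) * exp (u t))"
proof -
  obtain v k where vk: "\<And>n. v n \<in> trig_polys" "\<And>n. continuous_on UNIV (k n)" "\<And>n t. norm t = 1 \<Longrightarrow> \<bar>k n t\<bar> \<le> C + 1"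
    "\<And>n. AE t in arc_measure. rep (v n) t = complex_of_real (k n t)"
    "AE t in arc_measure. (\<lambda>n. k n t) \<longlonglongrightarrow> u t" by (rule bounded_approx_trig[OF u(1,2)]) (rule that)
  have [measurable]: "k n \<in> borel_measurable borel" for n using vk(2) by (rule borel_measurable_continuous_onI)
  note [measurable] = u(1)
  have intf: "integrable arc_measure (rep f)" using f by (simp add: Hp_def Lp1_iff)
  have le: "norm (fourier f 0) * exp (Re (fourier (v n) 0)) \<le> (LINT t|arc_measure. norm (rep f t) * exp (k n t))" for n
  proof -
    obtain q where q: "AE t in arc_measure. Re (poly q t) = k n t" "poly q 0 = fourier (v n) 0"
      using analytic_completion[OF vk(1) vk(4)] by metis
    have hol: "(\<lambda>t. exp (poly q t)) holomorphic_on UNIV" by (intro holomorphic_intros)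
    have pm [measurable]: "poly q \<in> borel_measurable borel" by (intro borel_measurable_continuous_onI continuous_intros)
    have "norm (fourier f 0) * exp (Re (fourier (v n) 0)) = norm (LINT t|arc_measure. rep f t * exp (poly q t))"
      unfolding integral_Hp1_entire(2)[OF f hol] by (simp add: norm_mult q)
    also have "\<dots> \<le> (LINT t|arc_measure. norm (rep f t * exp (poly q t)))" by (rule integral_norm_bound)
    also have "\<dots> = (LINT t|arc_measure. norm (rep f t) * exp (k n t))"
      by (rule integral_cong_AE) (use q(1) in \<open>auto elim!: eventually_mono simp: norm_mult\<close>)
    finally show ?thesis .
  qed
  have "(\<lambda>n. LINT t|arc_measure. k n t) \<longlonglongrightarrow> (LINT t|arc_measure. u t)"
  proof (rule integral_dominated_convergence)
    show "AE t in arc_measure. norm (k n t) \<le> C + 1" for n using AE_arc_measure_norm by eventually_elim (use vk(3) in auto)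
    show "integrable arc_measure (\<lambda>t. C + 1)" by simp
  qed (use vk(5) in simp_all)
  moreover have "(LINT t|arc_measure. k n t) = Re (fourier (v n) 0)" for n
  proof -
    have "fourier (v n) 0 = (LINT t|arc_measure. complex_of_real (k n t))"
      unfolding fourier_rep by (rule integral_cong_AE) (use vk(4)[of n] in \<open>auto elim!: eventually_mono\<close>)
    then show ?thesis by simp
  qed
  ultimately have l1: "(\<lambda>n. norm (fourier f 0) * exp (Re (fourier (v n) 0))) \<longlonglongrightarrow> norm (fourier f 0) * exp 0"
    using u(3) by (intro tendsto_intros) simp
  have l2: "(\<lambda>n. LINT t|arc_measure. norm (rep f t) * exp (k n t)) \<longlonglongrightarrow> (LINT t|arc_measure. norm (rep f t) * exp (u t))"
  proof (rule integral_dominated_convergence)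
    show "integrable arc_measure (\<lambda>t. norm (rep f t) * exp (C + 1))" using intf by simp
    show "AE t in arc_measure. (\<lambda>n. norm (rep f t) * exp (k n t)) \<longlonglongrightarrow> norm (rep f t) * exp (u t)"
      using vk(5) by eventually_elim (intro tendsto_intros)
    show "AE t in arc_measure. norm (norm (rep f t) * exp (k n t)) \<le> norm (rep f t) * exp (C + 1)" for n
      using AE_arc_measure_norm by eventually_elim (use vk(3) abs_le_D1 in \<open>auto intro!: mult_left_mono\<close>)
  qed simp_all
  show ?thesis using LIMSEQ_le[OF l1 l2] le by simp
qed

text \<open>If \<open>f\<close> vanished on a set \<open>E\<close> of positive measure, then \<open>u\<close> could be chosen with mean value \<open>0\<close> and equal to
  \<open>-n\<close> off \<open>E\<close>.\<close>

lemma Hp1_nonzero_fourier0: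
  assumes f: "f \<in> Hp 1" and f0: "fourier f 0 \<noteq> 0"
  shows "AE t in arc_measure. rep f t \<noteq> 0"
proof (rule ccontr)
  assume contr: "\<not> ?thesis"
  define E where "E = {t. rep f t = 0}"
  have E [measurable]: "E \<in> sets borel" unfolding E_def by measurable
  define m where "m = measure arc_measure E"
  have m: "m > 0"
  proof (rule ccontr)
    assume "\<not> m > 0"
    then have "measure arc_measure E = 0" using measure_nonneg[of arc_measure E] unfolding m_def by linarith
    then have "emeasure arc_measure E = 0" by (simp add: arc.emeasure_eq_measure)
    then have "AE t in arc_measure. t \<notin> E" by (intro AE_not_in) auto
    then show False using contr by (simp add: E_def)
  qed
  have m1: "m \<le> 1" using arc.bounded_measure[of E] by (simp add: m_def)
  have intf: "integrable arc_measure (rep f)" using f by (simp add: Hp_def Lp1_iff)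
  have bound: "norm (fourier f 0) \<le> exp (- real n) * Lp_norm 1 f" for n :: nat
  proof -
    define u where "u t = real n * (indicator E t / m - 1)" for t
    have um [measurable]: "u \<in> borel_measurable borel" unfolding u_def by measurable
    have ub: "\<bar>u t\<bar> \<le> real n * (1 / m)" for t
    proof -
      have "1 \<le> 1 / m" using m m1 by simp
      then have "\<bar>indicator E t / m - 1\<bar> \<le> 1 / m" using m by (cases "t \<in> E") auto
      then show ?thesis unfolding u_def abs_mult by (intro mult_mono) auto
    qed
    have "integrable arc_measure (indicat_real E)" by (rule integrable_arc_bounded[of _ 1]) (auto simp: indicator_def)
    then have ui: "(LINT t|arc_measure. u t) = 0" using m by (simp add: u_def m_def)
    have "norm (fourier f 0) \<le> (LINT t|arc_measure. norm (rep f t) * exp (u t))"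
      by (rule Hp1_exp_bound[OF f um ub ui])
    \<comment> \<open>On E the factor f vanishes, so the large values of u there do not
      count.\<close>
    also have "\<dots> = (LINT t|arc_measure. exp (- real n) * norm (rep f t))"
      by (rule Bochner_Integration.integral_cong) (auto simp: u_def indicator_def E_def)
    finally show ?thesis by (simp add: Lp1_norm)
  qed
  have "(\<lambda>n. exp (- real n) * Lp_norm 1 f) \<longlonglongrightarrow> 0 * Lp_norm 1 f"
  proof (intro tendsto_mult tendsto_const)
    show "(\<lambda>n. exp (- real n)) \<longlonglongrightarrow> 0"
      by (intro filterlim_compose[OF exp_at_bot] filterlim_compose[OF filterlim_uminus_at_bot_at_top] filterlim_real_sequentially)
  qed
  then have "norm (fourier f 0) \<le> 0" using bound by (intro LIMSEQ_le_const) auto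
  then show False using f0 by simp
qed

text \<open>Dividing by the power of t up to the first nonzero coefficient reduces to the case of a
  nonzero mean and does not change the zero set on the circle.\<close>

lemma Hp1_nonzero_AE:
  assumes f: "f \<in> Hp 1" and f0: "f \<noteq> 0"
  shows "AE t in arc_measure. rep f t \<noteq> 0"
proof -
  have "\<exists>n. fourier f (int n) \<noteq> 0"
  proof (rule ccontr)
    assume "\<nexists>n. fourier f (int n) \<noteq> 0"
    then have "fourier f n = 0" for n using f by (cases "n \<ge> 0") (auto simp: Hp_def elim: nonneg_int_cases)
    then show False using fourier_unique_zero f f0 by (auto simp: Hp_def)
  qed
  then obtain n where n: "fourier f (int n) \<noteq> 0" "\<And>m. m < n \<Longrightarrow> fourier f (int m) = 0"
    using exists_least_iff[of "\<lambda>n. fourier f (int n) \<noteq> 0"] by auto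
  define g where "g = monomial (- int n) * f"
  have z: "fourier f m = 0" if "m < int n" for m
    using n(2)[of "nat m"] f that by (cases "m \<ge> 0") (auto simp: Hp_def)
  have gH: "g \<in> Hp 1" using f z by (auto simp: g_def Hp_def monomial_mult_Lp fourier_mult_monomial)
  have "fourier g 0 \<noteq> 0" using n by (simp add: g_def fourier_mult_monomial)
  from Hp1_nonzero_fourier0[OF gH this] show ?thesis
    using rep_mult[of "monomial (- int n)" f] by eventually_elim (auto simp: g_def)
qed

text \<open>In w = c f conj g the product c f is antianalytic, which kills the coefficients of w at
  n \<ge> 0. Regrouped as f times the conjugate of conj c \<cdot> g, the same product has no
  coefficients at n \<le> 0. So w = 0, and c can be cancelled.\<close>

lemma Coburn:
  assumes pq: "conjugate_exponents p q" and c: "c \<in> Linf" "c * c' = 1"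
    and f: "f \<in> Hp p" "riesz (c * f) = 0" and g: "g \<in> Hp q" "riesz (conjugate c * g) = 0"
  shows "f = 0 \<or> g = 0"
proof -
  have p: "p > 1" "q > 1" using pq by (auto simp: conjugate_exponents_def)
  note qp = conjugate_exponents_sym[OF pq]
  have L: "c * f \<in> Lp p" "conjugate c * g \<in> Lp q"
    using c f g p by (auto intro!: mult_Lp simp: conjugate_Linf Hp_Lp)
  define w where "w = c * f * conjugate g"
  have anti: "monomial (-1) * conjugate h \<in> Hp r" if "1 < r" "h \<in> Lp r" "riesz h = 0" for r h
    using that by (auto simp: Hp_def monomial_mult_Lp conjugate_Lp fourier_mult_monomial fourier_conjugate riesz_eq_0_iff)
  have w1: "monomial (-1) * conjugate w \<in> Hp 1"
    using mult_Hp[OF pq anti[OF p(1) L(1) f(2)] g(1)] by (simp add: w_def conjugate_mult mult_ac)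
  have w2: "monomial (-1) * w \<in> Hp 1"
    using mult_Hp[OF qp anti[OF p(2) L(2) g(2)] f(1)] by (simp add: w_def conjugate_mult mult_ac)
  have wL: "w \<in> Lp 1" using w2 by (simp add: Hp_def monomial_mult_Lp)
  have "fourier w n = 0" for n
  proof (cases "n \<ge> 0")
    case True
    then have "fourier (monomial (-1) * conjugate w) (- n - 1) = 0" using w1 by (simp add: Hp_def)
    then show ?thesis by (simp add: fourier_mult_monomial fourier_conjugate)
  next
    case False
    then have "fourier (monomial (-1) * w) (n - 1) = 0" using w2 by (simp add: Hp_def)
    then show ?thesis by (simp add: fourier_mult_monomial)
  qed
  then have "w = 0" by (rule fourier_unique_zero[OF wL])
  then have "c' * w = 0" by simp
  then have fg: "f * conjugate g = 0" using c(2) by (simp add: w_def mult_ac) (metis mult.assoc mult.commute mult_1)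
  show ?thesis
  proof (cases "f = 0")
    case False
    have "AE t in arc_measure. rep f t \<noteq> 0" by (rule Hp1_nonzero_AE[OF Hp_Hp1[OF p(1) f(1)] False])
    then have "AE t in arc_measure. rep g t = rep 0 t"
      using rep_mult[of f "conjugate g"] rep_conjugate[of g] rep_zero by eventually_elim (auto simp: fg)
    then show ?thesis by (simp add: circ_fun_eqI)
  qed simp
qed

section \<open>Duality of Hardy spaces\<close>

text \<open>Strict Bernoulli, rescaled to the midpoint m, says that the p-th power lies strictly
  above its tangent at m; for x and y together the linear terms cancel.\<close>

lemma powr_midpoint_less:
  fixes x y p :: real
  assumes p: "p > 1" and xy: "x \<ge> 0" "y \<ge> 0" "x \<noteq> y"
  shows "((x + y) / 2) powr p < (x powr p + y powr p) / 2"
proof -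
  have bern: "1 + p * (r - 1) < r powr p" if r: "r \<ge> 0" "r \<noteq> 1" for r :: real
  proof (cases "r = 0")
    case False
    then have r0: "r > 0" using r by simp
    define f where "f r = r powr p - p * r" for r :: real
    have der: "(f has_real_derivative (p * (s powr (p - 1) - 1))) (at s)" if "s > 0" for s
      unfolding f_def using that by (auto intro!: derivative_eq_intros simp: algebra_simps)
    show ?thesis
    proof (cases "r > 1")
      case True
      obtain z where z: "1 < z" "z < r" "f r - f 1 = (r - 1) * (p * (z powr (p - 1) - 1))"
        using MVT2[OF True, of f "\<lambda>s. p * (s powr (p - 1) - 1)"] der by auto
      have "z powr (p - 1) > 1" using z(1) p powr_less_mono2[of "p - 1" 1 z] by simp
      then have "f r - f 1 > 0" unfolding z(3) using True p by simp
      then show ?thesis by (simp add: f_def algebra_simps)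
    next
      case False
      then have r1: "r < 1" using r by simp
      obtain z where z: "r < z" "z < 1" "f 1 - f r = (1 - r) * (p * (z powr (p - 1) - 1))"
        using MVT2[OF r1, of f "\<lambda>s. p * (s powr (p - 1) - 1)"] der r0 by auto
      have "z powr (p - 1) < 1" using z r0 p powr_less_mono2[of "p - 1" z 1] by simp
      then have "p * (z powr (p - 1) - 1) < 0" using p by (simp add: mult_pos_neg)
      then have "f 1 - f r < 0" unfolding z(3) using r1 by (simp add: mult_pos_neg)
      then show ?thesis by (simp add: f_def algebra_simps)
    qed
  qed (use p in simp)
  define m where "m = (x + y) / 2"
  have m: "m > 0" using xy by (auto simp: m_def)
  have tangent: "m powr p * (1 + p * (z / m - 1)) < z powr p" if z: "z \<ge> 0" "z \<noteq> m" for z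
  proof -
    have "m powr p * (1 + p * (z / m - 1)) < m powr p * (z / m) powr p"
      using z m by (intro mult_strict_left_mono bern) auto
    then show ?thesis using z m by (simp add: powr_divide)
  qed
  have 1: "m powr p * (1 + p * (x / m - 1)) < x powr p"
    by (rule tangent) (use xy in \<open>auto simp: m_def\<close>)
  have 2: "m powr p * (1 + p * (y / m - 1)) < y powr p"
    by (rule tangent) (use xy in \<open>auto simp: m_def\<close>)
  have "x + y = 2 * m" by (simp add: m_def)
  then have "x / m + y / m = 2" using m by (simp add: add_divide_distrib[symmetric])
  then have y: "y / m = 2 - x / m" by simp
  have "m powr p * (1 + p * (x / m - 1)) + m powr p * (1 + p * (y / m - 1)) = 2 * m powr p"
    unfolding y by (simp add: algebra_simps)
  then have "2 * m powr p < x powr p + y powr p" using 1 2 by linarith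
  then show ?thesis by (simp add: m_def)
qed

lemma powr_norm_midpoint_le:
  fixes a b :: complex
  assumes p: "p > 1"
  shows "norm ((a + b) / 2) powr p \<le> (norm a powr p + norm b powr p) / 2"
proof -
  have "norm ((a + b) / 2) powr p \<le> ((norm a + norm b) / 2) powr p"
    using p norm_triangle_ineq[of a b] by (intro powr_mono2) (auto simp: norm_divide)
  also have "\<dots> \<le> (norm a powr p + norm b powr p) / 2"
    using powr_midpoint_less[OF p, of "norm a" "norm b"] by (cases "norm a = norm b") auto
  finally show ?thesis .
qed

text \<open>If the moduli differ, strict convexity of the power applies. If they agree, the
  parallelogram law makes the modulus of the midpoint strictly smaller.\<close>

lemma powr_norm_midpoint_less:
  fixes a b :: complex
  assumes p: "p > 1" and ab: "a \<noteq> b"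
  shows "norm ((a + b) / 2) powr p < (norm a powr p + norm b powr p) / 2"
proof (cases "norm a = norm b")
  case False
  have "norm ((a + b) / 2) powr p \<le> ((norm a + norm b) / 2) powr p"
    using p norm_triangle_ineq[of a b] by (intro powr_mono2) (auto simp: norm_divide)
  also have "\<dots> < (norm a powr p + norm b powr p) / 2"
    using powr_midpoint_less[OF p _ _ False] by simp
  finally show ?thesis .
next
  case True
  have "(norm (a + b))\<^sup>2 + (norm (a - b))\<^sup>2 = 2 * (norm a)\<^sup>2 + 2 * (norm b)\<^sup>2"
    by (simp add: cmod_power2) (simp add: power2_eq_square algebra_simps)
  moreover have "(norm (a - b))\<^sup>2 > 0" using ab by simp
  ultimately have "(norm (a + b))\<^sup>2 < (2 * norm a)\<^sup>2" using True by (simp add: power2_eq_square)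
  then have "norm (a + b) < 2 * norm a" by (rule power2_less_imp_less) simp
  then have "norm ((a + b) / 2) powr p < norm a powr p"
    using p by (intro powr_less_mono2) (auto simp: norm_divide)
  then show ?thesis using True by simp
qed

text \<open>The defect on the right is homogeneous of degree p and positive off the diagonal, so it
  has a positive minimum d0 on the compact set K of normalised pairs. There the sum of the two
  powers is at most 2, whence d0 / 2.\<close>

lemma uniform_convexity_pointwise:
  assumes p: "p > 1" and e: "e > 0"
  obtains d where "d > 0" "\<And>a b :: complex. e * max (norm a) (norm b) \<le> norm (a - b) \<Longrightarrow>
    d * (norm a powr p + norm b powr p) \<le> (norm a powr p + norm b powr p) / 2 - norm ((a + b) / 2) powr p"
proof -
  define K where "K = {(a :: complex, b :: complex). max (norm a) (norm b) = 1 \<and> e \<le> norm (a - b)}"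
  define \<phi> where "\<phi> = (\<lambda>z :: complex \<times> complex. (norm (fst z) powr p + norm (snd z) powr p) / 2 - norm ((fst z + snd z) / 2) powr p)"
  have cK: "compact K"
  proof -
    have "closed {z :: complex \<times> complex. max (norm (fst z)) (norm (snd z)) = 1 \<and> e \<le> norm (fst z - snd z)}"
      by (intro closed_Collect_conj closed_Collect_eq closed_Collect_le continuous_intros)
    moreover have "K = {z. max (norm (fst z)) (norm (snd z)) = 1 \<and> e \<le> norm (fst z - snd z)}"
      by (auto simp: K_def)
    moreover have "bounded K"
      by (rule bounded_subset[of "cball 0 1 \<times> cball 0 1"]) (auto simp: K_def bounded_Times)
    ultimately show ?thesis by (simp add: compact_eq_bounded_closed)
  qed
  have c\<phi>: "continuous_on K \<phi>" unfolding \<phi>_def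
    using p by (intro continuous_intros continuous_on_powr') auto
  have pos: "\<phi> z > 0" if "z \<in> K" for z
  proof -
    have "fst z \<noteq> snd z" using that e by (auto simp: K_def)
    from powr_norm_midpoint_less[OF p this] show ?thesis by (simp add: \<phi>_def)
  qed
  obtain d0 where d0: "d0 > 0" "\<And>z. z \<in> K \<Longrightarrow> d0 \<le> \<phi> z"
  proof (cases "K = {}")
    case False
    then obtain z where "z \<in> K" "\<And>y. y \<in> K \<Longrightarrow> \<phi> z \<le> \<phi> y"
      using continuous_attains_inf[OF cK False c\<phi>] by blast
    then show ?thesis using that[of "\<phi> z"] pos by blast
  qed (use that[of 1] in simp)
  show ?thesis
  proof (rule that[of "d0 / 2"])
    fix a b :: complex assume ab: "e * max (norm a) (norm b) \<le> norm (a - b)"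
    define M where "M = max (norm a) (norm b)"
    show "d0 / 2 * (norm a powr p + norm b powr p) \<le> (norm a powr p + norm b powr p) / 2 - norm ((a + b) / 2) powr p"
    proof (cases "M = 0")
      case True
      then have "a = 0" "b = 0" by (auto simp: M_def max_def split: if_splits)
      then show ?thesis by simp
    next
      case False
      then have M: "M > 0" unfolding M_def using norm_ge_zero[of a] norm_ge_zero[of b] by linarith
      define x y where "x = a / of_real M" and "y = b / of_real M"
      have a: "a = of_real M * x" and b: "b = of_real M * y" using M by (auto simp: x_def y_def)
      have na: "norm a = M * norm x" "norm b = M * norm y" "norm ((a + b) / 2) = M * norm ((x + y) / 2)"
        using M by (auto simp: a b norm_mult norm_divide simp flip: distrib_left)
      have "max (norm x) (norm y) = 1" using M by (auto simp: x_def y_def norm_divide max_def field_simps M_def split: if_splits)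
      moreover have "e \<le> norm (x - y)"
      proof -
        have "norm (x - y) = norm (a - b) / M" using M by (simp add: x_def y_def norm_divide flip: diff_divide_distrib)
        then show ?thesis using ab M by (simp add: M_def[symmetric] pos_le_divide_eq)
      qed
      ultimately have "d0 \<le> \<phi> (x, y)" by (intro d0) (auto simp: K_def)
      moreover have "norm x powr p \<le> 1" "norm y powr p \<le> 1"
        using \<open>max (norm x) (norm y) = 1\<close> p powr_mono2[of p "norm x" 1] powr_mono2[of p "norm y" 1] by auto
      then have "d0 * (norm x powr p + norm y powr p) \<le> d0 * 2" using d0(1) by (intro mult_left_mono) auto
      then have "d0 / 2 * (norm x powr p + norm y powr p) \<le> d0" by simp
      ultimately have "d0 / 2 * (norm x powr p + norm y powr p) \<le> \<phi> (x, y)" by linarith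
      then have "M powr p * (d0 / 2 * (norm x powr p + norm y powr p)) \<le> M powr p * \<phi> (x, y)"
        by (intro mult_left_mono) auto
      then show ?thesis unfolding na powr_mult by (simp add: \<phi>_def algebra_simps)
    qed
  qed (use d0 in simp)
qed

text \<open>Where f and g are close relative to their moduli, |f - g|^p is a small multiple of |f|^p
  + |g|^p; elsewhere the pointwise convexity defect bounds it. Integration adds the two
  estimates.\<close>

lemma uniform_convexity_Lp:
  assumes p: "p > 1" and e: "e > 0" and M: "M \<ge> 0"
  obtains d where "d > 0" "\<And>f g. f \<in> Lp p \<Longrightarrow> g \<in> Lp p \<Longrightarrow> Lp_norm p f powr p \<le> M \<Longrightarrow> Lp_norm p g powr p \<le> M \<Longrightarrow>
    (Lp_norm p f powr p + Lp_norm p g powr p) / 2 - Lp_norm p (cscale (1/2) (f + g)) powr p < d \<Longrightarrow> Lp_norm p (f - g) < e"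
proof -
  \<comment> \<open>Chosen so that \<epsilon>^p (2 M + 2) is half of e^p; the bound on the defect
    accounts for the other half.\<close>
  define \<epsilon> where "\<epsilon> = (e powr p / (4 * M + 4)) powr (1/p)"
  have \<epsilon>: "\<epsilon> > 0" "\<epsilon> powr p = e powr p / (4 * M + 4)" using e p M by (auto simp: \<epsilon>_def powr_powr)
  obtain d where d: "d > 0" "\<And>a b :: complex. \<epsilon> * max (norm a) (norm b) \<le> norm (a - b) \<Longrightarrow>
    d * (norm a powr p + norm b powr p) \<le> (norm a powr p + norm b powr p) / 2 - norm ((a + b) / 2) powr p"
    using uniform_convexity_pointwise[OF p \<epsilon>(1)] by metis
  show ?thesis
  proof (rule that[of "d * e powr p / (2 * 2 powr p)"])
    show "d * e powr p / (2 * 2 powr p) > 0" using d e by simp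
    fix f g assume f: "f \<in> Lp p" and g: "g \<in> Lp p" and fM: "Lp_norm p f powr p \<le> M" and gM: "Lp_norm p g powr p \<le> M"
      and less: "(Lp_norm p f powr p + Lp_norm p g powr p) / 2 - Lp_norm p (cscale (1/2) (f + g)) powr p < d * e powr p / (2 * 2 powr p)"
    have L: "cscale (1/2) (f + g) \<in> Lp p" "f - g \<in> Lp p" using f g p by (auto intro!: Lp_cscale Lp_add Lp_diff)
    have pt: "norm (a - b) powr p \<le> \<epsilon> powr p * (norm a powr p + norm b powr p)
      + 2 powr p / d * ((norm a powr p + norm b powr p) / 2 - norm ((a + b) / 2) powr p)" (is "_ \<le> ?A + ?B") for a b :: complex
    proof -
      have mx: "max (norm a) (norm b) powr p \<le> norm a powr p + norm b powr p" by (auto simp: max_def)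
      have B: "?B \<ge> 0" using powr_norm_midpoint_le[OF p, of a b] d by simp
      show ?thesis
      proof (cases "\<epsilon> * max (norm a) (norm b) \<le> norm (a - b)")
        case True
        have "norm (a - b) \<le> 2 * max (norm a) (norm b)" using norm_triangle_ineq4[of a b] by (auto simp: max_def)
        then have "norm (a - b) powr p \<le> (2 * max (norm a) (norm b)) powr p" using p by (intro powr_mono2) auto
        also have "\<dots> = 2 powr p * max (norm a) (norm b) powr p" by (rule powr_mult)
        also have "\<dots> \<le> 2 powr p / d * (d * (norm a powr p + norm b powr p))" using mx d by simp
        also have "\<dots> \<le> ?B" using d(2)[OF True] d(1) by (intro mult_left_mono) auto
        also have "\<dots> \<le> ?A + ?B" by simp
        finally show ?thesis .
      next
        case False
        then have "norm (a - b) powr p \<le> (\<epsilon> * max (norm a) (norm b)) powr p" using p by (intro powr_mono2) auto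
        also have "\<dots> = \<epsilon> powr p * max (norm a) (norm b) powr p" by (rule powr_mult)
        also have "\<dots> \<le> ?A" using mx by (intro mult_left_mono) auto
        finally show ?thesis using B by linarith
      qed
    qed
    have "Lp_norm p (f - g) powr p = (LINT t|arc_measure. norm (rep (f - g) t) powr p)" using p by (simp add: Lp_norm_powr)
    also have "\<dots> \<le> (LINT t|arc_measure. \<epsilon> powr p * (norm (rep f t) powr p + norm (rep g t) powr p)
      + 2 powr p / d * ((norm (rep f t) powr p + norm (rep g t) powr p) / 2 - norm (rep (cscale (1/2) (f + g)) t) powr p))"
    proof (rule integral_mono_AE)
      show "AE t in arc_measure. norm (rep (f - g) t) powr p \<le> \<epsilon> powr p * (norm (rep f t) powr p + norm (rep g t) powr p)
      + 2 powr p / d * ((norm (rep f t) powr p + norm (rep g t) powr p) / 2 - norm (rep (cscale (1/2) (f + g)) t) powr p)"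
        using rep_diff[of f g] rep_add[of f g] rep_cscale[of "1/2" "f + g"]
      proof eventually_elim
        case (elim t)
        show ?case using pt[of "rep f t" "rep g t"] by (simp add: elim)
      qed
    qed (use f g L in \<open>auto simp: Lp_iff\<close>)
    also have "\<dots> = \<epsilon> powr p * (Lp_norm p f powr p + Lp_norm p g powr p)
      + 2 powr p / d * ((Lp_norm p f powr p + Lp_norm p g powr p) / 2 - Lp_norm p (cscale (1/2) (f + g)) powr p)"
      using f g L p by (simp add: Lp_iff Lp_norm_powr)
    also have "\<dots> < \<epsilon> powr p * (2 * M + 2) + 2 powr p / d * (d * e powr p / (2 * 2 powr p))"
    proof (rule add_less_le_mono)
      have "Lp_norm p f powr p + Lp_norm p g powr p < 2 * M + 2" using fM gM by simp
      then show "\<epsilon> powr p * (Lp_norm p f powr p + Lp_norm p g powr p) < \<epsilon> powr p * (2 * M + 2)"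
        using \<epsilon>(1) by (intro mult_strict_left_mono) auto
    qed (use less d in \<open>intro mult_left_mono, auto\<close>)
    also have "\<dots> = e powr p" using d M unfolding \<epsilon>(2) by (simp add: field_simps)
    finally have "Lp_norm p (f - g) powr p < e powr p" .
    then show "Lp_norm p (f - g) < e" using e p by (metis less_imp_le linorder_not_le powr_mono2 less_trans zero_less_one)
  qed
qed

section \<open>Nearest points, annihilators and representation of functionals\<close>

lemma Hp_closed:
  assumes p: "1 < p" and f: "\<And>n. f n \<in> Hp p" and g: "g \<in> Lp p" "(\<lambda>n. Lp_norm p (f n - g)) \<longlonglongrightarrow> 0"
  shows "g \<in> Hp p"
proof -
  have "fourier g m = 0" if "m < 0" for m
  proof -
    have "(\<lambda>n. fourier (f n) m) \<longlonglongrightarrow> fourier g m"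
      using p f g by (intro Lp_norm_fourier_tendsto[of p]) (auto simp: Hp_Lp)
    then show ?thesis using Hp_neg[OF p f that] by (simp add: LIMSEQ_const_iff)
  qed
  then show ?thesis using g by (simp add: Hp_def)
qed

text \<open>The midpoint of two members of a minimising sequence again lies in R, so its distance to
  y is at least the infimum; uniform convexity then forces the sequence to be Cauchy.\<close>

lemma nearest_point:
  assumes p: "1 < p" and R: "R \<subseteq> Hp p" "circ.subspace R" "closed_in_Hp p R" and y: "y \<in> Hp p"
  obtains r where "r \<in> R" "\<And>s. s \<in> R \<Longrightarrow> Lp_norm p (y - r) \<le> Lp_norm p (y - s)"
proof -
  have p1: "p \<ge> 1" "p > 0" using p by auto
  have yL: "y \<in> Lp p" using y by (rule Hp_Lp)
  have RL: "s \<in> Lp p" if "s \<in> R" for s using that R Hp_Lp by blast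
  define S where "S = (\<lambda>r. Lp_norm p (y - r)) ` R"
  define d where "d = Inf S"
  have Sne: "S \<noteq> {}" using circ.subspace_0[OF R(2)] by (auto simp: S_def)
  have bdd: "bdd_below S" by (rule bdd_belowI[of _ 0]) (auto simp: S_def)
  have dle: "d \<le> Lp_norm p (y - r)" if "r \<in> R" for r unfolding d_def using that bdd by (intro cInf_lower) (auto simp: S_def)
  have d0: "d \<ge> 0" unfolding d_def using Sne by (intro cInf_greatest) (auto simp: S_def)
  have "\<exists>r\<in>R. Lp_norm p (y - r) < d + 1 / Suc n" for n
    using cInf_lessD[OF Sne, of "d + 1 / Suc n"] by (auto simp: S_def d_def)
  then obtain r where r: "\<And>n. r n \<in> R" "\<And>n. Lp_norm p (y - r n) < d + 1 / Suc n" by metis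
  have dl: "y - r n \<in> Lp p" for n using yL RL[OF r(1)] p1 by (simp add: Lp_diff)
  have lim: "(\<lambda>n. (d + 1 / Suc n) powr p) \<longlonglongrightarrow> d powr p"
  proof -
    have "(\<lambda>n. d + inverse (real (Suc n))) \<longlonglongrightarrow> d + 0" by (intro tendsto_add tendsto_const LIMSEQ_inverse_real_of_nat)
    then have "(\<lambda>n. (d + inverse (real (Suc n))) powr p) \<longlonglongrightarrow> (d + 0) powr p"
      using p1 d0 by (intro tendsto_powr' tendsto_const) auto
    then show ?thesis by (simp add: inverse_eq_divide)
  qed
  have cau: "\<exists>N. \<forall>m\<ge>N. \<forall>n\<ge>N. Lp_norm p (r m - r n) < e" if e: "e > 0" for e
  proof -
    obtain \<delta> where \<delta>: "\<delta> > 0" "\<And>f g. f \<in> Lp p \<Longrightarrow> g \<in> Lp p \<Longrightarrow> Lp_norm p f powr p \<le> (d + 1) powr p \<Longrightarrow> Lp_norm p g powr p \<le> (d + 1) powr p \<Longrightarrow>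
    (Lp_norm p f powr p + Lp_norm p g powr p) / 2 - Lp_norm p (cscale (1/2) (f + g)) powr p < \<delta> \<Longrightarrow> Lp_norm p (f - g) < e"
      by (rule uniform_convexity_Lp[OF p e, of "(d + 1) powr p"]) (simp, rule that)
    obtain N where N: "\<And>n. n \<ge> N \<Longrightarrow> (d + 1 / Suc n) powr p < d powr p + \<delta>"
      using order_tendstoD(2)[OF lim, of "d powr p + \<delta>"] \<delta>(1) by (auto simp: eventually_sequentially)
    have avg: "A < D + x \<Longrightarrow> B < D + x \<Longrightarrow> D \<le> E \<Longrightarrow> (A + B) / 2 - E < x" for A B D E x :: real
      by (simp add: field_simps)
    have b1: "Lp_norm p (y - r n) powr p \<le> (d + 1) powr p" for n
    proof -
      have "1 / real (Suc n) \<le> 1" by simp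
      then have "Lp_norm p (y - r n) \<le> d + 1" using r(2)[of n] by linarith
      then show ?thesis using p1 by (intro powr_mono2) auto
    qed
    have "Lp_norm p (r m - r n) < e" if mn: "m \<ge> N" "n \<ge> N" for m n
    proof -
      have b2: "Lp_norm p (y - r k) powr p < d powr p + \<delta>" if "k \<ge> N" for k
        using N[OF that] powr_mono2[of p "Lp_norm p (y - r k)" "d + 1 / Suc k"] p1 r(2)[of k] by auto
      have "cscale (1/2) (r n + r m) \<in> R" by (intro circ.subspace_scale circ.subspace_add R r)
      then have "d \<le> Lp_norm p (y - cscale (1/2) (r n + r m))" by (rule dle)
      moreover have "y - cscale (1/2) (r n + r m) = cscale (1/2) ((y - r n) + (y - r m))"
      proof -
        have "y = cscale (1/2 + 1/2) y" by simp
        also have "\<dots> = cscale (1/2) y + cscale (1/2) y" by (rule circ.scale_left_distrib)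
        finally have "y = cscale (1/2) (y + y)" by (simp only: circ.scale_right_distrib)
        then have "y - cscale (1/2) (r n + r m) = cscale (1/2) (y + y) - cscale (1/2) (r n + r m)" by simp
        also have "\<dots> = cscale (1/2) ((y + y) - (r n + r m))" by (rule circ.scale_right_diff_distrib[symmetric])
        also have "(y + y) - (r n + r m) = (y - r n) + (y - r m)" by simp
        finally show ?thesis .
      qed
      ultimately have "d powr p \<le> Lp_norm p (cscale (1/2) ((y - r n) + (y - r m))) powr p"
        using d0 p1 by (intro powr_mono2) auto
      then have "Lp_norm p ((y - r n) - (y - r m)) < e"
        by (intro \<delta>(2) dl b1 avg[OF b2[OF mn(2)] b2[OF mn(1)]])
      also have "(y - r n) - (y - r m) = r m - r n" by simp
      finally show ?thesis .
    qed
    then show ?thesis by blast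
  qed
  obtain g where g: "g \<in> Lp p" "(\<lambda>n. Lp_norm p (r n - g)) \<longlonglongrightarrow> 0"
    by (rule Lp_complete[OF p1(1) RL[OF r(1)] cau]) (assumption, rule that)
  have gH: "g \<in> Hp p" using Hp_closed[OF p _ g] R r by blast
  have gR: "g \<in> R" using R(3) r(1) g(2) gH unfolding closed_in_Hp_def by blast
  have "Lp_norm p (y - g) \<le> d"
  proof (rule LIMSEQ_le_const)
    have "(\<lambda>n. (d + inverse (real (Suc n))) + Lp_norm p (r n - g)) \<longlonglongrightarrow> (d + 0) + 0"
      by (intro tendsto_add tendsto_const LIMSEQ_inverse_real_of_nat g)
    then show "(\<lambda>n. (d + 1 / Suc n) + Lp_norm p (r n - g)) \<longlonglongrightarrow> d" by (simp add: inverse_eq_divide)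
    have "Lp_norm p (y - g) \<le> (d + 1 / Suc n) + Lp_norm p (r n - g)" for n
    proof -
      have "y - g = (y - r n) + (r n - g)" by simp
      then have "Lp_norm p (y - g) \<le> Lp_norm p (y - r n) + Lp_norm p (r n - g)"
        using Lp_norm_triangle[OF dl Lp_diff[OF RL[OF r(1)] g(1) p1(1)] p1(1), of n n] by metis
      then show ?thesis using r(2)[of n] by linarith
    qed
    then show "\<exists>N. \<forall>n\<ge>N. Lp_norm p (y - g) \<le> (d + 1 / Suc n) + Lp_norm p (r n - g)" by blast
  qed
  then show ?thesis using that[OF gR] dle by (meson order_trans)
qed

text \<open>Dominated convergence in L^q: all moduli stay below (|w| + |s|)^(p-1), the modulus of
  the dual element of |w| + |s|.\<close>

lemma dual_map_tendsto:
  assumes pq: "conjugate_exponents p q" and w: "w \<in> Lp p" and s: "s \<in> Lp p"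
  shows "(\<lambda>n. Lp_norm q (dual_map p (w - cscale (of_real (1 / Suc n)) s) - dual_map p w)) \<longlonglongrightarrow> 0"
proof -
  have p: "p > 1" "q > 1" using pq by (auto simp: conjugate_exponents_def)
  define W where "W = abs_circ_fun (\<lambda>t. complex_of_real (norm (rep w t) + norm (rep s t)))"
  have "(\<lambda>t. complex_of_real (norm (rep w t) + norm (rep s t))) \<in> borel_measurable borel" by simp
  from rep_abs[OF this] have rW: "AE t in arc_measure. rep W t = complex_of_real (norm (rep w t) + norm (rep s t))"
    by (simp add: W_def)
  have WL: "W \<in> Lp p"
  proof -
    define w' s' where "w' = abs_circ_fun (\<lambda>t. complex_of_real (norm (rep w t)))" and "s' = abs_circ_fun (\<lambda>t. complex_of_real (norm (rep s t)))"
    have "(\<lambda>t. complex_of_real (norm (rep w t))) \<in> borel_measurable borel" "(\<lambda>t. complex_of_real (norm (rep s t))) \<in> borel_measurable borel" by auto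
    from rep_abs[OF this(1)] rep_abs[OF this(2)]
    have r: "AE t in arc_measure. rep w' t = complex_of_real (norm (rep w t))" "AE t in arc_measure. rep s' t = complex_of_real (norm (rep s t))"
      by (auto simp: w'_def s'_def)
    have "w' \<in> Lp p" "s' \<in> Lp p"
    proof -
      have "AE t in arc_measure. norm (rep w' t) = norm (rep w t)" using r(1) by eventually_elim simp
      then show "w' \<in> Lp p" using Lp_cong w by blast
      have "AE t in arc_measure. norm (rep s' t) = norm (rep s t)" using r(2) by eventually_elim simp
      then show "s' \<in> Lp p" using Lp_cong s by blast
    qed
    moreover have "W = w' + s'" by (rule circ_fun_eqI) (use r rW rep_add[of w' s'] in \<open>eventually_elim, simp\<close>)
    ultimately show ?thesis using p by (simp add: Lp_add)
  qed
  have nd: "norm (complex_of_real (norm z powr (p - 2)) * z) = norm z powr (p - 1)" for z :: complex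
    using powr_add[of "norm z" "p - 2" 1] by (cases "z = 0") (auto simp: norm_mult)
  show ?thesis
  proof (rule Lp_dominated_convergence[OF _ dual_map(1)[OF pq WL]])
    show "1 \<le> q" using p by simp
    have all: "AE t in arc_measure. \<forall>n. rep (dual_map p (w - cscale (of_real (1 / Suc n)) s)) t =
      (let z = rep w t - of_real (1 / Suc n) * rep s t in complex_of_real (norm z powr (p - 2)) * z)"
      unfolding AE_all_countable
    proof
      fix n show "AE t in arc_measure. rep (dual_map p (w - cscale (of_real (1 / Suc n)) s)) t =
        (let z = rep w t - of_real (1 / Suc n) * rep s t in complex_of_real (norm z powr (p - 2)) * z)"
        using rep_dual_map[of p "w - cscale (of_real (1 / Suc n)) s"] rep_diff[of w "cscale (of_real (1 / Suc n)) s"]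
          rep_cscale[of "of_real (1 / Suc n)" s]
        unfolding Let_def by eventually_elim metis
    qed
    show "AE t in arc_measure. (\<lambda>n. rep (dual_map p (w - cscale (of_real (1 / Suc n)) s)) t) \<longlonglongrightarrow> rep (dual_map p w) t"
      using all rep_dual_map[of p w]
    proof eventually_elim
      case (elim t)
      define z where "z n = rep w t - of_real (1 / Suc n) * rep s t" for n
      have "(\<lambda>n. rep w t - of_real (inverse (real (Suc n))) * rep s t) \<longlonglongrightarrow> rep w t - of_real 0 * rep s t"
        by (intro tendsto_intros LIMSEQ_inverse_real_of_nat)
      then have z: "z \<longlonglongrightarrow> rep w t" by (simp add: z_def[abs_def] inverse_eq_divide)
      have "(\<lambda>n. complex_of_real (norm (z n) powr (p - 2)) * z n) \<longlonglongrightarrow> complex_of_real (norm (rep w t) powr (p - 2)) * rep w t"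
      proof (cases "rep w t = 0")
        case False
        then show ?thesis using z by (intro tendsto_intros) auto
      next
        case True
        \<comment> \<open>For p < 2 the factor |z|^(p-2) alone is unbounded near 0; the modulus
          |z|^(p-1) of the product tends to 0.\<close>
        have "(\<lambda>n. norm (z n) powr (p - 1)) \<longlonglongrightarrow> norm (0::complex) powr (p - 1)"
          using z p True by (intro tendsto_powr' tendsto_norm tendsto_const) auto
        then have "(\<lambda>n. norm (complex_of_real (norm (z n) powr (p - 2)) * z n)) \<longlonglongrightarrow> 0" unfolding nd using p by simp
        then have "(\<lambda>n. complex_of_real (norm (z n) powr (p - 2)) * z n) \<longlonglongrightarrow> 0" by (rule tendsto_norm_zero_cancel)
        then show ?thesis using True by simp
      qed
      then show ?case using elim by (simp add: z_def Let_def)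
    qed
    show "AE t in arc_measure. norm (rep (dual_map p (w - cscale (of_real (1 / Suc n)) s)) t) \<le> norm (rep (dual_map p W) t)" for n
      using all rep_dual_map[of p W] rW
    proof eventually_elim
      case (elim t)
      define z where "z = rep w t - of_real (1 / Suc n) * rep s t"
      have "norm (complex_of_real (1 / Suc n) * rep s t) \<le> norm (rep s t)"
      proof -
        have "norm (complex_of_real (1 / Suc n)) \<le> 1" by (simp only: norm_of_real) simp
        then show ?thesis unfolding norm_mult by (intro mult_left_le_one_le) auto
      qed
      then have "norm z \<le> norm (rep w t) + norm (rep s t)"
        unfolding z_def using norm_triangle_ineq4[of "rep w t" "of_real (1 / Suc n) * rep s t"] by linarith
      also have "\<dots> = norm (rep W t)" unfolding elim(3) norm_of_real by simp
      finally have "norm z powr (p - 1) \<le> norm (rep W t) powr (p - 1)" using p by (intro powr_mono2) auto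
      then have "norm (complex_of_real (norm z powr (p - 2)) * z) \<le> norm (complex_of_real (norm (rep W t) powr (p - 2)) * rep W t)"
        unfolding nd .
      then show ?case using elim by (simp add: z_def Let_def)
    qed
  qed
qed

text \<open>No derivative of the norm is needed: for \<open>v = w - t u\<close> Hoelder's inequality and minimality give
  \<open>Re \<langle>w, D v\<rangle> \<le> \<parallel>v\<parallel>\<^sup>p = \<langle>v, D v\<rangle>\<close>, and \<open>t \<rightarrow> 0\<close>.\<close>

lemma nearest_point_orthogonal:
  assumes pq: "conjugate_exponents p q" and R: "R \<subseteq> Hp p" "circ.subspace R" and w: "w \<in> Lp p"
    and min: "\<And>s. s \<in> R \<Longrightarrow> Lp_norm p w \<le> Lp_norm p (w - s)" and s: "s \<in> R"
  shows "pairing s (dual_map p w) = 0"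
proof -
  have p: "p > 1" "q > 1" using pq by (auto simp: conjugate_exponents_def)
  have RL: "u \<in> Lp p" if "u \<in> R" for u using that R Hp_Lp by blast
  have step: "Re (pairing u (dual_map p w)) \<le> 0" if u: "u \<in> R" for u
  proof -
    define v where "v n = w - cscale (of_real (1 / Suc n)) u" for n
    have cu: "cscale (of_real (1 / Suc n)) u \<in> R" for n using u R by (intro circ.subspace_scale)
    have vL: "v n \<in> Lp p" for n unfolding v_def using w RL[OF cu] p by (intro Lp_diff) auto
    note uL = RL[OF u]
    have le: "Re (pairing u (dual_map p (v n))) \<le> 0" for n
    proof -
      have "Re (pairing w (dual_map p (v n))) \<le> norm (pairing w (dual_map p (v n)))" by (rule complex_Re_le_cmod)
      also have "\<dots> \<le> Lp_norm p w * Lp_norm p (v n) powr (p - 1)"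
        using norm_pairing_le[OF pq w dual_map(1)[OF pq vL]] by (simp add: dual_map(2)[OF pq vL])
      also have "\<dots> \<le> Lp_norm p (v n) * Lp_norm p (v n) powr (p - 1)"
        using min[OF cu, of n] by (intro mult_right_mono) (auto simp: v_def)
      also have "\<dots> = Lp_norm p (v n) powr p"
        using powr_add[of "Lp_norm p (v n)" 1 "p - 1"] by (cases "Lp_norm p (v n) = 0") auto
      also have "\<dots> = Re (pairing (v n) (dual_map p (v n)))" by (simp add: dual_map(3)[OF pq vL])
      finally have "Re (pairing (w - v n) (dual_map p (v n))) \<le> 0"
        using pairing_diff_left[OF pq w vL dual_map(1)[OF pq vL], of n n] by simp
      also have "w - v n = cscale (of_real (1 / Suc n)) u" by (simp add: v_def)
      finally have "1 / Suc n * Re (pairing u (dual_map p (v n))) \<le> 0"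
        by (simp only: pairing_cscale_left Re_complex_of_real Im_complex_of_real times_complex.sel)
      then show ?thesis by (simp add: mult_le_0_iff divide_le_0_iff)
    qed
    have "(\<lambda>n. pairing u (dual_map p (v n)) - pairing u (dual_map p w)) \<longlonglongrightarrow> 0"
    proof (rule Lim_null_comparison)
      show "\<forall>\<^sub>F n in sequentially. norm (pairing u (dual_map p (v n)) - pairing u (dual_map p w)) \<le>
          Lp_norm p u * Lp_norm q (dual_map p (v n) - dual_map p w)"
      proof (intro always_eventually allI)
        fix n
        show "norm (pairing u (dual_map p (v n)) - pairing u (dual_map p w)) \<le> Lp_norm p u * Lp_norm q (dual_map p (v n) - dual_map p w)"
          using pairing_diff_right[OF pq uL dual_map(1)[OF pq vL] dual_map(1)[OF pq w], of n]
            norm_pairing_le[OF pq uL Lp_diff[OF dual_map(1)[OF pq vL] dual_map(1)[OF pq w]], of n] p by simp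
      qed
      have "(\<lambda>n. Lp_norm p u * Lp_norm q (dual_map p (v n) - dual_map p w)) \<longlonglongrightarrow> Lp_norm p u * 0"
        unfolding v_def by (intro tendsto_mult tendsto_const dual_map_tendsto[OF pq w uL])
      then show "(\<lambda>n. Lp_norm p u * Lp_norm q (dual_map p (v n) - dual_map p w)) \<longlonglongrightarrow> 0" by simp
    qed
    then have "(\<lambda>n. pairing u (dual_map p (v n))) \<longlonglongrightarrow> pairing u (dual_map p w)" by (simp add: LIM_zero_iff)
    then have "(\<lambda>n. Re (pairing u (dual_map p (v n)))) \<longlonglongrightarrow> Re (pairing u (dual_map p w))" by (rule tendsto_Re)
    then show ?thesis using le by (intro LIMSEQ_le_const2) auto
  qed
  define z where "z = pairing s (dual_map p w)"
  \<comment> \<open>Scaling s by \<open>cnj z\<close> turns the bound on the real part into a bound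
    on |z|^2.\<close>
  have "Re (cnj z * z) \<le> 0"
    using step[of "cscale (cnj z) s"] circ.subspace_scale[OF R(2) s] by (simp add: pairing_cscale_left z_def)
  then have "(norm z)\<^sup>2 \<le> 0" using complex_norm_square[of z] by (metis Re_complex_of_real mult.commute)
  then show ?thesis by (simp add: z_def)
qed

text \<open>The residual w of the nearest point has a dual element orthogonal to R. Its Riesz
  projection lies in H^q and defines the same functional on H^p. This takes the place of the
  Hahn-Banach theorem.\<close>

lemma Hp_annihilator:
  assumes pq: "conjugate_exponents p q" and R: "R \<subseteq> Hp p" "circ.subspace R" "closed_in_Hp p R"
    and y: "y \<in> Hp p" "y \<notin> R"
  obtains g where "g \<in> Hp q" "\<And>r. r \<in> R \<Longrightarrow> pairing r g = 0" "pairing y g \<noteq> 0"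
proof -
  have p: "p > 1" "q > 1" using pq by (auto simp: conjugate_exponents_def)
  obtain r where r: "r \<in> R" "\<And>s. s \<in> R \<Longrightarrow> Lp_norm p (y - r) \<le> Lp_norm p (y - s)"
    using nearest_point[OF p(1) R y(1)] by metis
  define w where "w = y - r"
  have rH: "r \<in> Hp p" using r R by blast
  have wL: "w \<in> Lp p" "w \<noteq> 0" using y rH p r by (auto simp: w_def Hp_Lp Lp_diff)
  have orth: "pairing s (dual_map p w) = 0" if "s \<in> R" for s
  proof (rule nearest_point_orthogonal[OF pq R(1,2) wL(1) _ that])
    fix s assume "s \<in> R"
    then have "Lp_norm p (y - r) \<le> Lp_norm p (y - (r + s))" using circ.subspace_add[OF R(2) r(1)] by (intro r)
    then show "Lp_norm p w \<le> Lp_norm p (w - s)" by (simp add: w_def diff_diff_eq)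
  qed
  define g where "g = riesz (dual_map p w)"
  note D = dual_map(1)[OF pq wL(1)]
  have pg: "pairing f g = pairing f (dual_map p w)" if "f \<in> Hp p" for f
    using pairing_riesz[OF pq Hp_Lp[OF that] D] riesz_id[OF p(1) that] by (simp add: g_def)
  show ?thesis
  proof (rule that[of g])
    show "g \<in> Hp q" unfolding g_def by (rule riesz_Hp[OF p(2) D])
    show "pairing s g = 0" if "s \<in> R" for s using orth[OF that] pg that R by auto
    have "pairing y g = pairing w (dual_map p w) + pairing r (dual_map p w)"
      using pg[OF y(1)] pairing_diff_left[OF pq Hp_Lp[OF y(1)] Hp_Lp[OF rH] D] by (simp add: w_def)
    also have "\<dots> = complex_of_real (Lp_norm p w powr p)" using orth[OF r(1)] dual_map(3)[OF pq wL(1)] by simp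
    finally show "pairing y g \<noteq> 0" using wL Lp_norm_eq_0[of w p] p by auto
  qed
qed

text \<open>A functional is determined up to a factor by its kernel; an annihilator of the kernel is
  rescaled at one y outside it. The scalar is conjugated because the pairing is conjugate linear in
  its second argument.\<close>

lemma Hp_dual_representation:
  assumes pq: "conjugate_exponents p q"
    and add: "\<And>f g. f \<in> Hp p \<Longrightarrow> g \<in> Hp p \<Longrightarrow> l (f + g) = l f + l g"
    and scale: "\<And>z f. f \<in> Hp p \<Longrightarrow> l (cscale z f) = z * l f"
    and bound: "\<And>f. f \<in> Hp p \<Longrightarrow> norm (l f) \<le> C * Lp_norm p f"
  obtains g where "g \<in> Hp q" "\<And>f. f \<in> Hp p \<Longrightarrow> l f = pairing f g"
proof (cases "\<forall>f\<in>Hp p. l f = 0")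
  case True
  have "0 \<in> Hp q" using pq by (simp add: Hp_def conjugate_exponents_def)
  then show ?thesis using True that[of 0] by (simp add: pairing_fourier)
next
  case False
  have p: "p > 1" "q > 1" using pq by (auto simp: conjugate_exponents_def)
  obtain y where y: "y \<in> Hp p" "l y \<noteq> 0" using False by blast
  have diff: "l (f - g) = l f - l g" if "f \<in> Hp p" "g \<in> Hp p" for f g
    using add[of f "cscale (-1) g"] scale[of g "-1"] that Hp_scale[OF p(1) that(2), of "-1"] by (simp add: circ.scale_minus_left)
  define R where "R = {f \<in> Hp p. l f = 0}"
  have R: "R \<subseteq> Hp p" "circ.subspace R"
    using subspace_Hp[OF p(1)] scale[of 0 0] by (auto simp: R_def circ.subspace_def add scale)
  have "closed_in_Hp p R" unfolding closed_in_Hp_def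
  proof (intro allI impI, elim conjE)
    fix f g assume f: "\<forall>n::nat. f n \<in> R" and g: "g \<in> Hp p" and lim: "(\<lambda>n. Lp_norm p (f n - g)) \<longlonglongrightarrow> 0"
    have "norm (l g) \<le> C * Lp_norm p (f n - g)" for n
    proof -
      have fn: "f n \<in> Hp p" "l (f n) = 0" using f by (auto simp: R_def)
      show ?thesis using bound[OF Hp_diff[OF p(1) fn(1) g]] diff[OF fn(1) g] fn(2) by simp
    qed
    moreover have "(\<lambda>n. C * Lp_norm p (f n - g)) \<longlonglongrightarrow> C * 0" by (intro tendsto_intros lim)
    ultimately have "norm (l g) \<le> 0" by (intro LIMSEQ_le_const) auto
    then show "g \<in> R" using g by (simp add: R_def)
  qed
  moreover have "y \<notin> R" using y by (simp add: R_def)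
  ultimately obtain g where g: "g \<in> Hp q" "\<And>r. r \<in> R \<Longrightarrow> pairing r g = 0" "pairing y g \<noteq> 0"
    using Hp_annihilator[OF pq R _ y(1)] by metis
  define z where "z = l y / pairing y g"
  show ?thesis
  proof (rule that[of "cscale (cnj z) g"])
    show "cscale (cnj z) g \<in> Hp q" by (rule Hp_scale[OF p(2) g(1)])
    fix f assume f: "f \<in> Hp p"
    define k where "k = l f / l y"
    have ky: "cscale k y \<in> Hp p" by (rule Hp_scale[OF p(1) y(1)])
    have "f - cscale k y \<in> R"
      using f ky y by (simp add: R_def diff scale Hp_diff[OF p(1)] k_def)
    from g(2)[OF this] have "pairing f g = k * pairing y g"
      using pairing_diff_left[OF pq Hp_Lp[OF f] Hp_Lp[OF ky] Hp_Lp[OF g(1)]] by (simp add: pairing_cscale_left)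
    then show "l f = pairing f (cscale (cnj z) g)"
      using y(2) g(3) by (simp add: pairing_cscale_right z_def k_def)
  qed
qed

section \<open>Bounded inverses\<close>

lemma Lp_norm_minus_commute: "Lp_norm p (f - g) = Lp_norm p (g - f)"
proof (rule Lp_norm_cong)
  show "AE t in arc_measure. norm (rep (f - g) t) = norm (rep (g - f) t)"
    using rep_diff[of f g] rep_diff[of g f] by eventually_elim (simp add: norm_minus_commute)
qed

lemma Metric_space_Hp: "1 < p \<Longrightarrow> Metric_space (Hp p) (\<lambda>x y. Lp_norm p (x - y))"
proof
  assume p: "1 < p"
  show "Lp_norm p (x - y) = 0 \<longleftrightarrow> x = y" if "x \<in> Hp p" "y \<in> Hp p" for x y
    using Lp_norm_eq_0[of "x - y" p] Hp_diff[OF p that] p by (auto simp: Hp_Lp)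
  show "Lp_norm p (x - z) \<le> Lp_norm p (x - y) + Lp_norm p (y - z)" if "x \<in> Hp p" "y \<in> Hp p" "z \<in> Hp p" for x y z
    using Lp_norm_triangle[of "x - y" p "y - z"] Hp_diff[OF p] that p by (auto simp: Hp_Lp)
qed (simp_all add: Lp_norm_minus_commute)

lemma Hp_complete:
  fixes f :: "nat \<Rightarrow> circ_fun"
  assumes p: "1 < p" and f: "\<And>n. f n \<in> Hp p"
    and cauchy: "\<And>e. e > 0 \<Longrightarrow> \<exists>N. \<forall>m\<ge>N. \<forall>n\<ge>N. Lp_norm p (f m - f n) < e"
  obtains g where "g \<in> Hp p" "(\<lambda>n. Lp_norm p (f n - g)) \<longlonglongrightarrow> 0"
proof -
  have p1: "p \<ge> 1" using p by simp
  obtain g where g: "g \<in> Lp p" "(\<lambda>n. Lp_norm p (f n - g)) \<longlonglongrightarrow> 0"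
    by (rule Lp_complete[OF p1 Hp_Lp[OF f] cauchy]) (assumption, rule that)
  then show ?thesis using that Hp_closed[OF p f g] by blast
qed

lemma bounded_operator_imp:
  assumes "bounded_operator p A"
  shows "f \<in> Hp p \<Longrightarrow> A f \<in> Hp p" "f \<in> Hp p \<Longrightarrow> g \<in> Hp p \<Longrightarrow> A (f + g) = A f + A g"
    "f \<in> Hp p \<Longrightarrow> A (cscale z f) = cscale z (A f)"
  using assms by (auto simp: bounded_operator_def)

lemma bounded_operatorE:
  assumes "bounded_operator p A"
  obtains C where "C > 0" "\<And>f. f \<in> Hp p \<Longrightarrow> Lp_norm p (A f) \<le> C * Lp_norm p f"
proof -
  obtain C where C: "\<And>f. f \<in> Hp p \<Longrightarrow> Lp_norm p (A f) \<le> C * Lp_norm p f"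
    using assms unfolding bounded_operator_def by blast
  have "Lp_norm p (A f) \<le> max C 1 * Lp_norm p f" if "f \<in> Hp p" for f
    using C[OF that] mult_right_mono[of C "max C 1" "Lp_norm p f"] by simp
  then show ?thesis using that[of "max C 1"] by auto
qed

lemma bounded_operator_diff:
  assumes "bounded_operator p A" "1 < p" "f \<in> Hp p" "g \<in> Hp p"
  shows "A (f - g) = A f - A g"
  using bounded_operator_imp(2)[OF assms(1,3) Hp_scale[OF assms(2,4), of "-1"]]
    bounded_operator_imp(3)[OF assms(1,4), of "-1"] by (simp add: circ.scale_minus_left)

lemma bounded_operator_zero: "bounded_operator p A \<Longrightarrow> 1 < p \<Longrightarrow> A 0 = 0"
  using bounded_operator_imp(3)[of p A 0 0] Hp_0 by simp

text \<open>The open mapping theorem, through the Baire category theorem: the sets \<open>C n\<close> of approximate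
  images of balls are closed and cover the space.\<close>

lemma approximate_preimages:
  assumes p: "1 < p" and A: "bounded_operator p A" and surj: "Hp p \<subseteq> A ` Hp p"
  obtains K where "K \<ge> 0" "\<And>y. y \<in> Hp p \<Longrightarrow> \<exists>x\<in>Hp p. Lp_norm p x \<le> K * Lp_norm p y \<and> Lp_norm p (y - A x) \<le> Lp_norm p y / 2"
proof -
  interpret M: Metric_space "Hp p" "\<lambda>x y. Lp_norm p (x - y)" by (rule Metric_space_Hp[OF p])
  have p1: "p \<ge> 1" "p > 0" using p by auto
  define C where "C n = {y \<in> Hp p. \<forall>e>0. \<exists>x\<in>Hp p. Lp_norm p x \<le> real n \<and> Lp_norm p (y - A x) < e}" for n
  have tri: "Lp_norm p (x - z) \<le> Lp_norm p (x - y) + Lp_norm p (y - z)" if "x \<in> Hp p" "y \<in> Hp p" "z \<in> Hp p" for x y z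
    using M.triangle[OF that] .
  have complete: "M.mcomplete" unfolding M.mcomplete_def
  proof (intro allI impI)
    fix \<sigma> assume "M.MCauchy \<sigma>"
    then have s: "\<And>n. \<sigma> n \<in> Hp p" "\<And>e. e > 0 \<Longrightarrow> \<exists>N. \<forall>m\<ge>N. \<forall>n\<ge>N. Lp_norm p (\<sigma> m - \<sigma> n) < e"
      by (auto simp: M.MCauchy_def)
    obtain g where g: "g \<in> Hp p" "(\<lambda>n. Lp_norm p (\<sigma> n - g)) \<longlonglongrightarrow> 0"
      by (rule Hp_complete[OF p s]) (assumption, rule that)
    then have "limitin M.mtopology \<sigma> g sequentially"
      using s(1) by (auto simp: M.limitin_metric elim!: order_tendstoD)
    then show "\<exists>x. limitin M.mtopology \<sigma> x sequentially" by blast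
  qed
  have closed: "closedin M.mtopology (C n)" for n
  proof -
    have "M.mtopology closure_of C n \<subseteq> C n"
    proof
      fix y assume "y \<in> M.mtopology closure_of C n"
      then have y: "y \<in> Hp p" "\<And>r. r > 0 \<Longrightarrow> \<exists>z\<in>C n. Lp_norm p (y - z) < r"
        by (auto simp: M.metric_closure_of)
      have "\<exists>x\<in>Hp p. Lp_norm p x \<le> real n \<and> Lp_norm p (y - A x) < e" if e: "e > 0" for e
      proof -
        obtain z where z: "z \<in> C n" "Lp_norm p (y - z) < e/2" using y(2)[of "e/2"] e by auto
        then obtain x where x: "x \<in> Hp p" "Lp_norm p x \<le> real n" "Lp_norm p (z - A x) < e/2"
          using e unfolding C_def by (auto dest!: spec[of _ "e/2"])
        have "Lp_norm p (y - A x) < e"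
          using tri[of y z "A x"] y z x bounded_operator_imp(1)[OF A x(1)] by (auto simp: C_def)
        then show ?thesis using x by blast
      qed
      then show "y \<in> C n" using y(1) by (simp add: C_def)
    qed
    moreover have "C n \<subseteq> topspace M.mtopology" by (auto simp: C_def)
    ultimately show ?thesis by (metis closure_of_subset closure_of_subset_eq)
  qed
  have "\<exists>n. M.mtopology interior_of C n \<noteq> {}"
  proof (rule ccontr)
    assume "\<nexists>n. M.mtopology interior_of C n \<noteq> {}"
    then have "M.mtopology interior_of \<Union>(range C) = {}"
      using closed by (intro M.metric_Baire_category_alt[OF complete]) auto
    moreover have "\<Union>(range C) = Hp p"
    proof
      show "Hp p \<subseteq> \<Union>(range C)"
      proof
        fix y assume y: "y \<in> Hp p"
        then obtain x where x: "x \<in> Hp p" "y = A x" using surj by blast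
        obtain n where "Lp_norm p x \<le> real n" using real_arch_simple by blast
        then have "y \<in> C n" unfolding C_def using x y p1 by (auto intro!: bexI[of _ x])
        then show "y \<in> \<Union>(range C)" by blast
      qed
    qed (auto simp: C_def)
    ultimately have "M.mtopology interior_of (Hp p) = {}" by simp
    then have "Hp p = {}" using interior_of_topspace[of M.mtopology] by simp
    then show False using Hp_0[OF p] by blast
  qed
  then obtain n y0 where y0: "y0 \<in> M.mtopology interior_of C n" by blast
  then obtain r where r: "r > 0" "M.mball y0 r \<subseteq> M.mtopology interior_of C n"
    using M.openin_mtopology openin_interior_of by metis
  have ball: "M.mball y0 r \<subseteq> C n" using r(2) interior_of_subset[of M.mtopology "C n"] by (rule subset_trans)
  have y0H: "y0 \<in> Hp p" using y0 interior_of_subset[of M.mtopology "C n"] by (auto simp: C_def)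
  \<comment> \<open>y is rescaled to norm r/2, where approximate preimages have norm at most 2 n;
    undoing the rescaling multiplies by 2/r.\<close>
  define K where "K = 4 * real n / r"
  \<comment> \<open>Subtracting approximate preimages of y0 + y and of y0 moves the ball from y0 to
    the origin, at the price of doubling n.\<close>
  have near: "\<exists>x\<in>Hp p. Lp_norm p x \<le> 2 * real n \<and> Lp_norm p (y - A x) < e"
    if y: "y \<in> Hp p" "Lp_norm p y < r" and e: "e > 0" for y e
  proof -
    have "y0 + y \<in> C n" "y0 \<in> C n"
      using ball y y0H Hp_add[OF p y0H y(1)] r(1) p1 by (auto simp: M.mball_def Lp_norm_minus_commute[of p y0])
    then have e2: "\<exists>x\<in>Hp p. Lp_norm p x \<le> real n \<and> Lp_norm p ((y0 + y) - A x) < e/2"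
        "\<exists>x\<in>Hp p. Lp_norm p x \<le> real n \<and> Lp_norm p (y0 - A x) < e/2"
      using e half_gt_zero[OF e] unfolding C_def by blast+
    obtain x1 x2 where x: "x1 \<in> Hp p" "Lp_norm p x1 \<le> real n" "Lp_norm p ((y0 + y) - A x1) < e/2"
        "x2 \<in> Hp p" "Lp_norm p x2 \<le> real n" "Lp_norm p (y0 - A x2) < e/2" using e2 by blast
    have AH: "A x1 \<in> Hp p" "A x2 \<in> Hp p" using x bounded_operator_imp(1)[OF A] by auto
    have e: "y - A (x1 - x2) = ((y0 + y) - A x1) - (y0 - A x2)"
      using bounded_operator_diff[OF A p x(1,4)] by simp
    have "Lp_norm p (y - A (x1 - x2)) \<le> Lp_norm p ((y0 + y) - A x1) + Lp_norm p (y0 - A x2)"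
      unfolding e
      by (rule Lp_norm_triangle_diff[OF Hp_Lp[OF Hp_diff[OF p Hp_add[OF p y0H y(1)] AH(1)]] Hp_Lp[OF Hp_diff[OF p y0H AH(2)]] p1(1)])
    moreover have "Lp_norm p (x1 - x2) \<le> Lp_norm p x1 + Lp_norm p x2"
      using x p1 by (intro Lp_norm_triangle_diff Hp_Lp)
    ultimately show ?thesis using x Hp_diff[OF p x(1,4)] by (intro bexI[of _ "x1 - x2"]) auto
  qed
  show ?thesis
  proof (rule that[of K])
    show "K \<ge> 0" using r by (simp add: K_def)
    fix y assume y: "y \<in> Hp p"
    show "\<exists>x\<in>Hp p. Lp_norm p x \<le> K * Lp_norm p y \<and> Lp_norm p (y - A x) \<le> Lp_norm p y / 2"
    proof (cases "Lp_norm p y = 0")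
      case True
      then have "y = 0" using Lp_norm_eq_0[of y p] y p1 by (simp add: Hp_Lp)
      then show ?thesis using Hp_0[OF p] bounded_operator_zero[OF A p] p1 by (intro bexI[of _ 0]) auto
    next
      case False
      then have N: "Lp_norm p y > 0" using Lp_norm_nonneg[of p y] by linarith
      define s where "s = r / (2 * Lp_norm p y)"
      have s: "s > 0" "s * Lp_norm p y = r / 2" using r N by (auto simp: s_def)
      define y' where "y' = cscale (of_real s) y"
      have y': "y' \<in> Hp p" "Lp_norm p y' < r"
        using Hp_scale[OF p y] Lp_cscale(2)[OF Hp_Lp[OF y], of "of_real s"] p1 s r by (auto simp: y'_def)
      obtain x where x: "x \<in> Hp p" "Lp_norm p x \<le> 2 * real n" "Lp_norm p (y' - A x) < s * Lp_norm p y / 2"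
        using near[OF y', of "s * Lp_norm p y / 2"] s N by auto
      define x' where "x' = cscale (of_real (1 / s)) x"
      have x'H: "x' \<in> Hp p" unfolding x'_def by (rule Hp_scale[OF p x(1)])
      have nx: "Lp_norm p x' = Lp_norm p x / s"
        using Lp_cscale(2)[OF Hp_Lp[OF x(1)], of "of_real (1 / s)"] p1 s by (simp add: x'_def norm_divide)
      have "y - A x' = cscale (of_real (1 / s)) (y' - A x)"
      proof -
        have "cscale (of_real (1 / s)) y' = y" using s(1) by (simp add: y'_def flip: of_real_mult)
        then show ?thesis using bounded_operator_imp(3)[OF A x(1)] by (simp add: x'_def circ.scale_right_diff_distrib)
      qed
      then have "Lp_norm p (y - A x') = Lp_norm p (y' - A x) / s"
        using Lp_cscale(2)[OF Hp_Lp[OF Hp_diff[OF p y'(1) bounded_operator_imp(1)[OF A x(1)]]], of "of_real (1 / s)"] p1 s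
        by (simp add: norm_divide)
      also have "\<dots> \<le> Lp_norm p y / 2" using x(3) s by (simp add: field_simps)
      finally have 1: "Lp_norm p (y - A x') \<le> Lp_norm p y / 2" .
      have "Lp_norm p x' \<le> 2 * real n / s" unfolding nx using x(2) s by (simp add: divide_right_mono)
      also have "\<dots> = K * Lp_norm p y" using N r by (simp add: K_def s_def)
      finally show ?thesis using 1 x'H by blast
    qed
  qed
qed

text \<open>The residual is fed back into the approximate preimage and halves each time, so the
  corrections form a series dominated by a geometric one; its sum accounts for the factor 2 in the
  constant 2 K.\<close>

lemma bounded_preimages:
  assumes p: "1 < p" and A: "bounded_operator p A" and surj: "Hp p \<subseteq> A ` Hp p"
  obtains K where "\<And>y. y \<in> Hp p \<Longrightarrow> \<exists>x\<in>Hp p. A x = y \<and> Lp_norm p x \<le> K * Lp_norm p y"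
proof -
  have p1: "p \<ge> 1" "p > 0" using p by auto
  obtain K where K: "K \<ge> 0" "\<And>y. y \<in> Hp p \<Longrightarrow> \<exists>x\<in>Hp p. Lp_norm p x \<le> K * Lp_norm p y \<and> Lp_norm p (y - A x) \<le> Lp_norm p y / 2"
    using approximate_preimages[OF p A surj] by metis
  obtain F where F: "\<And>y. y \<in> Hp p \<Longrightarrow> F y \<in> Hp p" "\<And>y. y \<in> Hp p \<Longrightarrow> Lp_norm p (F y) \<le> K * Lp_norm p y"
    "\<And>y. y \<in> Hp p \<Longrightarrow> Lp_norm p (y - A (F y)) \<le> Lp_norm p y / 2" using K(2) by metis
  obtain C where C: "C > 0" "\<And>f. f \<in> Hp p \<Longrightarrow> Lp_norm p (A f) \<le> C * Lp_norm p f" by (rule bounded_operatorE[OF A]) (rule that)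
  show ?thesis
  proof (rule that[of "2 * K"])
    fix y assume y: "y \<in> Hp p"
    define s where "s = rec_nat 0 (\<lambda>_ s. s + F (y - A s))"
    have s0: "s 0 = 0" and sS: "s (Suc k) = s k + F (y - A (s k))" for k by (simp_all add: s_def)
    have sH: "s k \<in> Hp p" for k
      by (induction k) (auto simp: s0 sS Hp_0[OF p] Hp_add[OF p] Hp_diff[OF p] F y bounded_operator_imp(1)[OF A])
    have AH: "A (s k) \<in> Hp p" for k using sH bounded_operator_imp(1)[OF A] by blast
    have dH: "y - A (s k) \<in> Hp p" for k by (rule Hp_diff[OF p y AH])
    have res: "Lp_norm p (y - A (s k)) \<le> Lp_norm p y * (1/2)^k" for k
    proof (induction k)
      case (Suc k)
      have e: "y - A (s (Suc k)) = (y - A (s k)) - A (F (y - A (s k)))"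
        unfolding sS by (simp add: bounded_operator_imp(2)[OF A sH F(1)[OF dH]])
      have "Lp_norm p (y - A (s (Suc k))) \<le> Lp_norm p (y - A (s k)) / 2"
        by (subst e) (rule F(3)[OF dH])
      then show ?case using Suc by simp
    qed (simp add: s0 bounded_operator_zero[OF A p])
    define L where "L = K * Lp_norm p y"
    have L: "L \<ge> 0" using K by (simp add: L_def)
    have step: "Lp_norm p (s (Suc k) - s k) \<le> L * (1/2)^k" for k
    proof -
      have "Lp_norm p (s (Suc k) - s k) \<le> K * Lp_norm p (y - A (s k))" using F(2)[OF dH, of k] by (simp add: sS)
      also have "\<dots> \<le> K * (Lp_norm p y * (1/2)^k)" by (rule mult_left_mono[OF res K(1)])
      finally show ?thesis by (simp add: L_def)
    qed
    have tele: "Lp_norm p (s (k + j) - s k) \<le> 2 * L * ((1/2)^k - (1/2)^(k + j))" for k j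
    proof (induction j)
      case (Suc j)
      have "s (k + Suc j) - s k = (s (Suc (k + j)) - s (k + j)) + (s (k + j) - s k)" by simp
      then have "Lp_norm p (s (k + Suc j) - s k) \<le> Lp_norm p (s (Suc (k + j)) - s (k + j)) + Lp_norm p (s (k + j) - s k)"
        using Lp_norm_triangle[OF Hp_Lp[OF Hp_diff[OF p sH sH]] Hp_Lp[OF Hp_diff[OF p sH sH]] p1(1)] by metis
      also have "\<dots> \<le> L * (1/2)^(k + j) + 2 * L * ((1/2)^k - (1/2)^(k + j))" by (intro add_mono step Suc)
      also have "\<dots> = 2 * L * ((1/2)^k - (1/2)^(k + Suc j))" by (simp add: algebra_simps)
      finally show ?case .
    qed (use p1 in simp)
    have bd: "Lp_norm p (s m - s k) \<le> 2 * L * (1/2)^k" if "k \<le> m" for k m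
    proof -
      have "Lp_norm p (s m - s k) \<le> 2 * L * ((1/2)^k - (1/2)^m)" using tele[of k "m - k"] that by simp
      also have "\<dots> \<le> 2 * L * (1/2)^k" using L by (intro mult_left_mono) auto
      finally show ?thesis .
    qed
    have lim0: "(\<lambda>k. 2 * L * (1/2)^k) \<longlonglongrightarrow> 0"
      using tendsto_mult_left[OF LIMSEQ_realpow_zero[of "1/2::real"], of "2 * L"] by simp
    have cau: "\<exists>N. \<forall>m\<ge>N. \<forall>n\<ge>N. Lp_norm p (s m - s n) < e" if e: "e > 0" for e
    proof -
      obtain N where N: "\<And>n. n \<ge> N \<Longrightarrow> 2 * L * (1/2)^n < e"
        using order_tendstoD(2)[OF lim0 e] by (auto simp: eventually_sequentially)
      have "Lp_norm p (s m - s n) < e" if "m \<ge> N" "n \<ge> N" for m n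
      proof (cases "n \<le> m")
        case True
        then show ?thesis using bd[OF True] N[OF that(2)] by linarith
      next
        case False
        then show ?thesis using bd[of m n] N[OF that(1)] Lp_norm_minus_commute[of p "s m" "s n"] by simp
      qed
      then show ?thesis by blast
    qed
    obtain x where x: "x \<in> Hp p" "(\<lambda>n. Lp_norm p (s n - x)) \<longlonglongrightarrow> 0"
      by (rule Hp_complete[OF p sH cau]) (assumption, rule that)
    have "Lp_norm p x \<le> 2 * L"
    proof (rule LIMSEQ_le_const)
      show "(\<lambda>n. 2 * L + Lp_norm p (s n - x)) \<longlonglongrightarrow> 2 * L" using tendsto_add[OF tendsto_const x(2)] by simp
      have "Lp_norm p x \<le> 2 * L + Lp_norm p (s n - x)" for n
        using bd[of 0 n] Lp_norm_triangle_diff[OF Hp_Lp[OF sH] Hp_Lp[OF Hp_diff[OF p sH x(1)]] p1(1), of n n] by (simp add: s0)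
      then show "\<exists>N. \<forall>n\<ge>N. Lp_norm p x \<le> 2 * L + Lp_norm p (s n - x)" by blast
    qed
    moreover have "Lp_norm p (y - A x) \<le> 0"
    proof (rule LIMSEQ_le_const)
      have h: "(\<lambda>k. (1/2::real)^k) \<longlonglongrightarrow> 0" by (rule LIMSEQ_realpow_zero) auto
      then have "(\<lambda>n. Lp_norm p y * (1/2)^n + C * Lp_norm p (s n - x)) \<longlonglongrightarrow> Lp_norm p y * 0 + C * 0"
        by (intro tendsto_add tendsto_mult tendsto_const x h)
      then show "(\<lambda>n. Lp_norm p y * (1/2)^n + C * Lp_norm p (s n - x)) \<longlonglongrightarrow> 0" by simp
      have "Lp_norm p (y - A x) \<le> Lp_norm p y * (1/2)^n + C * Lp_norm p (s n - x)" for n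
      proof -
        have "y - A x = (y - A (s n)) + A (s n - x)" using bounded_operator_diff[OF A p sH x(1)] by simp
        then have "Lp_norm p (y - A x) \<le> Lp_norm p (y - A (s n)) + Lp_norm p (A (s n - x))"
          using Lp_norm_triangle[OF Hp_Lp[OF dH] Hp_Lp[OF bounded_operator_imp(1)[OF A Hp_diff[OF p sH x(1)]]] p1(1)] by metis
        then show ?thesis using res[of n] C(2)[OF Hp_diff[OF p sH x(1)], of n] by linarith
      qed
      then show "\<exists>N. \<forall>n\<ge>N. Lp_norm p (y - A x) \<le> Lp_norm p y * (1/2)^n + C * Lp_norm p (s n - x)" by blast
    qed
    then have "y - A x = 0"
      using Lp_norm_eq_0[of "y - A x" p] Lp_norm_nonneg[of p "y - A x"] Hp_Lp[OF Hp_diff[OF p y bounded_operator_imp(1)[OF A x(1)]]] p1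
      by (metis order_antisym)
    ultimately show "\<exists>x\<in>Hp p. A x = y \<and> Lp_norm p x \<le> 2 * K * Lp_norm p y" using x(1) by (auto simp: L_def)
  qed
qed

lemma bounded_inverse:
  assumes p: "1 < p" and A: "bounded_operator p A" and bij: "bij_betw A (Hp p) (Hp p)"
  shows "bounded_operator p (the_inv_into (Hp p) A)"
proof -
  have inj: "inj_on A (Hp p)" and surj: "A ` Hp p = Hp p" using bij by (auto simp: bij_betw_def)
  obtain K where K: "\<And>y. y \<in> Hp p \<Longrightarrow> \<exists>x\<in>Hp p. A x = y \<and> Lp_norm p x \<le> K * Lp_norm p y"
    using bounded_preimages[OF p A] surj by blast
  let ?B = "the_inv_into (Hp p) A"
  have B: "?B y \<in> Hp p" "A (?B y) = y" if "y \<in> Hp p" for y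
    using that surj the_inv_into_into[OF inj, of y "Hp p"] f_the_inv_into_f[OF inj, of y] by auto
  have Beq: "?B y = x" if "x \<in> Hp p" "A x = y" for x y using the_inv_into_f_eq[OF inj] that by blast
  show ?thesis unfolding bounded_operator_def
  proof (intro conjI ballI allI exI[of _ K])
    fix f assume f: "f \<in> Hp p"
    show "?B f \<in> Hp p" by (rule B[OF f])
    obtain x where "x \<in> Hp p" "A x = f" "Lp_norm p x \<le> K * Lp_norm p f" using K[OF f] by blast
    then show "Lp_norm p (?B f) \<le> K * Lp_norm p f" using Beq by simp
    show "?B (cscale z f) = cscale z (?B f)" for z
      using B[OF f] by (intro Beq) (auto simp: Hp_scale[OF p] bounded_operator_imp(3)[OF A])
    show "?B (f + g) = ?B f + ?B g" if g: "g \<in> Hp p" for g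
      using B[OF f] B[OF g] by (intro Beq) (auto simp: Hp_add[OF p] bounded_operator_imp(2)[OF A])
  qed
qed

section \<open>Fredholm Toeplitz operators\<close>

lemma toeplitz_bounded:
  assumes p: "1 < p" and c: "c \<in> Linf"
  shows "bounded_operator p (toeplitz c)"
proof -
  have L: "c * f \<in> Lp p" if "f \<in> Hp p" for f using mult_Lp[OF c Hp_Lp[OF that]] p by simp
  obtain D where D: "D > 0" "AE t in arc_measure. norm (rep c t) \<le> D" using c by (auto elim: LinfE)
  obtain C where C: "C > 0" "\<And>f. f \<in> Lp p \<Longrightarrow> riesz f \<in> Hp p \<and> Lp_norm p (riesz f) \<le> C * Lp_norm p f
     \<and> (\<forall>n\<ge>0. fourier (riesz f) n = fourier f n)" using riesz_bounded[OF p] by blast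
  have "Lp_norm p (toeplitz c f) \<le> C * D * Lp_norm p f" if f: "f \<in> Hp p" for f
  proof -
    have "Lp_norm p (toeplitz c f) \<le> C * Lp_norm p (c * f)" using C(2)[OF L[OF f]] by (simp add: toeplitz_def)
    also have "\<dots> \<le> C * (D * Lp_norm p f)"
      using Linf_mult_Lp(2)[OF D(2) _ Hp_Lp[OF f]] D(1) C(1) p by (intro mult_left_mono) auto
    finally show ?thesis by (simp add: mult.assoc)
  qed
  then show ?thesis unfolding bounded_operator_def toeplitz_def
    using L by (auto simp: riesz_Hp[OF p] distrib_left riesz_add[OF p] cscale_mult riesz_cscale[OF p])
qed

text \<open>For n \<le> 0 multiplication by t^n moves the negative part of f further to the left,
  out of sight of P.\<close>

lemma riesz_monomial_mult:
  assumes p: "1 < p" and f: "f \<in> Lp p" and n: "n \<le> 0"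
  shows "riesz (monomial n * riesz f) = riesz (monomial n * f)"
proof (rule riesz_eqI)
  have L: "monomial n * f \<in> Lp p" using f by (simp add: monomial_mult_Lp)
  show "riesz (monomial n * f) \<in> Hp 1" by (intro Hp_Hp1[OF p] riesz_Hp[OF p] L)
  show "fourier (riesz (monomial n * f)) m = fourier (monomial n * riesz f) m" if "m \<ge> 0" for m
    using that n by (simp add: fourier_riesz[OF p] L f fourier_mult_monomial)
qed

lemma toeplitz_coanalytic:
  assumes p: "1 < p" and c: "c \<in> Linf" and f: "f \<in> Hp p" and n: "n \<le> 0"
  shows "toeplitz (c * monomial n) f = riesz (monomial n * toeplitz c f)"
  using riesz_monomial_mult[OF p _ n, of "c * f"] mult_Lp[OF c Hp_Lp[OF f]] p
  by (simp add: toeplitz_def mult_ac)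

lemma toeplitz_mult_monomial: "toeplitz (c * monomial n) f = toeplitz c (monomial n * f)"
  by (simp add: toeplitz_def mult_ac)

lemma subspace_ker:
  assumes p: "1 < p" and A: "bounded_operator p A"
  shows "circ.subspace (ker p A)"
  using bounded_operator_imp[OF A] bounded_operator_zero[OF A p]
  by (auto simp: circ.subspace_def ker_def Hp_0[OF p] Hp_add[OF p] Hp_scale[OF p])

lemma ker_toeplitz_iff: "1 < p \<Longrightarrow> c \<in> Linf \<Longrightarrow> f \<in> ker p (toeplitz c) \<longleftrightarrow> f \<in> Hp p \<and> (\<forall>n\<ge>0. fourier (c * f) n = 0)"
  using mult_Lp[of c f p] riesz_eq_0_iff[of p "c * f"] by (auto simp: ker_def toeplitz_def Hp_Lp)

text \<open>c f has only negative coefficients, and dividing by t^n moves them further to the left;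
  f itself stays in H^p because its first n coefficients vanish.\<close>

lemma ker_toeplitz_divide:
  assumes p: "1 < p" and c: "c \<in> Linf" and f: "f \<in> ker p (toeplitz c)" and n: "n \<ge> 0"
    and z: "\<And>m. m < n \<Longrightarrow> fourier f m = 0"
  shows "monomial (- n) * f \<in> ker p (toeplitz c)"
proof -
  have e: "c * (monomial (- n) * f) = monomial (- n) * (c * f)" by (simp add: mult_ac)
  show ?thesis using f n z
    unfolding ker_toeplitz_iff[OF p c] e by (simp add: fourier_mult_monomial Hp_def monomial_mult_Lp)
qed

text \<open>A nonzero element of the kernel is divided by the largest possible power of t and
  normalised.\<close>

lemma ker_toeplitz_fourier0:
  assumes p: "1 < p" and c: "c \<in> Linf" and V: "ker p (toeplitz c) \<noteq> {0}"
  obtains e where "e \<in> ker p (toeplitz c)" "fourier e 0 = 1"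
proof -
  have "0 \<in> ker p (toeplitz c)" using circ.subspace_0[OF subspace_ker[OF p toeplitz_bounded[OF p c]]] .
  then obtain f where f: "f \<in> ker p (toeplitz c)" "f \<noteq> 0" using V by blast
  have fH: "f \<in> Hp p" using f by (simp add: ker_def)
  have "\<exists>n. fourier f (int n) \<noteq> 0"
  proof (rule ccontr)
    assume "\<nexists>n. fourier f (int n) \<noteq> 0"
    then have "fourier f n = 0" for n using Hp_neg[OF p fH] by (cases "n \<ge> 0") (auto elim: nonneg_int_cases)
    then show False using fourier_unique_zero Lp_Lp1[OF p Hp_Lp[OF fH]] f by auto
  qed
  then obtain n where n: "fourier f (int n) \<noteq> 0" "\<And>m. m < n \<Longrightarrow> fourier f (int m) = 0"
    using exists_least_iff[of "\<lambda>n. fourier f (int n) \<noteq> 0"] by auto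
  have z: "fourier f m = 0" if "m < int n" for m
    using n(2)[of "nat m"] Hp_neg[OF p fH] that by (cases "m \<ge> 0") auto
  define g where "g = monomial (- int n) * f"
  have g: "g \<in> ker p (toeplitz c)" unfolding g_def by (rule ker_toeplitz_divide[OF p c f(1) _ z]) auto
  have g0: "fourier g 0 \<noteq> 0" using n by (simp add: g_def fourier_mult_monomial)
  show ?thesis
  proof (rule that[of "cscale (1 / fourier g 0) g"])
    show "cscale (1 / fourier g 0) g \<in> ker p (toeplitz c)"
      by (rule circ.subspace_scale[OF subspace_ker[OF p toeplitz_bounded[OF p c]] g])
  qed (use g0 in \<open>simp add: fourier_cscale\<close>)
qed

section \<open>Kernels of Toeplitz operators and the shift of the symbol by powers of t\<close>

lemma finite_dimensional_basis:
  assumes "finite_dimensional V" "circ.subspace V"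
  obtains B where "finite B" "circ.independent B" "circ.span B = V" "card B = circ.dim V" "B \<subseteq> V"
proof -
  obtain S where S: "finite S" "V \<subseteq> circ.span S" using assms by (auto simp: finite_dimensional_def)
  obtain B where B: "B \<subseteq> V" "circ.independent B" "V \<subseteq> circ.span B" "card B = circ.dim V"
    using circ.basis_exists by blast
  have "finite B" using circ.independent_span_bound[OF S(1) B(2)] B(1) S(2) by blast
  moreover have "circ.span B = V" using B(1,3) circ.span_minimal[OF B(1) assms(2)] by blast
  ultimately show ?thesis using that B by blast
qed

lemma dim_eq_0D:
  assumes "finite_dimensional V" "circ.subspace V" "circ.dim V = 0"
  shows "V = {0}"
proof -
  obtain B where "finite B" "circ.span B = V" "card B = circ.dim V" using finite_dimensional_basis[OF assms(1,2)] by metis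
  then have "B = {}" using assms(3) by simp
  then show ?thesis using \<open>circ.span B = V\<close> by simp
qed

lemma dim_zero_space [simp]: "circ.dim {0} = 0"
  using circ.dim_unique[of "{}" "{0}" 0] circ.independent_empty by simp

lemma module_hom_monomial: "module_hom cscale cscale (\<lambda>f. monomial n * f)"
  by unfold_locales (simp_all add: distrib_left cscale_mult)

text \<open>Multiplication by t maps ker T(c t) onto the elements of ker T(c) with vanishing
  constant term. This is a hyperplane, complemented by an e with constant term 1.\<close>

lemma dim_ker_toeplitz_shift:
  assumes p: "1 < p" and c: "c \<in> Linf" and fd: "finite_dimensional (ker p (toeplitz c))"
    and V: "ker p (toeplitz c) \<noteq> {0}"
  shows "finite_dimensional (ker p (toeplitz (c * monomial 1)))"
    and "circ.dim (ker p (toeplitz c)) = Suc (circ.dim (ker p (toeplitz (c * monomial 1))))"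
proof -
  have c1: "c * monomial 1 \<in> Linf" using c by (intro mult_Linf monomial_Linf)
  define U where "U = ker p (toeplitz c)"
  define W where "W = ker p (toeplitz (c * monomial 1))"
  have sU: "circ.subspace U" and sW: "circ.subspace W"
    unfolding U_def W_def using subspace_ker[OF p] toeplitz_bounded[OF p] c c1 by auto
  obtain e where e: "e \<in> U" "fourier e 0 = 1" using ker_toeplitz_fourier0[OF p c V] U_def by metis
  have eH: "e \<in> Hp p" using e by (simp add: U_def ker_def)
  have WU: "monomial 1 * f \<in> U" "fourier (monomial 1 * f) 0 = 0" if "f \<in> W" for f
    using that unfolding W_def U_def
    by (auto simp: ker_def toeplitz_mult_monomial monomial_mult_Hp[OF p] fourier_mult_monomial Hp_neg[OF p])
  have UW: "monomial (-1) * f \<in> W" if "f \<in> U" "fourier f 0 = 0" for f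
  proof -
    have "fourier f m = 0" if "m < 1" for m
      using \<open>f \<in> U\<close> \<open>fourier f 0 = 0\<close> that Hp_neg[OF p, of f m] by (cases "m = 0") (auto simp: U_def ker_def)
    then have "monomial (-1) * f \<in> U" using that ker_toeplitz_divide[OF p c, of f 1] by (simp add: U_def)
    moreover have "toeplitz (c * monomial 1) (monomial (-1) * f) = toeplitz c f"
      by (simp add: toeplitz_mult_monomial mult.assoc[symmetric] monomial_add[symmetric])
    ultimately show ?thesis using that by (simp add: W_def U_def ker_def)
  qed
  have cancel: "monomial (-1) * (monomial 1 * f) = f" for f
    by (simp add: mult.assoc[symmetric] monomial_add[symmetric])
  interpret m: module_hom cscale cscale "\<lambda>f. monomial 1 * f" by (rule module_hom_monomial)
  interpret m': module_hom cscale cscale "\<lambda>f. monomial (-1) * f" by (rule module_hom_monomial)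
  obtain S where S: "finite S" "U \<subseteq> circ.span S" using fd by (auto simp: finite_dimensional_def U_def)
  have Wspan: "W \<subseteq> circ.span ((\<lambda>f. monomial (-1) * f) ` S)"
  proof
    fix f assume "f \<in> W"
    then have "monomial 1 * f \<in> circ.span S" using WU S by blast
    then show "f \<in> circ.span ((\<lambda>f. monomial (-1) * f) ` S)"
      unfolding m'.span_image using cancel[of f] by (metis imageI)
  qed
  then have fdW: "finite_dimensional W" using S(1) unfolding finite_dimensional_def by blast
  then show "finite_dimensional (ker p (toeplitz (c * monomial 1)))" by (simp add: W_def)
  obtain B where B: "finite B" "circ.independent B" "circ.span B = W" "card B = circ.dim W" "B \<subseteq> W"
    using finite_dimensional_basis[OF fdW sW] by metis
  define B' where "B' = (\<lambda>f. monomial 1 * f) ` B"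
  have inj: "inj (\<lambda>f. monomial 1 * f)" by (rule inj_on_inverseI[of _ "\<lambda>f. monomial (-1) * f"]) (rule cancel)
  have B'0: "fourier f 0 = 0" "f \<in> U" if "f \<in> circ.span B'" for f
  proof -
    have "f \<in> (\<lambda>f. monomial 1 * f) ` W" using that unfolding B'_def m.span_image B(3) .
    then show "fourier f 0 = 0" "f \<in> U" using WU by auto
  qed
  have indB': "circ.independent B'" unfolding B'_def by (rule m.independent_inj_image[OF B(2) inj])
  have e_notin: "e \<notin> circ.span B'" using B'0(1) e(2) by auto
  have "circ.dim U = card (insert e B')"
  proof (rule circ.dim_unique)
    show "insert e B' \<subseteq> U" using e B'0(2) circ.span_base by auto
    show "U \<subseteq> circ.span (insert e B')"
    proof
      fix f assume f: "f \<in> U"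
      define g where "g = f - cscale (fourier f 0) e"
      have fL: "f \<in> Lp 1" "e \<in> Lp 1" using f e Lp_Lp1[OF p] by (auto simp: U_def ker_def Hp_Lp)
      have gU: "g \<in> U" unfolding g_def by (intro circ.subspace_diff[OF sU] circ.subspace_scale[OF sU] f e)
      have "fourier g 0 = 0" using fL e by (simp add: g_def fourier_diff Lp_cscale fourier_cscale)
      then have "monomial (-1) * g \<in> circ.span B" using UW gU B(3) by blast
      then have "monomial 1 * (monomial (-1) * g) \<in> circ.span B'" unfolding B'_def m.span_image by blast
      then have "g \<in> circ.span B'" by (simp add: mult.assoc[symmetric] monomial_add[symmetric])
      then have "g + cscale (fourier f 0) e \<in> circ.span (insert e B')"
        by (intro circ.span_add circ.span_scale) (auto intro: circ.span_base subsetD[OF circ.span_mono])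
      then show "f \<in> circ.span (insert e B')" by (simp add: g_def)
    qed
    show "circ.independent (insert e B')" using indB' e_notin by (simp add: circ.independent_insert)
  qed simp
  also have "\<dots> = Suc (card B')"
    using e_notin B(1) circ.span_base by (subst card_insert_disjoint) (auto simp: B'_def)
  also have "card B' = circ.dim W" unfolding B'_def B(4)[symmetric] using inj by (intro card_image inj_on_subset[OF inj]) auto
  finally show "circ.dim (ker p (toeplitz c)) = Suc (circ.dim (ker p (toeplitz (c * monomial 1))))"
    by (simp add: U_def W_def)
qed

lemma toeplitz_inj:
  assumes p: "1 < p" and c: "c \<in> Linf" and "ker p (toeplitz c) = {0}"
  shows "inj_on (toeplitz c) (Hp p)"
proof (rule inj_onI)
  fix f g assume fg: "f \<in> Hp p" "g \<in> Hp p" "toeplitz c f = toeplitz c g"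
  then have "f - g \<in> ker p (toeplitz c)"
    using bounded_operator_diff[OF toeplitz_bounded[OF p c] p] Hp_diff[OF p] by (simp add: ker_def)
  then show "f = g" using assms by simp
qed

text \<open>Each factor t lowers the dimension of the kernel by one. Surjectivity survives: a
  preimage under T(c) is corrected by a multiple of e to have constant term 0 and then divided by
  t.\<close>

lemma toeplitz_surj_shift:
  assumes p: "1 < p" and c: "c \<in> Linf" and fd: "finite_dimensional (ker p (toeplitz c))"
    and "circ.dim (ker p (toeplitz c)) = n" and "toeplitz c ` Hp p = Hp p"
  shows "bij_betw (toeplitz (c * monomial (int n))) (Hp p) (Hp p)"
  using c fd assms(4,5)
proof (induction n arbitrary: c)
  case 0
  have "ker p (toeplitz c) = {0}"
    by (rule dim_eq_0D[OF 0(2) subspace_ker[OF p toeplitz_bounded[OF p 0(1)]] 0(3)])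
  then show ?case using toeplitz_inj[OF p 0(1)] 0(4) by (simp add: bij_betw_def)
next
  case (Suc n)
  note c = Suc.prems(1)
  have c1: "c * monomial 1 \<in> Linf" using c by (intro mult_Linf monomial_Linf)
  have V: "ker p (toeplitz c) \<noteq> {0}"
  proof
    assume "ker p (toeplitz c) = {0}"
    with Suc.prems(3) have "circ.dim {0} = Suc n" by (simp only:)
    then show False by (simp only: dim_zero_space)
  qed
  obtain e where e: "e \<in> ker p (toeplitz c)" "fourier e 0 = 1" by (rule ker_toeplitz_fourier0[OF p c V]) (rule that)
  have eH: "e \<in> Hp p" "toeplitz c e = 0" using e by (auto simp: ker_def)
  note T = toeplitz_bounded[OF p c]
  have "toeplitz (c * monomial 1) ` Hp p = Hp p"
  proof (intro equalityI subsetI)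
    fix y assume "y \<in> Hp p"
    then have "y \<in> toeplitz c ` Hp p" by (simp only: Suc.prems(4))
    then obtain h where h: "h \<in> Hp p" "toeplitz c h = y" by blast
    define g where "g = h - cscale (fourier h 0) e"
    have ce: "cscale (fourier h 0) e \<in> Hp p" by (rule Hp_scale[OF p eH(1)])
    have gH: "g \<in> Hp p" unfolding g_def by (rule Hp_diff[OF p h(1) ce])
    have g0: "fourier g 0 = 0"
      using e h(1) eH(1) Lp_Lp1[OF p Hp_Lp] by (simp add: g_def fourier_diff Lp_cscale fourier_cscale)
    have fH: "monomial (-1) * g \<in> Hp p"
    proof -
      have "fourier g m = 0" if "m < 1" for m using g0 Hp_neg[OF p gH, of m] that by (cases "m = 0") auto
      then show ?thesis using gH by (simp add: Hp_def monomial_mult_Lp fourier_mult_monomial)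
    qed
    have "toeplitz (c * monomial 1) (monomial (-1) * g) = toeplitz c g"
      by (simp add: toeplitz_mult_monomial mult.assoc[symmetric] monomial_add[symmetric])
    also have "\<dots> = y"
      using bounded_operator_diff[OF T p h(1) ce] bounded_operator_imp(3)[OF T eH(1)] h eH by (simp add: g_def)
    finally show "y \<in> toeplitz (c * monomial 1) ` Hp p" using fH by blast
  qed (use bounded_operator_imp(1)[OF toeplitz_bounded[OF p c1]] in blast)
  then have "bij_betw (toeplitz (c * monomial 1 * monomial (int n))) (Hp p) (Hp p)"
    using dim_ker_toeplitz_shift[OF p c Suc.prems(2) V] Suc.prems(3) by (intro Suc.IH[OF c1]) auto
  then show ?case by (simp add: mult.assoc monomial_add[symmetric])
qed

section \<open>Adjoints and cokernels\<close>

lemma pairing_toeplitz: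
  assumes pq: "conjugate_exponents p q" and c: "c \<in> Linf" and f: "f \<in> Hp p" and g: "g \<in> Hp q"
  shows "pairing (toeplitz c f) g = pairing f (toeplitz (conjugate c) g)"
proof -
  have p: "p > 1" "q > 1" using pq by (auto simp: conjugate_exponents_def)
  have "pairing (toeplitz c f) g = pairing (c * f) (riesz g)"
    unfolding toeplitz_def using mult_Lp[OF c Hp_Lp[OF f]] p by (intro pairing_riesz[OF pq _ Hp_Lp[OF g]]) auto
  also have "\<dots> = pairing f (conjugate c * g)" by (simp add: riesz_id[OF p(2) g] pairing_mult_left)
  also have "\<dots> = pairing (riesz f) (conjugate c * g)" by (simp add: riesz_id[OF p(1) f])
  also have "\<dots> = pairing f (toeplitz (conjugate c) g)"
    unfolding toeplitz_def using mult_Lp[of "conjugate c" g q] c p Hp_Lp[OF g]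
    by (intro pairing_riesz[OF pq Hp_Lp[OF f]]) (auto simp: conjugate_Linf)
  finally show ?thesis .
qed

lemma pairing_Hp_eq_0:
  assumes pq: "conjugate_exponents p q" and g: "g \<in> Hp q" and z: "\<And>f. f \<in> Hp p \<Longrightarrow> pairing f g = 0"
  shows "g = 0"
proof -
  have p: "p > 1" "q > 1" using pq by (auto simp: conjugate_exponents_def)
  have "fourier g n = 0" for n
  proof (cases "n \<ge> 0")
    case True
    have "pairing g (monomial n) = 0" using z[OF monomial_Hp[OF p(1) True]] by (metis pairing_cnj complex_cnj_zero)
    then show ?thesis by (simp add: pairing_monomial)
  qed (use Hp_neg[OF p(2) g] in simp)
  then show ?thesis using fourier_unique_zero[OF Lp_Lp1[OF p(2) Hp_Lp[OF g]]] by blast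
qed

lemma adjoint_Hp_eqI:
  assumes pq: "conjugate_exponents p q" and h: "h \<in> Hp q" and eq: "\<And>f. f \<in> Hp p \<Longrightarrow> pairing (A f) g = pairing f h"
  shows "adjoint_Hp p A g = h"
proof -
  have p: "p > 1" "q > 1" using pq by (auto simp: conjugate_exponents_def)
  have q: "conj_exponent p = q" using pq by (auto simp: conj_exponent_def conjugate_exponents_def field_simps)
  show ?thesis unfolding adjoint_Hp_def q
  proof (rule the_equality)
    fix h' assume h': "h' \<in> Hp q \<and> (\<forall>f\<in>Hp p. pairing (A f) g = pairing f h')"
    have "h' - h = 0"
    proof (rule pairing_Hp_eq_0[OF pq])
      show "h' - h \<in> Hp q" using h h' Hp_diff[OF p(2)] by blast
      show "pairing f (h' - h) = 0" if "f \<in> Hp p" for f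
        using pairing_diff_right[OF pq Hp_Lp[OF that], of h' h] h h' eq that by (simp add: Hp_Lp)
    qed
    then show "h' = h" by simp
  qed (use h eq in auto)
qed

text \<open>Elements of H^q are separated by H^p, so the description in \<open>adjoint_Hp\<close> is
  met by every B satisfying the transposition identity.\<close>

lemma coker_eqI:
  assumes pq: "conjugate_exponents p q" and "\<And>g. g \<in> Hp q \<Longrightarrow> B g \<in> Hp q"
    and "\<And>f g. f \<in> Hp p \<Longrightarrow> g \<in> Hp q \<Longrightarrow> pairing (A f) g = pairing f (B g)"
  shows "coker p A = ker q B"
proof -
  have q: "conj_exponent p = q" using pq by (auto simp: conj_exponent_def conjugate_exponents_def field_simps)
  have "adjoint_Hp p A g = B g" if "g \<in> Hp q" for g
    using assms that by (intro adjoint_Hp_eqI[OF pq]) auto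
  then show ?thesis unfolding coker_def q ker_def by auto
qed

lemma coker_toeplitz:
  assumes pq: "conjugate_exponents p q" and c: "c \<in> Linf"
  shows "coker p (toeplitz c) = ker q (toeplitz (conjugate c))"
proof (rule coker_eqI[OF pq _ pairing_toeplitz[OF pq c]])
  have q: "q > 1" using pq by (auto simp: conjugate_exponents_def)
  show "toeplitz (conjugate c) g \<in> Hp q" if "g \<in> Hp q" for g
    using bounded_operator_imp(1)[OF toeplitz_bounded[OF q] that] c by (simp add: conjugate_Linf)
qed

lemma image_subspace:
  assumes p: "1 < p" and A: "bounded_operator p A"
  shows "circ.subspace (A ` Hp p)"
proof (rule circ.subspaceI)
  show "0 \<in> A ` Hp p" using bounded_operator_zero[OF A p] Hp_0[OF p] by (metis imageI)
  show "x + y \<in> A ` Hp p" if xy: "x \<in> A ` Hp p" "y \<in> A ` Hp p" for x y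
  proof -
    obtain f g where "f \<in> Hp p" "g \<in> Hp p" "x = A f" "y = A g" using xy by blast
    then show ?thesis using bounded_operator_imp(2)[OF A] Hp_add[OF p] by (intro image_eqI[of _ _ "f + g"]) auto
  qed
  show "cscale z x \<in> A ` Hp p" if x: "x \<in> A ` Hp p" for z x
  proof -
    obtain f where "f \<in> Hp p" "x = A f" using x by blast
    then show ?thesis using bounded_operator_imp(3)[OF A] Hp_scale[OF p] by (intro image_eqI[of _ _ "cscale z f"]) auto
  qed
qed

text \<open>A function outside the closed range would be separated from it by some g in H^q, and
  this g would lie in the kernel of T(conj c).\<close>

lemma toeplitz_surj:
  assumes pq: "conjugate_exponents p q" and c: "c \<in> Linf" and cl: "closed_in_Hp p (toeplitz c ` Hp p)"
    and k: "ker q (toeplitz (conjugate c)) = {0}"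
  shows "toeplitz c ` Hp p = Hp p"
proof -
  have p: "p > 1" "q > 1" using pq by (auto simp: conjugate_exponents_def)
  note T = toeplitz_bounded[OF p(1) c]
  have sub: "toeplitz c ` Hp p \<subseteq> Hp p" using bounded_operator_imp(1)[OF T] by blast
  have "y \<in> toeplitz c ` Hp p" if y: "y \<in> Hp p" for y
  proof (rule ccontr)
    assume "y \<notin> toeplitz c ` Hp p"
    from Hp_annihilator[OF pq sub image_subspace[OF p(1) T] cl y this]
    obtain g where g: "g \<in> Hp q" "\<And>r. r \<in> toeplitz c ` Hp p \<Longrightarrow> pairing r g = 0" "pairing y g \<noteq> 0" by metis
    have Tg: "toeplitz (conjugate c) g \<in> Hp q"
      using bounded_operator_imp(1)[OF toeplitz_bounded[OF p(2)] g(1)] c by (simp add: conjugate_Linf)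
    have "toeplitz (conjugate c) g = 0"
      using g(2) pairing_toeplitz[OF pq c _ g(1)] by (intro pairing_Hp_eq_0[OF pq Tg]) auto
    then have "g = 0" using g(1) k by (auto simp: ker_def)
    then show False using g(3) by (simp add: pairing_fourier)
  qed
  then show ?thesis using sub by blast
qed

text \<open>An element \<open>e\<close> of the cokernel with \<open>e(0) = 1\<close> recovers from \<open>T(c t\<inverse>) f = P t\<inverse> T(c) f\<close> the constant
  term of \<open>T(c) f\<close>; this gives injectivity and closed range of \<open>T(c t\<inverse>)\<close>.\<close>

lemma toeplitz_inj_shift:
  assumes pq: "conjugate_exponents p q" and c: "c \<in> Linf" and fd: "finite_dimensional (ker q (toeplitz (conjugate c)))"
    and "circ.dim (ker q (toeplitz (conjugate c))) = n" and "ker p (toeplitz c) = {0}"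
    and "closed_in_Hp p (toeplitz c ` Hp p)"
  shows "bij_betw (toeplitz (c * monomial (- int n))) (Hp p) (Hp p)"
  using c fd assms(4-)
proof (induction n arbitrary: c)
  case 0
  have p: "p > 1" "q > 1" using pq by (auto simp: conjugate_exponents_def)
  have "conjugate c \<in> Linf" using 0 by (simp add: conjugate_Linf)
  then have "ker q (toeplitz (conjugate c)) = {0}"
    by (intro dim_eq_0D[OF 0(2) subspace_ker[OF p(2) toeplitz_bounded[OF p(2)]] 0(3)])
  then show ?case using toeplitz_inj[OF p(1) 0(1,4)] toeplitz_surj[OF pq 0(1,5)] by (simp add: bij_betw_def)
next
  case (Suc n)
  have p: "p > 1" "q > 1" using pq by (auto simp: conjugate_exponents_def)
  note c = Suc.prems(1)
  define c' where "c' = c * monomial (-1)"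
  have c': "c' \<in> Linf" unfolding c'_def using c by (intro mult_Linf monomial_Linf)
  have cc: "conjugate c \<in> Linf" using c by (simp add: conjugate_Linf)
  have conjc': "conjugate c' = conjugate c * monomial 1" by (simp add: c'_def conjugate_mult conjugate_monomial)
  have V: "ker q (toeplitz (conjugate c)) \<noteq> {0}"
  proof
    assume "ker q (toeplitz (conjugate c)) = {0}"
    with Suc.prems(3) have "circ.dim {0} = Suc n" by (simp only:)
    then show False by (simp only: dim_zero_space)
  qed
  obtain e where e: "e \<in> ker q (toeplitz (conjugate c))" "fourier e 0 = 1"
    by (rule ker_toeplitz_fourier0[OF p(2) cc V]) (rule that)
  have eH: "e \<in> Hp q" "toeplitz (conjugate c) e = 0" using e by (auto simp: ker_def)
  note T = toeplitz_bounded[OF p(1) c]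
  let ?R = "toeplitz c ` Hp p"
  have orth: "pairing (toeplitz c f) e = 0" if "f \<in> Hp p" for f
    using pairing_toeplitz[OF pq c that eH(1)] eH(2) by (simp add: pairing_fourier)
  have one: "pairing (cscale z 1) e = z" for z
  proof -
    have "pairing e 1 = 1" using pairing_monomial[of e 0] e(2) by simp
    then show ?thesis using pairing_cnj[of e 1] by (simp add: pairing_cscale_left)
  qed
  have oneH: "cscale z 1 \<in> Hp p" for z using monomial_Hp[OF p(1), of 0] by (auto intro: Hp_scale[OF p(1)])
  \<comment> \<open>Since T(c') f is P t^(-1) T(c) f, it is T(c) f shifted down, with the constant
    term lost.\<close>
  have S: "toeplitz c f = monomial 1 * toeplitz c' f + cscale (fourier (toeplitz c f) 0) 1" if f: "f \<in> Hp p" for f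
  proof (rule fourier_unique)
    have L: "toeplitz c f \<in> Hp p" "toeplitz c' f \<in> Hp p"
      using bounded_operator_imp(1)[OF T f] bounded_operator_imp(1)[OF toeplitz_bounded[OF p(1) c'] f] by auto
    have L1: "toeplitz c f \<in> Lp 1" "monomial 1 * toeplitz c' f \<in> Lp 1" "cscale (fourier (toeplitz c f) 0) 1 \<in> Lp 1"
      using L oneH by (auto intro!: Lp_Lp1[OF p(1)] simp: monomial_mult_Lp Hp_Lp)
    show "toeplitz c f \<in> Lp 1" "monomial 1 * toeplitz c' f + cscale (fourier (toeplitz c f) 0) 1 \<in> Lp 1"
      using L1 by (auto intro: Lp_add)
    fix n
    have f1: "fourier 1 k = (if k = 0 then 1 else 0)" for k using fourier_monomial[of 0 k] by simp
    have t': "toeplitz c' f = riesz (monomial (-1) * toeplitz c f)"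
      unfolding c'_def by (rule toeplitz_coanalytic[OF p(1) c f]) simp
    have "monomial (-1) * toeplitz c f \<in> Lp p" using L by (simp add: monomial_mult_Lp Hp_Lp)
    then have "fourier (toeplitz c' f) (n - 1) = (if n \<ge> 1 then fourier (toeplitz c f) n else 0)"
      unfolding t' by (simp add: fourier_riesz[OF p(1)] fourier_mult_monomial)
    then have "fourier (monomial 1 * toeplitz c' f) n = (if n \<ge> 1 then fourier (toeplitz c f) n else 0)"
      by (simp add: fourier_mult_monomial)
    then show "fourier (toeplitz c f) n = fourier (monomial 1 * toeplitz c' f + cscale (fourier (toeplitz c f) 0) 1) n"
      using L1 Hp_neg[OF p(1) L(1), of n] by (cases "n = 0"; cases "n > 0") (simp_all add: fourier_add fourier_cscale f1)
  qed
  have ker': "ker p (toeplitz c') = {0}"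
  proof -
    have "f = 0" if f: "f \<in> Hp p" "toeplitz c' f = 0" for f
    proof -
      have "toeplitz c f = cscale (fourier (toeplitz c f) 0) 1" using S[OF f(1)] f(2) by simp
      then have "fourier (toeplitz c f) 0 = 0" using orth[OF f(1)] one by metis
      then have "toeplitz c f = 0" using S[OF f(1)] f(2) by simp
      then show "f = 0" using Suc.prems(4) f(1) by (auto simp: ker_def)
    qed
    moreover have "0 \<in> ker p (toeplitz c')" by (rule circ.subspace_0[OF subspace_ker[OF p(1) toeplitz_bounded[OF p(1) c']]])
    ultimately show ?thesis by (auto simp: ker_def)
  qed
  have closed': "closed_in_Hp p (toeplitz c' ` Hp p)" unfolding closed_in_Hp_def
  proof (intro allI impI, elim conjE)
    fix F g assume F: "\<forall>n::nat. F n \<in> toeplitz c' ` Hp p" and g: "g \<in> Hp p" and lim: "(\<lambda>n. Lp_norm p (F n - g)) \<longlonglongrightarrow> 0"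
    have "\<forall>n. \<exists>h. h \<in> Hp p \<and> F n = toeplitz c' h" using F by (simp add: image_iff Bex_def)
    from choice[OF this] obtain h where h: "\<And>n. h n \<in> Hp p" "\<And>n. F n = toeplitz c' (h n)" by blast
    have FH: "F n \<in> Hp p" for n unfolding h(2) by (rule bounded_operator_imp(1)[OF toeplitz_bounded[OF p(1) c'] h(1)])
    define \<alpha> where "\<alpha> n = fourier (toeplitz c (h n)) 0" for n
    have Th: "toeplitz c (h n) \<in> Hp p" for n by (rule bounded_operator_imp(1)[OF T h(1)])
    have dec: "toeplitz c (h n) = monomial 1 * F n + cscale (\<alpha> n) 1" for n
      using S[OF h(1)] h(2) by (simp add: \<alpha>_def)
    have m1: "monomial 1 * f \<in> Hp p" if "f \<in> Hp p" for f using monomial_mult_Hp[OF p(1) that] by simp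
    \<comment> \<open>e annihilates the range of T(c), so pairing the decomposition with e expresses
      the lost constant term through F n alone; it therefore converges along with F n.\<close>
    have \<alpha>: "\<alpha> n = - pairing (monomial 1 * F n) e" for n
    proof -
      have "0 = pairing (monomial 1 * F n) e + pairing (cscale (\<alpha> n) 1) e"
        using orth[OF h(1)[of n]] pairing_add_left[OF pq Hp_Lp[OF m1[OF FH]] Hp_Lp[OF oneH] Hp_Lp[OF eH(1)]] unfolding dec by simp
      then show ?thesis using one by (simp add: eq_neg_iff_add_eq_0 add.commute)
    qed
    define a where "a = - pairing (monomial 1 * g) e"
    have \<alpha>le: "norm (\<alpha> n - a) \<le> Lp_norm p (F n - g) * Lp_norm q e" for n
    proof -
      have "\<alpha> n - a = - pairing (monomial 1 * (F n - g)) e"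
        using pairing_diff_left[OF pq Hp_Lp[OF m1[OF FH]] Hp_Lp[OF m1[OF g]] Hp_Lp[OF eH(1)], of n]
        by (simp add: \<alpha> a_def right_diff_distrib)
      then have "norm (\<alpha> n - a) = norm (pairing (monomial 1 * (F n - g)) e)" by simp
      also have "\<dots> \<le> Lp_norm p (monomial 1 * (F n - g)) * Lp_norm q e"
        using Hp_diff[OF p(1) FH g] by (intro norm_pairing_le[OF pq]) (auto simp: monomial_mult_Lp Hp_Lp eH)
      finally show ?thesis by (simp add: monomial_mult_Lp)
    qed
    define y where "y = monomial 1 * g + cscale a 1"
    have yH: "y \<in> Hp p" unfolding y_def by (intro Hp_add[OF p(1)] m1 g oneH)
    have "(\<lambda>n. Lp_norm p (toeplitz c (h n) - y)) \<longlonglongrightarrow> 0"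
    proof (rule Lim_null_comparison)
      show "\<forall>\<^sub>F n in sequentially. norm (Lp_norm p (toeplitz c (h n) - y)) \<le>
         Lp_norm p (F n - g) + Lp_norm p (F n - g) * Lp_norm q e * Lp_norm p 1"
      proof (intro always_eventually allI)
        fix n
        have d: "monomial 1 * (F n - g) \<in> Hp p" using m1 Hp_diff[OF p(1) FH g] by blast
        have eq: "toeplitz c (h n) - y = monomial 1 * (F n - g) + cscale (\<alpha> n - a) 1"
          unfolding dec y_def by (simp add: right_diff_distrib circ.scale_left_diff_distrib)
        have "Lp_norm p (toeplitz c (h n) - y) \<le> Lp_norm p (monomial 1 * (F n - g)) + Lp_norm p (cscale (\<alpha> n - a) 1)"
          unfolding eq using p by (intro Lp_norm_triangle Hp_Lp d oneH) auto
        also have "Lp_norm p (cscale (\<alpha> n - a) 1) = norm (\<alpha> n - a) * Lp_norm p 1"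
          using Lp_cscale(2)[of 1 p] Hp_Lp[OF oneH[of 1]] p by simp
        also have "\<dots> \<le> Lp_norm p (F n - g) * Lp_norm q e * Lp_norm p 1" by (intro mult_right_mono \<alpha>le) auto
        finally show "norm (Lp_norm p (toeplitz c (h n) - y)) \<le>
         Lp_norm p (F n - g) + Lp_norm p (F n - g) * Lp_norm q e * Lp_norm p 1" by (simp add: monomial_mult_Lp)
      qed
      have "(\<lambda>n. Lp_norm p (F n - g) + Lp_norm p (F n - g) * Lp_norm q e * Lp_norm p 1) \<longlonglongrightarrow> 0 + 0 * Lp_norm q e * Lp_norm p 1"
        by (intro tendsto_add tendsto_mult tendsto_const lim)
      then show "(\<lambda>n. Lp_norm p (F n - g) + Lp_norm p (F n - g) * Lp_norm q e * Lp_norm p 1) \<longlonglongrightarrow> 0" by simp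
    qed
    then have "y \<in> toeplitz c ` Hp p"
      using Suc.prems(5)[unfolded closed_in_Hp_def, rule_format, of "\<lambda>n. toeplitz c (h n)" y] h(1) yH by simp
    then obtain f where f: "f \<in> Hp p" "y = toeplitz c f" by blast
    \<comment> \<open>Shifting the limit y down again sends its constant term to t^(-1), which P
      removes; what remains is g.\<close>
    have "toeplitz c' f = riesz (monomial (-1) * y)"
      unfolding c'_def f(2) by (rule toeplitz_coanalytic[OF p(1) c f(1)]) simp
    also have "monomial (-1) * y = g + cscale a (monomial (-1))"
      by (simp add: y_def distrib_left mult.assoc[symmetric] monomial_add[symmetric] cscale_mult)
    also have "riesz \<dots> = g"
    proof (rule riesz_eqI)
      show "g \<in> Hp 1" by (rule Hp_Hp1[OF p(1) g])
      have "monomial (-1) \<in> Lp 1" by (intro Linf_subset_Lp monomial_Linf) simp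
      then show "fourier g m = fourier (g + cscale a (monomial (-1))) m" if "m \<ge> 0" for m
        using that Lp_Lp1[OF p(1) Hp_Lp[OF g]] by (simp add: fourier_add Lp_cscale fourier_cscale fourier_monomial)
    qed
    finally show "g \<in> toeplitz c' ` Hp p" using f(1) by blast
  qed
  have "bij_betw (toeplitz (c' * monomial (- int n))) (Hp p) (Hp p)"
    using dim_ker_toeplitz_shift[OF p(2) cc Suc.prems(2) V] Suc.prems(3) ker' closed'
    by (intro Suc.IH[OF c']) (auto simp: conjc')
  then show ?case by (simp add: c'_def mult.assoc monomial_add[symmetric])
qed

text \<open>By Coburn's lemma kernel or cokernel is zero, and the sign of \<kappa> tells which. The
  remaining one has dimension |\<kappa>|, and |\<kappa>| shifts of the symbol exhaust it.\<close>

theorem toeplitz_fredholm: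
  assumes pq: "conjugate_exponents p q" and c: "c \<in> Linf" "c * c' = 1" and F: "fredholm p (toeplitz c)"
  defines "\<kappa> \<equiv> ind p (toeplitz c)"
  shows "bij_betw (toeplitz (c * monomial \<kappa>)) (Hp p) (Hp p)"
    and "\<kappa> \<ge> 0 \<Longrightarrow> ker q (toeplitz (conjugate c)) = {0}"
    and "\<kappa> \<le> 0 \<Longrightarrow> ker p (toeplitz c) = {0}"
    and "ind q (toeplitz (conjugate c)) = - \<kappa>"
proof -
  have p: "p > 1" "q > 1" using pq by (auto simp: conjugate_exponents_def)
  have cc: "conjugate c \<in> Linf" using c by (simp add: conjugate_Linf)
  define U where "U = ker p (toeplitz c)"
  define W where "W = ker q (toeplitz (conjugate c))"
  have co: "coker p (toeplitz c) = W" unfolding W_def by (rule coker_toeplitz[OF pq c(1)])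
  have co': "coker q (toeplitz (conjugate c)) = U"
    using coker_toeplitz[OF conjugate_exponents_sym[OF pq] cc] by (simp add: U_def)
  have fd: "finite_dimensional U" "finite_dimensional W" and cl: "closed_in_Hp p (toeplitz c ` Hp p)"
    using F by (auto simp: fredholm_def co U_def)
  have sU: "circ.subspace U" and sW: "circ.subspace W"
    unfolding U_def W_def using subspace_ker toeplitz_bounded p c(1) cc by auto
  have \<kappa>: "\<kappa> = int (circ.dim U) - int (circ.dim W)" by (simp add: \<kappa>_def ind_def co U_def)
  show "ind q (toeplitz (conjugate c)) = - \<kappa>" by (simp add: \<kappa> ind_def co' W_def)
  have "U = {0} \<or> W = {0}"
  proof (rule ccontr)
    assume "\<not> ?thesis"
    then obtain f g where "f \<in> U" "f \<noteq> 0" "g \<in> W" "g \<noteq> 0" using circ.subspace_0[OF sU] circ.subspace_0[OF sW] by blast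
    then show False using Coburn[OF pq c, of f g] by (auto simp: U_def W_def ker_def toeplitz_def)
  qed
  moreover have "W = {0}" if "U = {0}" "\<kappa> \<ge> 0" using that \<kappa> by (intro dim_eq_0D[OF fd(2) sW]) simp
  moreover have "U = {0}" if "W = {0}" "\<kappa> \<le> 0" using that \<kappa> by (intro dim_eq_0D[OF fd(1) sU]) simp
  ultimately have cases: "\<kappa> \<ge> 0 \<Longrightarrow> W = {0}" "\<kappa> \<le> 0 \<Longrightarrow> U = {0}" by auto
  then show "\<kappa> \<ge> 0 \<Longrightarrow> ker q (toeplitz (conjugate c)) = {0}" "\<kappa> \<le> 0 \<Longrightarrow> ker p (toeplitz c) = {0}"
    by (auto simp: U_def W_def)
  show "bij_betw (toeplitz (c * monomial \<kappa>)) (Hp p) (Hp p)"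
  proof (cases "\<kappa> \<ge> 0")
    case True
    have "toeplitz c ` Hp p = Hp p" by (rule toeplitz_surj[OF pq c(1) cl]) (use cases(1)[OF True] W_def in simp)
    moreover have "\<kappa> = int (circ.dim U)" using \<kappa> cases(1)[OF True] by simp
    ultimately show ?thesis using toeplitz_surj_shift[OF p(1) c(1) _ refl] fd by (simp add: U_def)
  next
    case False
    then have "\<kappa> = - int (circ.dim W)" using \<kappa> cases(2) by simp
    then show ?thesis using toeplitz_inj_shift[OF pq c(1) _ refl _ cl] fd cases(2) False by (simp add: U_def W_def)
  qed
qed

text \<open>Injectivity follows from the surjectivity of T(c). For surjectivity, f \<mapsto> pairing
  (T(c)^(-1) f) h is a bounded functional, and the g representing it is a preimage of h.\<close>

lemma toeplitz_bij_adjoint: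
  assumes pq: "conjugate_exponents p q" and c: "c \<in> Linf" and bij: "bij_betw (toeplitz c) (Hp p) (Hp p)"
  shows "bij_betw (toeplitz (conjugate c)) (Hp q) (Hp q)"
proof -
  have p: "p > 1" "q > 1" using pq by (auto simp: conjugate_exponents_def)
  have cc: "conjugate c \<in> Linf" using c by (simp add: conjugate_Linf)
  note T = toeplitz_bounded[OF p(1) c]
  note T' = toeplitz_bounded[OF p(2) cc]
  have surj: "toeplitz c ` Hp p = Hp p" using bij by (simp add: bij_betw_def)
  have "ker q (toeplitz (conjugate c)) = {0}"
  proof -
    have "g = 0" if g: "g \<in> Hp q" "toeplitz (conjugate c) g = 0" for g
    proof (rule pairing_Hp_eq_0[OF pq g(1)])
      fix f assume "f \<in> Hp p"
      then obtain h where "h \<in> Hp p" "f = toeplitz c h" using surj by blast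
      then show "pairing f g = 0" using pairing_toeplitz[OF pq c _ g(1)] g(2) by (simp add: pairing_fourier)
    qed
    then show ?thesis using circ.subspace_0[OF subspace_ker[OF p(2) T']] by (auto simp: ker_def)
  qed
  then have inj: "inj_on (toeplitz (conjugate c)) (Hp q)" by (rule toeplitz_inj[OF p(2) cc])
  have "h \<in> toeplitz (conjugate c) ` Hp q" if h: "h \<in> Hp q" for h
  proof -
    let ?B = "the_inv_into (Hp p) (toeplitz c)"
    have B: "bounded_operator p ?B" by (rule bounded_inverse[OF p(1) T bij])
    obtain C where C: "C > 0" "\<And>f. f \<in> Hp p \<Longrightarrow> Lp_norm p (?B f) \<le> C * Lp_norm p f" by (rule bounded_operatorE[OF B]) (rule that)
    obtain g where g: "g \<in> Hp q" "\<And>f. f \<in> Hp p \<Longrightarrow> pairing (?B f) h = pairing f g"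
    proof (rule Hp_dual_representation[OF pq, of "\<lambda>f. pairing (?B f) h" "C * Lp_norm q h"])
      fix f assume f: "f \<in> Hp p"
      note BH = Hp_Lp[OF bounded_operator_imp(1)[OF B f]]
      show "pairing (?B (f + f')) h = pairing (?B f) h + pairing (?B f') h" if "f' \<in> Hp p" for f'
        using pairing_add_left[OF pq BH Hp_Lp[OF bounded_operator_imp(1)[OF B that]] Hp_Lp[OF h]] bounded_operator_imp(2)[OF B f that] by simp
      show "pairing (?B (cscale z f)) h = z * pairing (?B f) h" for z
        by (simp add: bounded_operator_imp(3)[OF B f] pairing_cscale_left)
      have "norm (pairing (?B f) h) \<le> Lp_norm p (?B f) * Lp_norm q h" by (rule norm_pairing_le[OF pq BH Hp_Lp[OF h]])
      also have "\<dots> \<le> C * Lp_norm p f * Lp_norm q h" by (intro mult_right_mono C f) simp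
      finally show "norm (pairing (?B f) h) \<le> C * Lp_norm q h * Lp_norm p f" by (simp add: mult_ac)
    qed (rule that)
    have "toeplitz (conjugate c) g - h = 0"
    proof (rule pairing_Hp_eq_0[OF pq])
      have Tg: "toeplitz (conjugate c) g \<in> Hp q" by (rule bounded_operator_imp(1)[OF T' g(1)])
      then show "toeplitz (conjugate c) g - h \<in> Hp q" by (rule Hp_diff[OF p(2) _ h])
      fix f assume f: "f \<in> Hp p"
      have Bf: "?B (toeplitz c f) = f" using bij f by (intro the_inv_into_f_f) (auto simp: bij_betw_def)
      have "pairing f (toeplitz (conjugate c) g) = pairing (toeplitz c f) g" by (rule pairing_toeplitz[OF pq c f g(1), symmetric])
      also have "\<dots> = pairing f h" using g(2)[OF bounded_operator_imp(1)[OF T f]] by (simp add: Bf)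
      finally show "pairing f (toeplitz (conjugate c) g - h) = 0"
        using pairing_diff_right[OF pq Hp_Lp[OF f] Hp_Lp[OF Tg] Hp_Lp[OF h]] by simp
    qed
    then show ?thesis using g(1) by (intro image_eqI[of _ _ g]) auto
  qed
  then show ?thesis using inj bounded_operator_imp(1)[OF T'] by (auto simp: bij_betw_def)
qed

section \<open>Toeplitz plus Hankel operators\<close>

text \<open>Multiplications and J leave H^p, so the inverses built below pass through L^p.
  Boundedness is collected there by composition, and only the final operator is restricted to
  H^p.\<close>

definition Lp_operator :: "real \<Rightarrow> (circ_fun \<Rightarrow> circ_fun) \<Rightarrow> bool" where
  "Lp_operator p A \<longleftrightarrow>
     (\<forall>f\<in>Lp p. A f \<in> Lp p) \<and> (\<forall>f\<in>Lp p. \<forall>g\<in>Lp p. A (f + g) = A f + A g) \<and>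
     (\<forall>z. \<forall>f\<in>Lp p. A (cscale z f) = cscale z (A f)) \<and> (\<exists>C\<ge>0. \<forall>f\<in>Lp p. Lp_norm p (A f) \<le> C * Lp_norm p f)"

lemma Lp_operator_bounded:
  assumes "Lp_operator p A" "\<And>f. f \<in> Hp p \<Longrightarrow> A f \<in> Hp p"
  shows "bounded_operator p A"
  using assms unfolding Lp_operator_def bounded_operator_def by (meson Hp_Lp)

lemma Lp_operator_id: "Lp_operator p (\<lambda>f. f)"
  by (auto simp: Lp_operator_def intro: exI[of _ 1])

lemma Lp_operatorE:
  assumes "Lp_operator p A"
  obtains C where "C \<ge> 0" "\<And>f. f \<in> Lp p \<Longrightarrow> Lp_norm p (A f) \<le> C * Lp_norm p f"
  using assms unfolding Lp_operator_def by blast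

lemma Lp_operator_compose:
  assumes A: "Lp_operator p A" and B: "Lp_operator p B"
  shows "Lp_operator p (\<lambda>f. A (B f))"
proof -
  obtain C where C: "C \<ge> 0" "\<And>f. f \<in> Lp p \<Longrightarrow> Lp_norm p (A f) \<le> C * Lp_norm p f" by (rule Lp_operatorE[OF A]) (rule that)
  obtain D where D: "D \<ge> 0" "\<And>f. f \<in> Lp p \<Longrightarrow> Lp_norm p (B f) \<le> D * Lp_norm p f" by (rule Lp_operatorE[OF B]) (rule that)
  have "Lp_norm p (A (B f)) \<le> C * D * Lp_norm p f" if f: "f \<in> Lp p" for f
  proof -
    have "B f \<in> Lp p" using B f by (simp add: Lp_operator_def)
    then have "Lp_norm p (A (B f)) \<le> C * Lp_norm p (B f)" by (rule C)
    also have "\<dots> \<le> C * (D * Lp_norm p f)" by (intro mult_left_mono D f C)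
    finally show ?thesis by (simp add: mult.assoc)
  qed
  then have "\<exists>K\<ge>0. \<forall>f\<in>Lp p. Lp_norm p (A (B f)) \<le> K * Lp_norm p f" using C D by (intro exI[of _ "C * D"]) simp
  then show ?thesis using A B by (simp add: Lp_operator_def)
qed

lemma Lp_operator_add:
  assumes p: "1 < p" and A: "Lp_operator p A" and B: "Lp_operator p B"
  shows "Lp_operator p (\<lambda>f. A f + B f)"
proof -
  obtain C where C: "C \<ge> 0" "\<And>f. f \<in> Lp p \<Longrightarrow> Lp_norm p (A f) \<le> C * Lp_norm p f" by (rule Lp_operatorE[OF A]) (rule that)
  obtain D where D: "D \<ge> 0" "\<And>f. f \<in> Lp p \<Longrightarrow> Lp_norm p (B f) \<le> D * Lp_norm p f" by (rule Lp_operatorE[OF B]) (rule that)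
  have "Lp_norm p (A f + B f) \<le> (C + D) * Lp_norm p f" if f: "f \<in> Lp p" for f
    using Lp_norm_triangle[of "A f" p "B f"] C(2)[OF f] D(2)[OF f] A B f p
    by (simp add: Lp_operator_def distrib_right)
  then have "\<exists>K\<ge>0. \<forall>f\<in>Lp p. Lp_norm p (A f + B f) \<le> K * Lp_norm p f" using C D by (intro exI[of _ "C + D"]) simp
  then show ?thesis using A B p by (simp add: Lp_operator_def Lp_add circ.scale_right_distrib)
qed

lemma Lp_operator_mult:
  assumes p: "1 < p" and c: "c \<in> Linf"
  shows "Lp_operator p (\<lambda>f. c * f)"
proof -
  obtain D where D: "D > 0" "AE t in arc_measure. norm (rep c t) \<le> D" using c by (auto elim: LinfE)
  have "\<exists>K\<ge>0. \<forall>f\<in>Lp p. Lp_norm p (c * f) \<le> K * Lp_norm p f"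
    using Linf_mult_Lp(2)[OF D(2)] D(1) p by (intro exI[of _ D]) simp
  then show ?thesis using mult_Lp[OF c] p by (simp add: Lp_operator_def distrib_left cscale_mult)
qed

lemma Lp_operator_flipJ: "Lp_operator p flipJ"
  by (auto simp: Lp_operator_def flipJ_Lp flipJ_Lp_norm flipJ_add flipJ_cscale intro: exI[of _ 1])

lemma Lp_operator_riesz: assumes p: "1 < p" shows "Lp_operator p riesz"
proof -
  obtain C where C: "C > 0" "\<And>f. f \<in> Lp p \<Longrightarrow> riesz f \<in> Hp p \<and> Lp_norm p (riesz f) \<le> C * Lp_norm p f
     \<and> (\<forall>n\<ge>0. fourier (riesz f) n = fourier f n)" using riesz_bounded[OF p] by blast
  have "\<exists>K\<ge>0. \<forall>f\<in>Lp p. Lp_norm p (riesz f) \<le> K * Lp_norm p f" using C by (intro exI[of _ C]) simp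
  then show ?thesis using C(2) by (simp add: Lp_operator_def riesz_add[OF p] riesz_cscale[OF p] Hp_Lp)
qed

text \<open>Precomposition with P extends an operator on H^p to all of L^p, so that it fits into
  such compositions.\<close>

lemma Lp_operator_on_Hp:
  assumes p: "1 < p" and A: "bounded_operator p A"
  shows "Lp_operator p (\<lambda>f. A (riesz f))"
proof -
  obtain C where C: "C > 0" "\<And>f. f \<in> Lp p \<Longrightarrow> riesz f \<in> Hp p \<and> Lp_norm p (riesz f) \<le> C * Lp_norm p f
     \<and> (\<forall>n\<ge>0. fourier (riesz f) n = fourier f n)" using riesz_bounded[OF p] by blast
  obtain D where D: "D > 0" "\<And>f. f \<in> Hp p \<Longrightarrow> Lp_norm p (A f) \<le> D * Lp_norm p f" by (rule bounded_operatorE[OF A]) (rule that)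
  have "Lp_norm p (A (riesz f)) \<le> D * C * Lp_norm p f" if f: "f \<in> Lp p" for f
  proof -
    have "Lp_norm p (A (riesz f)) \<le> D * Lp_norm p (riesz f)" using C(2)[OF f] by (intro D) simp
    also have "\<dots> \<le> D * (C * Lp_norm p f)" using C(2)[OF f] D(1) by (intro mult_left_mono) auto
    finally show ?thesis by (simp add: mult.assoc)
  qed
  then have "\<exists>K\<ge>0. \<forall>f\<in>Lp p. Lp_norm p (A (riesz f)) \<le> K * Lp_norm p f" using C D by (intro exI[of _ "D * C"]) simp
  then show ?thesis
    using bounded_operator_imp[OF A] by (simp add: Lp_operator_def riesz_add[OF p] riesz_cscale[OF p] Hp_Lp riesz_Hp[OF p])
qed

lemma bounded_operator_comp:
  assumes p: "1 < p" and A: "bounded_operator p A" and B: "bounded_operator p B"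
  shows "bounded_operator p (\<lambda>f. A (B f))"
proof -
  have "bounded_operator p (\<lambda>f. A (riesz (B (riesz f))))"
    by (rule Lp_operator_bounded[OF Lp_operator_compose[OF Lp_operator_on_Hp[OF p A] Lp_operator_on_Hp[OF p B]]])
      (simp add: riesz_id[OF p] bounded_operator_imp(1)[OF A] bounded_operator_imp(1)[OF B])
  moreover have "A (riesz (B (riesz f))) = A (B f)" if "f \<in> Hp p" for f
    using that by (simp add: riesz_id[OF p] bounded_operator_imp(1)[OF B])
  ultimately show ?thesis
    by (simp add: bounded_operator_def Hp_add[OF p] Hp_scale[OF p] cong: ball_cong)
qed

text \<open>For \<kappa> \<ge> 0, T(t^\<kappa>) is multiplication by t^\<kappa>, and T(g) is T(g
  t^\<kappa>) followed by P t^(-\<kappa>); the two powers cancel.\<close>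

lemma toeplitz_right_inverse:
  assumes p: "1 < p" and g: "g \<in> Linf" and \<kappa>: "\<kappa> = ind p (toeplitz g)" "\<kappa> \<ge> 0"
    and bij: "bij_betw (toeplitz (g * monomial \<kappa>)) (Hp p) (Hp p)"
  shows "bounded_operator p (toeplitz_right_inv p g)"
    and "\<And>f. f \<in> Hp p \<Longrightarrow> riesz (g * toeplitz_right_inv p g f) = f"
proof -
  have g\<kappa>: "g * monomial \<kappa> \<in> Linf" using g by (intro mult_Linf monomial_Linf)
  have R: "toeplitz_right_inv p g = (\<lambda>f. the_inv_into (Hp p) (toeplitz (g * monomial \<kappa>)) (toeplitz (monomial \<kappa>) f))"
    using \<kappa> by (simp add: toeplitz_right_inv_def Let_def coord_power fun_eq_iff)
  note B = bounded_inverse[OF p toeplitz_bounded[OF p g\<kappa>] bij]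
  note M = toeplitz_bounded[OF p monomial_Linf[of \<kappa>]]
  show "bounded_operator p (toeplitz_right_inv p g)" unfolding R by (rule bounded_operator_comp[OF p B M])
  fix f assume f: "f \<in> Hp p"
  define x where "x = toeplitz_right_inv p g f"
  have x: "x \<in> Hp p" using bounded_operator_imp(1)[OF \<open>bounded_operator p (toeplitz_right_inv p g)\<close> f] by (simp add: x_def)
  have mf: "toeplitz (monomial \<kappa>) f = monomial \<kappa> * f"
    using \<kappa>(2) by (simp add: toeplitz_def riesz_id[OF p] monomial_mult_Hp[OF p] f)
  have Tx: "toeplitz (g * monomial \<kappa>) x = monomial \<kappa> * f"
    unfolding x_def R mf using bij \<kappa>(2) monomial_mult_Hp[OF p f]
    by (intro f_the_inv_into_f) (auto simp: bij_betw_def)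
  have "riesz (g * x) = toeplitz (g * monomial \<kappa> * monomial (- \<kappa>)) x"
    by (simp add: toeplitz_def mult.assoc monomial_add[symmetric])
  also have "\<dots> = riesz (monomial (- \<kappa>) * (monomial \<kappa> * f))"
    using toeplitz_coanalytic[OF p g\<kappa> x, of "- \<kappa>"] \<kappa>(2) Tx by simp
  also have "\<dots> = f" by (simp add: mult.assoc[symmetric] monomial_add[symmetric] riesz_id[OF p f])
  finally show "riesz (g * toeplitz_right_inv p g f) = f" by (simp add: x_def)
qed

text \<open>For \<kappa> \<le> 0, T(g) f is T(g t^\<kappa>) applied to t^(-\<kappa>) f, which still
  lies in H^p; inverting and multiplying by t^\<kappa> recovers f.\<close>

lemma toeplitz_left_inverse:
  assumes p: "1 < p" and g: "g \<in> Linf" and \<kappa>: "\<kappa> \<le> 0"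
    and bij: "bij_betw (toeplitz (g * monomial \<kappa>)) (Hp p) (Hp p)"
  obtains L where "bounded_operator p L" "\<And>f. f \<in> Hp p \<Longrightarrow> L (riesz (g * f)) = f"
proof -
  let ?B = "the_inv_into (Hp p) (toeplitz (g * monomial \<kappa>))"
  have g\<kappa>: "g * monomial \<kappa> \<in> Linf" using g by (intro mult_Linf monomial_Linf)
  note B = bounded_inverse[OF p toeplitz_bounded[OF p g\<kappa>] bij]
  show ?thesis
  proof (rule that[OF bounded_operator_comp[OF p toeplitz_bounded[OF p monomial_Linf[of \<kappa>]] B]])
    fix f assume f: "f \<in> Hp p"
    have mf: "monomial (- \<kappa>) * f \<in> Hp p" using monomial_mult_Hp[OF p f] \<kappa> by simp
    have "riesz (g * f) = toeplitz (g * monomial \<kappa>) (monomial (- \<kappa>) * f)"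
      by (simp add: toeplitz_mult_monomial mult.assoc[symmetric] monomial_add[symmetric]) (simp add: toeplitz_def)
    then have "?B (riesz (g * f)) = monomial (- \<kappa>) * f"
      using bij mf by (simp add: the_inv_into_f_f bij_betw_def)
    then show "toeplitz (monomial \<kappa>) (?B (riesz (g * f))) = f"
      by (simp add: toeplitz_def mult.assoc[symmetric] monomial_add[symmetric] riesz_id[OF p f])
  qed
qed

lemma invertible_Linf_inverse:
  assumes "a \<in> Linf" "g \<in> Linf" "a * g = 1"
  shows "inverse a = g"
proof (rule circ_fun_eqI)
  show "AE t in arc_measure. rep (inverse a) t = rep g t"
    using rep_inverse[of a] rep_mult[of a g] rep_one
    by eventually_elim (use assms in \<open>auto intro: inverse_unique\<close>)
qed

text \<open>The sign \<open>\<epsilon>\<close> is one of the constant functions \<open>1\<close> and \<open>-1\<close>, so that both operators are treated at once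
  by identities in the ring \<open>circ_fun\<close>. On \<open>ker T(g)\<close> the operator \<open>J Q g P\<close> is \<open>f \<mapsto> J (g f)\<close>.\<close>

definition eigenspace :: "real \<Rightarrow> circ_fun \<Rightarrow> circ_fun \<Rightarrow> circ_fun set" where
  "eigenspace p \<epsilon> g = {f \<in> ker p (toeplitz g). flipJ (g * f) = \<epsilon> * f}"

definition T_H :: "circ_fun \<Rightarrow> circ_fun \<Rightarrow> circ_fun \<Rightarrow> circ_fun \<Rightarrow> circ_fun" where
  "T_H \<epsilon> a b f = riesz (a * f + \<epsilon> * (b * flipJ f))"

text \<open>Both \<open>phi_plus\<close> and \<open>phi_minus\<close>, with \<gamma> in place of the
  pair. Q has disappeared: P takes the same value on \<gamma> r and on the function to which the
  right inverse was applied, so their difference is already in the range of Q.\<close>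

definition phi :: "real \<Rightarrow> circ_fun \<Rightarrow> circ_fun \<Rightarrow> circ_fun \<Rightarrow> circ_fun \<Rightarrow> circ_fun" where
  "phi p \<epsilon> \<alpha> \<gamma> s =
     (let r = toeplitz_right_inv p \<gamma> (riesz (inverse (reflect \<alpha>) * s)) in r + \<epsilon> * flipJ (inverse (reflect \<alpha>) * s - \<gamma> * r))"

lemma flipJ_uminus: "flipJ (- f) = - flipJ f"
  using flipJ_cscale[of "-1" f] by (simp add: circ.scale_minus_left)

lemma flipJ_zero [simp]: "flipJ 0 = 0"
  using flipJ_diff[of 0 0] by simp

lemma riesz_zero [simp]: "riesz 0 = 0"
  by (rule riesz_eqI) (auto simp: Hp_def)

lemma reflect_uminus_one: "reflect (- 1) = - 1"
  using reflect_cscale[of "-1" 1] by (simp add: circ.scale_minus_left)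

section \<open>Eigenspaces of the involution f \<mapsto> J (g f)\<close>

locale reflection_sign =
  fixes p :: real and \<epsilon> :: circ_fun
  assumes p: "1 < p" and \<epsilon>: "\<epsilon> = 1 \<or> \<epsilon> = - 1"
begin

lemma eps_square [simp]: "\<epsilon> * \<epsilon> = 1" "\<epsilon> * (\<epsilon> * f) = f"
  using \<epsilon> by auto

lemma reflect_eps [simp]: "reflect \<epsilon> = \<epsilon>"
  using \<epsilon> reflect_uminus_one by auto

lemma eps_mult: "flipJ (\<epsilon> * f) = \<epsilon> * flipJ f" "\<epsilon> * f \<in> Lp p \<longleftrightarrow> f \<in> Lp p" "\<epsilon> * f \<in> Hp p \<longleftrightarrow> f \<in> Hp p"
  "f \<in> Lp p \<Longrightarrow> riesz (\<epsilon> * f) = \<epsilon> * riesz f"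
proof -
  have "- f \<in> Lp p \<longleftrightarrow> f \<in> Lp p" using Lp_uminus[of f p] Lp_uminus[of "- f" p] p by auto
  moreover have "- f \<in> Hp p \<longleftrightarrow> f \<in> Hp p"
    using circ.subspace_neg[OF subspace_Hp[OF p], of f] circ.subspace_neg[OF subspace_Hp[OF p], of "- f"] by auto
  moreover have "f \<in> Lp p \<Longrightarrow> riesz (- f) = - riesz f" using riesz_diff[OF p, of 0 f] p by simp
  ultimately show "flipJ (\<epsilon> * f) = \<epsilon> * flipJ f" "\<epsilon> * f \<in> Lp p \<longleftrightarrow> f \<in> Lp p" "\<epsilon> * f \<in> Hp p \<longleftrightarrow> f \<in> Hp p"
  "f \<in> Lp p \<Longrightarrow> riesz (\<epsilon> * f) = \<epsilon> * riesz f" using \<epsilon> by (auto simp: flipJ_uminus)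
qed

lemma eps_Linf: "\<epsilon> \<in> Linf"
proof -
  have "1 \<in> Linf" using monomial_Linf[of 0] by simp
  then show ?thesis using \<epsilon> circ.subspace_neg[OF subspace_Linf] by auto
qed

lemma subspace_eigenspace:
  assumes g: "g \<in> Linf"
  shows "circ.subspace (eigenspace p \<epsilon> g)"
  using circ.subspace_0[OF subspace_ker[OF p toeplitz_bounded[OF p g]]]
    circ.subspace_add[OF subspace_ker[OF p toeplitz_bounded[OF p g]]]
    circ.subspace_scale[OF subspace_ker[OF p toeplitz_bounded[OF p g]]]
  by (auto simp: circ.subspace_def eigenspace_def distrib_left flipJ_add cscale_mult flipJ_cscale)

text \<open>g \<cdot> reflect g = 1 makes J g an involution of ker T(g), and (I + \<epsilon> J g) /
  2 is the projection onto its \<epsilon>-eigenspace.\<close>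

lemma half_eigenprojection_image:
  assumes g: "g \<in> Linf" "g * reflect g = 1"
  shows "(\<lambda>f. cscale (1/2) (f + \<epsilon> * PP g f)) ` ker p (toeplitz g) = eigenspace p \<epsilon> g"
proof -
  have PP: "PP g f = flipJ (g * f)" if "f \<in> ker p (toeplitz g)" for f
    using that by (simp add: PP_def ker_def riesz_id[OF p] riesz_compl_def toeplitz_def)
  have gL: "g * f \<in> Lp p" if "f \<in> Hp p" for f using mult_Lp[OF g(1) Hp_Lp[OF that]] p by simp
  have inv: "g * flipJ (g * f) = flipJ f" for f using g(2) by (simp add: flipJ_mult mult.assoc[symmetric])
  have k: "flipJ (g * f) \<in> ker p (toeplitz g)" if "f \<in> ker p (toeplitz g)" for f
    using that flipJ_Hp[OF p gL] riesz_flipJ[OF p] by (auto simp: ker_def toeplitz_def inv)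
  note S = subspace_ker[OF p toeplitz_bounded[OF p g(1)]]
  have ek: "\<epsilon> * f \<in> ker p (toeplitz g)" if "f \<in> ker p (toeplitz g)" for f
    using \<epsilon> that circ.subspace_neg[OF S] by auto
  show ?thesis
  proof (intro equalityI subsetI)
    fix x assume "x \<in> (\<lambda>f. cscale (1/2) (f + \<epsilon> * PP g f)) ` ker p (toeplitz g)"
    then obtain f where f: "f \<in> ker p (toeplitz g)" "x = cscale (1/2) (f + \<epsilon> * flipJ (g * f))" using PP by auto
    have x: "x \<in> ker p (toeplitz g)" unfolding f(2) by (intro circ.subspace_scale[OF S] circ.subspace_add[OF S] f ek k)
    have "flipJ (g * x) = cscale (1/2) (flipJ (g * f) + \<epsilon> * f)"
      using inv[of f] by (simp add: f(2) cscale_mult flipJ_cscale distrib_left flipJ_add mult.left_commute[of g] eps_mult)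
    also have "\<dots> = \<epsilon> * x" by (simp add: f(2) cscale_mult distrib_left add.commute)
    finally show "x \<in> eigenspace p \<epsilon> g" using x by (simp add: eigenspace_def)
  next
    fix f assume "f \<in> eigenspace p \<epsilon> g"
    then have f: "f \<in> ker p (toeplitz g)" "flipJ (g * f) = \<epsilon> * f" by (auto simp: eigenspace_def)
    have "cscale (1/2) (f + \<epsilon> * PP g f) = cscale (1/2) f + cscale (1/2) f"
      by (simp only: PP[OF f(1)] f(2) eps_square circ.scale_right_distrib)
    also have "\<dots> = cscale (1/2 + 1/2) f" by (simp only: circ.scale_left_distrib)
    finally have "f = cscale (1/2) (f + \<epsilon> * PP g f)" by simp
    then show "f \<in> (\<lambda>f. cscale (1/2) (f + \<epsilon> * PP g f)) ` ker p (toeplitz g)" using f(1) by blast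
  qed
qed

lemma T_H_operator:
  assumes "a \<in> Linf" "b \<in> Linf"
  shows "bounded_operator p (T_H \<epsilon> a b)"
  unfolding T_H_def
  by (rule Lp_operator_bounded[OF Lp_operator_compose[OF Lp_operator_riesz[OF p] Lp_operator_add[OF p Lp_operator_mult[OF p assms(1)]
      Lp_operator_compose[OF Lp_operator_mult[OF p eps_Linf] Lp_operator_compose[OF Lp_operator_mult[OF p assms(2)] Lp_operator_flipJ]]]]])
    (use assms p in \<open>auto intro!: riesz_Hp Lp_add mult_Lp eps_Linf simp: flipJ_Lp Hp_Lp\<close>)

text \<open>With a right inverse \<open>R\<close> of \<open>T(g)\<close>, the first summand solves the analytic part of the equation and the
  second one corrects the remainder, which is an eigenvector of the involution.\<close>

lemma solve_reflection:
  assumes g: "g \<in> Linf" "g * reflect g = 1"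
    and R: "bounded_operator p R" "\<And>f. f \<in> Hp p \<Longrightarrow> riesz (g * R f) = f"
    and y: "y \<in> Lp p" "g * flipJ y = \<epsilon> * y"
  defines "x \<equiv> cscale (1/2) (R (riesz y) + \<epsilon> * flipJ (y - g * R (riesz y)))"
  shows "x \<in> Hp p" "g * x + \<epsilon> * flipJ x = y"
proof -
  define u where "u = R (riesz y)"
  have u: "u \<in> Hp p" "riesz (g * u) = riesz y"
    unfolding u_def using bounded_operator_imp(1)[OF R(1)] R(2) riesz_Hp[OF p y(1)] by auto
  have guL: "g * u \<in> Lp p" using mult_Lp[OF g(1) Hp_Lp[OF u(1)]] p by simp
  have dL: "y - g * u \<in> Lp p" using y guL p by (simp add: Lp_diff)
  have "riesz (y - g * u) = 0" using riesz_diff[OF p y(1) guL] u by simp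
  then have dH: "flipJ (y - g * u) \<in> Hp p" by (rule flipJ_Hp[OF p dL])
  show "x \<in> Hp p" unfolding x_def u_def[symmetric]
    by (intro Hp_scale[OF p] Hp_add[OF p] u) (simp add: eps_mult dH)
  have e: "g * flipJ (y - g * u) = \<epsilon> * y - flipJ u"
    using g(2) y(2) by (simp add: flipJ_diff flipJ_mult right_diff_distrib mult.assoc[symmetric])
  have gx: "g * x = cscale (1/2) (g * u + (y - \<epsilon> * flipJ u))"
    unfolding x_def u_def[symmetric] by (simp add: cscale_mult distrib_left mult.left_commute[of g \<epsilon>] e right_diff_distrib)
  have Jx: "\<epsilon> * flipJ x = cscale (1/2) (\<epsilon> * flipJ u + (y - g * u))"
    unfolding x_def u_def[symmetric] by (simp add: flipJ_cscale flipJ_add eps_mult cscale_mult distrib_left)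
  have "g * x + \<epsilon> * flipJ x = cscale (1/2) (y + y)"
    unfolding gx Jx circ.scale_right_distrib[symmetric] by (simp add: algebra_simps)
  also have "\<dots> = cscale (1/2 + 1/2) y" by (simp only: circ.scale_left_distrib circ.scale_right_distrib)
  finally show "g * x + \<epsilon> * flipJ x = y" by simp
qed

end

text \<open>The inverses a' and b' are parameters because \<open>circ_fun\<close> is only a ring:
  its pointwise \<open>inverse\<close> satisfies no field laws.\<close>

locale matching = reflection_sign +
  fixes a b c d a' b' :: circ_fun
  assumes ab: "a \<in> Linf" "b \<in> Linf" "a' \<in> Linf" "b' \<in> Linf" "a * a' = 1" "b * b' = 1"
    and match: "a * reflect a = b * reflect b"
    and c: "c = a * b'" and d: "d = b * reflect a'"
begin

lemma cd_Linf: "c \<in> Linf" "d \<in> Linf"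
  using ab by (auto simp: c d reflect_Linf intro: mult_Linf)

lemma unit_cancel: "a * (a' * f) = f" "b * (b' * f) = f" "a' * (a * f) = f" "b' * (b * f) = f"
  "reflect a * (reflect a' * f) = f" "reflect b * (reflect b' * f) = f" "reflect a' * (reflect a * f) = f" "reflect b' * (reflect b * f) = f"
proof -
  have r: "reflect a * reflect a' = 1" "reflect b * reflect b' = 1"
    unfolding reflect_mult[symmetric] ab(5,6) by simp_all
  have com: "x * y = 1 \<Longrightarrow> y * x = 1" for x y :: circ_fun by (simp add: mult.commute)
  show "a * (a' * f) = f" "b * (b' * f) = f" "a' * (a * f) = f" "b' * (b * f) = f"
  "reflect a * (reflect a' * f) = f" "reflect b * (reflect b' * f) = f" "reflect a' * (reflect a * f) = f" "reflect b' * (reflect b * f) = f"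
    using ab(5,6) r com[OF ab(5)] com[OF ab(6)] com[OF r(1)] com[OF r(2)] by (simp_all add: mult.assoc[symmetric])
qed

lemma match_mult: "b * (reflect b * f) = a * (reflect a * f)"
  using match by (simp add: mult.assoc[symmetric])

lemma cd_reflect: "c * reflect c = 1" "d * reflect d = 1"
proof -
  have "c * reflect c = b' * (reflect b' * (a * (reflect a * 1)))" by (simp add: c reflect_mult mult_ac)
  also have "\<dots> = b' * (reflect b' * (b * (reflect b * 1)))" by (simp only: match_mult)
  also have "\<dots> = 1" using unit_cancel(4)[of 1] unit_cancel(8)[of 1] by (simp add: mult.left_commute[of "reflect b'" b] unit_cancel)
  finally show "c * reflect c = 1" .
  have "d * reflect d = a' * (reflect a' * (b * (reflect b * 1)))" by (simp add: d reflect_mult mult_ac)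
  also have "\<dots> = a' * (reflect a' * (a * (reflect a * 1)))" by (simp only: match_mult)
  also have "\<dots> = 1" using unit_cancel(3)[of 1] unit_cancel(7)[of 1] by (simp add: mult.left_commute[of "reflect a'" a] unit_cancel)
  finally show "d * reflect d = 1" .
qed

lemma b_mult: "b * (c * f) = a * f" "b * (reflect a' * f) = d * f" "b' * (d * f) = reflect a' * f" "b' * (a * f) = c * f"
proof -
  show "b * (c * f) = a * f" by (simp add: c mult.assoc mult.left_commute[of b a] unit_cancel)
  show "b * (reflect a' * f) = d * f" by (simp add: d mult.assoc)
  show "b' * (d * f) = reflect a' * f" by (simp add: d mult.assoc unit_cancel)
  show "b' * (a * f) = c * f" by (simp add: c mult_ac)
qed

text \<open>The second form of the subordinated function, c = reflect b / reflect a, which is the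
  matching condition divided by b and by reflect a.\<close>

lemma c_reflect_b': "c * (reflect b' * f) = reflect a' * f"
proof -
  have "c * (reflect b' * f) = b' * (reflect b' * (reflect a' * (a * (reflect a * f))))"
    by (simp add: c mult.assoc unit_cancel mult.left_commute[of "reflect a'" a] mult.left_commute[of a b']
        mult.left_commute[of a "reflect b'"])
  also have "\<dots> = b' * (reflect b' * (reflect a' * (b * (reflect b * f))))" by (simp only: match_mult)
  also have "\<dots> = reflect a' * f"
    by (simp add: unit_cancel mult.left_commute[of "reflect a'" b] mult.left_commute[of "reflect b'" b]
        mult.left_commute[of "reflect a'" "reflect b"])
  finally show ?thesis .
qed

lemma d_reflect: "d * (reflect a * f) = b * f" "d * (reflect b * f) = a * f"
proof -
  show "d * (reflect a * f) = b * f" by (simp add: d mult.assoc unit_cancel)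
  have "d * (reflect b * f) = reflect a' * (b * (reflect b * f))" by (simp add: d mult_ac)
  also have "\<dots> = reflect a' * (a * (reflect a * f))" by (simp only: match_mult)
  also have "\<dots> = a * f" by (simp add: mult.left_commute[of "reflect a'" a] unit_cancel)
  finally show "d * (reflect b * f) = a * f" .
qed

text \<open>The function G of the overview: the operator before the final projection.\<close>

definition pre_T_H :: "circ_fun \<Rightarrow> circ_fun" where
  "pre_T_H f = a * f + \<epsilon> * (b * flipJ f)"

lemma pre_T_H_Lp: "f \<in> Lp p \<Longrightarrow> pre_T_H f \<in> Lp p"
  unfolding pre_T_H_def using ab p by (intro Lp_add) (auto simp: flipJ_Lp intro!: mult_Lp eps_Linf)

text \<open>J replaces a and b by their reflections and exchanges f with J f; d turns reflect a into
  b and reflect b into a, which restores the two terms in the opposite order.\<close>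

lemma d_flipJ_pre_T_H: "d * flipJ (pre_T_H f) = \<epsilon> * pre_T_H f"
  by (simp add: pre_T_H_def flipJ_add eps_mult flipJ_mult distrib_left d_reflect mult.left_commute[of d \<epsilon>] add.commute)

lemma pre_T_H_eq: "pre_T_H f = b * (c * f + \<epsilon> * flipJ f)"
  by (simp add: pre_T_H_def distrib_left b_mult mult.left_commute[of b \<epsilon>])

lemma pre_T_H_eq_0_iff: "pre_T_H f = 0 \<longleftrightarrow> c * f = - (\<epsilon> * flipJ f)"
proof
  assume "pre_T_H f = 0"
  then have "b' * pre_T_H f = 0" by simp
  then show "c * f = - (\<epsilon> * flipJ f)" by (simp add: pre_T_H_eq unit_cancel eq_neg_iff_add_eq_0)
qed (simp add: pre_T_H_eq)

text \<open>After division by b the equation reads c f = -\<epsilon> J f. As P annihilates J f, such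
  an f lies in ker T(c) automatically.\<close>

lemma pre_T_H_kernel:
  assumes f: "f \<in> Hp p"
  shows "pre_T_H f = 0 \<longleftrightarrow> f \<in> eigenspace p (- \<epsilon>) c"
proof
  assume "pre_T_H f = 0"
  then have e: "c * f = - (\<epsilon> * flipJ f)" by (simp add: pre_T_H_eq_0_iff)
  have "riesz (\<epsilon> * flipJ f) = 0" using riesz_flipJ[OF p f] Hp_Lp[OF f] by (simp add: eps_mult flipJ_Lp)
  then have "riesz (0 - \<epsilon> * flipJ f) = 0"
    using riesz_diff[OF p, of 0 "\<epsilon> * flipJ f"] p Hp_Lp[OF f] by (simp add: eps_mult flipJ_Lp)
  then show "f \<in> eigenspace p (- \<epsilon>) c"
    using f e by (simp add: eigenspace_def ker_def toeplitz_def flipJ_uminus eps_mult)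
next
  assume "f \<in> eigenspace p (- \<epsilon>) c"
  then have "flipJ (flipJ (c * f)) = flipJ (- (\<epsilon> * f))" by (simp add: eigenspace_def)
  then show "pre_T_H f = 0" by (simp add: pre_T_H_eq_0_iff flipJ_uminus eps_mult)
qed

lemma T_H_kernel:
  assumes f: "f \<in> ker p (T_H \<epsilon> a b)"
  shows "flipJ (pre_T_H f) \<in> eigenspace p \<epsilon> d"
proof -
  have fH: "f \<in> Hp p" and r: "riesz (pre_T_H f) = 0" using f by (auto simp: ker_def T_H_def pre_T_H_def)
  have sH: "flipJ (pre_T_H f) \<in> Hp p" by (rule flipJ_Hp[OF p pre_T_H_Lp[OF Hp_Lp[OF fH]] r])
  have "riesz (d * flipJ (pre_T_H f)) = 0" using r pre_T_H_Lp[OF Hp_Lp[OF fH]] by (simp add: d_flipJ_pre_T_H eps_mult)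
  then show ?thesis using sH by (simp add: eigenspace_def ker_def toeplitz_def d_flipJ_pre_T_H eps_mult)
qed

lemma eigenspace_subset_kernel: "eigenspace p (- \<epsilon>) c \<subseteq> ker p (T_H \<epsilon> a b)"
proof
  fix f assume f: "f \<in> eigenspace p (- \<epsilon>) c"
  then have fH: "f \<in> Hp p" by (simp add: eigenspace_def ker_def)
  then have "pre_T_H f = 0" using pre_T_H_kernel f by blast
  then show "f \<in> ker p (T_H \<epsilon> a b)" using fH by (simp add: ker_def T_H_def pre_T_H_def[symmetric])
qed

lemma T_H_kernel_injective:
  assumes "ker p (toeplitz d) = {0}"
  shows "ker p (T_H \<epsilon> a b) = eigenspace p (- \<epsilon>) c"
proof
  show "ker p (T_H \<epsilon> a b) \<subseteq> eigenspace p (- \<epsilon>) c"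
  proof
    fix f assume f: "f \<in> ker p (T_H \<epsilon> a b)"
    then have "flipJ (pre_T_H f) = 0" using T_H_kernel[OF f] assms by (simp add: eigenspace_def)
    then have "pre_T_H f = 0" by (metis flipJ_flipJ flipJ_zero)
    then show "f \<in> eigenspace p (- \<epsilon>) c" using pre_T_H_kernel f by (simp add: ker_def)
  qed
qed (rule eigenspace_subset_kernel)

text \<open>A solution of P G = g has the form G = g + J x1 with x1 in H^p, and d J G = \<epsilon> G
  becomes d x1 - \<epsilon> J x1 = \<epsilon> g - d J g. This is the reflection equation for d with
  sign -\<epsilon>. Then c f + \<epsilon> J f = b' G, the equation for c with sign \<epsilon>,
  yields f.\<close>

lemma T_H_right_invertible:
  assumes R: "bounded_operator p R" "\<And>f. f \<in> Hp p \<Longrightarrow> riesz (c * R f) = f"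
    and S: "bounded_operator p S" "\<And>f. f \<in> Hp p \<Longrightarrow> riesz (d * S f) = f"
  shows "right_invertible p (T_H \<epsilon> a b)"
proof -
  interpret neg: reflection_sign p "- \<epsilon>" by unfold_locales (use p \<epsilon> in auto)
  \<comment> \<open>The solution formulas are written with sums and the factors - d, - c, to match
    the rules for sums and products of operators on L^p.\<close>
  define X1 where "X1 y = cscale (1/2) (S (riesz y) + (- \<epsilon>) * flipJ (y + (- d) * S (riesz y)))" for y
  define X where "X y = cscale (1/2) (R (riesz y) + \<epsilon> * flipJ (y + (- c) * R (riesz y)))" for y
  define B where "B g = X (b' * (g + flipJ (X1 (\<epsilon> * g + (- d) * flipJ g))))" for g
  have neg_Linf: "- c \<in> Linf" "- d \<in> Linf" "- \<epsilon> \<in> Linf"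
    using cd_Linf eps_Linf circ.subspace_neg[OF subspace_Linf] by auto
  have half: "Lp_operator p (cscale (1/2))"
    using p by (auto simp: Lp_operator_def Lp_cscale circ.scale_right_distrib mult.commute intro!: exI[of _ "1/2"])
  note ops = Lp_operator_compose Lp_operator_add[OF p] Lp_operator_mult[OF p] Lp_operator_flipJ Lp_operator_id
  note opR = Lp_operator_on_Hp[OF p R(1)] and opS = Lp_operator_on_Hp[OF p S(1)]
  have opX1: "Lp_operator p X1" unfolding X1_def
    by (rule Lp_operator_compose[OF half], rule Lp_operator_add[OF p opS], rule Lp_operator_compose[OF Lp_operator_mult[OF p neg_Linf(3)]],
      rule Lp_operator_compose[OF Lp_operator_flipJ], rule Lp_operator_add[OF p Lp_operator_id], rule Lp_operator_compose[OF Lp_operator_mult[OF p neg_Linf(2)] opS])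
  have opX: "Lp_operator p X" unfolding X_def
    by (rule Lp_operator_compose[OF half], rule Lp_operator_add[OF p opR], rule Lp_operator_compose[OF Lp_operator_mult[OF p eps_Linf]],
      rule Lp_operator_compose[OF Lp_operator_flipJ], rule Lp_operator_add[OF p Lp_operator_id], rule Lp_operator_compose[OF Lp_operator_mult[OF p neg_Linf(1)] opR])
  have opB: "Lp_operator p B" unfolding B_def
    by (rule Lp_operator_compose[OF opX], rule Lp_operator_compose[OF Lp_operator_mult[OF p ab(4)]], rule Lp_operator_add[OF p Lp_operator_id],
      rule Lp_operator_compose[OF Lp_operator_flipJ], rule Lp_operator_compose[OF opX1], 
      rule Lp_operator_add[OF p Lp_operator_mult[OF p eps_Linf]], rule Lp_operator_compose[OF Lp_operator_mult[OF p neg_Linf(2)] Lp_operator_flipJ])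
  have sol: "B g \<in> Hp p \<and> T_H \<epsilon> a b (B g) = g" if g: "g \<in> Hp p" for g
  proof -
    define y1 where "y1 = \<epsilon> * g + (- d) * flipJ g"
    define x1 where "x1 = X1 y1"
    have y1L: "y1 \<in> Lp p" unfolding y1_def using g p neg_Linf
      by (intro Lp_add) (auto simp: flipJ_Lp Hp_Lp simp del: mult_minus_left intro!: mult_Lp eps_Linf)
    have dd: "d * (reflect d * f) = f" for f using cd_reflect(2) by (simp add: mult.assoc[symmetric])
    have "d * flipJ y1 = - \<epsilon> * y1"
      by (simp add: y1_def flipJ_diff flipJ_mult eps_mult right_diff_distrib dd mult.left_commute[of d \<epsilon>])
    from neg.solve_reflection[OF cd_Linf(2) cd_reflect(2) S y1L this] have x1: "x1 \<in> Hp p" "d * x1 = y1 + \<epsilon> * flipJ x1"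
      by (auto simp: x1_def X1_def algebra_simps)
    define G where "G = g + flipJ x1"
    have GL: "G \<in> Lp p" unfolding G_def using g x1 p by (intro Lp_add) (auto simp: flipJ_Lp Hp_Lp)
    have dG: "d * flipJ G = \<epsilon> * G"
      by (simp add: G_def flipJ_add distrib_left x1(2)) (simp add: y1_def)
    define y where "y = b' * G"
    have yL: "y \<in> Lp p" unfolding y_def using mult_Lp[OF ab(4) GL] p by simp
    have "c * flipJ y = b' * (d * flipJ G)" by (simp add: y_def flipJ_mult c_reflect_b' b_mult)
    then have cy: "c * flipJ y = \<epsilon> * y" by (simp add: dG y_def mult_ac)
    have X: "X y \<in> Hp p" "c * X y + \<epsilon> * flipJ (X y) = y"
      using solve_reflection[OF cd_Linf(1) cd_reflect(1) R yL cy] by (simp_all add: X_def)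
    have "pre_T_H (X y) = G" by (simp add: pre_T_H_eq X(2)) (simp add: y_def unit_cancel)
    moreover have "riesz G = g"
      using riesz_add[OF p Hp_Lp[OF g], of "flipJ x1"] x1 by (simp add: G_def flipJ_Lp Hp_Lp riesz_id[OF p g] riesz_flipJ[OF p])
    moreover have "B g = X y" by (simp add: B_def y_def G_def x1_def y1_def)
    ultimately show ?thesis using X(1) by (simp add: T_H_def pre_T_H_def)
  qed
  then have "bounded_operator p B" using Lp_operator_bounded[OF opB] by blast
  then show ?thesis unfolding right_invertible_def using T_H_operator[OF ab(1,2)] sol by blast
qed

text \<open>With g = P G and G = g + J s, the relation d J G = \<epsilon> G gives d s = \<epsilon> g
  - d J g + \<epsilon> J s. P removes the last term, and the left inverse of T(d) recovers s, hence
  G. The left inverse of T(c) then recovers f from b' G = c f + \<epsilon> J f.\<close>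

lemma T_H_left_invertible:
  assumes R: "bounded_operator p R" "\<And>f. f \<in> Hp p \<Longrightarrow> R (riesz (c * f)) = f"
    and S: "bounded_operator p S" "\<And>f. f \<in> Hp p \<Longrightarrow> S (riesz (d * f)) = f"
  shows "left_invertible p (T_H \<epsilon> a b)"
proof -
  define B where "B g = R (riesz (b' * (g + flipJ (S (riesz (\<epsilon> * g + (- d) * flipJ g))))))" for g
  have neg_Linf: "- d \<in> Linf" using cd_Linf circ.subspace_neg[OF subspace_Linf] by auto
  have opB: "Lp_operator p B" unfolding B_def
    by (rule Lp_operator_compose[OF Lp_operator_on_Hp[OF p R(1)]], rule Lp_operator_compose[OF Lp_operator_mult[OF p ab(4)]],
      rule Lp_operator_add[OF p Lp_operator_id],
      rule Lp_operator_compose[OF Lp_operator_flipJ], rule Lp_operator_compose[OF Lp_operator_on_Hp[OF p S(1)]], 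
      rule Lp_operator_add[OF p Lp_operator_mult[OF p eps_Linf]], rule Lp_operator_compose[OF Lp_operator_mult[OF p neg_Linf] Lp_operator_flipJ])
  have BH: "B g \<in> Hp p" if g: "g \<in> Hp p" for g
  proof -
    have "\<epsilon> * g + (- d) * flipJ g \<in> Lp p"
      using g p neg_Linf by (intro Lp_add) (auto simp: flipJ_Lp Hp_Lp simp del: mult_minus_left intro!: mult_Lp eps_Linf)
    then have "S (riesz (\<epsilon> * g + (- d) * flipJ g)) \<in> Hp p" by (intro bounded_operator_imp(1)[OF S(1)] riesz_Hp[OF p])
    then have "b' * (g + flipJ (S (riesz (\<epsilon> * g + (- d) * flipJ g)))) \<in> Lp p"
      using g p ab(4) by (intro mult_Lp Lp_add) (auto simp: flipJ_Lp Hp_Lp)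
    then show ?thesis unfolding B_def by (intro bounded_operator_imp(1)[OF R(1)] riesz_Hp[OF p])
  qed
  have "B (T_H \<epsilon> a b f) = f" if f: "f \<in> Hp p" for f
  proof -
    define g where "g = T_H \<epsilon> a b f"
    have FL: "pre_T_H f \<in> Lp p" by (rule pre_T_H_Lp[OF Hp_Lp[OF f]])
    have g: "g = riesz (pre_T_H f)" "g \<in> Hp p" using riesz_Hp[OF p FL] by (auto simp: g_def T_H_def pre_T_H_def)
    define s where "s = flipJ (pre_T_H f - g)"
    have "riesz (pre_T_H f - g) = 0" using riesz_diff[OF p FL Hp_Lp[OF g(2)]] riesz_id[OF p g(2)] g(1) by simp
    then have s: "s \<in> Hp p" unfolding s_def using FL g(2) p by (intro flipJ_Hp) (auto simp: Lp_diff Hp_Lp)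
    have Fs: "pre_T_H f = g + flipJ s" by (simp add: s_def)
    have "d * flipJ (pre_T_H f) = \<epsilon> * pre_T_H f" by (rule d_flipJ_pre_T_H)
    then have "d * s = (\<epsilon> * g + (- d) * flipJ g) + \<epsilon> * flipJ s"
      unfolding Fs by (simp add: flipJ_add distrib_left algebra_simps)
    moreover have L: "\<epsilon> * g + (- d) * flipJ g \<in> Lp p" "\<epsilon> * flipJ s \<in> Lp p"
      using g(2) s p neg_Linf by (auto simp: flipJ_Lp Hp_Lp simp del: mult_minus_left intro!: mult_Lp Lp_add eps_Linf)
    ultimately have "riesz (d * s) = riesz (\<epsilon> * g + (- d) * flipJ g)"
      using riesz_add[OF p L] s by (simp add: eps_mult flipJ_Lp Hp_Lp riesz_flipJ[OF p])
    then have Ss: "S (riesz (\<epsilon> * g + (- d) * flipJ g)) = s" using S(2)[OF s] by simp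
    have "b' * pre_T_H f = c * f + \<epsilon> * flipJ f" by (simp add: pre_T_H_eq unit_cancel)
    moreover have L2: "c * f \<in> Lp p" "\<epsilon> * flipJ f \<in> Lp p" using f p cd_Linf by (auto simp: flipJ_Lp Hp_Lp intro!: mult_Lp eps_Linf)
    ultimately have "riesz (b' * pre_T_H f) = riesz (c * f)"
      using riesz_add[OF p L2] f by (simp add: eps_mult flipJ_Lp Hp_Lp riesz_flipJ[OF p])
    then have "R (riesz (b' * (g + flipJ s))) = f" using R(2)[OF f] Fs by simp
    then show ?thesis unfolding B_def g_def[symmetric] Ss .
  qed
  moreover have "bounded_operator p B" using Lp_operator_bounded[OF opB] BH by blast
  ultimately show ?thesis unfolding left_invertible_def using T_H_operator[OF ab(1,2)] by blast
qed

text \<open>The map f \<mapsto> G has kernel the (-\<epsilon>)-eigenspace for c and sends phi(s) to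
  2 \<epsilon> J s. Subtracting the phi belonging to half of \<epsilon> J G therefore brings a
  kernel element into that eigenspace.\<close>

lemma T_H_kernel_direct_sum:
  assumes a': "inverse (reflect a) = reflect a'"
    and R: "bounded_operator p (toeplitz_right_inv p c)" "\<And>f. f \<in> Hp p \<Longrightarrow> riesz (c * toeplitz_right_inv p c f) = f"
  shows "direct_sum (ker p (T_H \<epsilon> a b)) (eigenspace p (- \<epsilon>) c) (phi p \<epsilon> a c ` eigenspace p \<epsilon> d)"
proof -
  interpret neg: reflection_sign p "- \<epsilon>" by unfold_locales (use p \<epsilon> in auto)
  note neg = neg.subspace_eigenspace[OF cd_Linf(1)]
  let ?R = "toeplitz_right_inv p c"
  note V = subspace_ker[OF p T_H_operator[OF ab(1,2)]]
  have sd: "circ.subspace (eigenspace p \<epsilon> d)" by (rule subspace_eigenspace[OF cd_Linf(2)])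
  have aL: "reflect a' * s \<in> Lp p" if "s \<in> Hp p" for s
    using mult_Lp[of "reflect a'" s p] that ab(3) p by (simp add: reflect_Linf Hp_Lp)
  have phi: "phi p \<epsilon> a c s \<in> Hp p \<and> pre_T_H (phi p \<epsilon> a c s) = cscale 2 (\<epsilon> * flipJ s)" if s: "s \<in> eigenspace p \<epsilon> d" for s
  proof -
    have sH: "s \<in> Hp p" and "flipJ (d * s) = \<epsilon> * s" using s by (auto simp: eigenspace_def ker_def)
    then have "flipJ (flipJ (d * s)) = flipJ (\<epsilon> * s)" by simp
    then have ds: "d * s = \<epsilon> * flipJ s" by (simp add: eps_mult)
    \<comment> \<open>Since d s = \<epsilon> J s, this is b' J s, the right-hand side of the
      reflection equation for c. Its solution is half of \<epsilon> phi(s).\<close>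
    define y where "y = \<epsilon> * (reflect a' * s)"
    have yL: "y \<in> Lp p" using aL[OF sH] by (simp add: y_def eps_mult)
    have "y = \<epsilon> * (b' * (\<epsilon> * flipJ s))" unfolding y_def ds[symmetric] b_mult(3) ..
    then have "y = b' * flipJ s" by (simp add: mult.left_commute[of b' \<epsilon>])
    then have "c * flipJ y = reflect a' * s" by (simp add: flipJ_mult c_reflect_b')
    then have "c * flipJ y = \<epsilon> * y" by (simp add: y_def)
    note X = solve_reflection[OF cd_Linf(1) cd_reflect(1) R yL this]
    define r where "r = ?R (riesz (reflect a' * s))"
    have ry: "?R (riesz y) = \<epsilon> * r"
    proof -
      have H: "riesz (reflect a' * s) \<in> Hp p" by (rule riesz_Hp[OF p aL[OF sH]])
      have "?R (- h) = - ?R h" if "h \<in> Hp p" for h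
        using bounded_operator_imp(3)[OF R(1) that, of "-1"] by (simp add: circ.scale_minus_left)
      then have "?R (\<epsilon> * h) = \<epsilon> * ?R h" if "h \<in> Hp p" for h using \<epsilon> that by auto
      then show ?thesis using H aL[OF sH] by (simp add: y_def r_def eps_mult)
    qed
    have ph: "phi p \<epsilon> a c s = r + \<epsilon> * flipJ (reflect a' * s - c * r)" by (simp add: phi_def a' r_def Let_def)
    have "cscale (1/2) (?R (riesz y) + \<epsilon> * flipJ (y - c * ?R (riesz y))) = cscale (1/2) (\<epsilon> * phi p \<epsilon> a c s)"
      unfolding ry ph unfolding y_def
      by (simp add: distrib_left mult.left_commute[of c \<epsilon>] eps_mult flip: right_diff_distrib)
    then have X': "cscale (1/2) (\<epsilon> * phi p \<epsilon> a c s) \<in> Hp p"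
      "c * cscale (1/2) (\<epsilon> * phi p \<epsilon> a c s) + \<epsilon> * flipJ (cscale (1/2) (\<epsilon> * phi p \<epsilon> a c s)) = y" using X by simp_all
    have e2: "cscale 2 (cscale (1/2) (\<epsilon> * phi p \<epsilon> a c s)) = \<epsilon> * phi p \<epsilon> a c s" by simp
    have H: "phi p \<epsilon> a c s \<in> Hp p" using Hp_scale[OF p X'(1), of 2] unfolding e2 by (simp add: eps_mult)
    have "cscale (1/2) (\<epsilon> * (c * phi p \<epsilon> a c s + \<epsilon> * flipJ (phi p \<epsilon> a c s))) = y"
      using X'(2) by (simp add: cscale_mult flipJ_cscale eps_mult distrib_left circ.scale_right_distrib mult.left_commute[of c \<epsilon>])
    then have "cscale 2 (cscale (1/2) (\<epsilon> * (c * phi p \<epsilon> a c s + \<epsilon> * flipJ (phi p \<epsilon> a c s)))) = cscale 2 y" by (rule arg_cong)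
    then have "\<epsilon> * (c * phi p \<epsilon> a c s + \<epsilon> * flipJ (phi p \<epsilon> a c s)) = cscale 2 y" by simp
    then have "\<epsilon> * (\<epsilon> * (c * phi p \<epsilon> a c s + \<epsilon> * flipJ (phi p \<epsilon> a c s))) = \<epsilon> * cscale 2 y" by (rule arg_cong)
    then have "c * phi p \<epsilon> a c s + \<epsilon> * flipJ (phi p \<epsilon> a c s) = cscale 2 (reflect a' * s)"
      by (simp only: eps_square cscale_mult y_def)
    then have "pre_T_H (phi p \<epsilon> a c s) = cscale 2 (d * s)" by (simp add: pre_T_H_eq cscale_mult b_mult)
    then show ?thesis using H ds by simp
  qed
  have sub: "phi p \<epsilon> a c ` eigenspace p \<epsilon> d \<subseteq> ker p (T_H \<epsilon> a b)"
  proof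
    fix x assume "x \<in> phi p \<epsilon> a c ` eigenspace p \<epsilon> d"
    then obtain s where s: "s \<in> eigenspace p \<epsilon> d" "x = phi p \<epsilon> a c s" by blast
    have sH: "s \<in> Hp p" using s(1) by (simp add: eigenspace_def ker_def)
    have "riesz (pre_T_H x) = cscale 2 (riesz (\<epsilon> * flipJ s))"
      using phi[OF s(1)] s(2) Hp_Lp[OF sH] by (simp add: riesz_cscale[OF p] eps_mult flipJ_Lp)
    also have "\<dots> = 0" using riesz_flipJ[OF p sH] Hp_Lp[OF sH] by (simp add: eps_mult flipJ_Lp)
    finally show "x \<in> ker p (T_H \<epsilon> a b)" using phi[OF s(1)] s(2) by (simp add: ker_def T_H_def pre_T_H_def)
  qed
  have add: "phi p \<epsilon> a c (s + t) = phi p \<epsilon> a c s + phi p \<epsilon> a c t" if "s \<in> eigenspace p \<epsilon> d" "t \<in> eigenspace p \<epsilon> d" for s t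
  proof -
    have H: "s \<in> Hp p" "t \<in> Hp p" using that by (auto simp: eigenspace_def ker_def)
    show ?thesis unfolding phi_def a' Let_def distrib_left riesz_add[OF p aL[OF H(1)] aL[OF H(2)]]
        bounded_operator_imp(2)[OF R(1) riesz_Hp[OF p aL[OF H(1)]] riesz_Hp[OF p aL[OF H(2)]]]
      by (simp add: flipJ_add flipJ_diff algebra_simps)
  qed
  have scale: "phi p \<epsilon> a c (cscale z s) = cscale z (phi p \<epsilon> a c s)" if "s \<in> eigenspace p \<epsilon> d" for s z
  proof -
    have H: "s \<in> Hp p" using that by (auto simp: eigenspace_def ker_def)
    show ?thesis unfolding phi_def a' Let_def cscale_mult riesz_cscale[OF p aL[OF H]]
        bounded_operator_imp(3)[OF R(1) riesz_Hp[OF p aL[OF H]]]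
      by (simp add: flipJ_cscale flipJ_diff cscale_mult circ.scale_right_distrib circ.scale_right_diff_distrib right_diff_distrib)
  qed
  have sW: "circ.subspace (phi p \<epsilon> a c ` eigenspace p \<epsilon> d)"
  proof (rule circ.subspaceI)
    have "phi p \<epsilon> a c (cscale 0 0) = cscale 0 (phi p \<epsilon> a c 0)" using circ.subspace_0[OF sd] by (rule scale)
    then show "0 \<in> phi p \<epsilon> a c ` eigenspace p \<epsilon> d" using circ.subspace_0[OF sd] by (intro image_eqI[of _ _ 0]) auto
    show "x + y \<in> phi p \<epsilon> a c ` eigenspace p \<epsilon> d" if xy: "x \<in> phi p \<epsilon> a c ` eigenspace p \<epsilon> d" "y \<in> phi p \<epsilon> a c ` eigenspace p \<epsilon> d" for x y
    proof -
      obtain s t where "s \<in> eigenspace p \<epsilon> d" "t \<in> eigenspace p \<epsilon> d" "x = phi p \<epsilon> a c s" "y = phi p \<epsilon> a c t" using xy by blast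
      then show ?thesis using add circ.subspace_add[OF sd] by (intro image_eqI[of _ _ "s + t"]) auto
    qed
    show "cscale z x \<in> phi p \<epsilon> a c ` eigenspace p \<epsilon> d" if x: "x \<in> phi p \<epsilon> a c ` eigenspace p \<epsilon> d" for z x
    proof -
      obtain s where "s \<in> eigenspace p \<epsilon> d" "x = phi p \<epsilon> a c s" using x by blast
      then show ?thesis using scale circ.subspace_scale[OF sd] by (intro image_eqI[of _ _ "cscale z s"]) auto
    qed
  qed
  have F0: "pre_T_H x = 0" if "x \<in> eigenspace p (- \<epsilon>) c" for x using pre_T_H_kernel that by (simp add: eigenspace_def ker_def)
  have Fadd: "pre_T_H (x - y) = pre_T_H x - pre_T_H y" for x y by (simp add: pre_T_H_def flipJ_diff algebra_simps)
  have int: "eigenspace p (- \<epsilon>) c \<inter> phi p \<epsilon> a c ` eigenspace p \<epsilon> d = {0}"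
  proof (intro equalityI subsetI)
    fix x assume "x \<in> eigenspace p (- \<epsilon>) c \<inter> phi p \<epsilon> a c ` eigenspace p \<epsilon> d"
    then obtain s where s: "s \<in> eigenspace p \<epsilon> d" "x = phi p \<epsilon> a c s" and x: "pre_T_H x = 0" using F0 by blast
    have "cscale 2 (\<epsilon> * flipJ s) = 0" using phi[OF s(1)] s(2) x by simp
    then have "cscale (1/2) (cscale 2 (\<epsilon> * flipJ s)) = 0" by (simp only: circ.scale_zero_right)
    then have "\<epsilon> * flipJ s = 0" by simp
    then have "flipJ s = 0" using eps_square(2)[of "flipJ s"] by simp
    then have "s = 0" by (metis flipJ_flipJ flipJ_zero)
    moreover have "phi p \<epsilon> a c (cscale 0 0) = cscale 0 (phi p \<epsilon> a c 0)" using circ.subspace_0[OF sd] by (rule scale)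
    ultimately show "x \<in> {0}" using s(2) by simp
  qed (use circ.subspace_0[OF neg] circ.subspace_0[OF sW] in auto)
  have "ker p (T_H \<epsilon> a b) \<subseteq> {u + w | u w. u \<in> eigenspace p (- \<epsilon>) c \<and> w \<in> phi p \<epsilon> a c ` eigenspace p \<epsilon> d}"
  proof
    fix f assume f: "f \<in> ker p (T_H \<epsilon> a b)"
    \<comment> \<open>The half compensates for the factor 2 in G(phi(s)) = 2 \<epsilon> J s.\<close>
    define s where "s = cscale (1/2) (\<epsilon> * flipJ (pre_T_H f))"
    have "\<epsilon> * flipJ (pre_T_H f) \<in> eigenspace p \<epsilon> d" using T_H_kernel[OF f] \<epsilon> circ.subspace_neg[OF sd] by auto
    then have s: "s \<in> eigenspace p \<epsilon> d" unfolding s_def by (rule circ.subspace_scale[OF sd])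
    have "pre_T_H (phi p \<epsilon> a c s) = pre_T_H f" using phi[OF s] by (simp add: s_def flipJ_cscale eps_mult cscale_mult)
    then have "pre_T_H (f - phi p \<epsilon> a c s) = 0" by (simp add: Fadd)
    moreover have "f - phi p \<epsilon> a c s \<in> Hp p" using f phi[OF s] by (intro Hp_diff[OF p]) (auto simp: ker_def)
    ultimately have "f - phi p \<epsilon> a c s \<in> eigenspace p (- \<epsilon>) c" using pre_T_H_kernel by blast
    then show "f \<in> {u + w | u w. u \<in> eigenspace p (- \<epsilon>) c \<and> w \<in> phi p \<epsilon> a c ` eigenspace p \<epsilon> d}"
      using s by (intro CollectI exI[of _ "f - phi p \<epsilon> a c s"] exI[of _ "phi p \<epsilon> a c s"]) auto
  qed
  moreover have "{u + w | u w. u \<in> eigenspace p (- \<epsilon>) c \<and> w \<in> phi p \<epsilon> a c ` eigenspace p \<epsilon> d} \<subseteq> ker p (T_H \<epsilon> a b)"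
    using eigenspace_subset_kernel sub circ.subspace_add[OF V] by blast
  ultimately show ?thesis unfolding direct_sum_def using neg sW int by blast
qed

end

section \<open>The adjoint operator and its matching pair\<close>

lemma (in matching) swapped_quotients: "c = reflect b * reflect a'" "d = a * reflect b'"
proof -
  have r: "reflect b' * reflect b = 1" "reflect b * reflect b' = 1"
    using unit_cancel(6)[of 1] unit_cancel(8)[of 1] by simp_all
  show "c = reflect b * reflect a'"
    using c_reflect_b'[of "reflect b"] unfolding r by (simp add: mult.commute)
  show "d = a * reflect b'" using d_reflect(2)[of "reflect b'"] unfolding r by simp
qed

text \<open>The second coefficient of the adjoint is reflected, and d = a / reflect b, c = reflect b
  / reflect a. Conjugating these quotients shows that c and d exchange their places.\<close>

lemma (in matching) conjugate_matching:
  assumes "1 < q"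
  shows "matching q \<epsilon> (conjugate a) (reflect (conjugate b)) (conjugate d) (conjugate c) (conjugate a') (reflect (conjugate b'))"
proof
  show "1 < q" by fact
  show "\<epsilon> = 1 \<or> \<epsilon> = - 1" by (rule \<epsilon>)
  show "conjugate a \<in> Linf" "reflect (conjugate b) \<in> Linf" "conjugate a' \<in> Linf" "reflect (conjugate b') \<in> Linf"
    using ab by (simp_all add: conjugate_Linf reflect_Linf)
  show "conjugate a * conjugate a' = 1" "reflect (conjugate b) * reflect (conjugate b') = 1"
    using ab(5,6) by (simp_all flip: conjugate_mult reflect_mult)
  have "conjugate (a * reflect a) = conjugate (b * reflect b)" using match by simp
  then show "conjugate a * reflect (conjugate a) = reflect (conjugate b) * reflect (reflect (conjugate b))"
    by (simp add: conjugate_mult conjugate_reflect mult.commute)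
  show "conjugate d = conjugate a * reflect (conjugate b')"
    by (simp add: swapped_quotients(2) conjugate_mult conjugate_reflect)
  show "conjugate c = reflect (conjugate b) * reflect (conjugate a')"
    by (simp add: swapped_quotients(1) conjugate_mult conjugate_reflect)
qed

text \<open>P and J are selfadjoint for the pairing, and moving J past conj b reflects it.\<close>

lemma (in matching) coker_T_H:
  assumes pq: "conjugate_exponents p q"
  shows "coker p (T_H \<epsilon> a b) = ker q (T_H \<epsilon> (conjugate a) (reflect (conjugate b)))"
proof (rule coker_eqI[OF pq])
  have q: "1 < q" using pq by (simp add: conjugate_exponents_def)
  interpret adj: matching q \<epsilon> "conjugate a" "reflect (conjugate b)" "conjugate d" "conjugate c" "conjugate a'" "reflect (conjugate b')"
    by (rule conjugate_matching[OF q])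
  show "T_H \<epsilon> (conjugate a) (reflect (conjugate b)) g \<in> Hp q" if "g \<in> Hp q" for g
    by (rule bounded_operator_imp(1)[OF adj.T_H_operator[OF adj.ab(1,2)] that])
  fix f g assume f: "f \<in> Hp p" and g: "g \<in> Hp q"
  have conj_eps: "conjugate \<epsilon> = \<epsilon>"
    using \<epsilon> conjugate_cscale[of "-1" 1] by (auto simp: circ.scale_minus_left)
  have aL: "a * f \<in> Lp p" "\<epsilon> * (b * flipJ f) \<in> Lp p"
    using f ab p by (auto simp: flipJ_Lp Hp_Lp intro!: mult_Lp eps_Linf)
  have gL: "conjugate a * g \<in> Lp q" "\<epsilon> * (reflect (conjugate b) * flipJ g) \<in> Lp q"
    using g adj.ab q by (auto simp: flipJ_Lp Hp_Lp intro!: mult_Lp eps_Linf)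
  have "pairing (T_H \<epsilon> a b f) g = pairing (a * f + \<epsilon> * (b * flipJ f)) g"
    unfolding T_H_def using pairing_riesz[OF pq Lp_add[OF aL] Hp_Lp[OF g]] p riesz_id[OF q g] by simp
  also have "\<dots> = pairing (a * f) g + pairing (\<epsilon> * (b * flipJ f)) g" by (rule pairing_add_left[OF pq aL Hp_Lp[OF g]])
  also have "pairing (\<epsilon> * (b * flipJ f)) g = pairing f (\<epsilon> * (reflect (conjugate b) * flipJ g))"
    by (simp add: pairing_mult_left pairing_flipJ flipJ_mult conj_eps eps_mult mult.left_commute)
  also have "pairing (a * f) g = pairing f (conjugate a * g)" by (rule pairing_mult_left)
  also have "pairing f (conjugate a * g) + pairing f (\<epsilon> * (reflect (conjugate b) * flipJ g)) =
      pairing f (conjugate a * g + \<epsilon> * (reflect (conjugate b) * flipJ g))"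
    by (rule pairing_add_right[OF pq Hp_Lp[OF f] gL, symmetric])
  also have "\<dots> = pairing f (T_H \<epsilon> (conjugate a) (reflect (conjugate b)) g)"
    unfolding T_H_def using pairing_riesz[OF pq Hp_Lp[OF f] Lp_add[OF gL]] q riesz_id[OF p f] by simp
  finally show "pairing (T_H \<epsilon> a b f) g = pairing f (T_H \<epsilon> (conjugate a) (reflect (conjugate b)) g)" .
qed

lemma eigenspace_trivial: "1 < p \<Longrightarrow> c \<in> Linf \<Longrightarrow> ker p (toeplitz c) = {0} \<Longrightarrow> eigenspace p \<epsilon> c = {0}"
  using circ.subspace_0[OF subspace_ker[OF _ toeplitz_bounded]] by (auto simp: eigenspace_def)

text \<open>Statements on the cokernel are those on the kernel for the adjoint pair on H^q; the
  index of T(conj d) there is -\<kappa>2, so the sign conditions turn into the required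
  ones.\<close>

lemma (in matching) T_H_main:
  assumes pq: "conjugate_exponents p q" and F: "fredholm p (toeplitz c)" "fredholm p (toeplitz d)"
    and \<kappa>: "\<kappa>1 = ind p (toeplitz c)" "\<kappa>2 = ind p (toeplitz d)"
  shows "\<kappa>1 \<ge> 0 \<Longrightarrow> \<kappa>2 \<ge> 0 \<Longrightarrow> right_invertible p (T_H \<epsilon> a b) \<and>
      direct_sum (ker p (T_H \<epsilon> a b)) (eigenspace p (- \<epsilon>) c) (phi p \<epsilon> a c ` eigenspace p \<epsilon> d)"
    and "\<kappa>1 \<le> 0 \<Longrightarrow> \<kappa>2 \<le> 0 \<Longrightarrow> left_invertible p (T_H \<epsilon> a b) \<and>
      direct_sum (coker p (T_H \<epsilon> a b)) (eigenspace q (- \<epsilon>) (conjugate d))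
        (phi q \<epsilon> (conjugate a) (conjugate d) ` eigenspace q \<epsilon> (conjugate c))"
    and "\<kappa>1 \<ge> 0 \<Longrightarrow> \<kappa>2 \<le> 0 \<Longrightarrow> ker p (T_H \<epsilon> a b) = eigenspace p (- \<epsilon>) c \<and>
      coker p (T_H \<epsilon> a b) = eigenspace q (- \<epsilon>) (conjugate d)"
    and "\<kappa>2 = 0 \<Longrightarrow> eigenspace q \<epsilon> (conjugate d) = {0}"
proof -
  have q: "1 < q" using pq by (simp add: conjugate_exponents_def)
  interpret adj: matching q \<epsilon> "conjugate a" "reflect (conjugate b)" "conjugate d" "conjugate c" "conjugate a'" "reflect (conjugate b')"
    by (rule conjugate_matching[OF q])
  note fc = toeplitz_fredholm[OF pq cd_Linf(1) cd_reflect(1) F(1), folded \<kappa>]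
  note fd = toeplitz_fredholm[OF pq cd_Linf(2) cd_reflect(2) F(2), folded \<kappa>]
  have inv: "inverse (reflect a) = reflect a'" "inverse (reflect (conjugate a)) = reflect (conjugate a')"
    using ab adj.ab
    by (auto intro!: invertible_Linf_inverse simp: reflect_Linf simp flip: reflect_mult)
  show "\<kappa>1 \<ge> 0 \<Longrightarrow> \<kappa>2 \<ge> 0 \<Longrightarrow> right_invertible p (T_H \<epsilon> a b) \<and>
      direct_sum (ker p (T_H \<epsilon> a b)) (eigenspace p (- \<epsilon>) c) (phi p \<epsilon> a c ` eigenspace p \<epsilon> d)"
    using T_H_right_invertible[OF toeplitz_right_inverse[OF p cd_Linf(1) \<kappa>(1) _ fc(1)] toeplitz_right_inverse[OF p cd_Linf(2) \<kappa>(2) _ fd(1)]]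
      T_H_kernel_direct_sum[OF inv(1) toeplitz_right_inverse[OF p cd_Linf(1) \<kappa>(1) _ fc(1)]] by simp
  show "left_invertible p (T_H \<epsilon> a b) \<and>
      direct_sum (coker p (T_H \<epsilon> a b)) (eigenspace q (- \<epsilon>) (conjugate d))
        (phi q \<epsilon> (conjugate a) (conjugate d) ` eigenspace q \<epsilon> (conjugate c))" if neg: "\<kappa>1 \<le> 0" "\<kappa>2 \<le> 0"
  proof
    obtain R where R: "bounded_operator p R" "\<And>f. f \<in> Hp p \<Longrightarrow> R (riesz (c * f)) = f"
      by (rule toeplitz_left_inverse[OF p cd_Linf(1) neg(1) fc(1)]) (rule that)
    obtain S where S: "bounded_operator p S" "\<And>f. f \<in> Hp p \<Longrightarrow> S (riesz (d * f)) = f"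
      by (rule toeplitz_left_inverse[OF p cd_Linf(2) neg(2) fd(1)]) (rule that)
    show "left_invertible p (T_H \<epsilon> a b)" by (rule T_H_left_invertible[OF R S])
    have d\<kappa>: "d * monomial \<kappa>2 \<in> Linf" by (intro mult_Linf cd_Linf monomial_Linf)
    \<comment> \<open>Bijectivity on H^q is the transpose of that of T(d t^\<kappa>2) on
      H^p.\<close>
    have bij: "bij_betw (toeplitz (conjugate d * monomial (- \<kappa>2))) (Hp q) (Hp q)"
      using toeplitz_bij_adjoint[OF pq d\<kappa> fd(1)] by (simp add: conjugate_mult conjugate_monomial)
    note RR = toeplitz_right_inverse[OF q adj.cd_Linf(1) fd(4)[symmetric] _ bij]
    show "direct_sum (coker p (T_H \<epsilon> a b)) (eigenspace q (- \<epsilon>) (conjugate d))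
        (phi q \<epsilon> (conjugate a) (conjugate d) ` eigenspace q \<epsilon> (conjugate c))"
      unfolding coker_T_H[OF pq] using adj.T_H_kernel_direct_sum[OF inv(2) RR] neg(2) by simp
  qed
  show "ker p (T_H \<epsilon> a b) = eigenspace p (- \<epsilon>) c \<and> coker p (T_H \<epsilon> a b) = eigenspace q (- \<epsilon>) (conjugate d)"
    if s: "\<kappa>1 \<ge> 0" "\<kappa>2 \<le> 0"
    unfolding coker_T_H[OF pq]
    using T_H_kernel_injective[OF fd(3)[OF s(2)]] adj.T_H_kernel_injective[OF fc(2)[OF s(1)]] by simp
  show "eigenspace q \<epsilon> (conjugate d) = {0}" if "\<kappa>2 = 0"
    using eigenspace_trivial[OF q adj.cd_Linf(1) fd(2)] that by simp
qed

section \<open>Return from the sign \<epsilon> to T(a) + H(b) and T(a) - H(b)\<close>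

lemma bounded_operator_cong:
  assumes p: "1 < p" and eq: "\<And>f. f \<in> Hp p \<Longrightarrow> A f = B f" and B: "bounded_operator p B"
  shows "bounded_operator p A"
  using B unfolding bounded_operator_def by (simp add: eq Hp_add[OF p] Hp_scale[OF p])

lemma invertible_cong:
  assumes p: "1 < p" and eq: "\<And>f. f \<in> Hp p \<Longrightarrow> A f = B f"
  shows "right_invertible p B \<Longrightarrow> right_invertible p A" "left_invertible p B \<Longrightarrow> left_invertible p A"
proof -
  have A: "bounded_operator p B \<Longrightarrow> bounded_operator p A" by (rule bounded_operator_cong[OF p eq])
  show "right_invertible p A" if "right_invertible p B"
  proof -
    obtain S where S: "bounded_operator p B" "bounded_operator p S" "\<forall>f\<in>Hp p. B (S f) = f"
      using \<open>right_invertible p B\<close> unfolding right_invertible_def by blast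
    then have "\<forall>f\<in>Hp p. A (S f) = f" using eq bounded_operator_imp(1) by simp
    then show ?thesis unfolding right_invertible_def using A S by blast
  qed
  show "left_invertible p A" if "left_invertible p B"
  proof -
    obtain S where S: "bounded_operator p B" "bounded_operator p S" "\<forall>f\<in>Hp p. S (B f) = f"
      using \<open>left_invertible p B\<close> unfolding left_invertible_def by blast
    then have "\<forall>f\<in>Hp p. S (A f) = f" using eq by simp
    then show ?thesis unfolding left_invertible_def using A S by blast
  qed
qed

lemma ker_cong: "(\<And>f. f \<in> Hp p \<Longrightarrow> A f = B f) \<Longrightarrow> ker p A = ker p B"
  by (auto simp: ker_def)

lemma coker_cong:
  assumes "\<And>f. f \<in> Hp p \<Longrightarrow> A f = B f" shows "coker p A = coker p B"
proof -
  have "adjoint_Hp p A = adjoint_Hp p B"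
    unfolding adjoint_Hp_def using assms by (intro ext) (simp cong: ball_cong)
  then show ?thesis by (simp add: coker_def)
qed

text \<open>For f in H^p the function J f has only negative coefficients, so Q acts on it as the
  identity.\<close>

lemma T_plus_minus_H:
  assumes p: "1 < p" and ab: "a \<in> Linf" "b \<in> Linf" and f: "f \<in> Hp p"
  shows "T_plus_H a b f = T_H 1 a b f" "T_minus_H a b f = T_H (- 1) a b f"
proof -
  have L: "a * f \<in> Lp p" "b * flipJ f \<in> Lp p" using ab f p by (auto intro!: mult_Lp simp: flipJ_Lp Hp_Lp)
  have h: "hankel b f = riesz (b * flipJ f)" by (simp add: hankel_def riesz_compl_def riesz_flipJ[OF p f])
  show "T_plus_H a b f = T_H 1 a b f" "T_minus_H a b f = T_H (- 1) a b f"
    using riesz_add[OF p L] riesz_diff[OF p L] by (simp_all add: T_plus_H_def T_minus_H_def T_H_def toeplitz_def h)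
qed

lemma im_PP_eigenspace:
  assumes "1 < p" "g \<in> Linf" "g * reflect g = 1"
  shows "im_PP_plus p g = eigenspace p 1 g" "im_PP_minus p g = eigenspace p (- 1) g"
proof -
  interpret plus: reflection_sign p 1 by unfold_locales (use assms in auto)
  interpret minus: reflection_sign p "- 1" by unfold_locales (use assms in auto)
  show "im_PP_plus p g = eigenspace p 1 g" "im_PP_minus p g = eigenspace p (- 1) g"
    using plus.half_eigenprojection_image[OF assms(2,3)] minus.half_eigenprojection_image[OF assms(2,3)]
    by (simp_all add: im_PP_plus_def im_PP_minus_def)
qed

lemma phi_plus_minus:
  assumes p: "1 < p" and g: "\<gamma> = fst (subordinated_pair \<alpha> \<beta>)" and \<alpha>: "inverse (reflect \<alpha>) \<in> Linf"
    and R: "bounded_operator p (toeplitz_right_inv p \<gamma>)" "\<And>f. f \<in> Hp p \<Longrightarrow> riesz (\<gamma> * toeplitz_right_inv p \<gamma> f) = f"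
    and s: "s \<in> Hp p"
  shows "phi_plus p \<alpha> \<beta> s = phi p 1 \<alpha> \<gamma> s" "phi_minus p \<alpha> \<beta> s = phi p (- 1) \<alpha> \<gamma> s"
proof -
  define r where "r = toeplitz_right_inv p \<gamma> (riesz (inverse (reflect \<alpha>) * s))"
  have H: "riesz (inverse (reflect \<alpha>) * s) \<in> Hp p" using mult_Lp[OF \<alpha> Hp_Lp[OF s]] p by (simp add: riesz_Hp)
  have r: "riesz r = r" "riesz (\<gamma> * r) = riesz (inverse (reflect \<alpha>) * s)"
    unfolding r_def by (rule riesz_id[OF p bounded_operator_imp(1)[OF R(1) H]], rule R(2)[OF H])
  show "phi_plus p \<alpha> \<beta> s = phi p 1 \<alpha> \<gamma> s" "phi_minus p \<alpha> \<beta> s = phi p (- 1) \<alpha> \<gamma> s"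
    unfolding phi_plus_def phi_minus_def phi_def Let_def toeplitz_def g[symmetric] r_def[symmetric]
    by (simp_all add: riesz_compl_def r flipJ_diff)
qed

theorem theorem6p1:
  fixes p q :: real and a b c d :: circ_fun and \<kappa>1 \<kappa>2 :: int
  assumes "1 < p" and "1 / p + 1 / q = 1"
    and "fredholm_matching_pair p a b"
    and "subordinated_pair a b = (c, d)"
    and "\<kappa>1 = ind p (toeplitz c)" and "\<kappa>2 = ind p (toeplitz d)"
  shows "(\<kappa>1 \<ge> 0 \<and> \<kappa>2 \<ge> 0 \<longrightarrow>
            right_invertible p (T_plus_H a b) \<and>
            right_invertible p (T_minus_H a b) \<and>
            direct_sum (ker p (T_plus_H a b))
              (im_PP_minus p c) (phi_plus p a b ` im_PP_plus p d) \<and>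
            direct_sum (ker p (T_minus_H a b))
              (im_PP_plus p c) (phi_minus p a b ` im_PP_minus p d)) \<and>
         (\<kappa>1 \<le> 0 \<and> \<kappa>2 \<le> 0 \<longrightarrow>
            left_invertible p (T_plus_H a b) \<and>
            left_invertible p (T_minus_H a b) \<and>
            direct_sum (coker p (T_plus_H a b))
              (im_PP_minus q (conjugate d))
              (phi_plus q (conjugate a) (reflect (conjugate b)) ` im_PP_plus q (conjugate c)) \<and>
            direct_sum (coker p (T_minus_H a b))
              (im_PP_plus q (conjugate d))
              (phi_minus q (conjugate a) (reflect (conjugate b)) ` im_PP_minus q (conjugate c)) \<and>
            (\<kappa>2 = 0 \<longrightarrow> im_PP_plus q (conjugate d) = {0} \<and> im_PP_minus q (conjugate d) = {0})) \<and>
         (\<kappa>1 \<ge> 0 \<and> \<kappa>2 < 0 \<longrightarrow>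
            ker p (T_plus_H a b) = im_PP_minus p c \<and>
            coker p (T_plus_H a b) = im_PP_minus q (conjugate d) \<and>
            ker p (T_minus_H a b) = im_PP_plus p c \<and>
            coker p (T_minus_H a b) = im_PP_plus q (conjugate d))"
proof -
  have pq: "conjugate_exponents p q"
  proof -
    have "1 / q = (p - 1) / p" using assms(1,2) by (simp add: field_simps)
    then have "q = p / (p - 1)" by (metis inverse_divide inverse_eq_divide inverse_inverse_eq)
    then show ?thesis using assms(1,2) by (simp add: conjugate_exponents_def)
  qed
  then have p: "1 < p" and q: "1 < q" by (auto simp: conjugate_exponents_def)
  have match: "matching_pair a b" and c: "c = a * inverse b" and d: "d = b * inverse (reflect a)"
    and F: "fredholm p (toeplitz c)" "fredholm p (toeplitz d)"
    using assms(3,4) by (auto simp: fredholm_matching_pair_def subordinated_pair_def)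
  obtain a' where a: "a \<in> Linf" "a' \<in> Linf" "a * a' = 1" and b: "b \<in> Linf" and ab: "a * reflect a = b * reflect b"
    using match by (auto simp: matching_pair_def invertible_Linf_def)
  have ra: "reflect a * reflect a' = 1" using a(3) unfolding reflect_mult[symmetric] by simp
  \<comment> \<open>b (reflect b) = a (reflect a) is invertible, so b has the inverse reflect b / (a
    reflect a).\<close>
  define b' where "b' = reflect b * a' * reflect a'"
  have b': "b' \<in> Linf" using a b by (simp add: b'_def mult_Linf reflect_Linf)
  have "b * b' = (a * reflect a) * (a' * reflect a')" unfolding ab by (simp add: b'_def mult.assoc)
  also have "\<dots> = (a * a') * (reflect a * reflect a')" by (simp add: mult_ac)
  finally have bb': "b * b' = 1" by (simp add: a ra)
  have inv: "inverse b = b'" "inverse (reflect a) = reflect a'"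
    using invertible_Linf_inverse a b b' bb' ra by (auto simp: reflect_Linf)
  have M: "matching p \<epsilon> a b c d a' b'" if "\<epsilon> = 1 \<or> \<epsilon> = - 1" for \<epsilon>
    by unfold_locales (use p that a b b' bb' ab c d inv in auto)
  interpret plus: matching p 1 a b c d a' b' by (rule M) simp
  interpret minus: matching p "- 1" a b c d a' b' by (rule M) simp
  interpret plus_adj: matching q 1 "conjugate a" "reflect (conjugate b)" "conjugate d" "conjugate c" "conjugate a'" "reflect (conjugate b')"
    by (rule plus.conjugate_matching[OF q])
  note Tp = T_plus_minus_H(1)[OF p a(1) b] and Tm = T_plus_minus_H(2)[OF p a(1) b]
  note im = im_PP_eigenspace[OF p plus.cd_Linf(1) plus.cd_reflect(1)] im_PP_eigenspace[OF p plus.cd_Linf(2) plus.cd_reflect(2)]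
    im_PP_eigenspace[OF q plus_adj.cd_Linf(1) plus_adj.cd_reflect(1)] im_PP_eigenspace[OF q plus_adj.cd_Linf(2) plus_adj.cd_reflect(2)]
  have kc: "ker p (T_plus_H a b) = ker p (T_H 1 a b)" "ker p (T_minus_H a b) = ker p (T_H (- 1) a b)"
    "coker p (T_plus_H a b) = coker p (T_H 1 a b)" "coker p (T_minus_H a b) = coker p (T_H (- 1) a b)"
    by (rule ker_cong, erule Tp, rule ker_cong, erule Tm, rule coker_cong, erule Tp, rule coker_cong, erule Tm)
  note mp = plus.T_H_main[OF pq F assms(5,6)] and mm = minus.T_H_main[OF pq F assms(5,6)]
  note fc = toeplitz_fredholm[OF pq plus.cd_Linf(1) plus.cd_reflect(1) F(1), folded assms(5)]
  note fd = toeplitz_fredholm[OF pq plus.cd_Linf(2) plus.cd_reflect(2) F(2), folded assms(6)]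
  have eig: "f \<in> Hp r" if "f \<in> eigenspace r e g" for f r e g using that by (simp add: eigenspace_def ker_def)
  have "phi_plus p a b ` eigenspace p 1 d = phi p 1 a c ` eigenspace p 1 d"
    "phi_minus p a b ` eigenspace p (- 1) d = phi p (- 1) a c ` eigenspace p (- 1) d" if k: "\<kappa>1 \<ge> 0"
  proof -
    have g: "c = fst (subordinated_pair a b)" and L: "inverse (reflect a) \<in> Linf"
      using assms(4) a by (simp_all add: inv reflect_Linf)
    note R = toeplitz_right_inverse[OF p plus.cd_Linf(1) assms(5) k fc(1)]
    have ph: "phi_plus p a b s = phi p 1 a c s" "phi_minus p a b s = phi p (- 1) a c s" if "s \<in> Hp p" for s
      by (rule phi_plus_minus[OF p g L R(1) _ that], erule R(2))+
    show "phi_plus p a b ` eigenspace p 1 d = phi p 1 a c ` eigenspace p 1 d"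
      by (rule image_cong[OF refl]) (rule ph(1)[OF eig])
    show "phi_minus p a b ` eigenspace p (- 1) d = phi p (- 1) a c ` eigenspace p (- 1) d"
      by (rule image_cong[OF refl]) (rule ph(2)[OF eig])
  qed
  note phi1 = this
  have "phi_plus q (conjugate a) (reflect (conjugate b)) ` eigenspace q 1 (conjugate c) =
      phi q 1 (conjugate a) (conjugate d) ` eigenspace q 1 (conjugate c)"
    "phi_minus q (conjugate a) (reflect (conjugate b)) ` eigenspace q (- 1) (conjugate c) =
      phi q (- 1) (conjugate a) (conjugate d) ` eigenspace q (- 1) (conjugate c)" if k: "\<kappa>2 \<le> 0"
  proof -
    have inv': "inverse (reflect (conjugate b)) = reflect (conjugate b')" "inverse (reflect (conjugate a)) = reflect (conjugate a')"
      using arg_cong[OF inv(1), of "\<lambda>f. reflect (conjugate f)"] arg_cong[OF inv(2), of conjugate]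
      by (simp_all add: reflect_inverse conjugate_inverse conjugate_reflect)
    \<comment> \<open>For the adjoint pair the right inverse inside phi belongs to T(conj d), whose
      index on H^q is -\<kappa>2 \<ge> 0.\<close>
    have g: "conjugate d = fst (subordinated_pair (conjugate a) (reflect (conjugate b)))"
      by (simp add: subordinated_pair_def inv' plus_adj.c)
    have L: "inverse (reflect (conjugate a)) \<in> Linf" using plus_adj.ab by (simp add: inv' reflect_Linf)
    have "bij_betw (toeplitz (conjugate (d * monomial \<kappa>2))) (Hp q) (Hp q)"
      by (rule toeplitz_bij_adjoint[OF pq mult_Linf[OF plus.cd_Linf(2) monomial_Linf] fd(1)])
    then have bij: "bij_betw (toeplitz (conjugate d * monomial (- \<kappa>2))) (Hp q) (Hp q)"
      by (simp add: conjugate_mult conjugate_monomial)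
    have "- \<kappa>2 \<ge> 0" using k by simp
    note R = toeplitz_right_inverse[OF q plus_adj.cd_Linf(1) fd(4)[symmetric] this bij]
    have ph: "phi_plus q (conjugate a) (reflect (conjugate b)) s = phi q 1 (conjugate a) (conjugate d) s"
      "phi_minus q (conjugate a) (reflect (conjugate b)) s = phi q (- 1) (conjugate a) (conjugate d) s" if "s \<in> Hp q" for s
      by (rule phi_plus_minus[OF q g L R(1) _ that], erule R(2))+
    show "phi_plus q (conjugate a) (reflect (conjugate b)) ` eigenspace q 1 (conjugate c) =
        phi q 1 (conjugate a) (conjugate d) ` eigenspace q 1 (conjugate c)"
      by (rule image_cong[OF refl]) (rule ph(1)[OF eig])
    show "phi_minus q (conjugate a) (reflect (conjugate b)) ` eigenspace q (- 1) (conjugate c) =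
        phi q (- 1) (conjugate a) (conjugate d) ` eigenspace q (- 1) (conjugate c)"
      by (rule image_cong[OF refl]) (rule ph(2)[OF eig])
  qed
  note phi2 = this
  have inv_cong: "right_invertible p (T_H 1 a b) \<Longrightarrow> right_invertible p (T_plus_H a b)"
    "left_invertible p (T_H 1 a b) \<Longrightarrow> left_invertible p (T_plus_H a b)"
    "right_invertible p (T_H (- 1) a b) \<Longrightarrow> right_invertible p (T_minus_H a b)"
    "left_invertible p (T_H (- 1) a b) \<Longrightarrow> left_invertible p (T_minus_H a b)"
    using invertible_cong[of p "T_plus_H a b" "T_H 1 a b"] invertible_cong[of p "T_minus_H a b" "T_H (- 1) a b"] p Tp Tm
    by blast+
  show ?thesis unfolding im kc
    using mp mm phi1 phi2 inv_cong by (simp add: less_imp_le)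
qed

end
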